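(* There exist a finite connected graph $\Gamma$, a positive integer $n$, and a proper subgroup $P$ of the graph braid group $B_n(\Gamma)$ such that $B_n(\Gamma)$ is hyperbolic relative to $P$, the group $P$ is thick, and $P$ is not contained in (i.e. is not isomorphic to a subgroup of) any graph braid group of the form $B_k(\Lambda,S)$ with $k \leq n$, $\Lambda \subsetneq \Gamma$ a proper subgraph, and $S$ a base configuration of $k$ particles on $\Lambda$.
   Context: For a finite graph $\Gamma$ (regarded as a 1-dimensional CW complex) and a positive integer $n$, let $C_n^{\mathrm{top}}(\Gamma)=\{(x_1,\dots,x_n)\in\Gamma^n : x_i\neq x_j \text{ for } i\neq j\}$ and $UC_n^{\mathrm{top}}(\Gamma)=C_n^{\mathrm{top}}(\Gamma)/S_n$, where $S_n$ permutes coordinates. The graph braid group is $B_n(\Gamma,S)=\pi_1(UC_n^{\mathrm{top}}(\Gamma),S)$, where $S\in UC_n^{\mathrm{top}}(\Gamma)$ is a base point; when $\Gamma$ is connected it does not depend on the base point up to isomorphism and is written $B_n(\Gamma)$. Subgraphs $\Lambda$ of $\Gamma$ need not be connected. Thickness is in the sense of Behrstock, Druţu and Mosher, applied to a finitely generated group with a word metric. An infinite finitely generated group is unconstricted if at least one of its asymptotic cones has no cut-points. More generally, a family of metric spaces is uniformly unconstricted if every point of every space in it lies at uniformly bounded distance from a bi-infinite quasi-geodesic with uniform constants, and for every sequence $(X_i)$ in the family there are a non-principal ultrafilter $\omega$ and a scaling sequence $(d_i)$ such that, for every choice of base points $x_i\in X_i$, the ultralimit $\lim_\omega (X_i,x_i,\tfrac{1}{d_i}\mathrm{dist}_i)$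 has no cut-points. A family is uniformly thick of order $0$ if it is uniformly unconstricted. A metric space $X$ is thick of order at most $m+1$ if there are $\tau\geq 0$ and a collection $\mathcal{L}$ of subsets of $X$ (with the restricted metrics) that is uniformly thick of order at most $m$, such that $X$ is the union of the $\tau$-neighbourhoods $N_\tau(L)$, $L\in\mathcal{L}$, and any $L,L'\in\mathcal{L}$ can be joined by a sequence $L=L_1,\dots,L_r=L'$ in $\mathcal{L}$ such that each $N_\tau(L_j)\cap N_\tau(L_{j+1})$ has infinite diameter (a family of spaces is uniformly thick of order at most $m+1$ if this holds for each of its members with a common $\tau$ and with the union of the collections $\mathcal{L}$ uniformly thick of order at most $m$). A group is thick if it is thick of order at most $m$ for some $m\ge 0$. *)

theory Defs
  imports
    "HOL-Analysis.Analysis"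
    "HOL-Algebra.Generated_Groups"
    "HOL-Algebra.Left_Coset"
    "HOL-Combinatorics.Permutations"
    "Graph_Theory.Digraph_Component"
begin

section \<open>Graphs as one-dimensional CW complexes\<close>

text \<open>
  A finite graph (loops and parallel edges allowed) is a \<^locale>\<open>fin_digraph\<close>: every edge
  carries an arbitrary orientation, used only to parametrise it by the unit interval.
\<close>

datatype ('v, 'e) graph_point = Vertex 'v | Inner 'e real

definition char_map :: "('v, 'e) pre_digraph \<Rightarrow> 'e \<Rightarrow> real \<Rightarrow> ('v, 'e) graph_point" where
  "char_map \<Gamma> e t =
     (if t = 0 then Vertex (tail \<Gamma> e) else if t = 1 then Vertex (head \<Gamma> e) else Inner e t)"

definition graph_points :: "('v, 'e) pre_digraph \<Rightarrow> ('v, 'e) graph_point set" where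
  "graph_points \<Gamma> = Vertex ` verts \<Gamma> \<union> (\<Union>e\<in>arcs \<Gamma>. char_map \<Gamma> e ` {0..1})"

text \<open>The weak topology: a set is open iff its preimage in every closed cell is open.\<close>

definition realization :: "('v, 'e) pre_digraph \<Rightarrow> ('v, 'e) graph_point topology" where
  "realization \<Gamma> = topology (\<lambda>U. U \<subseteq> graph_points \<Gamma> \<and>
     (\<forall>e\<in>arcs \<Gamma>. openin (top_of_set {0..1}) {t \<in> {0..1}. char_map \<Gamma> e t \<in> U}))"

lemma openin_realization:
  "openin (realization \<Gamma>) U \<longleftrightarrow> U \<subseteq> graph_points \<Gamma> \<and>
     (\<forall>e\<in>arcs \<Gamma>. openin (top_of_set {0..1}) {t \<in> {0..1}. char_map \<Gamma> e t \<in> U})"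
proof -
  let ?pre = "\<lambda>e U. {t \<in> {0..1}. char_map \<Gamma> e t \<in> U}"
  let ?op = "\<lambda>U. U \<subseteq> graph_points \<Gamma> \<and>
     (\<forall>e\<in>arcs \<Gamma>. openin (top_of_set {0..1}) (?pre e U))"
  have "istopology ?op"
    unfolding istopology_def
  proof (intro conjI allI impI)
    fix S T
    assume S: "?op S" and T: "?op T"
    then show "S \<inter> T \<subseteq> graph_points \<Gamma>" by blast
    show "\<forall>e\<in>arcs \<Gamma>. openin (top_of_set {0..1}) (?pre e (S \<inter> T))"
    proof
      fix e assume "e \<in> arcs \<Gamma>"
      moreover have "?pre e (S \<inter> T) = ?pre e S \<inter> ?pre e T" by auto
      ultimately show "openin (top_of_set {0..1}) (?pre e (S \<inter> T))"
        using S T by (metis (no_types, lifting) openin_Int)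
    qed
  next
    fix K
    assume K: "\<forall>U\<in>K. ?op U"
    then show "\<Union>K \<subseteq> graph_points \<Gamma>" by blast
    show "\<forall>e\<in>arcs \<Gamma>. openin (top_of_set {0..1}) (?pre e (\<Union>K))"
    proof
      fix e assume e: "e \<in> arcs \<Gamma>"
      have "?pre e (\<Union>K) = (\<Union>U\<in>K. ?pre e U)" by auto
      moreover have "openin (top_of_set {0..1}) (\<Union>U\<in>K. ?pre e U)"
        using K e by (intro openin_Union) auto
      ultimately show "openin (top_of_set {0..1}) (?pre e (\<Union>K))" by simp
    qed
  qed
  then show ?thesis
    by (simp add: realization_def topology_inverse')
qed

lemma topspace_realization:
  "topspace (realization \<Gamma>) = graph_points \<Gamma>"
proof -
  have "{t \<in> {0..1}. char_map \<Gamma> e t \<in> graph_points \<Gamma>} = {0..1}" if "e \<in> arcs \<Gamma>" for e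
    using that by (auto simp: graph_points_def)
  then have "openin (realization \<Gamma>) (graph_points \<Gamma>)"
    by (simp add: openin_realization)
  then show ?thesis
    by (metis openin_realization openin_subset openin_topspace subset_antisym)
qed

section \<open>Configuration spaces and graph braid groups\<close>

definition quotient_topology :: "'a topology \<Rightarrow> ('a \<Rightarrow> 'b) \<Rightarrow> 'b topology" where
  "quotient_topology X f =
     topology (\<lambda>U. U \<subseteq> f ` topspace X \<and> openin X {x \<in> topspace X. f x \<in> U})"

lemma openin_quotient_topology:
  "openin (quotient_topology X f) U \<longleftrightarrow>
     U \<subseteq> f ` topspace X \<and> openin X {x \<in> topspace X. f x \<in> U}"
proof -
  let ?pre = "\<lambda>U. {x \<in> topspace X. f x \<in> U}"
  have "istopology (\<lambda>U. U \<subseteq> f ` topspace X \<and> openin X (?pre U))"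
    unfolding istopology_def
  proof (intro conjI allI impI)
    fix S T
    assume ST: "S \<subseteq> f ` topspace X \<and> openin X (?pre S)" "T \<subseteq> f ` topspace X \<and> openin X (?pre T)"
    then show "S \<inter> T \<subseteq> f ` topspace X" by blast
    have "?pre (S \<inter> T) = ?pre S \<inter> ?pre T" by auto
    with ST show "openin X (?pre (S \<inter> T))"
      by (metis (no_types, lifting) openin_Int)
  next
    fix K
    assume K: "\<forall>U\<in>K. U \<subseteq> f ` topspace X \<and> openin X (?pre U)"
    then show "\<Union>K \<subseteq> f ` topspace X" by blast
    have "?pre (\<Union>K) = (\<Union>U\<in>K. ?pre U)" by auto
    moreover have "openin X (\<Union>U\<in>K. ?pre U)"
      using K by (intro openin_Union) auto
    ultimately show "openin X (?pre (\<Union>K))" by simp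
  qed
  then show ?thesis
    by (simp add: quotient_topology_def topology_inverse')
qed

lemma quotient_map_quotient_topology: "quotient_map X (quotient_topology X f) f"
proof -
  have "{x \<in> topspace X. f x \<in> f ` topspace X} = topspace X" by auto
  then have "openin (quotient_topology X f) (f ` topspace X)"
    by (simp add: openin_quotient_topology)
  then have "topspace (quotient_topology X f) = f ` topspace X"
    by (metis openin_quotient_topology openin_subset openin_topspace subset_antisym)
  then show ?thesis
    by (auto simp: quotient_map_def openin_quotient_topology)
qed

definition conf_space :: "nat \<Rightarrow> 'a topology \<Rightarrow> (nat \<Rightarrow> 'a) topology" where
  "conf_space n X = subtopology (product_topology (\<lambda>_. X) {..<n}) {x. inj_on x {..<n}}"

definition perm_orbit :: "nat \<Rightarrow> (nat \<Rightarrow> 'a) \<Rightarrow> (nat \<Rightarrow> 'a) set" where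
  "perm_orbit n x = {x \<circ> \<sigma> | \<sigma>. \<sigma> permutes {..<n}}"

definition uconf_space :: "nat \<Rightarrow> 'a topology \<Rightarrow> (nat \<Rightarrow> 'a) set topology" where
  "uconf_space n X = quotient_topology (conf_space n X) (perm_orbit n)"

text \<open>
  The library's \<^const>\<open>joinpaths\<close> needs a type of class \<^class>\<open>topological_space\<close>;
  this is the same operation for an arbitrary type.
\<close>

definition path_join :: "(real \<Rightarrow> 'a) \<Rightarrow> (real \<Rightarrow> 'a) \<Rightarrow> real \<Rightarrow> 'a" where
  "path_join p q = (\<lambda>t. if t \<le> 1/2 then p (2 * t) else q (2 * t - 1))"

definition loops_at :: "'a topology \<Rightarrow> 'a \<Rightarrow> (real \<Rightarrow> 'a) set" where
  "loops_at X a = {p. pathin X p \<and> p 0 = a \<and> p 1 = a}"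

definition loop_class :: "'a topology \<Rightarrow> 'a \<Rightarrow> (real \<Rightarrow> 'a) \<Rightarrow> (real \<Rightarrow> 'a) set" where
  "loop_class X a p =
     {q. homotopic_with (\<lambda>r. r 0 = a \<and> r 1 = a) (top_of_set {0..1}) X p q}"

definition fundamental_group :: "'a topology \<Rightarrow> 'a \<Rightarrow> (real \<Rightarrow> 'a) set monoid" where
  "fundamental_group X a =
     \<lparr>carrier = loop_class X a ` loops_at X a,
      mult = (\<lambda>A B. \<Union>p\<in>A. \<Union>q\<in>B. loop_class X a (path_join p q)),
      one = loop_class X a (\<lambda>_. a)\<rparr>"

definition uconf_graph ::
    "nat \<Rightarrow> ('v, 'e) pre_digraph \<Rightarrow> (nat \<Rightarrow> ('v, 'e) graph_point) set topology" where
  "uconf_graph n \<Gamma> = uconf_space n (realization \<Gamma>)"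

definition graph_braid_group ::
    "nat \<Rightarrow> ('v, 'e) pre_digraph \<Rightarrow> (nat \<Rightarrow> ('v, 'e) graph_point) set
      \<Rightarrow> (real \<Rightarrow> (nat \<Rightarrow> ('v, 'e) graph_point) set) set monoid" where
  "graph_braid_group n \<Gamma> S = fundamental_group (uconf_graph n \<Gamma>) S"

section \<open>Graph metrics and word metrics\<close>

text \<open>Here a graph is a vertex set with a symmetric set of pairs as adjacency relation.\<close>

definition graph_dist :: "('a \<times> 'a) set \<Rightarrow> 'a \<Rightarrow> 'a \<Rightarrow> nat" where
  "graph_dist E u v = (LEAST n. (u, v) \<in> E ^^ n)"

definition graph_metric :: "'a set \<Rightarrow> ('a \<times> 'a) set \<Rightarrow> 'a metric" where
  "graph_metric V E = metric (V, \<lambda>u v. real (graph_dist E u v))"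

lemma sym_relpow:
  assumes "sym E" "(u, v) \<in> E ^^ n"
  shows "(v, u) \<in> E ^^ n"
  using assms(2)
proof (induction n arbitrary: v)
  case (Suc n)
  then obtain w where "(u, w) \<in> E ^^ n" "(w, v) \<in> E" by auto
  with Suc.IH assms(1) show ?case
    by (meson relpow_Suc_I2 symD)
qed simp

lemma Metric_space_graph_dist:
  assumes "sym E" and conn: "\<And>u v. \<lbrakk>u \<in> V; v \<in> V\<rbrakk> \<Longrightarrow> (u, v) \<in> E\<^sup>*"
  shows "Metric_space V (\<lambda>u v. real (graph_dist E u v))"
proof -
  have dist: "(u, v) \<in> E ^^ graph_dist E u v" if "u \<in> V" "v \<in> V" for u v
    using conn[OF that] unfolding graph_dist_def
    by (metis LeastI rtrancl_power)
  have le: "graph_dist E u v \<le> n" if "(u, v) \<in> E ^^ n" for u v n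
    unfolding graph_dist_def using that by (rule Least_le)
  show ?thesis
  proof
    show "real (graph_dist E u v) = real (graph_dist E v u)" for u v
      unfolding graph_dist_def by (metis sym_relpow[OF assms(1)])
    show "real (graph_dist E u v) = 0 \<longleftrightarrow> u = v" if "u \<in> V" "v \<in> V" for u v
      using dist[OF that] le[of u v 0] by (auto simp: relpow_0_I)
    show "real (graph_dist E u w) \<le> real (graph_dist E u v) + real (graph_dist E v w)"
      if "u \<in> V" "v \<in> V" "w \<in> V" for u v w
    proof -
      have "(u, w) \<in> E ^^ (graph_dist E u v + graph_dist E v w)"
        using dist that by (auto simp: relpow_add)
      then show ?thesis using le by fastforce
    qed
  qed simp
qed

definition cayley_edges :: "('a, 'b) monoid_scheme \<Rightarrow> 'a set \<Rightarrow> ('a \<times> 'a) set" where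
  "cayley_edges G X =
     {(g, g \<otimes>\<^bsub>G\<^esub> x) | g x. g \<in> carrier G \<and> x \<in> X} \<union>
     {(g \<otimes>\<^bsub>G\<^esub> x, g) | g x. g \<in> carrier G \<and> x \<in> X}"

definition word_metric :: "('a, 'b) monoid_scheme \<Rightarrow> 'a set \<Rightarrow> 'a metric" where
  "word_metric G X = graph_metric (carrier G) (cayley_edges G X)"

definition finite_generating_set :: "('a, 'b) monoid_scheme \<Rightarrow> 'a set \<Rightarrow> bool" where
  "finite_generating_set G X \<longleftrightarrow>
     finite X \<and> X \<subseteq> carrier G \<and> generate G X = carrier G"

lemma sym_cayley_edges: "sym (cayley_edges G X)"
  by (auto simp: sym_def cayley_edges_def)

lemma (in group) cayley_edges_connected:
  assumes "X \<subseteq> carrier G" "generate G X = carrier G" "g \<in> carrier G" "h \<in> carrier G"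
  shows "(g, h) \<in> (cayley_edges G X)\<^sup>*"
proof -
  have *: "(g, g \<otimes> k) \<in> (cayley_edges G X)\<^sup>*" if "k \<in> generate G X" "g \<in> carrier G" for g k
    using that
  proof (induction arbitrary: g)
    case one
    then show ?case by simp
  next
    case (incl x)
    then show ?case by (auto simp: cayley_edges_def intro!: r_into_rtrancl)
  next
    case (inv x)
    then have x: "x \<in> carrier G" using assms(1) by blast
    then have "g = g \<otimes> inv x \<otimes> x" using inv by (simp add: m_assoc)
    with inv x have "(g, g \<otimes> inv x) \<in> cayley_edges G X"
      unfolding cayley_edges_def by (metis (mono_tags, lifting) UnI2 inv_closed m_closed mem_Collect_eq)
    then show ?case by blast
  next
    case (eng h1 h2)
    have c: "h1 \<in> carrier G" "h2 \<in> carrier G"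
      using eng.hyps assms(2) by auto
    have "(g, g \<otimes> h1) \<in> (cayley_edges G X)\<^sup>*"
      "(g \<otimes> h1, g \<otimes> h1 \<otimes> h2) \<in> (cayley_edges G X)\<^sup>*"
      using eng c by auto
    then show ?case using c eng.prems by (simp add: m_assoc)
  qed
  have "inv g \<otimes> h \<in> generate G X" using assms by simp
  from *[OF this assms(3)] show ?thesis
    using assms by (simp add: m_assoc[symmetric])
qed

lemma (in group)
  assumes "finite_generating_set G X"
  shows mspace_word_metric: "mspace (word_metric G X) = carrier G"
    and mdist_word_metric:
      "mdist (word_metric G X) = (\<lambda>g h. real (graph_dist (cayley_edges G X) g h))"
proof -
  interpret Metric_space "carrier G" "\<lambda>g h. real (graph_dist (cayley_edges G X) g h)"
    using assms sym_cayley_edges cayley_edges_connected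
    by (intro Metric_space_graph_dist) (auto simp: finite_generating_set_def)
  show "mspace (word_metric G X) = carrier G"
    "mdist (word_metric G X) = (\<lambda>g h. real (graph_dist (cayley_edges G X) g h))"
    by (simp_all add: word_metric_def graph_metric_def)
qed

section \<open>Relative hyperbolicity\<close>

definition gromov_product :: "'a metric \<Rightarrow> 'a \<Rightarrow> 'a \<Rightarrow> 'a \<Rightarrow> real" where
  "gromov_product M w x y = (mdist M x w + mdist M y w - mdist M x y) / 2"

definition gromov_hyperbolic :: "'a metric \<Rightarrow> bool" where
  "gromov_hyperbolic M \<longleftrightarrow>
     (\<exists>\<delta>\<ge>0. \<forall>w\<in>mspace M. \<forall>x\<in>mspace M. \<forall>y\<in>mspace M. \<forall>z\<in>mspace M.
        gromov_product M w x z \<ge> min (gromov_product M w x y) (gromov_product M w y z) - \<delta>)"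

text \<open>A circuit is an embedded closed edge path, given by its cyclic list of vertices.\<close>

definition circuit :: "('a \<times> 'a) set \<Rightarrow> 'a list \<Rightarrow> bool" where
  "circuit E vs \<longleftrightarrow> length vs \<ge> 3 \<and> distinct vs \<and>
     (\<forall>i<length vs. (vs ! i, vs ! ((i + 1) mod length vs)) \<in> E)"

definition fine_graph :: "('a \<times> 'a) set \<Rightarrow> bool" where
  "fine_graph E \<longleftrightarrow> (\<forall>(u, v)\<in>E. \<forall>n. finite {vs. circuit E vs \<and> length vs = n \<and>
     (\<exists>i<n. {vs ! i, vs ! ((i + 1) mod n)} = {u, v})})"

text \<open>The coned-off Cayley graph: one cone vertex for every left coset of the subgroup.\<close>

definition coned_off_verts :: "('a, 'b) monoid_scheme \<Rightarrow> 'a set \<Rightarrow> ('a + 'a set) set" where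
  "coned_off_verts G P = Inl ` carrier G \<union> Inr ` (lcosets\<^bsub>G\<^esub> P)"

definition coned_off_edges ::
    "('a, 'b) monoid_scheme \<Rightarrow> 'a set \<Rightarrow> 'a set \<Rightarrow> (('a + 'a set) \<times> ('a + 'a set)) set" where
  "coned_off_edges G X P =
     map_prod Inl Inl ` cayley_edges G X \<union>
     {(Inl g, Inr (g <#\<^bsub>G\<^esub> P)) | g. g \<in> carrier G} \<union>
     {(Inr (g <#\<^bsub>G\<^esub> P), Inl g) | g. g \<in> carrier G}"

text \<open>
  Relative hyperbolicity of a finitely generated group in the strong sense of Farb and Bowditch:
  the coned-off Cayley graph is hyperbolic and fine (fineness is equivalent to Farb's bounded
  coset penetration property). This does not depend on the finite generating set.
\<close>

definition hyperbolic_relative_to :: "('a, 'b) monoid_scheme \<Rightarrow> 'a set \<Rightarrow> bool" where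
  "hyperbolic_relative_to G P \<longleftrightarrow>
     subgroup P G \<and>
     (\<exists>X. finite_generating_set G X \<and>
        gromov_hyperbolic (graph_metric (coned_off_verts G P) (coned_off_edges G X P)) \<and>
        fine_graph (coned_off_edges G X P))"

lemma (in group) Metric_space_coned_off:
  assumes "finite_generating_set G X" "subgroup P G"
  shows "Metric_space (coned_off_verts G P) (\<lambda>u v. real (graph_dist (coned_off_edges G X P) u v))"
proof (rule Metric_space_graph_dist)
  let ?E = "coned_off_edges G X P"
  have "map_prod Inl Inl ` cayley_edges G X = {(Inl g, Inl h) | g h. (g, h) \<in> cayley_edges G X}"
    by (auto simp: image_iff)
  then show sym: "sym ?E"
    using sym_cayley_edges[of G X] by (auto simp: sym_def coned_off_edges_def)
  have Inl: "(Inl g, Inl h) \<in> ?E\<^sup>*" if "(g, h) \<in> (cayley_edges G X)\<^sup>*" for g h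
    using that
  proof induction
    case (step y z)
    then have "(Inl y, Inl z) \<in> ?E" by (force simp: coned_off_edges_def)
    with step.IH show ?case by (rule rtrancl_into_rtrancl)
  qed simp
  have near: "\<exists>g\<in>carrier G. (u, Inl g) \<in> ?E\<^sup>*" if "u \<in> coned_off_verts G P" for u
    using that by (auto simp: coned_off_verts_def LCOSETS_def coned_off_edges_def)
  fix u v assume "u \<in> coned_off_verts G P" "v \<in> coned_off_verts G P"
  with near obtain g h where
    gh: "g \<in> carrier G" "h \<in> carrier G" "(u, Inl g) \<in> ?E\<^sup>*" "(v, Inl h) \<in> ?E\<^sup>*" by metis
  have "(Inl g, Inl h) \<in> ?E\<^sup>*"
    using Inl cayley_edges_connected assms gh by (simp add: finite_generating_set_def)
  moreover have "(Inl h, v) \<in> ?E\<^sup>*"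
    using gh(4) sym by (meson sym_rtrancl symD)
  ultimately show "(u, v) \<in> ?E\<^sup>*" using gh(3) by (meson rtrancl_trans)
qed

section \<open>Ultralimits\<close>

definition nonprincipal_ultrafilter :: "nat filter \<Rightarrow> bool" where
  "nonprincipal_ultrafilter \<omega> \<longleftrightarrow>
     \<omega> \<noteq> bot \<and>
     (\<forall>Q. eventually Q \<omega> \<or> eventually (\<lambda>i. \<not> Q i) \<omega>) \<and>
     (\<forall>k. eventually (\<lambda>i. i \<noteq> k) \<omega>)"

definition scaling_sequence :: "nat filter \<Rightarrow> (nat \<Rightarrow> real) \<Rightarrow> bool" where
  "scaling_sequence \<omega> d \<longleftrightarrow> (\<forall>i. d i > 0) \<and> filterlim d at_top \<omega>"

definition ultralimit_seqs ::
    "nat filter \<Rightarrow> (nat \<Rightarrow> 'a metric) \<Rightarrow> (nat \<Rightarrow> 'a) \<Rightarrow> (nat \<Rightarrow> real) \<Rightarrow> (nat \<Rightarrow> 'a) set" where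
  "ultralimit_seqs \<omega> X x d =
     {y. (\<forall>i. y i \<in> mspace (X i)) \<and>
         (\<exists>B. eventually (\<lambda>i. mdist (X i) (x i) (y i) / d i \<le> B) \<omega>)}"

definition ultralimit_pdist ::
    "nat filter \<Rightarrow> (nat \<Rightarrow> 'a metric) \<Rightarrow> (nat \<Rightarrow> real) \<Rightarrow> (nat \<Rightarrow> 'a) \<Rightarrow> (nat \<Rightarrow> 'a) \<Rightarrow> real" where
  "ultralimit_pdist \<omega> X d y z = Lim \<omega> (\<lambda>i. mdist (X i) (y i) (z i) / d i)"

definition ultralimit_class ::
    "nat filter \<Rightarrow> (nat \<Rightarrow> 'a metric) \<Rightarrow> (nat \<Rightarrow> 'a) \<Rightarrow> (nat \<Rightarrow> real) \<Rightarrow> (nat \<Rightarrow> 'a) \<Rightarrow> (nat \<Rightarrow> 'a) set" where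
  "ultralimit_class \<omega> X x d y = {z \<in> ultralimit_seqs \<omega> X x d. ultralimit_pdist \<omega> X d y z = 0}"

definition ultralimit_space ::
    "nat filter \<Rightarrow> (nat \<Rightarrow> 'a metric) \<Rightarrow> (nat \<Rightarrow> 'a) \<Rightarrow> (nat \<Rightarrow> real) \<Rightarrow> (nat \<Rightarrow> 'a) set set" where
  "ultralimit_space \<omega> X x d = ultralimit_class \<omega> X x d ` ultralimit_seqs \<omega> X x d"

text \<open>
  The value 0 off the space is irrelevant: \<^locale>\<open>Metric_space\<close> asks for nonnegativity on the
  whole type.
\<close>

definition ultralimit_dist ::
    "nat filter \<Rightarrow> (nat \<Rightarrow> 'a metric) \<Rightarrow> (nat \<Rightarrow> 'a) \<Rightarrow> (nat \<Rightarrow> real)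
      \<Rightarrow> (nat \<Rightarrow> 'a) set \<Rightarrow> (nat \<Rightarrow> 'a) set \<Rightarrow> real" where
  "ultralimit_dist \<omega> X x d A B =
     (if A \<in> ultralimit_space \<omega> X x d \<and> B \<in> ultralimit_space \<omega> X x d
      then ultralimit_pdist \<omega> X d (SOME y. y \<in> A) (SOME z. z \<in> B) else 0)"

definition ultralimit ::
    "nat filter \<Rightarrow> (nat \<Rightarrow> 'a metric) \<Rightarrow> (nat \<Rightarrow> 'a) \<Rightarrow> (nat \<Rightarrow> real) \<Rightarrow> (nat \<Rightarrow> 'a) set metric" where
  "ultralimit \<omega> X x d = metric (ultralimit_space \<omega> X x d, ultralimit_dist \<omega> X x d)"

lemma ultrafilter_tendsto_real:
  fixes f :: "nat \<Rightarrow> real"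
  assumes \<omega>: "nonprincipal_ultrafilter \<omega>" and ev: "eventually (\<lambda>i. f i \<in> {a..b}) \<omega>"
  shows "\<exists>l. (f \<longlongrightarrow> l) \<omega>"
proof -
  have "filtermap f \<omega> \<noteq> bot"
    using \<omega> by (simp add: nonprincipal_ultrafilter_def filtermap_bot_iff)
  moreover have "eventually (\<lambda>x. x \<in> {a..b}) (filtermap f \<omega>)"
    using ev by (simp add: eventually_filtermap)
  ultimately obtain l where l: "inf (nhds l) (filtermap f \<omega>) \<noteq> bot"
    using compact_Icc[of a b] unfolding compact_filter by (auto simp: le_principal)
  have "(f \<longlongrightarrow> l) \<omega>"
  proof (rule topological_tendstoI)
    fix S assume S: "open S" "l \<in> S"
    have "\<not> eventually (\<lambda>i. \<not> f i \<in> S) \<omega>"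
    proof
      assume "eventually (\<lambda>i. \<not> f i \<in> S) \<omega>"
      then have "eventually (\<lambda>x. x \<notin> S) (filtermap f \<omega>)" by (simp add: eventually_filtermap)
      moreover have "eventually (\<lambda>x. x \<in> S) (nhds l)" using S by (rule eventually_nhds_in_open)
      ultimately have "eventually (\<lambda>x. False) (inf (nhds l) (filtermap f \<omega>))"
        unfolding eventually_inf by blast
      with l show False by (simp add: eventually_False)
    qed
    with \<omega> show "eventually (\<lambda>i. f i \<in> S) \<omega>"
      unfolding nonprincipal_ultrafilter_def by blast
  qed
  then show ?thesis by blast
qed

lemma Metric_space_ultralimit:
  assumes \<omega>: "nonprincipal_ultrafilter \<omega>" and d: "scaling_sequence \<omega> d"
    and x: "\<And>i. x i \<in> mspace (X i)"
  shows "Metric_space (ultralimit_space \<omega> X x d) (ultralimit_dist \<omega> X x d)"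
proof -
  let ?S = "ultralimit_seqs \<omega> X x d"
  let ?p = "ultralimit_pdist \<omega> X d"
  let ?c = "ultralimit_class \<omega> X x d"
  have dpos: "d i > 0" for i using d by (simp add: scaling_sequence_def)
  have nb: "\<omega> \<noteq> bot" using \<omega> by (simp add: nonprincipal_ultrafilter_def)
  have mem: "y i \<in> mspace (X i)" if "y \<in> ?S" for y i
    using that by (simp add: ultralimit_seqs_def)
  have tri: "mdist (X i) (y i) (w i) / d i \<le> mdist (X i) (y i) (z i) / d i + mdist (X i) (z i) (w i) / d i"
    if "y i \<in> mspace (X i)" "z i \<in> mspace (X i)" "w i \<in> mspace (X i)" for y z w i
    using mdist_triangle[OF that] dpos[of i]
    by (simp add: add_divide_distrib[symmetric] divide_right_mono)
  have lim: "((\<lambda>i. mdist (X i) (y i) (z i) / d i) \<longlongrightarrow> ?p y z) \<omega>"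
    if y: "y \<in> ?S" and z: "z \<in> ?S" for y z
  proof -
    obtain B C where "eventually (\<lambda>i. mdist (X i) (x i) (y i) / d i \<le> B) \<omega>"
      "eventually (\<lambda>i. mdist (X i) (x i) (z i) / d i \<le> C) \<omega>"
      using y z by (auto simp: ultralimit_seqs_def)
    then have "eventually (\<lambda>i. mdist (X i) (y i) (z i) / d i \<in> {0..B + C}) \<omega>"
    proof eventually_elim
      case (elim i)
      have "mdist (X i) (y i) (z i) / d i \<le> B + C"
        using tri[of y i x z] mem[OF y, of i] mem[OF z, of i] x[of i] elim mdist_commute[of "X i" "y i" "x i"]
        by simp
      then show ?case using dpos[of i] by simp
    qed
    from ultrafilter_tendsto_real[OF \<omega> this] show ?thesis
      unfolding ultralimit_pdist_def using nb tendsto_Lim by blast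
  qed
  have p0: "?p y z \<ge> 0" if "y \<in> ?S" "z \<in> ?S" for y z
    by (rule tendsto_lowerbound[OF lim[OF that] _ nb]) (simp add: dpos less_imp_le)
  have pc: "?p y z = ?p z y" for y z
    unfolding ultralimit_pdist_def by (simp add: mdist_commute)
  have pt: "?p y w \<le> ?p y z + ?p z w" if "y \<in> ?S" "z \<in> ?S" "w \<in> ?S" for y z w
  proof (rule tendsto_le[OF nb tendsto_add[OF lim lim] lim])
    show "\<forall>\<^sub>F i in \<omega>. mdist (X i) (y i) (w i) / d i
        \<le> mdist (X i) (y i) (z i) / d i + mdist (X i) (z i) (w i) / d i"
      using that mem tri by (intro always_eventually) blast
  qed (use that in auto)
  have pr: "?p y y = 0" if "y \<in> ?S" for y
  proof -
    have "(\<lambda>i. mdist (X i) (y i) (y i) / d i) = (\<lambda>i. 0)"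
      using mem[OF that] by (auto simp: fun_eq_iff)
    then show ?thesis
      using lim[OF that that] nb tendsto_unique[of \<omega> "\<lambda>i. 0::real" "?p y y" 0] by simp
  qed
  have rep: "(SOME y. y \<in> A) \<in> ?S" "A = ?c (SOME y. y \<in> A)"
    if A: "A \<in> ultralimit_space \<omega> X x d" for A
  proof -
    obtain y where y: "y \<in> ?S" "A = ?c y" using A by (auto simp: ultralimit_space_def)
    then have "y \<in> A" using pr by (simp add: ultralimit_class_def)
    then have s: "(SOME y. y \<in> A) \<in> A" by (metis someI)
    let ?s = "SOME y. y \<in> A"
    from s y show S: "?s \<in> ?S" by (simp add: ultralimit_class_def)
    have ys: "?p y ?s = 0" using s y by (simp add: ultralimit_class_def)
    have "?p y z = 0 \<longleftrightarrow> ?p ?s z = 0" if z: "z \<in> ?S" for z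
      using pt[OF y(1) S z] pt[OF S y(1) z] ys pc[of ?s y] p0[OF y(1) z] p0[OF S z] by linarith
    then show "A = ?c ?s" using y by (auto simp: ultralimit_class_def)
  qed
  show ?thesis
  proof
    fix A B
    show "0 \<le> ultralimit_dist \<omega> X x d A B"
      using p0 rep by (simp add: ultralimit_dist_def)
    show "ultralimit_dist \<omega> X x d A B = ultralimit_dist \<omega> X x d B A"
      using pc by (simp add: ultralimit_dist_def)
  next
    fix A B
    assume A: "A \<in> ultralimit_space \<omega> X x d" and B: "B \<in> ultralimit_space \<omega> X x d"
    let ?a = "SOME y. y \<in> A" and ?b = "SOME y. y \<in> B"
    have eq: "ultralimit_dist \<omega> X x d A B = ?p ?a ?b"
      using A B by (simp add: ultralimit_dist_def)
    have "A = B" if "?p ?a ?b = 0"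
    proof -
      have "?p ?a z = 0 \<longleftrightarrow> ?p ?b z = 0" if z: "z \<in> ?S" for z
        using pt[OF rep(1)[OF A] rep(1)[OF B] z] pt[OF rep(1)[OF B] rep(1)[OF A] z]
          \<open>?p ?a ?b = 0\<close> pc[of ?a ?b] p0[OF rep(1)[OF A] z] p0[OF rep(1)[OF B] z] by linarith
      then have "?c ?a = ?c ?b" by (auto simp: ultralimit_class_def)
      then show "A = B" using rep(2)[OF A] rep(2)[OF B] by simp
    qed
    then show "ultralimit_dist \<omega> X x d A B = 0 \<longleftrightarrow> A = B"
      using eq pr rep(1)[OF A] by auto
  next
    fix A B C
    assume "A \<in> ultralimit_space \<omega> X x d" "B \<in> ultralimit_space \<omega> X x d"
      "C \<in> ultralimit_space \<omega> X x d"
    then show "ultralimit_dist \<omega> X x d A C \<le> ultralimit_dist \<omega> X x d A B + ultralimit_dist \<omega> X x d B C"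
      using pt rep(1) by (simp add: ultralimit_dist_def)
  qed
qed

section \<open>Thickness\<close>

definition cut_point :: "'a topology \<Rightarrow> 'a \<Rightarrow> bool" where
  "cut_point T p \<longleftrightarrow>
     p \<in> topspace T \<and> \<not> connected_space (subtopology T (topspace T - {p}))"

definition biinfinite_quasigeodesic :: "real \<Rightarrow> real \<Rightarrow> 'a metric \<Rightarrow> (real \<Rightarrow> 'a) \<Rightarrow> bool" where
  "biinfinite_quasigeodesic K C X q \<longleftrightarrow>
     (\<forall>t. q t \<in> mspace X) \<and>
     (\<forall>s t. \<bar>s - t\<bar> / K - C \<le> mdist X (q s) (q t) \<and> mdist X (q s) (q t) \<le> K * \<bar>s - t\<bar> + C)"

definition uniformly_unconstricted :: "'a metric set \<Rightarrow> bool" where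
  "uniformly_unconstricted \<F> \<longleftrightarrow>
     (\<exists>K\<ge>1. \<exists>C\<ge>0. \<exists>D\<ge>0. \<forall>X\<in>\<F>. \<forall>x\<in>mspace X.
        \<exists>q. biinfinite_quasigeodesic K C X q \<and> (\<exists>t. mdist X x (q t) \<le> D)) \<and>
     (\<forall>X. (\<forall>i. X i \<in> \<F>) \<longrightarrow>
        (\<exists>\<omega> d. nonprincipal_ultrafilter \<omega> \<and> scaling_sequence \<omega> d \<and>
           (\<forall>x. (\<forall>i. x i \<in> mspace (X i)) \<longrightarrow>
              (\<nexists>p. cut_point (mtopology_of (ultralimit \<omega> X x d)) p))))"

definition nbhd :: "'a metric \<Rightarrow> real \<Rightarrow> 'a set \<Rightarrow> 'a set" where
  "nbhd X \<tau> A = {x \<in> mspace X. \<exists>a\<in>A. mdist X x a \<le> \<tau>}"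

definition thick_network :: "'a metric \<Rightarrow> real \<Rightarrow> 'a set set \<Rightarrow> bool" where
  "thick_network X \<tau> \<L> \<longleftrightarrow>
     (\<forall>L\<in>\<L>. L \<subseteq> mspace X) \<and>
     mspace X = (\<Union>L\<in>\<L>. nbhd X \<tau> L) \<and>
     (\<forall>L\<in>\<L>. \<forall>L'\<in>\<L>. (L, L') \<in> {(A, B). A \<in> \<L> \<and> B \<in> \<L> \<and>
        \<not> Metric_space.mbounded (mspace X) (mdist X) (nbhd X \<tau> A \<inter> nbhd X \<tau> B)}\<^sup>*)"

text \<open>\<open>uniformly_thick m \<F>\<close>: the family \<open>\<F>\<close> is uniformly thick of order at most \<open>m\<close>.\<close>

primrec uniformly_thick :: "nat \<Rightarrow> 'a metric set \<Rightarrow> bool" where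
  "uniformly_thick 0 \<F> \<longleftrightarrow> uniformly_unconstricted \<F>"
| "uniformly_thick (Suc m) \<F> \<longleftrightarrow>
     (\<exists>\<tau>\<ge>0. \<exists>\<L>. (\<forall>X\<in>\<F>. thick_network X \<tau> (\<L> X)) \<and>
        uniformly_thick m (\<Union>X\<in>\<F>. submetric X ` \<L> X))"

definition thick_group :: "('a, 'b) monoid_scheme \<Rightarrow> bool" where
  "thick_group G \<longleftrightarrow>
     (\<exists>X. finite_generating_set G X \<and> (\<exists>m. uniformly_thick m {word_metric G X}))"

section \<open>Embeddings of groups\<close>

definition embeds_in_group :: "('a, 'c) monoid_scheme \<Rightarrow> ('b, 'd) monoid_scheme \<Rightarrow> bool" where
  "embeds_in_group H G \<longleftrightarrow> (\<exists>K. subgroup K G \<and> H \<cong> G\<lparr>carrier := K\<rparr>)"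

end

theory Submission
  imports Defs "HOL-Library.Sublist" "HOL-Number_Theory.Cong"
begin

text \<open>
  Take the tree with two vertices of degree 3 joined by an edge, not subdivided any further, and four
  particles. Drawn as a comb (a spine with two prongs), its configuration space falls into cells
  according to the number of particles on each prong. Crossing a foot of a prong gives a generator
  which depends only on the numbers of particles on that prong and on the outer half of the spine; at
  configurations occupying both feet the two crossings commute. With four particles this leaves one
  commuting pair and ten free generators, so the braid group is the free product of the plane
  \<open>\<int>\<^sup>2\<close> and a free group of rank 10. The isomorphism is the holonomy of a flat cocycle with values
  in reduced words; its inverse is built from parallel transport. A free product is hyperbolic relative to
  its factor \<open>\<int>\<^sup>2\<close> because all free edges of the coned-off graph are bridges, and \<open>\<int>\<^sup>2\<close> is
  unconstricted. A proper subgraph lacks an edge, so it has at most one vertex of degree 3 and can be drawn as a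
  comb with one prong; the same holonomy then embeds its braid groups into free groups, which do not contain
  \<open>\<int>\<^sup>2\<close>.
\<close>

section \<open>The free product of the plane and a free group\<close>

text \<open>Why four particles: two crossings commute only while a particle stands on each foot, and
  after a change of gauge a crossing has a nontrivial value only if the outer half of the spine next
  to it is occupied. A commuting pair of nontrivial crossings thus needs four particles, and with
  exactly four the prongs and the middle of the spine are empty, so there is just one such pair. A
  crossing is indexed by the numbers i on the prong and b on the outer half, with b >= 1 and i + b
  <= 3. These are six pairs for each prong, of which (0, 1) yields the plane, whence 2 * 5 = 10 free
  generators. The obstacle is that the groups are defined by loops in spaces of point
  configurations, without a cell complex. Three devices replace it: a fixed enumeration of the
  particles, which turns a change of configuration within a cell into a straight-line motion; flags
  on the feet, which give a boundary configuration one description for each adjacent cell; and a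
  cocycle that is trusted only for pairs of configurations in a common small neighbourhood.\<close>

datatype 'i letter = Ab int int | Fr 'i bool

fun linv :: "'i letter => 'i letter" where
  "linv (Ab i j) = Ab (- i) (- j)"
| "linv (Fr x s) = Fr x (\<not> s)"

text \<open>A whole plane element is one letter, so two adjacent ones would merge, and a free letter
  would cancel against its inverse. Words avoiding both, and the zero of the plane, are the normal
  forms of the free product.\<close>

fun compatible_letters :: "'i letter => 'i letter => bool" where
  "compatible_letters (Ab _ _) (Ab _ _) \<longleftrightarrow> False"
| "compatible_letters (Fr x s) (Fr y t) \<longleftrightarrow> x \<noteq> y \<or> s = t"
| "compatible_letters _ _ \<longleftrightarrow> True"

definition reduced_word :: "'i letter list => bool" where
  "reduced_word w \<longleftrightarrow> successively compatible_letters w \<and> Ab 0 0 \<notin> set w"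

text \<open>Left multiplication of a normal form by one letter, so that
  \<open>foldr push u v\<close> is the product of words. As in van der Waerden's construction,
  associativity comes from letting the letters act on normal forms.\<close>

fun push :: "'i letter => 'i letter list => 'i letter list" where
  "push (Ab i j) (Ab i' j' # w) =
     (if i + i' = 0 \<and> j + j' = 0 then w else Ab (i + i') (j + j') # w)"
| "push (Fr x s) (Fr y t # w) = (if x = y \<and> s \<noteq> t then w else Fr x s # Fr y t # w)"
| "push l w = (if l = Ab 0 0 then w else l # w)"

lemma reduced_Nil [simp]: "reduced_word []"
  by (simp add: reduced_word_def)

lemma reduced_Cons:
  "reduced_word (l # w) \<longleftrightarrow> l \<noteq> Ab 0 0 \<and> reduced_word w \<and> (w = [] \<or> compatible_letters l (hd w))"
  by (cases w) (auto simp: reduced_word_def)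

lemma reduced_append:
  "reduced_word (u @ v) \<longleftrightarrow> reduced_word u \<and> reduced_word v \<and> (u = [] \<or> v = [] \<or> compatible_letters (last u) (hd v))"
  by (auto simp: reduced_word_def successively_append_iff)

lemma reduced_push: "reduced_word w ==> reduced_word (push l w)"
proof (induction l w rule: push.induct)
  case (1 i j i' j' w)
  then show ?case by (cases w; cases "hd w") (auto simp: reduced_Cons)
qed (auto simp: reduced_Cons)

lemma push_compatible:
  "w = [] \<or> compatible_letters l (hd w) ==> push l w = (if l = Ab 0 0 then w else l # w)"
  by (cases "(l, w)" rule: push.cases) auto

text \<open>A reduced word starts with at most one plane letter; once it is split off, a plane
  letter can only be prepended to the tail.\<close>

lemma push_Ab_Ab:
  assumes "reduced_word w"
  shows "push (Ab i j) (push (Ab i' j') w) = push (Ab (i + i') (j + j')) w"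
proof (cases "\<exists>k l v. w = Ab k l # v")
  case True
  then obtain k l v where w: "w = Ab k l # v" by blast
  have v: "push (Ab i j) v = (if i = 0 \<and> j = 0 then v else Ab i j # v)" for i j
  proof (subst push_compatible)
    show "v = [] \<or> compatible_letters (Ab i j) (hd v)"
      using assms w by (cases v; cases "hd v") (auto simp: reduced_Cons)
  qed simp
  show ?thesis by (auto simp: w v add.assoc)
next
  case False
  then have w: "push (Ab i j) w = (if i = 0 \<and> j = 0 then w else Ab i j # w)" for i j
    by (subst push_compatible) (cases w; cases "hd w"; auto)+
  show ?thesis by (auto simp: w)
qed

lemma push_Fr_Fr:
  assumes "reduced_word w"
  shows "push (Fr x s) (push (Fr x (\<not> s)) w) = w"
proof (cases "\<exists>v. w = Fr x s # v")
  case True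
  then obtain v where w: "w = Fr x s # v" by blast
  then have "push (Fr x s) v = Fr x s # v"
    using assms push_compatible[of v "Fr x s"] by (simp add: reduced_Cons)
  then show ?thesis by (simp add: w)
next
  case False
  then have "push (Fr x (\<not> s)) w = Fr x (\<not> s) # w"
    using push_compatible[of w "Fr x (\<not> s)"] by (cases w; cases "hd w") auto
  then show ?thesis by simp
qed

lemma push_zero [simp]: "reduced_word w ==> push (Ab 0 0) w = w"
  by (cases "(Ab 0 0 :: 'a letter, w)" rule: push.cases) (auto simp: reduced_Cons)

lemma push_linv: "reduced_word w ==> push (linv l) (push l w) = w"
  by (cases l) (auto simp: push_Ab_Ab push_Fr_Fr[of w _ "\<not> s" for s, simplified])

lemma push_reduced: "reduced_word (l # w) ==> push l w = l # w"
  by (cases "(l, w)" rule: push.cases) (auto simp: reduced_Cons)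

lemma reduced_foldr_push: "reduced_word v ==> reduced_word (foldr push u v)"
  by (induction u) (auto simp: reduced_push)

text \<open>The word \<open>w\<close> acts on \<open>v\<close> through its letters, and multiplying
  \<open>w\<close> by \<open>l\<close> has to multiply this action by \<open>l\<close>. Only merging
  and cancelling need an argument, namely the relations \<open>push_Ab_Ab\<close> and
  \<open>push_Fr_Fr\<close>.\<close>

lemma foldr_push_push:
  assumes "reduced_word w" "reduced_word v"
  shows "foldr push (push l w) v = push l (foldr push w v)"
  using assms
proof (induction l w rule: push.induct)
  case (1 i j i' j' w)
  then show ?case
    using push_Ab_Ab[of "foldr push w v" i j i' j'] reduced_foldr_push[of v w] by auto
next
  case (2 x s y t w)
  then show ?case
    using push_Fr_Fr[of "foldr push w v" x s] reduced_foldr_push[of v w] by auto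
qed (auto simp: reduced_foldr_push reduced_push)

lemma foldr_push_assoc:
  assumes "reduced_word v" "reduced_word w"
  shows "foldr push (foldr push u v) w = foldr push u (foldr push v w)"
  using assms by (induction u) (auto simp: foldr_push_push reduced_foldr_push)

lemma foldr_push_Nil: "reduced_word u ==> foldr push u [] = u"
  by (induction u) (auto simp: reduced_Cons push_reduced)

definition winv :: "'i letter list => 'i letter list" where
  "winv u = rev (map linv u)"

lemma linv_linv [simp]: "linv (linv l) = l"
  by (cases l) auto

lemma winv_simps [simp]:
  "winv [] = []" "winv (l # u) = winv u @ [linv l]" "winv (u @ v) = winv v @ winv u"
  "length (winv u) = length u" "winv (winv u) = u" "winv u = [] \<longleftrightarrow> u = []"
  by (auto simp: winv_def rev_map o_def)

lemma compatible_linv: "compatible_letters (linv m) (linv l) \<longleftrightarrow> compatible_letters l m"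
  by (cases l; cases m) auto

lemma reduced_winv: "reduced_word u ==> reduced_word (winv u)"
proof (induction u)
  case (Cons l u)
  moreover have "last (winv u) = linv (hd u)" if "u \<noteq> []"
    using that by (simp add: winv_def last_rev hd_map)
  moreover have "linv l \<noteq> Ab 0 0" using Cons by (cases l) (auto simp: reduced_Cons)
  ultimately show ?case
    by (cases "u = []") (auto simp: reduced_append reduced_Cons compatible_linv)
qed simp

lemma foldr_push_winv: "reduced_word u ==> foldr push (winv u) u = []"
proof (induction u)
  case (Cons l u)
  then have "push (linv l) (l # u) = u"
    using push_linv[of u l] by (simp add: reduced_Cons push_reduced)
  with Cons show ?case by (simp add: reduced_Cons)
qed simp

definition words_over :: "'i set => 'i letter list set" where
  "words_over J = {w. reduced_word w \<and> (\<forall>x s. Fr x s \<in> set w --> x \<in> J)}"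

definition word_group :: "'i set => 'i letter list monoid" where
  "word_group J = \<lparr>carrier = words_over J, mult = foldr push, one = []\<rparr>"

lemma word_group_simps [simp]:
  "carrier (word_group J) = words_over J" "mult (word_group J) = foldr push" "\<one>\<^bsub>word_group J\<^esub> = []"
  by (simp_all add: word_group_def)

lemma set_push: "set (push l w) \<subseteq> insert l (set w) \<union> range (\<lambda>(i, j). Ab i j)"
  by (induction l w rule: push.induct) (auto simp: image_iff)

lemma Fr_in_foldr_push: "Fr x s \<in> set (foldr push u v) ==> Fr x s \<in> set u \<union> set v"
proof (induction u)
  case (Cons l u)
  then show ?case using set_push[of l "foldr push u v"] by auto
qed simp

lemma words_overD: "w \<in> words_over J ==> reduced_word w"
  by (simp add: words_over_def)

lemma words_over_mult: "u \<in> words_over J ==> v \<in> words_over J ==> foldr push u v \<in> words_over J"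
  using Fr_in_foldr_push[of _ _ u v] reduced_foldr_push[of v u] by (fastforce simp: words_over_def)

lemma linv_eq_Fr: "linv l = Fr x s \<longleftrightarrow> l = Fr x (\<not> s)"
  by (cases l) auto

lemma words_over_winv: "u \<in> words_over J ==> winv u \<in> words_over J"
proof -
  have "Fr x s \<in> set (winv u) \<longleftrightarrow> Fr x (\<not> s) \<in> set u" for x s
    by (force simp: winv_def image_iff linv_eq_Fr eq_commute[of "Fr _ _"])
  then show "u \<in> words_over J ==> winv u \<in> words_over J"
    by (auto simp: words_over_def reduced_winv)
qed

lemma group_word_group: "group (word_group J)"
proof (rule groupI)
  show "x \<otimes>\<^bsub>word_group J\<^esub> y \<otimes>\<^bsub>word_group J\<^esub> z = x \<otimes>\<^bsub>word_group J\<^esub> (y \<otimes>\<^bsub>word_group J\<^esub> z)"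
    if "x \<in> carrier (word_group J)" "y \<in> carrier (word_group J)" "z \<in> carrier (word_group J)" for x y z
    using that by (simp add: foldr_push_assoc words_overD)
  show "\<exists>y\<in>carrier (word_group J). y \<otimes>\<^bsub>word_group J\<^esub> x = \<one>\<^bsub>word_group J\<^esub>"
    if "x \<in> carrier (word_group J)" for x
    using that words_over_winv[of x J] foldr_push_winv[of x] by (auto dest: words_overD)
qed (auto simp: words_over_mult, auto simp: words_over_def)

lemma inv_word_group: "u \<in> words_over J ==> inv\<^bsub>word_group J\<^esub> u = winv u"
  using group.inv_equality[OF group_word_group[of J], of "winv u" u] words_over_winv[of u J]
    foldr_push_winv[of u] by (simp add: words_overD)

section \<open>Evaluation of words in an arbitrary group\<close>

definition letter_val ::
    "('a, 'b) monoid_scheme => 'a => 'a => ('i => 'a) => 'i letter => 'a" where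
  "letter_val K \<alpha> \<beta> \<zeta> l = (case l of Ab i j => \<alpha> [^]\<^bsub>K\<^esub> i \<otimes>\<^bsub>K\<^esub> \<beta> [^]\<^bsub>K\<^esub> j
     | Fr x s => if s then \<zeta> x else inv\<^bsub>K\<^esub> \<zeta> x)"

definition word_val ::
    "('a, 'b) monoid_scheme => 'a => 'a => ('i => 'a) => 'i letter list => 'a" where
  "word_val K \<alpha> \<beta> \<zeta> w = foldr (\<lambda>l r. letter_val K \<alpha> \<beta> \<zeta> l \<otimes>\<^bsub>K\<^esub> r) w \<one>\<^bsub>K\<^esub>"

context group begin

lemma letter_val_closed:
  "\<alpha> \<in> carrier G ==> \<beta> \<in> carrier G ==> (\<And>x. \<zeta> x \<in> carrier G) ==> letter_val G \<alpha> \<beta> \<zeta> l \<in> carrier G"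
  by (auto simp: letter_val_def split: letter.splits)

lemma word_val_closed:
  "\<alpha> \<in> carrier G ==> \<beta> \<in> carrier G ==> (\<And>x. \<zeta> x \<in> carrier G) ==> word_val G \<alpha> \<beta> \<zeta> w \<in> carrier G"
  by (induction w) (simp_all add: word_val_def letter_val_closed)

lemma int_pow_commute:
  assumes "\<alpha> \<in> carrier G" "\<beta> \<in> carrier G" "\<alpha> \<otimes> \<beta> = \<beta> \<otimes> \<alpha>"
  shows "\<alpha> [^] (i::int) \<otimes> \<beta> [^] (j::int) = \<beta> [^] j \<otimes> \<alpha> [^] i"
proof -
  have invc: "inv x \<otimes> y = y \<otimes> inv x"
    if "x \<in> carrier G" "y \<in> carrier G" "x \<otimes> y = y \<otimes> x" for x y
  proof -
    have "inv x \<otimes> y = inv x \<otimes> (y \<otimes> x) \<otimes> inv x" using that(1,2) by (simp add: m_assoc)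
    also have "\<dots> = (inv x \<otimes> x) \<otimes> y \<otimes> inv x" unfolding that(3)[symmetric] using that(1,2) by (simp only: m_assoc m_closed inv_closed)
    finally show ?thesis using that(1,2) by simp
  qed
  have int: "x [^] (i::int) \<otimes> y = y \<otimes> x [^] i"
    if "x \<in> carrier G" "y \<in> carrier G" "x \<otimes> y = y \<otimes> x" for x y i
  proof (cases i rule: int_cases)
    case (nonneg n)
    show ?thesis unfolding nonneg int_pow_int by (rule group_commutes_pow[OF that(3,1,2)])
  next
    case (neg n)
    show ?thesis unfolding neg int_pow_neg_int[OF that(1)]
      by (rule invc[OF nat_pow_closed[OF that(1)] that(2) group_commutes_pow[OF that(3,1,2)]])
  qed
  have "\<alpha> \<otimes> \<beta> [^] j = \<beta> [^] j \<otimes> \<alpha>" 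
    by (rule int[OF assms(2,1) assms(3)[symmetric], symmetric])
  then show ?thesis by (rule int[OF assms(1) int_pow_closed[OF assms(2)]])
qed

text \<open>The commutation of \<alpha> and \<beta> enters where two plane letters merge.\<close>

lemma word_val_push:
  assumes c: "\<alpha> \<in> carrier G" "\<beta> \<in> carrier G" "\<alpha> \<otimes> \<beta> = \<beta> \<otimes> \<alpha>"
    and z: "\<And>x. \<zeta> x \<in> carrier G"
  shows "word_val G \<alpha> \<beta> \<zeta> (push l w) = letter_val G \<alpha> \<beta> \<zeta> l \<otimes> word_val G \<alpha> \<beta> \<zeta> w"
proof -
  have cl: "foldr (\<lambda>l. (\<otimes>) (letter_val G \<alpha> \<beta> \<zeta> l)) w \<one> \<in> carrier G" for w
    using word_val_closed[OF c(1,2) z] by (simp add: word_val_def)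
  have one: "letter_val G \<alpha> \<beta> \<zeta> (Ab 0 0) = \<one>" by (simp add: letter_val_def)
  show ?thesis
proof (induction l w rule: push.induct)
  case (1 i j i' j' w)
  let ?v = "word_val G \<alpha> \<beta> \<zeta> w"
  have v: "?v \<in> carrier G" by (rule word_val_closed[OF c(1,2) z])
  have *: "\<alpha> [^] i \<otimes> \<beta> [^] j \<otimes> (\<alpha> [^] i' \<otimes> \<beta> [^] j' \<otimes> ?v) = \<alpha> [^] (i + i') \<otimes> \<beta> [^] (j + j') \<otimes> ?v"
  proof -
    have "\<alpha> [^] i \<otimes> \<beta> [^] j \<otimes> (\<alpha> [^] i' \<otimes> \<beta> [^] j' \<otimes> ?v)
        = \<alpha> [^] i \<otimes> (\<beta> [^] j \<otimes> \<alpha> [^] i') \<otimes> \<beta> [^] j' \<otimes> ?v"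
      using c(1,2) v by (simp add: m_assoc)
    also have "\<dots> = \<alpha> [^] i \<otimes> (\<alpha> [^] i' \<otimes> \<beta> [^] j) \<otimes> \<beta> [^] j' \<otimes> ?v"
      by (simp only: int_pow_commute[OF c, of i' j])
    also have "\<dots> = (\<alpha> [^] i \<otimes> \<alpha> [^] i') \<otimes> (\<beta> [^] j \<otimes> \<beta> [^] j') \<otimes> ?v"
      using c(1,2) v by (simp add: m_assoc)
    finally show ?thesis using c(1,2) by (simp add: int_pow_mult)
  qed
  then show ?case
    using v c(1,2) by (auto simp: word_val_def letter_val_def)
next
  case (2 x s y t w)
  have "word_val G \<alpha> \<beta> \<zeta> w \<in> carrier G" by (rule word_val_closed[OF c(1,2) z])
  then show ?case using z by (auto simp: word_val_def letter_val_def m_assoc[symmetric])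
qed (auto simp: word_val_def letter_val_closed[OF c(1,2) z] cl one)
qed

text \<open>Universal property of the free product: a commuting pair and arbitrary images of the
  free generators determine a homomorphism.\<close>

lemma word_val_hom:
  assumes c: "\<alpha> \<in> carrier G" "\<beta> \<in> carrier G" "\<alpha> \<otimes> \<beta> = \<beta> \<otimes> \<alpha>"
    and z: "\<And>x. \<zeta> x \<in> carrier G"
  shows "word_val G \<alpha> \<beta> \<zeta> \<in> hom (word_group J) G"
proof (rule homI)
  have cl: "letter_val G \<alpha> \<beta> \<zeta> l \<in> carrier G" "word_val G \<alpha> \<beta> \<zeta> w \<in> carrier G" for l w
    by (rule letter_val_closed[OF c(1,2) z] word_val_closed[OF c(1,2) z])+
  show "word_val G \<alpha> \<beta> \<zeta> u \<in> carrier G" for u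
    by (rule cl)
  have "word_val G \<alpha> \<beta> \<zeta> (foldr push u v) = word_val G \<alpha> \<beta> \<zeta> u \<otimes> word_val G \<alpha> \<beta> \<zeta> v" for u v
  proof (induction u)
    case Nil
    show ?case using cl(2)[of v] by (simp add: word_val_def)
  next
    case (Cons l u)
    have "word_val G \<alpha> \<beta> \<zeta> (l # u) = letter_val G \<alpha> \<beta> \<zeta> l \<otimes> word_val G \<alpha> \<beta> \<zeta> u"
      by (simp add: word_val_def)
    then show ?case using Cons cl by (simp add: word_val_push[OF c z] m_assoc)
  qed
  then show "word_val G \<alpha> \<beta> \<zeta> (u \<otimes>\<^bsub>word_group J\<^esub> v) = word_val G \<alpha> \<beta> \<zeta> u \<otimes> word_val G \<alpha> \<beta> \<zeta> v" for u v
    by simp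
qed

end

section \<open>Commuting elements of a free group\<close>

definition free_words :: "'i letter list set" where
  "free_words = {w. reduced_word w \<and> (\<forall>i j. Ab i j \<notin> set w)}"

text \<open>Cancellation happens only at the junction, and \<open>c\<close> counts the cancelled
  letters. A letter prepended to \<open>u\<close> meets the next letter of \<open>u\<close>, with
  which it is compatible, unless all of \<open>u\<close> has been used up; only then does it meet a
  letter of \<open>v\<close>.\<close>

lemma free_words_product:
  assumes "u \<in> free_words" "v \<in> free_words"
  shows "\<exists>c. c \<le> length u \<and> c \<le> length v \<and> foldr push u v = take (length u - c) u @ drop c v \<and>
     drop (length u - c) u = winv (take c v)"
  using assms(1)
proof (induction u)
  case Nil
  then show ?case by auto
next
  case (Cons l u)
  then have u: "u \<in> free_words" and lu: "reduced_word (l # u)" and "\<And>i j. l \<noteq> Ab i j"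
    by (auto simp: free_words_def reduced_Cons)
  then obtain x s where l: "l = Fr x s" by (cases l) auto
  from Cons.IH[OF u] obtain c where c: "c \<le> length u" "c \<le> length v"
    "foldr push u v = take (length u - c) u @ drop c v" "drop (length u - c) u = winv (take c v)" by blast
  show ?case
  proof (cases "c = length u")
    case False
    then obtain m u' where m: "take (length u - c) u = m # u'" "hd u = m" "u \<noteq> []" using c(1)
      by (cases u; cases "length u - c") auto
    then have "compatible_letters l m" using lu by (auto simp: reduced_Cons)
    moreover have "m \<in> set u" using m by (cases u) auto
    then have "m \<noteq> Ab i j" for i j using u by (auto simp: free_words_def)
    then obtain y t where "m = Fr y t" by (cases m) auto
    ultimately have "push l (foldr push u v) = l # foldr push u v" using c(3) m l by auto
    then show ?thesis using c by (intro exI[of _ c]) (simp add: Suc_diff_le)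
  next
    case True
    then have f: "foldr push u v = drop c v" "u = winv (take c v)" using c by auto
    show ?thesis
    proof (cases "c < length v \<and> v ! c = linv l")
      case T: True
      then have d: "drop c v = linv l # drop (Suc c) v" by (metis Cons_nth_drop_Suc)
      then have "push l (drop c v) = drop (Suc c) v" using l by auto
      moreover have "take (Suc c) v = take c v @ [linv l]" using T by (simp add: take_Suc_conv_app_nth)
      ultimately show ?thesis
        using T c(1,2) by (intro exI[of _ "Suc c"]) (simp add: f(1) f(2)[symmetric] True[symmetric])
    next
      case F: False
      have "push l (drop c v) = l # drop c v"
      proof (cases "drop c v")
        case Nil then show ?thesis using l by auto
      next
        case (Cons m v')
        then have cv: "c < length v" "v ! c = m"
          by (metis drop_all linorder_not_less list.distinct(1)) (metis Cons nth_via_drop)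
        then have "m \<in> set v" by auto
        then have "m \<noteq> Ab i j" for i j using assms(2) by (auto simp: free_words_def)
        then obtain y t where m: "m = Fr y t" by (cases m) auto
        have "m \<noteq> linv l" using F cv by blast
        then have "\<not> (x = y \<and> s \<noteq> t)" by (simp add: m l)
        then have "push (Fr x s) (Fr y t # v') = Fr x s # Fr y t # v'" by (simp only: push.simps if_False)
        then show ?thesis by (simp only: Cons m l)
      qed
      then show ?thesis
        using c(1,2) by (intro exI[of _ c]) (simp add: f(1) f(2)[symmetric] True[symmetric])
    qed
  qed
qed

lemma not_reduced_cancel: "\<not> reduced_word (u @ l # linv l # v)"
  by (cases l) (auto simp: reduced_append reduced_Cons)

lemma free_words_winv: "u \<in> free_words ==> winv u \<in> free_words"
proof -
  have "linv l = Ab i j \<longleftrightarrow> l = Ab (- i) (- j)" for l :: "'a letter" and i j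
    by (cases l) auto
  then show "u \<in> free_words ==> winv u \<in> free_words"
    using reduced_winv[of u] by (auto simp: free_words_def winv_def eq_commute[of "Ab _ _"])
qed

lemma free_words_mult:
  assumes "u \<in> free_words" "v \<in> free_words"
  shows "foldr push u v \<in> free_words"
proof -
  obtain c where "foldr push u v = take (length u - c) u @ drop c v"
    using free_words_product[OF assms] by blast
  then have "set (foldr push u v) \<subseteq> set u \<union> set v"
    by (auto dest: in_set_takeD in_set_dropD)
  then show ?thesis using assms reduced_foldr_push by (fastforce simp: free_words_def)
qed

text \<open>
  Both products being at least as long as the factors leaves room for cancelling at most half of
  the shorter factor, while commutativity forces cancelling at least half of it.
\<close>

lemma free_words_commuting_shorter:
  assumes x: "x \<in> free_words" and y: "y \<in> free_words" and "x \<noteq> []" and xy: "length x \<le> length y"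
    and comm: "foldr push x y = foldr push y x"
    and l1: "length y \<le> length (foldr push x y)" and l2: "length y \<le> length (foldr push (winv x) y)"
  shows False
proof -
  obtain c1 where c1: "c1 \<le> length x" "foldr push x y = take (length x - c1) x @ drop c1 y"
    "drop (length x - c1) x = winv (take c1 y)"
    using free_words_product[OF x y] by blast
  obtain c4 where c4: "c4 \<le> length x" "foldr push y x = take (length y - c4) y @ drop c4 x"
    using free_words_product[OF y x] by blast
  obtain c2 where c2: "c2 \<le> length x" "foldr push (winv x) y = take (length x - c2) (winv x) @ drop c2 y"
    "drop (length x - c2) (winv x) = winv (take c2 y)"
    using free_words_product[OF free_words_winv[OF x] y] by auto
  have "length (foldr push x y) = length x + length y - 2 * c1"
    "length (foldr push y x) = length x + length y - 2 * c4"
    "length (foldr push (winv x) y) = length x + length y - 2 * c2"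
    using c1 c2 c4 xy by auto
  then have "c1 = c4" and h1: "2 * c1 \<le> length x" and h2: "2 * c2 \<le> length x"
    using comm l1 l2 c1(1) c4(1) c2(1) xy by auto
  have "take (length x - c1) (foldr push x y) = take (length x - c1) x" using c1 by simp
  moreover have "take (length x - c1) (foldr push x y) = take (length x - c1) y"
    using comm c4 \<open>c1 = c4\<close> xy by (simp add: min_def)
  ultimately have pre: "take (length x - c1) x = take (length x - c1) y" by simp
  \<comment> \<open>By \<open>pre\<close> the words share a prefix of length
    \<open>length x - c1\<close>. If the cancellation between \<open>winv x\<close> and
    \<open>y\<close> stopped earlier, the letters facing each other at the junction would be
    mutually inverse.\<close>
  have "length x - c1 \<le> c2"
  proof (rule ccontr)
    assume "\<not> ?thesis"
    then have lt: "c2 < length x - c1" "c2 < length x" "c2 < length y" using xy by auto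
    then have eq: "x ! c2 = y ! c2" using pre by (metis nth_take)
    have "winv x = winv (drop (Suc c2) x) @ [linv (x ! c2)] @ winv (take c2 x)"
      by (metis (no_types, lifting) append_Cons append_Nil append_take_drop_id Cons_nth_drop_Suc lt(2) winv_simps(2,3) append_assoc)
    moreover have "length x - c2 = length (winv (drop (Suc c2) x) @ [linv (x ! c2)])" using lt by simp
    ultimately have "take (length x - c2) (winv x) = winv (drop (Suc c2) x) @ [linv (x ! c2)]"
      by (metis append_assoc append_eq_conv_conj)
    moreover have "drop c2 y = y ! c2 # drop (Suc c2) y" using lt by (simp add: Cons_nth_drop_Suc)
    ultimately have "foldr push (winv x) y = winv (drop (Suc c2) x) @ linv (x ! c2) # linv (linv (x ! c2)) # drop (Suc c2) y"
      using c2(2) eq by simp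
    moreover have "reduced_word (foldr push (winv x) y)" using y by (simp add: reduced_foldr_push free_words_def)
    ultimately show False using not_reduced_cancel by metis
  qed
  \<comment> \<open>Each cancellation takes at most half of \<open>x\<close>, and together they
    cover \<open>x\<close>, so each is exactly half. Then \<open>x\<close> is its first half
    followed by the inverse of that half, which is not reduced.\<close>
  then have c: "length x = 2 * c1" using h1 h2 by linarith
  then have c0: "c1 > 0" using \<open>x \<noteq> []\<close> by (cases c1) auto
  have "drop c1 x = winv (take c1 x)" using c1(3) pre c by simp
  then have "x = take c1 x @ winv (take c1 x)" by (metis append_take_drop_id)
  moreover obtain p l where "take c1 x = p @ [l]" using c0 c by (cases "take c1 x" rule: rev_cases) auto
  ultimately have "x = p @ l # linv l # winv p" by simp
  moreover have "reduced_word x" using x by (simp add: free_words_def)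
  ultimately show False using not_reduced_cancel by metis
qed

text \<open>A basis of a subgroup isomorphic to Z^2. Whether such a pair exists is the invariant
  that keeps the plane out of the braid groups of proper subgraphs.\<close>

definition (in group) independent_pair :: "'a => 'a => bool" where
  "independent_pair x y \<longleftrightarrow> x \<in> carrier G \<and> y \<in> carrier G \<and> x \<otimes> y = y \<otimes> x \<and>
     (\<forall>i j. x [^] (i::int) \<otimes> y [^] (j::int) = \<one> --> i = 0 \<and> j = 0)"

context group begin

lemma independent_pair_swap: "independent_pair x y ==> independent_pair y x"
  unfolding independent_pair_def using int_pow_commute by metis

text \<open>Together with swapping and inverting, this is one of the elementary Nielsen moves by
  which a pair in a free group is shortened below.\<close>

lemma independent_pair_mult: "independent_pair x y ==> independent_pair x (x \<otimes> y)"
  unfolding independent_pair_def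
proof (intro conjI allI impI; elim conjE)
  assume x: "x \<in> carrier G" "y \<in> carrier G" and c: "x \<otimes> y = y \<otimes> x"
    and ind: "\<forall>i j. x [^] (i::int) \<otimes> y [^] (j::int) = \<one> --> i = 0 \<and> j = 0"
  show "x \<otimes> y \<in> carrier G" using x by simp
  show "x \<otimes> (x \<otimes> y) = x \<otimes> y \<otimes> x" using x c by (metis m_assoc)
  fix i j :: int assume "x [^] i \<otimes> (x \<otimes> y) [^] j = \<one>"
  then have "x [^] (i + j) \<otimes> y [^] j = \<one>"
    using x c int_pow_mult_distrib[OF c x] by (simp add: int_pow_mult m_assoc)
  then have "i + j = 0 \<and> j = 0" using ind by blast
  then show "i = 0" "j = 0" by auto
qed

lemma independent_pair_inv: "independent_pair x y ==> independent_pair (inv x) y"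
  unfolding independent_pair_def
proof (intro conjI allI impI; elim conjE)
  assume x: "x \<in> carrier G" "y \<in> carrier G" and c: "x \<otimes> y = y \<otimes> x"
    and ind: "\<forall>i j. x [^] (i::int) \<otimes> y [^] (j::int) = \<one> --> i = 0 \<and> j = 0"
  show "inv x \<otimes> y = y \<otimes> inv x"
    using int_pow_commute[OF x c, of "-1" 1] x by (simp add: int_pow_neg int_pow_1)
  fix i j :: int assume "inv x [^] i \<otimes> y [^] j = \<one>"
  then have "x [^] (- i) \<otimes> y [^] j = \<one>" using x by (simp add: int_pow_neg int_pow_inv)
  then have "- i = 0 \<and> j = 0" using ind by blast
  then show "i = 0" "j = 0" by auto
qed (auto)

lemma independent_pair_not_one: "independent_pair x y ==> x \<noteq> \<one>"
  unfolding independent_pair_def using int_pow_0 int_pow_one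
  by (metis one_closed r_one zero_neq_one)

end

text \<open>Nielsen reduction by descent on the total length. If multiplying the longer word by the
  shorter one or its inverse shortened it, the new pair would be smaller and still independent; if
  it never does, \<open>free_words_commuting_shorter\<close> applies.\<close>

lemma free_words_no_independent_pair:
  assumes "x \<in> free_words" "y \<in> free_words"
  shows "\<not> group.independent_pair (word_group UNIV) x y"
  using assms
proof (induction "length x + length y" arbitrary: x y rule: less_induct)
  case less
  interpret group "word_group UNIV :: 'a letter list monoid" by (rule group_word_group)
  show ?case
  proof
    assume ind: "independent_pair x y"
    have *: False if "independent_pair p q" "p \<in> free_words" "q \<in> free_words" "length p \<le> length q"
      "length p + length q = length x + length y" for p q
    proof (rule free_words_commuting_shorter[OF that(2,3) _ that(4)])
      show "p \<noteq> []" using independent_pair_not_one[OF that(1)] by simp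
      show "foldr push p q = foldr push q p" using that(1) by (simp add: independent_pair_def)
      show "length q \<le> length (foldr push p q)"
        using less.hyps[of p "foldr push p q"] independent_pair_mult[OF that(1)] that
          free_words_mult[OF that(2,3)] by fastforce
      have wp: "p \<in> words_over UNIV" using that(1) by (simp add: independent_pair_def)
      show "length q \<le> length (foldr push (winv p) q)"
        using less.hyps[of "winv p" "foldr push (winv p) q"] independent_pair_mult[OF independent_pair_inv[OF that(1)]]
          that free_words_mult[OF free_words_winv[OF that(2)] that(3)] free_words_winv[OF that(2)]
        by (fastforce simp: inv_word_group[OF wp])
    qed
    show False
      using *[OF ind] *[OF independent_pair_swap[OF ind]] less.prems by (meson add.commute nat_le_linear)
  qed
qed

section \<open>Relative hyperbolicity\<close>

text \<open>The length of a letter in the coned-off graph: two edges through a cone vertex replace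
  any plane element, and only the generators of the plane and their inverses cost a single
  edge.\<close>

definition letter_weight :: "'i letter => nat" where
  "letter_weight l = (case l of Ab i j => min 2 (nat \<bar>i\<bar> + nat \<bar>j\<bar>) | Fr _ _ => 1)"

definition word_weight :: "'i letter list => nat" where
  "word_weight w = sum_list (map letter_weight w)"

lemma word_weight_simps [simp]:
  "word_weight [] = 0" "word_weight (l # w) = letter_weight l + word_weight w"
  "word_weight (u @ v) = word_weight u + word_weight v"
  by (simp_all add: word_weight_def)

lemma letter_weight_simps [simp]:
  "letter_weight (Fr x s) = 1" "letter_weight (linv l) = letter_weight l" "letter_weight l \<le> 2"
  by (cases l; simp add: letter_weight_def)+

lemma letter_weight_pos: "l \<noteq> Ab 0 0 ==> 1 \<le> letter_weight l"
  by (cases l) (auto simp: letter_weight_def)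

lemma word_weight_winv [simp]: "word_weight (winv w) = word_weight w"
  by (induction w) auto

lemma foldr_push_append: "reduced_word (u @ v) ==> foldr push u v = u @ v"
proof (induction u)
  case (Cons l u)
  then show ?case by (simp add: reduced_Cons push_reduced)
qed simp

section \<open>The plane and its left cosets\<close>

definition plane_subgroup :: "'i letter list set" where
  "plane_subgroup = {push (Ab i j) [] | i j. True}"

text \<open>Pushing onto the empty word keeps the zero in normal form: \<open>plane_elt 0 0\<close>
  is \<open>[]\<close> and not \<open>[Ab 0 0]\<close>.\<close>

definition plane_elt :: "int => int => 'i letter list" where
  "plane_elt i j = push (Ab i j) []"

lemma plane_elt_mult: "foldr push (plane_elt i j) (plane_elt k l) = plane_elt (i + k) (j + l)"
  by (auto simp: plane_elt_def)

lemma plane_elt_inj: "plane_elt i j = plane_elt k l ==> i = k \<and> j = l"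
  by (auto simp: plane_elt_def split: if_splits)

lemma plane_elt_words_over: "plane_elt i j \<in> words_over J"
  by (auto simp: plane_elt_def words_over_def reduced_Cons)

lemma reduced_plane_elt [simp]: "reduced_word (plane_elt i j)"
  by (auto simp: plane_elt_def reduced_Cons)

lemma reduced_Fr [simp]: "reduced_word [Fr x s]"
  by (simp add: reduced_Cons)

lemma plane_subgroup_eq: "plane_subgroup = {plane_elt i j | i j. True}"
  by (simp add: plane_subgroup_def plane_elt_def)

lemma subgroup_plane: "subgroup plane_subgroup (word_group J)"
proof -
  interpret group "word_group J" by (rule group_word_group)
  have inv: "inv\<^bsub>word_group J\<^esub> plane_elt i j = plane_elt (- i) (- j)" for i j
  proof (rule inv_equality)
    show "plane_elt (- i) (- j) \<otimes>\<^bsub>word_group J\<^esub> plane_elt i j = \<one>\<^bsub>word_group J\<^esub>"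
      by (simp only: word_group_simps plane_elt_mult) (simp add: plane_elt_def)
  qed (simp_all add: plane_elt_words_over)
  show ?thesis
    by (rule subgroupI) (auto simp: plane_subgroup_eq plane_elt_words_over inv plane_elt_mult, blast+)
qed

text \<open>Dropping a final plane letter gives a canonical representative of the left coset of the
  plane, so that cone vertices can be handled through words.\<close>

definition stem :: "'i letter list => 'i letter list" where
  "stem w = (if w \<noteq> [] \<and> (\<exists>i j. last w = Ab i j) then butlast w else w)"

text \<open>Right multiplication by the plane touches only the last letter. Hence a left coset
  consists of one stem followed by all plane elements, and weights along it can be compared by
  arithmetic on the last letter.\<close>

lemma stem_decomp:
  assumes "reduced_word w"
  obtains i j where "w = stem w @ plane_elt i j" "reduced_word (stem w)"
    "\<And>k l. reduced_word (stem w @ plane_elt k l)" "\<And>k l. stem (stem w @ plane_elt k l) = stem w"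
    "\<And>k l. foldr push w (plane_elt k l) = stem w @ plane_elt (i + k) (j + l)"
proof -
  have key: "\<exists>i j. w = stem w @ plane_elt i j \<and> (stem w = [] \<or> (\<forall>i j. last (stem w) \<noteq> Ab i j))"
  proof (cases "w \<noteq> [] \<and> (\<exists>i j. last w = Ab i j)")
    case True
    then obtain i j where ij: "last w = Ab i j" by blast
    then have w: "w = stem w @ [Ab i j]" using True by (simp add: stem_def) (metis append_butlast_last_id)
    then have "reduced_word (stem w @ [Ab i j])" using assms by simp
    then have "Ab i j \<noteq> Ab 0 0" "stem w = [] \<or> compatible_letters (last (stem w)) (Ab i j)"
      by (auto simp: reduced_append reduced_Cons)
    then have "w = stem w @ plane_elt i j" "stem w = [] \<or> (\<forall>i j. last (stem w) \<noteq> Ab i j)"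
      using w by (auto simp: plane_elt_def)
    then show ?thesis by blast
  next
    case False
    then have "stem w = w" by (simp only: stem_def if_False)
    then show ?thesis using False by (intro exI[of _ 0]) (auto simp: plane_elt_def)
  qed
  then obtain i j where w: "w = stem w @ plane_elt i j"
    and st: "stem w = [] \<or> (\<forall>i j. last (stem w) \<noteq> Ab i j)" by blast
  have rs: "reduced_word (stem w)" using assms w by (metis reduced_append)
  have compat: "stem w = [] \<or> compatible_letters (last (stem w)) (Ab k l)" for k l
    using st by (cases "last (stem w)") auto
  have red: "reduced_word (stem w @ plane_elt k l)" for k l
    using rs compat[of k l] by (auto simp: reduced_append plane_elt_def reduced_Cons)
  have stem: "stem (stem w @ plane_elt k l) = stem w" for k l
  proof -
    have "stem (s @ plane_elt k l) = s" if "s = [] \<or> (\<forall>i j. last s \<noteq> Ab i j)" for s :: "'a letter list"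
      using that by (auto simp: plane_elt_def stem_def)
    then show ?thesis using st by blast
  qed
  have "foldr push w (plane_elt k l) = stem w @ plane_elt (i + k) (j + l)" for k l
  proof -
    have "foldr push w (plane_elt k l) = foldr push (stem w) (foldr push (plane_elt i j) (plane_elt k l))"
      using w foldr_append[of push "stem w" "plane_elt i j"] by (metis comp_apply)
    also have "\<dots> = stem w @ plane_elt (i + k) (j + l)"
      unfolding plane_elt_mult by (rule foldr_push_append[OF red])
    finally show ?thesis .
  qed
  with w rs red stem show ?thesis using that by blast
qed

lemma word_weight_plane_elt: "word_weight (plane_elt i j) = min 2 (nat \<bar>i\<bar> + nat \<bar>j\<bar>)"
  by (auto simp: plane_elt_def letter_weight_def)

lemma foldr_push_Fr:
  assumes "reduced_word w"
  shows "foldr push w [Fr x s] = (if w \<noteq> [] \<and> last w = Fr x (\<not> s) then butlast w else w @ [Fr x s])"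
proof (cases "w \<noteq> [] \<and> last w = Fr x (\<not> s)")
  case True
  then have w: "w = butlast w @ [Fr x (\<not> s)]" by (metis append_butlast_last_id)
  then have "foldr push w [Fr x s] = foldr push (butlast w) (push (Fr x (\<not> s)) [Fr x s])"
    using foldr_append[of push "butlast w" "[Fr x (\<not> s)]"] by (metis comp_apply foldr.simps(1) foldr.simps(2) id_apply)
  also have "\<dots> = butlast w"
    using w assms by (simp add: foldr_push_Nil) (metis foldr_push_Nil reduced_append)
  finally show ?thesis using True by simp
next
  case False
  have "w = [] \<or> compatible_letters (last w) (Fr x s)"
    using False by (cases "last w") auto
  then have "reduced_word (w @ [Fr x s])" using assms by (auto simp: reduced_append reduced_Cons)
  then show ?thesis by (simp only: foldr_push_append if_not_P[OF False])
qed

lemma foldr_push_winv_cancel: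
  assumes "reduced_word u" "reduced_word v"
  shows "foldr push (winv u) (foldr push u v) = v" "foldr push u (foldr push (winv u) v) = v"
  using assms foldr_push_assoc[of u v "winv u"] foldr_push_assoc[of "winv u" v u]
    foldr_push_winv[of u] foldr_push_winv[of "winv u"]
  by (auto simp: reduced_winv)

locale finite_index_words =
  fixes J :: "'i set"
  assumes finite_J: "finite J"
begin

abbreviation W where "W \<equiv> word_group J"

definition wgens :: "'i letter list set" where
  "wgens = {plane_elt 1 0, plane_elt 0 1} \<union> (\<lambda>x. [Fr x True]) ` J"

definition cedges where "cedges = coned_off_edges W wgens plane_subgroup"

sublocale group W by (rule group_word_group)

lemma Fr_words_over: "x \<in> J ==> [Fr x s] \<in> words_over J"
  by (auto simp: words_over_def reduced_Cons)

lemma finite_generating_wgens: "finite_generating_set W wgens"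
proof -
  have sub: "wgens \<subseteq> carrier W"
    by (auto simp: wgens_def plane_elt_words_over Fr_words_over)
  have nat: "plane_elt (int n) 0 \<in> generate W wgens \<and> plane_elt 0 (int n) \<in> generate W wgens" for n
  proof (induction n)
    case 0
    have "plane_elt (int 0) 0 = \<one>\<^bsub>W\<^esub>" by (simp add: plane_elt_def)
    moreover have "plane_elt 0 (int 0) = \<one>\<^bsub>W\<^esub>" by (simp add: plane_elt_def)
    ultimately show ?case using generate.one[of W wgens] by simp
  next
    case (Suc n)
    have "plane_elt 1 0 \<in> generate W wgens" "plane_elt 0 1 \<in> generate W wgens"
      by (auto simp: wgens_def intro: generate.incl)
    with Suc generate.eng[of "plane_elt 1 0" W wgens "plane_elt (int n) 0"]
      generate.eng[of "plane_elt 0 1" W wgens "plane_elt 0 (int n)"]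
    show ?case by (simp add: plane_elt_mult)
  qed
  have inv: "inv\<^bsub>W\<^esub> (plane_elt i j) = plane_elt (- i) (- j)" for i j
  proof (rule inv_equality)
    show "plane_elt (- i) (- j) \<otimes>\<^bsub>W\<^esub> plane_elt i j = \<one>\<^bsub>W\<^esub>"
      by (simp only: word_group_simps plane_elt_mult) (simp add: plane_elt_def)
  qed (simp_all add: plane_elt_words_over)
  have "plane_elt i 0 \<in> generate W wgens" "plane_elt 0 i \<in> generate W wgens" for i
    using nat[of "nat i"] nat[of "nat (- i)"] generate_m_inv_closed[OF sub, of "plane_elt (int (nat (- i))) 0"]
      generate_m_inv_closed[OF sub, of "plane_elt 0 (int (nat (- i)))"]
    by (cases "i \<ge> 0"; simp add: inv)+
  then have pl: "plane_elt i j \<in> generate W wgens" for i j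
    using generate.eng[of "plane_elt i 0" W wgens "plane_elt 0 j"] by (simp add: plane_elt_mult)
  have fr: "[Fr x s] \<in> generate W wgens" if "x \<in> J" for x s
  proof -
    have g: "[Fr x True] \<in> generate W wgens" using that by (auto simp: wgens_def intro: generate.incl)
    have "inv\<^bsub>W\<^esub> [Fr x True] = [Fr x False]"
      using inv_word_group[OF Fr_words_over[OF that, of True]] by simp
    then show ?thesis using g generate_m_inv_closed[OF sub g] by (cases s) auto
  qed
  have "w \<in> words_over J ==> w \<in> generate W wgens" for w
  proof (induction w)
    case Nil
    show ?case using generate.one[of W wgens] by simp
  next
    case (Cons l w)
    then have w: "w \<in> words_over J" and r: "reduced_word (l # w)"
      by (auto simp: words_over_def reduced_Cons)
    have l: "[l] \<in> generate W wgens"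
    proof (cases l)
      case (Ab i j)
      then have "[l] = plane_elt i j" using r by (auto simp: plane_elt_def reduced_Cons)
      then show ?thesis using pl by simp
    next
      case (Fr x s)
      then have "x \<in> J" using Cons.prems by (auto simp: words_over_def)
      then show ?thesis using fr Fr by simp
    qed
    have "foldr push [l] w = l # w" using r by (simp add: push_reduced)
    then show ?case using generate.eng[OF l Cons.IH[OF w]] by simp
  qed
  then have "carrier W \<subseteq> generate W wgens" by auto
  then show ?thesis
    using sub generate_in_carrier[OF sub] finite_J by (auto simp: finite_generating_set_def wgens_def)
qed

abbreviation coset where "coset g \<equiv> g <#\<^bsub>W\<^esub> plane_subgroup"

lemma coset_eq: "coset g = {foldr push g (plane_elt i j) | i j. True}"
  by (auto simp: l_coset_def plane_subgroup_eq)

lemma coset_mem: "g \<in> words_over J ==> g \<in> coset g"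
  unfolding coset_eq using foldr_push_Nil[of g] words_overD[of g J]
  by (auto simp: plane_elt_def intro!: exI[of _ 0])

text \<open>The Cayley graph is undirected, and reading an edge backwards inverts the generator;
  hence the arbitrary signs of the steps.\<close>

lemma cayley_step:
  assumes "(g, h) \<in> cayley_edges W wgens"
  shows "g \<in> words_over J \<and> h \<in> words_over J \<and>
    ((\<exists>i j. \<bar>i\<bar> \<le> 1 \<and> \<bar>j\<bar> \<le> 1 \<and> \<bar>i\<bar> + \<bar>j\<bar> = 1 \<and> h = foldr push g (plane_elt i j)) \<or>
     (\<exists>x s. x \<in> J \<and> h = foldr push g [Fr x s]))"
proof -
  obtain k x where k: "k \<in> words_over J" "x \<in> wgens"
    and gh: "(g = k \<and> h = foldr push k x) \<or> (h = k \<and> g = foldr push k x)"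
    using assms by (auto simp: cayley_edges_def)
  have x: "x \<in> words_over J" using k(2) by (auto simp: wgens_def plane_elt_words_over Fr_words_over)
  have bk: "h = foldr push g (winv x)" if "h = k" "g = foldr push k x"
    using that foldr_push_assoc[of x "winv x" k] foldr_push_winv[of "winv x"] x k(1) foldr_push_Nil[of k]
    by (simp add: words_overD reduced_winv)
  have mem: "g \<in> words_over J" "h \<in> words_over J" using gh k(1) x by (auto intro: words_over_mult)
  have wv: "winv (plane_elt i j :: 'i letter list) = plane_elt (- i) (- j)" for i j
    by (auto simp: plane_elt_def)
  from k(2) consider "x = plane_elt 1 0" | "x = plane_elt 0 1" | y where "y \<in> J" "x = [Fr y True]"
    by (auto simp: wgens_def)
  then show ?thesis
  proof cases
    case 1
    then have "h = foldr push g (plane_elt 1 0) \<or> h = foldr push g (plane_elt (-1) 0)" using gh bk by (auto simp: wv)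
    then show ?thesis using mem by (metis abs_0 abs_minus_cancel abs_one add.right_neutral order_refl zero_le_one)
  next
    case 2
    then have "h = foldr push g (plane_elt 0 1) \<or> h = foldr push g (plane_elt 0 (-1))" using gh bk by (auto simp: wv)
    then show ?thesis using mem by (metis abs_0 abs_minus_cancel abs_one add_0 order_refl zero_le_one)
  next
    case (3 y)
    then have "h = foldr push g [Fr y True] \<or> h = foldr push g [Fr y False]" using gh bk by auto
    then show ?thesis using mem 3(1) by blast
  qed
qed

lemma cayley_stepI:
  assumes "g \<in> words_over J"
  shows "x \<in> J ==> (g, foldr push g [Fr x s]) \<in> cayley_edges W wgens"
    "\<bar>i\<bar> + \<bar>j\<bar> = 1 ==> (g, foldr push g (plane_elt i j)) \<in> cayley_edges W wgens"
proof -
  have *: "(g, foldr push g x) \<in> cayley_edges W wgens" "(g, foldr push g (winv x)) \<in> cayley_edges W wgens"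
    if xw: "x \<in> wgens" for x
  proof -
    have x: "x \<in> words_over J" using xw by (auto simp: wgens_def plane_elt_words_over Fr_words_over)
    show "(g, foldr push g x) \<in> cayley_edges W wgens" using xw assms by (auto simp: cayley_edges_def)
    have "foldr push (foldr push g (winv x)) x = g"
      using foldr_push_assoc[of "winv x" x g] foldr_push_winv[of x] x assms foldr_push_Nil[of g]
      by (simp add: words_overD reduced_winv)
    moreover have "foldr push g (winv x) \<in> words_over J" using x assms by (intro words_over_mult words_over_winv)
    ultimately have "\<exists>k y. (g, foldr push g (winv x)) = (foldr push k y, k) \<and> k \<in> words_over J \<and> y \<in> wgens"
      using xw by (intro exI[of _ "foldr push g (winv x)"] exI[of _ x]) simp
    then show "(g, foldr push g (winv x)) \<in> cayley_edges W wgens" by (auto simp: cayley_edges_def)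
  qed
  show "(g, foldr push g [Fr x s]) \<in> cayley_edges W wgens" if "x \<in> J"
    using *[of "[Fr x True]"] that by (cases s) (auto simp: wgens_def)
  assume "\<bar>i\<bar> + \<bar>j\<bar> = 1"
  then have "(i = 1 \<and> j = 0) \<or> (i = -1 \<and> j = 0) \<or> (i = 0 \<and> j = 1) \<or> (i = 0 \<and> j = -1)" by presburger
  moreover have "winv (plane_elt 1 0 :: 'i letter list) = plane_elt (-1) 0" "winv (plane_elt 0 1 :: 'i letter list) = plane_elt 0 (-1)"
    by (auto simp: plane_elt_def)
  moreover have "(plane_elt 1 0 :: 'i letter list) \<in> wgens" "(plane_elt 0 1 :: 'i letter list) \<in> wgens" by (auto simp: wgens_def)
  ultimately show "(g, foldr push g (plane_elt i j)) \<in> cayley_edges W wgens"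
    using *[of "plane_elt 1 0"] *[of "plane_elt 0 1"] by auto
qed

lemma cedges_cases:
  assumes "(u, v) \<in> cedges"
  obtains g h where "u = Inl g" "v = Inl h" "(g, h) \<in> cayley_edges W wgens"
  | g where "u = Inl g" "v = Inr (coset g)" "g \<in> words_over J"
  | g where "u = Inr (coset g)" "v = Inl g" "g \<in> words_over J"
  using assms unfolding cedges_def coned_off_edges_def by auto

interpretation Met: Metric_space "coned_off_verts W plane_subgroup" "\<lambda>u v. real (graph_dist cedges u v)"
  unfolding cedges_def by (rule Metric_space_coned_off[OF finite_generating_wgens subgroup_plane])

text \<open>The expected distance from \<open>g\<close> in the coned-off graph. A cone vertex is one
  step beyond the stem of its coset; by \<open>stem_coset\<close> the chosen representative does not
  matter.\<close>

definition height :: "'i letter list => 'i letter list + 'i letter list set => nat" where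
  "height g v = (case v of Inl h => word_weight (foldr push (winv g) h)
     | Inr C => word_weight (stem (foldr push (winv g) (SOME h. h \<in> C))) + 1)"

lemma stem_coset:
  assumes g: "g \<in> words_over J" and h: "h \<in> words_over J" and h': "h' \<in> coset h"
  shows "stem (foldr push (winv g) h') = stem (foldr push (winv g) h)"
proof -
  obtain i j where "h' = foldr push h (plane_elt i j)" using h' by (auto simp: coset_eq)
  then have "foldr push (winv g) h' = foldr push (foldr push (winv g) h) (plane_elt i j)"
    using foldr_push_assoc[of h "plane_elt i j" "winv g"] h plane_elt_words_over[of i j J] by (simp add: words_overD)
  moreover have "reduced_word (foldr push (winv g) h)" using h by (simp add: reduced_foldr_push words_overD)
  ultimately show ?thesis by (metis stem_decomp)
qed

lemma height_coset:
  assumes "g \<in> words_over J" "h \<in> words_over J"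
  shows "height g (Inr (coset h)) = word_weight (stem (foldr push (winv g) h)) + 1"
proof -
  have "(SOME k. k \<in> coset h) \<in> coset h" using coset_mem[OF assms(2)] by (rule someI)
  then show ?thesis using stem_coset[OF assms] by (simp add: height_def)
qed

text \<open>A plane step changes only the last letter, whose weight is a truncated l^1 norm; a free
  step adds or removes one last letter; on a cone edge the last letter weighs between 0 and 2
  against the 1 of the cone.\<close>

lemma height_edge:
  assumes g: "g \<in> words_over J" and e: "(u, v) \<in> cedges"
  shows "height g v \<le> height g u + 1"
  using e
proof (cases rule: cedges_cases)
  case (1 h h')
  let ?w = "foldr push (winv g) h"
  have hh: "h \<in> words_over J" using cayley_step[OF 1(3)] by blast
  have r: "reduced_word ?w" using hh by (simp add: reduced_foldr_push words_overD)
  consider i j where "\<bar>i\<bar> + \<bar>j\<bar> = 1" "h' = foldr push h (plane_elt i j)" | x s where "h' = foldr push h [Fr x s]" "x \<in> J"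
    using cayley_step[OF 1(3)] by blast
  then show ?thesis
  proof cases
    case a: (1 i j)
    have w': "foldr push (winv g) h' = foldr push ?w (plane_elt i j)"
      using a(2) foldr_push_assoc[of h "plane_elt i j" "winv g"] hh plane_elt_words_over[of i j J] by (simp add: words_overD)
    obtain k l where kl: "?w = stem ?w @ plane_elt k l" "foldr push ?w (plane_elt i j) = stem ?w @ plane_elt (k + i) (l + j)"
      using stem_decomp[OF r] by metis
    have "word_weight ?w = word_weight (stem ?w) + min 2 (nat \<bar>k\<bar> + nat \<bar>l\<bar>)"
      using kl(1) word_weight_simps(3)[of "stem ?w" "plane_elt k l"] by (metis word_weight_plane_elt)
    moreover have "word_weight (foldr push (winv g) h') = word_weight (stem ?w) + min 2 (nat \<bar>k + i\<bar> + nat \<bar>l + j\<bar>)"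
      by (simp add: w' kl(2) word_weight_plane_elt)
    moreover have "nat \<bar>k + i\<bar> + nat \<bar>l + j\<bar> \<le> nat \<bar>k\<bar> + nat \<bar>l\<bar> + 1" using a(1) by linarith
    ultimately show ?thesis by (simp add: 1 height_def min_def)
  next
    case b: (2 x s)
    have w': "foldr push (winv g) h' = foldr push ?w [Fr x s]"
      using b(1) foldr_push_assoc[of h "[Fr x s]" "winv g"] hh Fr_words_over[OF b(2)] by (simp add: words_overD)
    have "word_weight (butlast ?w) \<le> word_weight ?w"
      by (cases ?w rule: rev_cases) auto
    then show ?thesis unfolding 1 height_def sum.case w' foldr_push_Fr[OF r] by auto
  qed
next
  case (2 h)
  let ?w = "foldr push (winv g) h"
  have r: "reduced_word ?w" using 2 by (simp add: reduced_foldr_push words_overD)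
  then obtain k l where "?w = stem ?w @ plane_elt k l" using stem_decomp by metis
  then have "word_weight (stem ?w) \<le> word_weight ?w" by (metis le_add1 word_weight_simps(3))
  then show ?thesis using height_coset[OF g 2(3)] by (simp add: 2 height_def)
next
  case (3 h)
  let ?w = "foldr push (winv g) h"
  have r: "reduced_word ?w" using 3 by (simp add: reduced_foldr_push words_overD)
  then obtain k l where "?w = stem ?w @ plane_elt k l" using stem_decomp by metis
  then have "word_weight ?w = word_weight (stem ?w) + min 2 (nat \<bar>k\<bar> + nat \<bar>l\<bar>)"
    by (metis word_weight_simps(3) word_weight_plane_elt)
  then show ?thesis using height_coset[OF g 3(3)] by (simp add: 3 height_def)
qed

lemma height_relpow:
  assumes g: "g \<in> words_over J" and e: "(u, v) \<in> cedges ^^ n"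
  shows "height g v \<le> height g u + n"
  using e
proof (induction n arbitrary: v)
  case (Suc n)
  then obtain w where w: "(u, w) \<in> cedges ^^ n" "(w, v) \<in> cedges" by auto
  then show ?case using Suc.IH[OF w(1)] height_edge[OF g w(2)] by simp
qed simp

lemma cedgesI:
  "(g, h) \<in> cayley_edges W wgens ==> (Inl g, Inl h) \<in> cedges"
  "g \<in> words_over J ==> (Inl g, Inr (coset g)) \<in> cedges"
  "g \<in> words_over J ==> (Inr (coset g), Inl g) \<in> cedges"
  unfolding cedges_def coned_off_edges_def by force+

lemma coset_plane:
  assumes "g \<in> words_over J"
  shows "coset (foldr push g (plane_elt i j)) = coset g"
proof -
  have "foldr push (foldr push g (plane_elt i j)) (plane_elt k l) = foldr push g (plane_elt (i + k) (j + l))" for k l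
    using foldr_push_assoc[of "plane_elt i j" "plane_elt k l" g] plane_elt_words_over[of _ _ J]
    by (simp add: words_overD plane_elt_mult)
  then show ?thesis unfolding coset_eq by (metis (no_types, opaque_lifting) add.commute diff_add_cancel)
qed

text \<open>Letter by letter: free letters and unit plane letters are edges of the Cayley graph, any
  other plane letter is a detour of two edges over the cone vertex of the current coset.\<close>

lemma coned_path:
  assumes g: "g \<in> words_over J" and "w \<in> words_over J"
  shows "(Inl g, Inl (foldr push g w)) \<in> cedges ^^ word_weight w"
  using assms(2)
proof (induction w rule: rev_induct)
  case Nil
  show ?case using foldr_push_Nil[of g] g by (simp add: words_overD)
next
  case (snoc l w)
  then have w: "w \<in> words_over J" and r: "reduced_word (w @ [l])" and lJ: "\<And>x s. l = Fr x s ==> x \<in> J"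
    by (auto simp: words_over_def reduced_append)
  let ?h = "foldr push g w"
  have h: "?h \<in> words_over J" using g w by (rule words_over_mult)
  have rl: "reduced_word [l]" "l \<noteq> Ab 0 0" using r by (auto simp: reduced_append reduced_Cons)
  have e: "foldr push g (w @ [l]) = foldr push ?h [l]"
    using foldr_push_assoc[of w "[l]" g] foldr_push_append[OF r] w rl by (simp add: words_overD)
  have "(Inl ?h, Inl (foldr push ?h [l])) \<in> cedges ^^ letter_weight l"
  proof (cases l)
    case (Fr x s)
    then show ?thesis using cedgesI(1)[OF cayley_stepI(1)[OF h lJ[OF Fr]]] by simp
  next
    case (Ab i j)
    then have l: "[l] = plane_elt i j" using rl by (auto simp: plane_elt_def)
    show ?thesis
    proof (cases "\<bar>i\<bar> + \<bar>j\<bar> = 1")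
      case True
      then have "letter_weight l = 1" using Ab by (auto simp: letter_weight_def)
      then show ?thesis using cedgesI(1)[OF cayley_stepI(2)[OF h True]] l by simp
    next
      case False
      then have "letter_weight l = 2" using Ab rl(2) by (auto simp: letter_weight_def min_def)
      moreover have "(Inl ?h, Inr (coset ?h)) \<in> cedges" by (rule cedgesI(2)[OF h])
      moreover have "(Inr (coset ?h), Inl (foldr push ?h [l])) \<in> cedges"
        using cedgesI(3)[OF words_over_mult[OF h plane_elt_words_over[of i j J]]] coset_plane[OF h] l by simp
      ultimately show ?thesis by (simp add: numeral_2_eq_2) blast
    qed
  qed
  then show ?case using snoc.IH[OF w] unfolding e by (auto simp: relpow_add)
qed

text \<open>The path of \<open>coned_path\<close> bounds the distance from above, the slow growth of
  \<open>height\<close> from below.\<close>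

lemma graph_dist_cedges:
  assumes g: "g \<in> words_over J" and h: "h \<in> words_over J"
  shows "graph_dist cedges (Inl g) (Inl h) = word_weight (foldr push (winv g) h)"
proof -
  let ?w = "foldr push (winv g) h"
  have "?w \<in> words_over J" using g h by (intro words_over_mult words_over_winv)
  then have "(Inl g, Inl (foldr push g ?w)) \<in> cedges ^^ word_weight ?w" by (rule coned_path[OF g])
  then have p: "(Inl g, Inl h) \<in> cedges ^^ word_weight ?w"
    using foldr_push_winv_cancel(2)[of g h] g h by (simp add: words_overD)
  then have le: "graph_dist cedges (Inl g) (Inl h) \<le> word_weight ?w"
    unfolding graph_dist_def by (rule Least_le)
  have "(Inl g, Inl h) \<in> cedges ^^ graph_dist cedges (Inl g) (Inl h)"
    unfolding graph_dist_def using p by (rule LeastI)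
  from height_relpow[OF g this] have "word_weight ?w \<le> graph_dist cedges (Inl g) (Inl h)"
    using foldr_push_winv[of g] g by (simp add: height_def words_overD)
  with le show ?thesis by simp
qed

end

text \<open>Past the common prefix the remainders of \<open>x\<close> and \<open>y\<close> start
  with different letters, so in the product they stand side by side unless both start with plane
  letters. Those two merge into one nonzero letter; the constant 4 is the largest weight of two
  letters. Hence Gromov products are weights of common prefixes up to a constant, as in a
  tree.\<close>

lemma common_prefix_weight:
  assumes x: "reduced_word x" and y: "reduced_word y"
  defines "p \<equiv> longest_common_prefix x y"
  shows "word_weight (foldr push (winv x) y) + 2 * word_weight p \<le> word_weight x + word_weight y"
    "word_weight x + word_weight y \<le> word_weight (foldr push (winv x) y) + 2 * word_weight p + 4"
proof -
  obtain x' where x': "x = p @ x'" using longest_common_prefix_prefix1[of x y] by (auto simp: p_def prefix_def)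
  obtain y' where y': "y = p @ y'" using longest_common_prefix_prefix2[of x y] by (auto simp: p_def prefix_def)
  have rx: "reduced_word x'" "reduced_word y'" "reduced_word p" using x y x' y' by (auto simp: reduced_append)
  have py: "foldr push p y' = y" using foldr_push_append[of p y'] y y' by simp
  have e: "foldr push (winv x) y = foldr push (winv x') y'"
    using foldr_push_winv_cancel(1)[OF rx(3,2)] py by (simp add: x')
  have "x' = [] \<or> y' = [] \<or> hd x' \<noteq> hd y'"
  proof (rule ccontr)
    assume n: "\<not> ?thesis"
    then obtain l a b where "x' = l # a" "y' = l # b" by (metis list.exhaust_sel)
    then have "prefix (p @ [l]) x" "prefix (p @ [l]) y" using x' y' by (auto simp: prefix_def)
    then have "prefix (p @ [l]) p" unfolding p_def by (rule longest_common_prefix_max_prefix)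
    then show False by (auto simp: prefix_def)
  qed
  then have main: "word_weight (foldr push (winv x') y') \<le> word_weight x' + word_weight y' \<and>
    word_weight x' + word_weight y' \<le> word_weight (foldr push (winv x') y') + 4"
  proof (elim disjE)
    assume "x' = []" then show ?thesis by simp
  next
    assume "y' = []" then show ?thesis using foldr_push_Nil[OF reduced_winv[OF rx(1)]] by simp
  next
    assume hd: "hd x' \<noteq> hd y'"
    show ?thesis
    proof (cases "x' = [] \<or> y' = []")
      case True
      then show ?thesis using foldr_push_Nil[OF reduced_winv[OF rx(1)]] by auto
    next
      case False
      then obtain l a m b where lm: "x' = l # a" "y' = m # b" by (metis list.exhaust)
      have rw: "reduced_word (winv a @ [linv l])" using reduced_winv[OF rx(1)] lm by simp
      show ?thesis
      proof (cases "compatible_letters (linv l) m")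
        case True
        then have "reduced_word ((winv a @ [linv l]) @ y')"
          using rw rx(2) lm by (subst reduced_append) auto
        from foldr_push_append[OF this] show ?thesis by (simp add: lm)
      next
        case False
        then obtain i j k n where ij: "l = Ab i j" "m = Ab k n"
          using hd lm by (cases l; cases m) auto
        have ne: "- i + k \<noteq> 0 \<or> - j + n \<noteq> 0" using hd lm ij by auto
        have pu: "push (linv l) y' = Ab (- i + k) (- j + n) # b" using ne by (auto simp: lm ij)
        have "reduced_word (winv a @ Ab (- i + k) (- j + n) # b)"
          using rw rx(2) ne lm ij
          by (cases "last (winv a)"; cases "hd b") (auto simp: reduced_append reduced_Cons)
        then have f: "foldr push (winv x') y' = winv a @ Ab (- i + k) (- j + n) # b"
          using foldr_push_append[of "winv a"] pu by (simp add: lm)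
        have "1 \<le> letter_weight l" "1 \<le> letter_weight m"
          using rx lm letter_weight_pos[of l] letter_weight_pos[of m] by (auto simp: reduced_Cons)
        moreover have "letter_weight (Ab (- i + k) (- j + n) :: 'a letter) \<le> 2" "letter_weight l \<le> 2" "letter_weight m \<le> 2" by simp_all
        ultimately show ?thesis unfolding f unfolding lm word_weight_simps word_weight_winv by (intro conjI) linarith+
      qed
    qed
  qed
  show "word_weight (foldr push (winv x) y) + 2 * word_weight p \<le> word_weight x + word_weight y"
    "word_weight x + word_weight y \<le> word_weight (foldr push (winv x) y) + 2 * word_weight p + 4"
    using main by (simp_all add: e) (simp_all add: x' y')
qed

lemma word_weight_prefix: "prefix u v ==> word_weight u \<le> word_weight v"
  by (auto simp: prefix_def)

text \<open>Two prefixes of \<open>y\<close> are comparable, and the shorter one is a common prefix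
  of \<open>x\<close> and \<open>z\<close>.\<close>

lemma common_prefix_ultrametric:
  "min (word_weight (longest_common_prefix x y)) (word_weight (longest_common_prefix y z))
     \<le> word_weight (longest_common_prefix x z)"
proof -
  let ?p = "longest_common_prefix x y" and ?q = "longest_common_prefix y z"
  have "prefix ?p ?q \<or> prefix ?q ?p"
    by (rule prefix_same_cases[of ?p y ?q]) (simp_all add: longest_common_prefix_prefix1 longest_common_prefix_prefix2)
  then show ?thesis
  proof
    assume "prefix ?p ?q"
    then have "prefix ?p z" by (metis longest_common_prefix_prefix2 prefix_order.trans)
    then have "prefix ?p (longest_common_prefix x z)"
      by (intro longest_common_prefix_max_prefix) (simp_all add: longest_common_prefix_prefix1)
    then show ?thesis using word_weight_prefix by fastforce
  next
    assume "prefix ?q ?p"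
    then have "prefix ?q x" by (metis longest_common_prefix_prefix1 prefix_order.trans)
    then have "prefix ?q (longest_common_prefix x z)"
      by (intro longest_common_prefix_max_prefix) (simp_all add: longest_common_prefix_prefix2)
    then show ?thesis using word_weight_prefix by fastforce
  qed
qed

context finite_index_words begin

interpretation Met: Metric_space "coned_off_verts W plane_subgroup" "\<lambda>u v. real (graph_dist cedges u v)"
  unfolding cedges_def by (rule Metric_space_coned_off[OF finite_generating_wgens subgroup_plane])

text \<open>For group elements the claim is the ultrametric inequality for common prefixes, seen
  from the base point \<open>w\<close>; a cone vertex is first replaced by an adjacent group
  element.\<close>

lemma gromov_hyperbolic_cedges:
  "gromov_hyperbolic (graph_metric (coned_off_verts W plane_subgroup) cedges)"
proof -
  let ?V = "coned_off_verts W plane_subgroup"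
  define D where "D u v = real (graph_dist cedges u v)" for u v
  have ms: "mspace (graph_metric ?V cedges) = ?V" and md: "mdist (graph_metric ?V cedges) = D"
    by (simp_all add: graph_metric_def D_def fun_eq_iff)
  have InlV: "Inl g \<in> ?V" if "g \<in> words_over J" for g
    using that by (simp add: coned_off_verts_def)
  have near: "\<exists>g. g \<in> words_over J \<and> D v (Inl g) \<le> 1" if v: "v \<in> ?V" for v
  proof -
    have 1: "D u w \<le> 1" if "(u, w) \<in> cedges" for u w
    proof -
      have "(u, w) \<in> cedges ^^ 1" using that by simp
      then have "graph_dist cedges u w \<le> 1" unfolding graph_dist_def by (rule Least_le)
      then show ?thesis by (simp add: D_def)
    qed
    have "(\<exists>g\<in>words_over J. v = Inl g) \<or> (\<exists>g\<in>words_over J. v = Inr (coset g))"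
      using v by (auto simp: coned_off_verts_def LCOSETS_def)
    then show ?thesis
    proof
      assume "\<exists>g\<in>words_over J. v = Inl g"
      then obtain g where g: "g \<in> words_over J" "v = Inl g" by blast
      have "D v (Inl g) = 0" using Met.zero[OF InlV[OF g(1)] InlV[OF g(1)]] by (simp add: D_def g)
      then show ?thesis using g by (intro exI[of _ g]) simp
    next
      assume "\<exists>g\<in>words_over J. v = Inr (coset g)"
      then show ?thesis using 1 cedgesI(3) by blast
    qed
  qed
  have grp: "min (D x w + D y w - D x y) (D y w + D z w - D y z) \<le> D x w + D z w - D x z + 4"
    if "x = Inl x0" "y = Inl y0" "z = Inl z0" "w = Inl w0"
      "x0 \<in> words_over J" "y0 \<in> words_over J" "z0 \<in> words_over J" "w0 \<in> words_over J" for x y z w x0 y0 z0 w0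
  proof -
    let ?t = "\<lambda>x. foldr push (winv w0) x"
    have Dw: "D (Inl x) (Inl w0) = word_weight (?t x)" if "x \<in> words_over J" for x
      using Met.commute[of "Inl x" "Inl w0"] graph_dist_cedges[OF \<open>w0 \<in> words_over J\<close> that] by (simp add: D_def)
    have Dxy: "D (Inl x) (Inl y) = word_weight (foldr push (winv (?t x)) (?t y))"
      if x: "x \<in> words_over J" and y: "y \<in> words_over J" for x y
    proof -
      let ?u = "foldr push (winv x) y"
      note r = words_overD[OF x] words_overD[OF y] words_overD[OF \<open>w0 \<in> words_over J\<close>]
      have ru: "reduced_word ?u" "reduced_word (?t x)" using r by (simp_all add: reduced_foldr_push)
      have "foldr push (?t x) ?u = foldr push (winv w0) (foldr push x ?u)"
        using foldr_push_assoc[OF r(1) ru(1)] .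
      then have "foldr push (?t x) ?u = ?t y" using foldr_push_winv_cancel(2)[OF r(1,2)] by simp
      then have "foldr push (winv (?t x)) (?t y) = ?u" using foldr_push_winv_cancel(1)[OF ru(2,1)] by simp
      then show ?thesis using graph_dist_cedges[OF x y] by (simp add: D_def)
    qed
    have red: "reduced_word (?t x)" if "x \<in> words_over J" for x
      using that by (simp add: reduced_foldr_push words_overD)
    note c = common_prefix_weight[OF red red]
    show ?thesis
      unfolding that(1-4) Dw[OF that(5)] Dw[OF that(6)] Dw[OF that(7)] Dxy[OF that(5,6)] Dxy[OF that(6,7)] Dxy[OF that(5,7)]
      using c(2)[OF that(5,6)] c(2)[OF that(6,7)] c(1)[OF that(5,7)]
        common_prefix_ultrametric[of "?t x0" "?t y0" "?t z0"]
      by (simp add: min_def split: if_splits)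
  qed
  \<comment> \<open>Moving both ends to group elements changes a distance by at most 2, hence a sum
    of three distances by at most 6. In total 6 + 4 + 6 = 16, and half of it is 8.\<close>
  have "gromov_product (graph_metric ?V cedges) w x z \<ge>
      min (gromov_product (graph_metric ?V cedges) w x y) (gromov_product (graph_metric ?V cedges) w y z) - 8"
    if V: "w \<in> ?V" "x \<in> ?V" "y \<in> ?V" "z \<in> ?V" for w x y z
  proof -
    obtain w0 x0 y0 z0 where g: "w0 \<in> words_over J" "x0 \<in> words_over J" "y0 \<in> words_over J" "z0 \<in> words_over J"
      and n: "D w (Inl w0) \<le> 1" "D x (Inl x0) \<le> 1" "D y (Inl y0) \<le> 1" "D z (Inl z0) \<le> 1"
      using near[OF V(1)] near[OF V(2)] near[OF V(3)] near[OF V(4)] by blast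
    have cm: "D u v = D v u" for u v by (simp add: D_def Met.commute)
    have tri: "D u t \<le> D u v + D v t" if "u \<in> ?V" "v \<in> ?V" "t \<in> ?V" for u v t
      using Met.triangle[OF that] by (simp add: D_def)
    have ap: "D u v \<le> D (Inl a) (Inl b) + 2" "D (Inl a) (Inl b) \<le> D u v + 2"
      if h: "u \<in> ?V" "v \<in> ?V" "a \<in> words_over J" "b \<in> words_over J" "D u (Inl a) \<le> 1" "D v (Inl b) \<le> 1" for u v a b
      using tri[OF h(1) InlV[OF h(3)] h(2)] tri[OF InlV[OF h(3)] InlV[OF h(4)] h(2)]
        tri[OF InlV[OF h(3)] h(1) InlV[OF h(4)]] tri[OF h(1,2) InlV[OF h(4)]] h(5,6)
        cm[of v "Inl b"] cm[of u "Inl a"] by linarith+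
    let ?A = "D x w + D y w - D x y" and ?B = "D y w + D z w - D y z" and ?C = "D x w + D z w - D x z"
    have "?A \<le> D (Inl x0) (Inl w0) + D (Inl y0) (Inl w0) - D (Inl x0) (Inl y0) + 6"
      using ap(1)[OF V(2,1) g(2,1) n(2,1)] ap(1)[OF V(3,1) g(3,1) n(3,1)] ap(2)[OF V(2,3) g(2,3) n(2,3)] by simp
    moreover have "?B \<le> D (Inl y0) (Inl w0) + D (Inl z0) (Inl w0) - D (Inl y0) (Inl z0) + 6"
      using ap(1)[OF V(3,1) g(3,1) n(3,1)] ap(1)[OF V(4,1) g(4,1) n(4,1)] ap(2)[OF V(3,4) g(3,4) n(3,4)] by simp
    moreover have "D (Inl x0) (Inl w0) + D (Inl z0) (Inl w0) - D (Inl x0) (Inl z0) \<le> ?C + 6"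
      using ap(2)[OF V(2,1) g(2,1) n(2,1)] ap(2)[OF V(4,1) g(4,1) n(4,1)] ap(1)[OF V(2,4) g(2,4) n(2,4)] by simp
    ultimately have "min ?A ?B \<le> ?C + 16"
      using grp[OF refl refl refl refl g(2,3,4,1)] unfolding min_le_iff_disj by (elim disjE) simp_all
    moreover have "min (?A / 2) (?B / 2) = min ?A ?B / 2" by (simp add: min_def)
    ultimately show ?thesis unfolding gromov_product_def md by simp
  qed
  then show ?thesis unfolding gromov_hyperbolic_def ms by (intro exI[of _ 8]) auto
qed

lemma circuit_edge:
  assumes "circuit E vs" "n = length vs"
  shows "(vs ! ((i + k) mod n), vs ! ((i + Suc k) mod n)) \<in> E"
proof -
  have n3: "n \<ge> 3" using assms by (simp add: circuit_def)
  then have "(i + k) mod n < n" by simp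
  moreover have "((i + k) mod n + 1) mod n = (i + Suc k) mod n" by (simp add: mod_Suc_eq)
  ultimately show ?thesis using assms by (metis circuit_def)
qed

lemma circuit_inj:
  assumes "circuit E vs" "n = length vs" "k < n" "k' < n" "vs ! ((i + k) mod n) = vs ! ((i + k') mod n)"
  shows "k = k'"
proof -
  have "(i + k) mod n < n" "(i + k') mod n < n" using assms(3) by simp_all
  then have "(i + k) mod n = (i + k') mod n"
    using assms nth_eq_iff_index_eq[of vs "(i + k) mod n" "(i + k') mod n"] by (auto simp: circuit_def)
  then have "[i + k = i + k'] (mod n)" by (simp add: unique_euclidean_semiring_class.cong_def)
  then have "[k = k'] (mod n)" using cong_add_lcancel_nat by blast
  then show ?thesis using assms(3,4) by (simp add: unique_euclidean_semiring_class.cong_def)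
qed

lemma stem_Fr: "\<exists>v. stem (Fr x s # w) = Fr x s # v"
  by (cases w rule: rev_cases) (auto simp: stem_def)

text \<open>Deleting a free edge separates the coned-off graph, so no circuit runs through it.\<close>

lemma circuit_no_free_edge:
  assumes c: "circuit cedges vs" and n: "n = length vs" and i: "i < n"
    and g: "g \<in> words_over J" and x: "x \<in> J"
    and vi: "vs ! (i mod n) = Inl g" "vs ! (Suc i mod n) = Inl (foldr push g [Fr x s])"
  shows False
proof -
  let ?h = "foldr push g [Fr x s]"
  let ?start = "\<lambda>k. \<exists>w. stem (foldr push (winv g) k) = Fr x s # w"
  \<comment> \<open>The far side of the free edge: vertices whose normal form, seen from
    \<open>g\<close>, starts with the letter of the edge. The stem makes this a property of cosets
    as well.\<close>
  define S where "S v = (case v of Inl k => ?start k | Inr C => ?start (SOME k. k \<in> C))" for v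
  have n3: "n \<ge> 3" using c n by (simp add: circuit_def)
  have S_coset: "S (Inr (coset k)) \<longleftrightarrow> S (Inl k)" if k: "k \<in> words_over J" for k
  proof -
    have "(SOME k'. k' \<in> coset k) \<in> coset k" using coset_mem[OF k] by (rule someI)
    then show ?thesis using stem_coset[OF g k] by (simp add: S_def)
  qed
  have hm: "?h \<in> words_over J" by (rule words_over_mult[OF g Fr_words_over[OF x]])
  have gh: "foldr push (winv g) ?h = [Fr x s]"
    by (rule foldr_push_winv_cancel(1)) (use g Fr_words_over[OF x] in \<open>auto dest: words_overD\<close>)
  have Sh: "S (Inl ?h)" by (simp add: S_def gh stem_def)
  have Sg: "\<not> S (Inl g)" using foldr_push_winv[of g] g by (simp add: S_def words_overD stem_def)
  have cross: "a = Inl ?h \<and> b = Inl g" if e: "(a, b) \<in> cedges" and "S a" "\<not> S b" for a b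
    using e
  proof (cases rule: cedges_cases)
    case (1 k k')
    have k: "k \<in> words_over J" "k' \<in> words_over J" using cayley_step[OF 1(3)] by auto
    let ?w = "foldr push (winv g) k"
    have r: "reduced_word ?w" using k by (simp add: reduced_foldr_push words_overD)
    obtain w where w: "stem ?w = Fr x s # w" using \<open>S a\<close> by (auto simp: S_def 1)
    have "\<not> (\<exists>i j. k' = foldr push k (plane_elt i j))"
    proof
      assume "\<exists>i j. k' = foldr push k (plane_elt i j)"
      then have "k' \<in> coset k" by (auto simp: coset_eq)
      then have "S b" using stem_coset[OF g k(1)] w by (simp add: S_def 1)
      then show False using \<open>\<not> S b\<close> by simp
    qed
    then obtain y t where y: "y \<in> J" "k' = foldr push k [Fr y t]" using cayley_step[OF 1(3)] by blast
    have w': "foldr push (winv g) k' = foldr push ?w [Fr y t]"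
      using y foldr_push_assoc[of k "[Fr y t]" "winv g"] k Fr_words_over[OF y(1)] by (simp add: words_overD)
    obtain p q where pq: "?w = stem ?w @ plane_elt p q" using stem_decomp[OF r] by metis
    show ?thesis
    proof (cases "?w \<noteq> [] \<and> last ?w = Fr y (\<not> t)")
      case False
      then have "foldr push (winv g) k' = Fr x s # (w @ plane_elt p q @ [Fr y t])"
        using w' foldr_push_Fr[OF r, of y t] pq w by (metis (no_types, lifting) append_Cons append_assoc)
      then have "S b" using stem_Fr by (simp add: S_def 1)
      then show ?thesis using \<open>\<not> S b\<close> by simp
    next
      case True
      then have "stem ?w = ?w" by (simp add: stem_def)
      then have ww: "?w = Fr x s # w" using w by simp
      have b: "foldr push (winv g) k' = butlast ?w" using w' foldr_push_Fr[OF r, of y t] True by simp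
      show ?thesis
      proof (cases "w = []")
        case False
        then have "foldr push (winv g) k' = Fr x s # butlast w" using b ww by simp
        then have "S b" using stem_Fr by (simp add: S_def 1)
        then show ?thesis using \<open>\<not> S b\<close> by simp
      next
        case wn: True
        have can: "m = m'" if e: "foldr push (winv g) m = foldr push (winv g) m'" and m: "m \<in> words_over J" "m' \<in> words_over J" for m m'
        proof -
          have "m = foldr push g (foldr push (winv g) m)"
            by (rule foldr_push_winv_cancel(2)[symmetric]) (use m g in \<open>auto dest: words_overD\<close>)
          also have "\<dots> = m'" unfolding e
            by (rule foldr_push_winv_cancel(2)) (use m g in \<open>auto dest: words_overD\<close>)
          finally show ?thesis .
        qed
        have "k = ?h" by (rule can[OF _ k(1) hm]) (simp only: gh ww wn)
        moreover have "k' = g"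
          by (rule can[OF _ k(2) g]) (simp only: b ww wn foldr_push_winv[OF words_overD[OF g]] butlast.simps if_True simp_thms)
        ultimately show ?thesis using 1 by simp
      qed
    qed
  next
    case (2 k)
    then show ?thesis using S_coset[of k] that by simp
  next
    case (3 k)
    then show ?thesis using S_coset[of k] that by simp
  qed
  define f where "f k = vs ! ((Suc i + k) mod n)" for k
  have f0: "f 0 = Inl ?h" by (simp add: f_def vi)
  have fn: "f (n - 1) = Inl g"
  proof -
    have "Suc i + (n - 1) = i + n" using n3 by simp
    then show ?thesis using vi i by (simp add: f_def)
  qed
  have edge: "(f k, f (Suc k)) \<in> cedges" for k
    unfolding f_def using circuit_edge[OF c n, of "Suc i" k] by simp
  \<comment> \<open>Without the edge the circuit is a path from its far end back to
    \<open>g\<close>, so it leaves \<open>S\<close> somewhere. By \<open>cross\<close> it does so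
    along the edge itself, which is impossible for distinct vertices and length at least 3.\<close>
  have "\<exists>k<n - 1. S (f k) \<and> \<not> S (f (Suc k))"
  proof (rule ccontr)
    assume "\<not> ?thesis"
    then have "k \<le> n - 1 ==> S (f k)" for k by (induction k) (auto simp: f0 Sh)
    from this[of "n - 1"] show False using Sg fn by simp
  qed
  then obtain k where k: "k < n - 1" "S (f k)" "\<not> S (f (Suc k))" by blast
  then have "f k = f 0" "f (Suc k) = f (n - 1)" using cross[OF edge] f0 fn by auto
  then have "k = 0" "Suc k = n - 1"
    using circuit_inj[OF c n, of k 0 "Suc i"] circuit_inj[OF c n, of "Suc k" "n - 1" "Suc i"] k(1) n3
    unfolding f_def by auto
  then show False using n3 by simp
qed

text \<open>A circuit avoids free edges, so from a group element \<open>g\<close> it can only make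
  plane steps or visit the cone vertex of the coset of \<open>g\<close>. In a circuit of length
  \<open>n\<close> the plane steps stay in a box of radius \<open>n\<close>, which leaves finitely
  many vertices.\<close>

lemma fine_cedges: "fine_graph cedges"
  unfolding fine_graph_def
proof (clarify)
  fix u v n assume uv: "(u, v) \<in> cedges"
  obtain g where g: "g \<in> words_over J" "Inl g \<in> {u, v}"
    using uv by (cases rule: cedges_cases) (auto dest: cayley_step)
  let ?B = "insert (Inr (coset g)) ((\<lambda>(i, j). Inl (foldr push g (plane_elt i j))) ` ({- int n..int n} \<times> {- int n..int n}))"
  have "set vs \<subseteq> ?B" if c: "circuit cedges vs" and n: "length vs = n"
    and e: "i < n" "{vs ! i, vs ! ((i + 1) mod n)} = {u, v}" for vs i
  proof -
    note n' = n[symmetric]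
    have n3: "n \<ge> 3" using c n by (simp add: circuit_def)
    obtain i0 where i0: "i0 < n" "vs ! i0 = Inl g"
    proof -
      have "vs ! i = Inl g \<or> vs ! ((i + 1) mod n) = Inl g" using g(2) e(2) by (auto simp: doubleton_eq_iff)
      moreover have "(i + 1) mod n < n" using n3 by simp
      ultimately show ?thesis using that e(1) by blast
    qed
    define f where "f k = vs ! ((i0 + k) mod n)" for k
    have f0: "f 0 = Inl g" "f n = Inl g" using i0 by (simp_all add: f_def)
    have edge: "(f k, f (Suc k)) \<in> cedges" for k
      unfolding f_def by (rule circuit_edge[OF c n'])
    have inj: "k = k'" if "f k = f k'" "k < n" "k' < n" for k k'
      using circuit_inj[OF c n' that(2,3)] that(1) by (simp add: f_def)
    have nofree: "\<not> (\<exists>a x s. a \<in> words_over J \<and> x \<in> J \<and> f k = Inl a \<and> f (Suc k) = Inl (foldr push a [Fr x s]))" for k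
    proof clarify
      fix a x s assume "a \<in> words_over J" "x \<in> J" "f k = Inl a" "f (Suc k) = Inl (foldr push a [Fr x s])"
      moreover have "(i0 + k) mod n < n" using n3 by simp
      moreover have "Suc ((i0 + k) mod n) mod n = (i0 + Suc k) mod n" by (simp add: mod_Suc_eq)
      ultimately show False
        using circuit_no_free_edge[OF c n', of "(i0 + k) mod n" a x s] by (simp add: f_def)
    qed
    define near where "near m w \<longleftrightarrow> (\<exists>i j. \<bar>i\<bar> \<le> int m \<and> \<bar>j\<bar> \<le> int m \<and> w = Inl (foldr push g (plane_elt i j)))" for m and w :: "'i letter list + 'i letter list set"
    have shift: "near (Suc m) (Inl (foldr push a (plane_elt i j)))" if nr: "near m (Inl a)" "\<bar>i\<bar> \<le> 1" "\<bar>j\<bar> \<le> 1" for m a i j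
    proof -
      obtain k l where kl: "\<bar>k\<bar> \<le> int m" "\<bar>l\<bar> \<le> int m" "a = foldr push g (plane_elt k l)"
        using nr(1) unfolding near_def by blast
      have "foldr push a (plane_elt i j) = foldr push g (plane_elt (k + i) (l + j))"
        unfolding kl(3) using foldr_push_assoc[of "plane_elt k l" "plane_elt i j" g] plane_elt_words_over[of _ _ J]
        by (simp add: words_overD plane_elt_mult)
      moreover have "\<bar>k + i\<bar> \<le> int (Suc m)" "\<bar>l + j\<bar> \<le> int (Suc m)" using kl nr(2,3) by auto
      ultimately show ?thesis unfolding near_def by blast
    qed
    have plane: "\<exists>a i j. a \<in> words_over J \<and> \<bar>i\<bar> \<le> 1 \<and> \<bar>j\<bar> \<le> 1 \<and> f k = Inl a \<and> f (Suc k) = Inl (foldr push a (plane_elt i j))"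
      if "isl (f k)" "isl (f (Suc k))" for k
      using edge[of k]
    proof (cases rule: cedges_cases)
      case (1 a b)
      then show ?thesis using cayley_step[OF 1(3)] nofree[of k] by blast
    qed (use that in auto)
    have fwd: "near k (f k)" if "\<forall>k'\<le>k. isl (f k')" for k
      using that
    proof (induction k)
      case 0
      show ?case using foldr_push_Nil[of g] g(1)
        by (auto simp: near_def f0 plane_elt_def words_overD intro!: exI[of _ 0])
    next
      case (Suc k)
      then have "near k (f k)" by simp
      then show ?case using plane[of k] Suc.prems shift by (metis le_SucI order_refl)
    qed
    have bwd: "near j (f (n - j))" if "j \<le> n" "\<forall>j'\<le>j. isl (f (n - j'))" for j
      using that
    proof (induction j)
      case 0
      show ?case using foldr_push_Nil[of g] g(1)
        by (auto simp: near_def f0 plane_elt_def words_overD intro!: exI[of _ 0])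
    next
      case (Suc j)
      then have ne: "near j (f (n - j))" by simp
      have S: "Suc (n - Suc j) = n - j" using Suc.prems(1) by simp
      obtain a p q where a: "a \<in> words_over J" "\<bar>p\<bar> \<le> 1" "\<bar>q\<bar> \<le> 1" "f (n - Suc j) = Inl a" "f (n - j) = Inl (foldr push a (plane_elt p q))"
        using plane[of "n - Suc j"] Suc.prems(2) unfolding S by (metis le_SucI order_refl)
      have "foldr push (foldr push a (plane_elt p q)) (plane_elt (- p) (- q)) = a"
        using foldr_push_assoc[of "plane_elt p q" "plane_elt (- p) (- q)" a] plane_elt_words_over[of _ _ J] a(1)
          foldr_push_Nil[of a] plane_elt_mult[of p q "- p" "- q"]
        by (simp add: words_overD) (simp add: plane_elt_def words_overD)
      then show ?case using shift[of j "foldr push a (plane_elt p q)" "- p" "- q"] ne a by simp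
    qed
    have cone: "f k = Inr (coset g)" if "\<not> isl (f k)" "k > 0" "near m (f (k - 1)) \<or> near m (f (Suc k))" for k m
    proof -
      have *: "coset a = coset g" if "near m (Inl a)" for a
        using that coset_plane[OF g(1)] unfolding near_def by auto
      show ?thesis using that(3)
      proof
        assume nr: "near m (f (k - 1))"
        have "(f (k - 1), f k) \<in> cedges" using edge[of "k - 1"] that(2) by simp
        then show ?thesis
          by (cases rule: cedges_cases) (use that(1) nr * in \<open>auto simp: near_def\<close>)
      next
        assume nr: "near m (f (Suc k))"
        show ?thesis using edge[of k]
          by (cases rule: cedges_cases) (use that(1) nr * in \<open>auto simp: near_def\<close>)
      qed
    qed
    have main: "f k \<in> ?B" if k: "k < n" for k
    proof (cases "\<exists>k'<n. \<not> isl (f k')")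
      case False
      then have "near k (f k)" using k by (intro fwd) auto
      then show ?thesis using k by (force simp: near_def abs_le_iff)
    next
      case True
      \<comment> \<open>The first cone vertex met going forwards from \<open>g\<close>, and
        \<open>j1\<close> the first one met going backwards. Both are the cone vertex of the coset
        of \<open>g\<close>, which a circuit visits only once; so all other vertices are reached
        from \<open>g\<close> by plane steps in one of the two directions.\<close>
      define k1 where "k1 = (LEAST k'. k' < n \<and> \<not> isl (f k'))"
      have k1: "k1 < n" "\<not> isl (f k1)" using LeastI_ex[OF True[unfolded Bex_def]] by (auto simp: k1_def)
      have lt: "isl (f k')" if "k' < k1" for k'
        using not_less_Least[of k' "\<lambda>k'. k' < n \<and> \<not> isl (f k')"] that k1(1) by (auto simp: k1_def)
      have k1p: "k1 > 0" using k1(2) f0(1) by (cases k1) auto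
      have fk1: "f k1 = Inr (coset g)"
        using fwd[of "k1 - 1"] lt k1p by (intro cone[OF k1(2) k1p]) auto
      define j1 where "j1 = (LEAST j. j \<le> n \<and> \<not> isl (f (n - j)))"
      have ex: "\<exists>j. j \<le> n \<and> \<not> isl (f (n - j))" using k1 by (intro exI[of _ "n - k1"]) auto
      have j1: "j1 \<le> n" "\<not> isl (f (n - j1))" using LeastI_ex[OF ex] by (auto simp: j1_def)
      have ltj: "isl (f (n - j'))" if "j' < j1" for j'
        using not_less_Least[of j' "\<lambda>j. j \<le> n \<and> \<not> isl (f (n - j))"] that j1(1) by (auto simp: j1_def)
      have j1p: "j1 > 0" using j1(2) f0(2) by (cases j1) auto
      have j1n: "j1 < n" using j1 f0(1) by (cases "j1 = n") auto
      have "f (n - j1) = Inr (coset g)"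
      proof (rule cone[OF j1(2)])
        have "near (j1 - 1) (f (n - (j1 - 1)))" using bwd[of "j1 - 1"] ltj j1p j1(1) by auto
        moreover have "n - (j1 - 1) = Suc (n - j1)" using j1p j1(1) by simp
        ultimately show "near (j1 - 1) (f (n - j1 - 1)) \<or> near (j1 - 1) (f (Suc (n - j1)))" by metis
      qed (use j1n in simp)
      then have eq: "n - j1 = k1" using fk1 inj[of "n - j1" k1] k1(1) j1p n3 by auto
      consider "k < k1" | "k = k1" | "k > k1" by linarith
      then show ?thesis
      proof cases
        case 1
        then have "near k (f k)" using lt by (intro fwd) auto
        then show ?thesis using k by (force simp: near_def abs_le_iff)
      next
        case 2
        then show ?thesis using fk1 by simp
      next
        case 3
        then have "\<forall>j'\<le>n - k. isl (f (n - j'))" using eq j1(1) k by (auto intro!: ltj)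
        then have "near (n - k) (f (n - (n - k)))" by (intro bwd) auto
        then have "near (n - k) (f k)" using k by simp
        then show ?thesis using k by (force simp: near_def abs_le_iff)
      qed
    qed
    show ?thesis
    proof
      fix w assume "w \<in> set vs"
      then obtain j where j: "j < n" "w = vs ! j" using n by (auto simp: in_set_conv_nth)
      have "f ((j + (n - i0)) mod n) = w"
      proof -
        have "(i0 + (j + (n - i0)) mod n) mod n = (j + n) mod n" using i0(1) by (simp add: mod_add_right_eq)
        then show ?thesis using j by (simp add: f_def)
      qed
      moreover have "(j + (n - i0)) mod n < n" using n3 by simp
      ultimately show "w \<in> ?B" using main by metis
    qed
  qed
  then have "{vs. circuit cedges vs \<and> length vs = n \<and> (\<exists>i<n. {vs ! i, vs ! ((i + 1) mod n)} = {u, v})}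
      \<subseteq> {vs. set vs \<subseteq> ?B \<and> length vs = n}" by blast
  moreover have "finite {vs. set vs \<subseteq> ?B \<and> length vs = n}" by (rule finite_lists_length_eq) auto
  ultimately show "finite {vs. circuit cedges vs \<and> length vs = n \<and> (\<exists>i<n. {vs ! i, vs ! ((i + 1) mod n)} = {u, v})}"
    by (rule finite_subset)
qed

theorem hyperbolic_relative_to_plane: "hyperbolic_relative_to W plane_subgroup"
  unfolding hyperbolic_relative_to_def
  using subgroup_plane finite_generating_wgens gromov_hyperbolic_cedges fine_cedges
  unfolding cedges_def by blast

end

section \<open>Invariance of relative hyperbolicity under isomorphisms\<close>

lemma relpow_map_prod:
  assumes inj: "inj_on f V" and E: "E \<subseteq> V \<times> V" and u: "u \<in> V" and v: "v \<in> V"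
  shows "(f u, f v) \<in> (map_prod f f ` E) ^^ n \<longleftrightarrow> (u, v) \<in> E ^^ n"
  using v
proof (induction n arbitrary: v)
  case 0
  then show ?case using inj u by (auto dest: inj_onD)
next
  case (Suc n)
  show ?case
  proof
    assume "(f u, f v) \<in> (map_prod f f ` E) ^^ Suc n"
    then obtain w where w: "(f u, w) \<in> (map_prod f f ` E) ^^ n" "(w, f v) \<in> map_prod f f ` E"
      by (rule relpow_Suc_E)
    then obtain a b where ab: "(a, b) \<in> E" "w = f a" "f v = f b" by auto
    then have "v = b" "a \<in> V" using inj E Suc.prems by (auto dest: inj_onD)
    then show "(u, v) \<in> E ^^ Suc n" using Suc.IH[of a] w ab by auto
  next
    assume "(u, v) \<in> E ^^ Suc n"
    then obtain w where w: "(u, w) \<in> E ^^ n" "(w, v) \<in> E" by auto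
    then have "(f w, f v) \<in> map_prod f f ` E" "w \<in> V" using E by auto
    then show "(f u, f v) \<in> (map_prod f f ` E) ^^ Suc n" using Suc.IH[of w] w by auto
  qed
qed

lemma fine_graph_map_prod:
  assumes inj: "inj_on f V" and E: "E \<subseteq> V \<times> V" and fine: "fine_graph E"
  shows "fine_graph (map_prod f f ` E)"
  unfolding fine_graph_def
proof clarify
  fix u' v' n a b assume ab: "(a, b) \<in> E"
  let ?F = "map_prod f f ` E"
  have V: "a \<in> V" "b \<in> V" using ab E by auto
  have "finite {vs. circuit E vs \<and> length vs = n \<and> (\<exists>i<n. {vs ! i, vs ! ((i + 1) mod n)} = {a, b})}" (is "finite ?S")
    using fine ab unfolding fine_graph_def by blast
  moreover have "{vs. circuit ?F vs \<and> length vs = n \<and> (\<exists>i<n. {vs ! i, vs ! ((i + 1) mod n)} = {f a, f b})} \<subseteq> map f ` ?S"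
  proof clarify
    fix vs i assume c: "circuit ?F vs" and n: "n = length vs" and i: "i < length vs"
      and e: "{vs ! i, vs ! ((i + 1) mod length vs)} = {f a, f b}"
    let ?g = "inv_into V f"
    have len: "length vs \<ge> 3" using c by (simp add: circuit_def)
    have gf: "?g (f x) = x" if "x \<in> V" for x using that inj by simp
    have vsj: "\<exists>x\<in>V. vs ! j = f x" if "j < length vs" for j
    proof -
      have "(vs ! j, vs ! ((j + 1) mod length vs)) \<in> ?F" using c that by (simp add: circuit_def)
      then show ?thesis using E by auto
    qed
    have fg: "f (?g (vs ! j)) = vs ! j" if "j < length vs" for j
      using vsj[OF that] gf by auto
    have vs: "vs = map f (map ?g vs)" by (rule nth_equalityI) (auto simp: fg)
    have edge: "(?g (vs ! j), ?g (vs ! ((j + 1) mod length vs))) \<in> E" if "j < length vs" for j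
    proof -
      have "(vs ! j, vs ! ((j + 1) mod length vs)) \<in> ?F" using c that by (simp add: circuit_def)
      then obtain x y where xy: "(x, y) \<in> E" "vs ! j = f x" "vs ! ((j + 1) mod length vs) = f y" by auto
      then show ?thesis using gf E by auto
    qed
    have md: "(j + 1) mod length vs < length vs" for j
      using len by (intro mod_less_divisor) linarith
    have "distinct (map ?g vs)"
      using c vs by (metis circuit_def distinct_map)
    then have "circuit E (map ?g vs)"
      using edge len md by (simp add: circuit_def)
    moreover have "{map ?g vs ! i, map ?g vs ! ((i + 1) mod length vs)} = {a, b}"
    proof -
      have "{map ?g vs ! i, map ?g vs ! ((i + 1) mod length vs)} = ?g ` {vs ! i, vs ! ((i + 1) mod length vs)}"
        using i md[of i] by simp
      also have "\<dots> = ?g ` {f a, f b}" unfolding e ..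
      finally show ?thesis using gf V by simp
    qed
    ultimately have "map ?g vs \<in> {ws. circuit E ws \<and> length ws = length vs \<and> (\<exists>i<length vs. {ws ! i, ws ! ((i + 1) mod length vs)} = {a, b})}"
      using i unfolding mem_Collect_eq length_map by blast
    then show "vs \<in> map f ` {ws. circuit E ws \<and> length ws = length vs \<and> (\<exists>i<length vs. {ws ! i, ws ! ((i + 1) mod length vs)} = {a, b})}"
      using vs by (metis (no_types, lifting) image_eqI)
  qed
  ultimately show "finite {vs. circuit ?F vs \<and> length vs = n \<and> (\<exists>i<n. {vs ! i, vs ! ((i + 1) mod n)} = {f a, f b})}"
    using finite_surj by blast
qed

theorem hyperbolic_relative_to_iso:
  assumes G: "group G" and H: "group H" and phi: "\<phi> \<in> iso G H" and hyp: "hyperbolic_relative_to G P"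
  shows "hyperbolic_relative_to H (\<phi> ` P)"
proof -
  interpret G: group G by (rule G)
  interpret H: group H by (rule H)
  interpret h: group_hom G H \<phi> using phi by unfold_locales (auto simp: iso_def)
  have bij: "bij_betw \<phi> (carrier G) (carrier H)" using phi by (auto simp: iso_def)
  then have inj: "inj_on \<phi> (carrier G)" and img: "\<phi> ` carrier G = carrier H" by (auto simp: bij_betw_def)
  obtain X where P: "subgroup P G" and X: "finite_generating_set G X"
    and gr: "gromov_hyperbolic (graph_metric (coned_off_verts G P) (coned_off_edges G X P))"
    and fine: "fine_graph (coned_off_edges G X P)"
    using hyp unfolding hyperbolic_relative_to_def by blast
  have XG: "X \<subseteq> carrier G" and PG: "P \<subseteq> carrier G"
    using X subgroup.subset[OF P] by (auto simp: finite_generating_set_def)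
  have P': "subgroup (\<phi> ` P) H" using P by (rule h.subgroup_img_is_subgroup)
  have X': "finite_generating_set H (\<phi> ` X)"
  proof -
    have "generate H (\<phi> ` X) = \<phi> ` generate G X" using h.generate_img[OF XG] by simp
    then show ?thesis using X img by (auto simp: finite_generating_set_def)
  qed
  \<comment> \<open>The isomorphism acts on cone vertices by direct images of cosets, and so
    relabels the whole coned-off graph.\<close>
  define f where "f = map_sum \<phi> (image \<phi>)"
  let ?V = "coned_off_verts G P" and ?E = "coned_off_edges G X P"
  have coset: "\<phi> g <#\<^bsub>H\<^esub> \<phi> ` P = \<phi> ` (g <#\<^bsub>G\<^esub> P)" if "g \<in> carrier G" for g
    using that PG by (force simp: l_coset_def image_iff)
  have cosetG: "g <#\<^bsub>G\<^esub> P \<subseteq> carrier G" if "g \<in> carrier G" for g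
    using that PG by (auto simp: l_coset_def)
  have cay: "cayley_edges H (\<phi> ` X) = map_prod \<phi> \<phi> ` cayley_edges G X"
  proof -
    have m: "\<phi> (g \<otimes>\<^bsub>G\<^esub> x) = \<phi> g \<otimes>\<^bsub>H\<^esub> \<phi> x" if "g \<in> carrier G" "x \<in> X" for g x using that XG by auto
    show ?thesis
    proof (intro equalityI subsetI)
      fix z assume "z \<in> cayley_edges H (\<phi> ` X)"
      then obtain g x where gx: "g \<in> carrier H" "x \<in> \<phi> ` X" "z = (g, g \<otimes>\<^bsub>H\<^esub> x) \<or> z = (g \<otimes>\<^bsub>H\<^esub> x, g)"
        by (auto simp: cayley_edges_def)
      obtain x0 where x0: "x0 \<in> X" "x = \<phi> x0" using gx(2) by blast
      obtain g0 where g00: "g0 \<in> carrier G" "g = \<phi> g0" using gx(1) img by blast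
      note g0 = g00 x0
      have "(g0, g0 \<otimes>\<^bsub>G\<^esub> x0) \<in> cayley_edges G X" "(g0 \<otimes>\<^bsub>G\<^esub> x0, g0) \<in> cayley_edges G X"
        using g0 by (auto simp: cayley_edges_def)
      then show "z \<in> map_prod \<phi> \<phi> ` cayley_edges G X"
        using gx(3) m[OF g0(1,3)] g0 by (metis (no_types, lifting) image_eqI map_prod_simp)
    next
      fix z assume "z \<in> map_prod \<phi> \<phi> ` cayley_edges G X"
      then obtain g x where gx: "g \<in> carrier G" "x \<in> X" "z = (\<phi> g, \<phi> (g \<otimes>\<^bsub>G\<^esub> x)) \<or> z = (\<phi> (g \<otimes>\<^bsub>G\<^esub> x), \<phi> g)"
        by (auto simp: cayley_edges_def)
      have "(\<phi> g, \<phi> g \<otimes>\<^bsub>H\<^esub> \<phi> x) \<in> cayley_edges H (\<phi> ` X)" "(\<phi> g \<otimes>\<^bsub>H\<^esub> \<phi> x, \<phi> g) \<in> cayley_edges H (\<phi> ` X)"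
        unfolding cayley_edges_def using gx(1,2) img by blast+
      then show "z \<in> cayley_edges H (\<phi> ` X)"
        using m[OF gx(1,2)] gx(3) by metis
    qed
  qed
  have E': "coned_off_edges H (\<phi> ` X) (\<phi> ` P) = map_prod f f ` ?E"
  proof -
    have 1: "map_prod Inl Inl ` map_prod \<phi> \<phi> ` cayley_edges G X = map_prod f f ` map_prod Inl Inl ` cayley_edges G X"
      by (simp add: image_image map_prod_def f_def case_prod_beta)
    have 2: "{(Inl g, Inr (g <#\<^bsub>H\<^esub> \<phi> ` P)) | g. g \<in> carrier H} = map_prod f f ` {(Inl g, Inr (g <#\<^bsub>G\<^esub> P)) | g. g \<in> carrier G}"
      unfolding Setcompr_eq_image img[symmetric] image_image by (rule image_cong) (simp_all add: f_def coset)
    have 3: "{(Inr (g <#\<^bsub>H\<^esub> \<phi> ` P), Inl g) | g. g \<in> carrier H} = map_prod f f ` {(Inr (g <#\<^bsub>G\<^esub> P), Inl g) | g. g \<in> carrier G}"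
      unfolding Setcompr_eq_image img[symmetric] image_image by (rule image_cong) (simp_all add: f_def coset)
    show ?thesis unfolding coned_off_edges_def cay 1 2 3 image_Un ..
  qed
  have V': "coned_off_verts H (\<phi> ` P) = f ` ?V"
  proof -
    have "lcosets\<^bsub>H\<^esub> (\<phi> ` P) = image \<phi> ` (lcosets\<^bsub>G\<^esub> P)"
      unfolding LCOSETS_def UNION_singleton_eq_range img[symmetric] image_image
      by (rule image_cong) (simp_all add: coset)
    then show ?thesis
      unfolding coned_off_verts_def image_Un img[symmetric] by (simp add: image_image f_def)
  qed
  have injf: "inj_on f ?V"
  proof (rule inj_onI)
    fix u v assume u: "u \<in> ?V" and v: "v \<in> ?V" and e: "f u = f v"
    show "u = v"
    proof (cases u)
      case (Inl g)
      then obtain h where "v = Inl h" using e by (cases v) (auto simp: f_def)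
      then show ?thesis using Inl u v e inj by (auto simp: f_def coned_off_verts_def dest: inj_onD)
    next
      case (Inr C)
      then obtain C' where C': "v = Inr C'" using e by (cases v) (auto simp: f_def)
      then have "C \<subseteq> carrier G" "C' \<subseteq> carrier G" "\<phi> ` C = \<phi> ` C'"
        using Inr u v e cosetG by (auto simp: f_def coned_off_verts_def LCOSETS_def)
      then show ?thesis using inj Inr C' by (metis inj_on_image_eq_iff)
    qed
  qed
  have EV: "?E \<subseteq> ?V \<times> ?V"
    using XG by (auto simp: coned_off_edges_def coned_off_verts_def cayley_edges_def LCOSETS_def)
  have dist: "graph_dist (map_prod f f ` ?E) (f u) (f v) = graph_dist ?E u v" if "u \<in> ?V" "v \<in> ?V" for u v
    unfolding graph_dist_def using relpow_map_prod[OF injf EV that] by simp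
  interpret M: Metric_space ?V "\<lambda>u v. real (graph_dist ?E u v)" by (rule G.Metric_space_coned_off[OF X P])
  interpret M': Metric_space "f ` ?V" "\<lambda>u v. real (graph_dist (map_prod f f ` ?E) u v)"
    using H.Metric_space_coned_off[OF X' P'] by (simp add: V' E')
  have "gromov_hyperbolic (graph_metric (f ` ?V) (map_prod f f ` ?E))"
    using gr unfolding gromov_hyperbolic_def gromov_product_def graph_metric_def by (simp add: dist)
  moreover have "fine_graph (map_prod f f ` ?E)" by (rule fine_graph_map_prod[OF injf EV fine])
  ultimately show ?thesis
    unfolding hyperbolic_relative_to_def using P' X' E' V' by metis
qed

section \<open>Thickness of the plane\<close>

text \<open>Zorn's lemma for proper filters finer than \<open>sequentially\<close>: a minimal one
  decides every predicate, since otherwise it could be refined. Being finer than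
  \<open>sequentially\<close> lets ordinary limits of sequences pass to it.\<close>

lemma ex_nonprincipal_ultrafilter: "\<exists>\<omega>. nonprincipal_ultrafilter \<omega> \<and> \<omega> \<le> sequentially"
proof -
  let ?A = "{f :: nat filter. f \<noteq> bot \<and> f \<le> sequentially}"
  have po: "partial_order_on ?A (relation_of (\<lambda>f g. g \<le> f) ?A)"
    by (auto simp: partial_order_on_def preorder_on_def refl_on_def trans_def antisym_def relation_of_def)
  have "\<exists>m\<in>?A. \<forall>f\<in>?A. f \<le> m --> f = m"
  proof (rule predicate_Zorn[OF po])
    fix C assume C: "C \<in> Chains (relation_of (\<lambda>f g. g \<le> f) ?A)"
    then have CA: "C \<subseteq> ?A" and ch: "\<And>f g. f \<in> C ==> g \<in> C ==> f \<le> g \<or> g \<le> f"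
      by (auto simp: Chains_def relation_of_def)
    show "\<exists>u\<in>?A. \<forall>f\<in>C. u \<le> f"
    proof (cases "C = {}")
      case True
      then show ?thesis by (intro bexI[of _ sequentially]) auto
    next
      case False
      have "eventually P (Inf C) \<longleftrightarrow> (\<exists>b\<in>C. eventually P b)" for P
        by (rule eventually_Inf_base[OF False]) (metis ch inf.orderE inf.orderI inf_commute)
      then have "Inf C \<noteq> bot" using CA by (auto simp: trivial_limit_def)
      moreover have "Inf C \<le> sequentially"
        using CA False by (metis (mono_tags, lifting) Inf_lower2 all_not_in_conv mem_Collect_eq subsetD)
      ultimately show ?thesis by (intro bexI[of _ "Inf C"]) (auto intro: Inf_lower)
    qed
  qed
  then obtain m where m: "m \<noteq> bot" "m \<le> sequentially"
    and min: "\<And>f. f \<noteq> bot ==> f \<le> sequentially ==> f \<le> m ==> f = m" by auto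
  have "eventually Q m \<or> eventually (\<lambda>i. \<not> Q i) m" for Q
  proof (rule disjCI)
    assume n: "\<not> eventually (\<lambda>i. \<not> Q i) m"
    let ?f = "inf m (principal {i. Q i})"
    have "?f \<noteq> bot" using n by (simp add: trivial_limit_def eventually_inf_principal)
    then have "?f = m" using m(2) by (intro min) (auto intro: le_infI1)
    then have "m \<le> principal {i. Q i}" by (metis inf.cobounded2)
    then show "eventually Q m" by (simp add: le_principal)
  qed
  moreover have "eventually (\<lambda>i. i \<noteq> k) m" for k
    using m(2) eventually_gt_at_top[of k] by (auto simp: le_filter_def elim: eventually_mono)
  ultimately show ?thesis using m unfolding nonprincipal_ultrafilter_def by blast
qed

section \<open>The pseudometric behind an ultralimit\<close>

context
  fixes \<omega> :: "nat filter" and X :: "nat => 'a metric" and x :: "nat => 'a" and d :: "nat => real"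
  assumes \<omega>: "nonprincipal_ultrafilter \<omega>" and d: "scaling_sequence \<omega> d"
    and x: "\<And>i. x i \<in> mspace (X i)"
begin

lemma ultralimit_pdist_tendsto:
  assumes y: "y \<in> ultralimit_seqs \<omega> X x d" and z: "z \<in> ultralimit_seqs \<omega> X x d"
  shows "((\<lambda>i. mdist (X i) (y i) (z i) / d i) \<longlongrightarrow> ultralimit_pdist \<omega> X d y z) \<omega>"
proof -
  have dpos: "d i > 0" for i using d by (simp add: scaling_sequence_def)
  obtain B C where "eventually (\<lambda>i. mdist (X i) (x i) (y i) / d i \<le> B) \<omega>"
    "eventually (\<lambda>i. mdist (X i) (x i) (z i) / d i \<le> C) \<omega>"
    using y z by (auto simp: ultralimit_seqs_def)
  then have "eventually (\<lambda>i. mdist (X i) (y i) (z i) / d i \<in> {0..B + C}) \<omega>"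
  proof eventually_elim
    case (elim i)
    have "mdist (X i) (y i) (z i) \<le> mdist (X i) (x i) (y i) + mdist (X i) (x i) (z i)"
      using mdist_triangle[of "y i" "X i" "x i" "z i"] x[of i] y z
      by (simp add: ultralimit_seqs_def mdist_commute)
    then have "mdist (X i) (y i) (z i) / d i \<le> mdist (X i) (x i) (y i) / d i + mdist (X i) (x i) (z i) / d i"
      using dpos[of i] by (simp add: add_divide_distrib[symmetric] divide_right_mono)
    then show ?case using dpos[of i] elim by simp
  qed
  from ultrafilter_tendsto_real[OF \<omega> this] show ?thesis
    unfolding ultralimit_pdist_def using \<omega> tendsto_Lim
    by (metis nonprincipal_ultrafilter_def)
qed

lemma ultralimit_pdist_eqI:
  assumes "y \<in> ultralimit_seqs \<omega> X x d" "z \<in> ultralimit_seqs \<omega> X x d"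
    and "((\<lambda>i. mdist (X i) (y i) (z i) / d i) \<longlongrightarrow> l) \<omega>"
  shows "ultralimit_pdist \<omega> X d y z = l"
  using tendsto_unique[OF _ ultralimit_pdist_tendsto[OF assms(1,2)] assms(3)] \<omega>
  by (simp add: nonprincipal_ultrafilter_def)

lemma ultralimit_pdist_triangle:
  assumes "y \<in> ultralimit_seqs \<omega> X x d" "z \<in> ultralimit_seqs \<omega> X x d" "w \<in> ultralimit_seqs \<omega> X x d"
  shows "ultralimit_pdist \<omega> X d y w \<le> ultralimit_pdist \<omega> X d y z + ultralimit_pdist \<omega> X d z w"
proof (rule tendsto_le[OF _ tendsto_add[OF ultralimit_pdist_tendsto ultralimit_pdist_tendsto] ultralimit_pdist_tendsto])
  have dpos: "d i > 0" for i using d by (simp add: scaling_sequence_def)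
  have "mdist (X i) (y i) (w i) / d i \<le> mdist (X i) (y i) (z i) / d i + mdist (X i) (z i) (w i) / d i" for i
    using mdist_triangle[of "y i" "X i" "z i" "w i"] assms dpos[of i]
    by (simp add: add_divide_distrib[symmetric] divide_right_mono ultralimit_seqs_def)
  then show "\<forall>\<^sub>F i in \<omega>. mdist (X i) (y i) (w i) / d i
        \<le> mdist (X i) (y i) (z i) / d i + mdist (X i) (z i) (w i) / d i" by simp
qed (use assms \<omega> in \<open>auto simp: nonprincipal_ultrafilter_def\<close>)

lemma ultralimit_pdist_commute: "ultralimit_pdist \<omega> X d y z = ultralimit_pdist \<omega> X d z y"
  unfolding ultralimit_pdist_def by (simp add: mdist_commute)

lemma ultralimit_pdist_refl:
  assumes "y \<in> ultralimit_seqs \<omega> X x d"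
  shows "ultralimit_pdist \<omega> X d y y = 0"
proof (rule ultralimit_pdist_eqI[OF assms assms])
  have "(\<lambda>i. mdist (X i) (y i) (y i) / d i) = (\<lambda>i. 0)"
    using assms by (auto simp: fun_eq_iff ultralimit_seqs_def)
  then show "((\<lambda>i. mdist (X i) (y i) (y i) / d i) \<longlongrightarrow> 0) \<omega>" by simp
qed

lemma ultralimit_pdist_nonneg:
  assumes "y \<in> ultralimit_seqs \<omega> X x d" "z \<in> ultralimit_seqs \<omega> X x d"
  shows "0 \<le> ultralimit_pdist \<omega> X d y z"
  using ultralimit_pdist_triangle[OF assms(1,2,1)] ultralimit_pdist_refl[OF assms(1)]
  by (simp add: ultralimit_pdist_commute[of z y])

lemma ultralimit_class_eq:
  assumes "y \<in> ultralimit_seqs \<omega> X x d" "z \<in> ultralimit_seqs \<omega> X x d" "ultralimit_pdist \<omega> X d y z = 0"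
  shows "ultralimit_class \<omega> X x d y = ultralimit_class \<omega> X x d z"
proof -
  have "ultralimit_pdist \<omega> X d y w = 0 \<longleftrightarrow> ultralimit_pdist \<omega> X d z w = 0"
    if w: "w \<in> ultralimit_seqs \<omega> X x d" for w
    using ultralimit_pdist_triangle[OF assms(1,2) w] ultralimit_pdist_triangle[OF assms(2,1) w]
      ultralimit_pdist_nonneg[OF assms(1) w] ultralimit_pdist_nonneg[OF assms(2) w] assms(3)
      ultralimit_pdist_commute[of y z] by linarith
  then show ?thesis by (auto simp: ultralimit_class_def)
qed

lemma ultralimit_dist_class:
  assumes y: "y \<in> ultralimit_seqs \<omega> X x d" and z: "z \<in> ultralimit_seqs \<omega> X x d"
  shows "ultralimit_dist \<omega> X x d (ultralimit_class \<omega> X x d y) (ultralimit_class \<omega> X x d z)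
    = ultralimit_pdist \<omega> X d y z"
proof -
  let ?p = "ultralimit_pdist \<omega> X d"
  have rep: "(SOME u. u \<in> ultralimit_class \<omega> X x d w) \<in> ultralimit_class \<omega> X x d w"
    if "w \<in> ultralimit_seqs \<omega> X x d" for w
    by (rule someI[of _ w]) (simp add: ultralimit_class_def that ultralimit_pdist_refl)
  let ?y = "SOME u. u \<in> ultralimit_class \<omega> X x d y" and ?z = "SOME u. u \<in> ultralimit_class \<omega> X x d z"
  have yz: "?y \<in> ultralimit_seqs \<omega> X x d" "?z \<in> ultralimit_seqs \<omega> X x d" "?p y ?y = 0" "?p z ?z = 0"
    using rep[OF y] rep[OF z] by (auto simp: ultralimit_class_def)
  have "?p ?y ?z = ?p y z"
    using ultralimit_pdist_triangle[OF y yz(1) z] ultralimit_pdist_triangle[OF yz(1,2) z]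
      ultralimit_pdist_triangle[OF yz(1) y yz(2)] ultralimit_pdist_triangle[OF y z yz(2)]
      yz(3,4) ultralimit_pdist_commute[of ?y y] ultralimit_pdist_commute[of ?z z] by linarith
  then show ?thesis using y z by (simp add: ultralimit_dist_def ultralimit_space_def)
qed

end

text \<open>A copy of Z^2 with coordinates \<open>e\<close>, so that thickness and independence can
  be stated directly for the image of the plane in the braid group.\<close>

locale int_plane_group = group G for G (structure) +
  fixes e :: "int => int => 'a"
  assumes carrier_eq: "carrier G = {e i j | i j. True}"
    and e_inj: "e i j = e k l ==> i = k \<and> j = l"
    and e_mult: "e i j \<otimes> e k l = e (i + k) (j + l)"
begin

definition "gens = {e 1 0, e 0 1}"

lemma e_carrier [simp]: "e i j \<in> carrier G"
  by (auto simp: carrier_eq)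

lemma e_one: "e 0 0 = \<one>"
  using e_mult[of 0 0 0 0] by (simp add: l_cancel_one')

lemma e_inv: "inv (e i j) = e (- i) (- j)"
  by (rule inv_equality) (simp_all add: e_mult e_one)

lemma finite_generating_gens: "finite_generating_set G gens"
proof -
  have 1: "e (int n) 0 \<in> generate G gens" "e 0 (int n) \<in> generate G gens" for n
  proof (induction n)
    case 0
    show "e (int 0) 0 \<in> generate G gens" "e 0 (int 0) \<in> generate G gens"
      by (simp_all add: e_one generate.one)
  next
    case (Suc n)
    have "e 1 0 \<in> generate G gens" "e 0 1 \<in> generate G gens"
      by (auto simp: gens_def intro: generate.incl)
    from generate.eng[OF this(1) Suc(1)] generate.eng[OF this(2) Suc(2)]
    show "e (int (Suc n)) 0 \<in> generate G gens" "e 0 (int (Suc n)) \<in> generate G gens"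
      by (simp_all add: e_mult)
  qed
  have gens: "gens \<subseteq> carrier G" by (auto simp: gens_def)
  have 2: "e i 0 \<in> generate G gens" "e 0 i \<in> generate G gens" for i
    using 1[of "nat i"] generate_m_inv_closed[OF gens 1(1)[of "nat (- i)"]]
      generate_m_inv_closed[OF gens 1(2)[of "nat (- i)"]]
    by (cases "i \<ge> 0"; simp add: e_inv)+
  have "e i j \<in> generate G gens" for i j
    using generate.eng[OF 2(1)[of i] 2(2)[of j]] by (simp add: e_mult)
  then have "carrier G \<subseteq> generate G gens" by (auto simp: carrier_eq)
  then show ?thesis
    using gens generate_in_carrier[OF gens] by (auto simp: finite_generating_set_def gens_def)
qed

lemma cayley_edges_iff:
  "(e i j, e k l) \<in> cayley_edges G gens \<longleftrightarrow> \<bar>i - k\<bar> + \<bar>j - l\<bar> = 1"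
proof -
  have edge: "(g, g \<otimes> x) \<in> cayley_edges G gens" "(g \<otimes> x, g) \<in> cayley_edges G gens"
    if "g \<in> carrier G" "x \<in> gens" for g x
    using that by (auto simp: cayley_edges_def)
  have "(e i j, e k l) \<in> cayley_edges G gens \<longleftrightarrow>
      (k = i + 1 \<and> l = j) \<or> (k = i \<and> l = j + 1) \<or> (i = k + 1 \<and> j = l) \<or> (i = k \<and> j = l + 1)"
    (is "_ \<longleftrightarrow> ?R")
  proof
    assume "(e i j, e k l) \<in> cayley_edges G gens"
    then show ?R
      by (auto simp: cayley_edges_def gens_def carrier_eq e_mult dest!: e_inj)
  next
    assume ?R
    then show "(e i j, e k l) \<in> cayley_edges G gens"
      using edge[of "e i j" "e 1 0"] edge[of "e i j" "e 0 1"] edge[of "e k l" "e 1 0"] edge[of "e k l" "e 0 1"]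
      by (auto simp: e_mult gens_def)
  qed
  also have "\<dots> \<longleftrightarrow> \<bar>i - k\<bar> + \<bar>j - l\<bar> = 1" by presburger
  finally show ?thesis .
qed

text \<open>The word metric is the l^1 metric: an edge changes the l^1 distance by at most one, and
  walking along one axis and then along the other attains it.\<close>

lemma graph_dist_e: "int (graph_dist (cayley_edges G gens) (e i j) (e k l)) = \<bar>i - k\<bar> + \<bar>j - l\<bar>"
proof -
  let ?E = "cayley_edges G gens"
  have range: "v \<in> carrier G" if "(u, v) \<in> ?E" for u v
    using that by (auto simp: cayley_edges_def gens_def)
  have lower: "\<bar>i - k\<bar> + \<bar>j - l\<bar> \<le> int n" if "(e i j, e k l) \<in> ?E ^^ n" for n i j k l
    using that
  proof (induction n arbitrary: k l)
    case 0
    then show ?case by (auto dest: e_inj)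
  next
    case (Suc n)
    then obtain v where v: "(e i j, v) \<in> ?E ^^ n" "(v, e k l) \<in> ?E" by auto
    have "(e k l, v) \<in> ?E" using v(2) sym_cayley_edges[of G gens] by (meson symD)
    then obtain k' l' where vkl: "v = e k' l'" using range[of "e k l" v] by (auto simp: carrier_eq)
    then have "\<bar>i - k'\<bar> + \<bar>j - l'\<bar> \<le> int n" "\<bar>k' - k\<bar> + \<bar>l' - l\<bar> = 1"
      using v Suc.IH[of k' l'] cayley_edges_iff by auto
    then show ?case by linarith
  qed
  have up: "(e i j, e (i + s * int n) (j + t * int n)) \<in> ?E ^^ n" if "\<bar>s\<bar> + \<bar>t\<bar> = 1" for i j s t n
  proof (induction n)
    case (Suc n)
    have "(e (i + s * int n) (j + t * int n), e (i + s * int (Suc n)) (j + t * int (Suc n))) \<in> ?E"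
      using that unfolding cayley_edges_iff by (simp add: algebra_simps)
    then show ?case using Suc by (meson relpow_Suc_I)
  qed simp
  have "(e i j, e k j) \<in> ?E ^^ nat \<bar>i - k\<bar>" "(e k j, e k l) \<in> ?E ^^ nat \<bar>j - l\<bar>"
    using up[of 1 0 i j "nat (k - i)"] up[of "-1" 0 i j "nat (i - k)"]
      up[of 0 1 k j "nat (l - j)"] up[of 0 "-1" k j "nat (j - l)"]
    by (cases "i \<le> k"; cases "j \<le> l"; simp add: abs_if)+
  then have "(e i j, e k l) \<in> ?E ^^ (nat \<bar>i - k\<bar> + nat \<bar>j - l\<bar>)" by (auto simp: relpow_add)
  then have "graph_dist ?E (e i j) (e k l) \<le> nat \<bar>i - k\<bar> + nat \<bar>j - l\<bar>"
    "(e i j, e k l) \<in> ?E ^^ graph_dist ?E (e i j) (e k l)"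
    unfolding graph_dist_def by (auto intro: Least_le LeastI)
  with lower show ?thesis by fastforce
qed

lemma mspace_plane: "mspace (word_metric G gens) = carrier G"
  by (rule mspace_word_metric[OF finite_generating_gens])

lemma mdist_plane:
  "mdist (word_metric G gens) (e i j) (e k l) = of_int (\<bar>i - k\<bar> + \<bar>j - l\<bar>)"
  by (simp add: mdist_word_metric[OF finite_generating_gens] graph_dist_e[symmetric])

lemma floor_scaled_tendsto: "(\<lambda>n. real_of_int \<lfloor>s * (real n + 1)\<rfloor> / (real n + 1)) \<longlonglongrightarrow> s"
proof (rule real_tendsto_sandwich)
  show "\<forall>\<^sub>F n in sequentially. s - 1 / (real n + 1) \<le> real_of_int \<lfloor>s * (real n + 1)\<rfloor> / (real n + 1)"
  proof (rule always_eventually, rule allI)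
    fix n
    have "s * (real n + 1) - 1 \<le> real_of_int \<lfloor>s * (real n + 1)\<rfloor>" by linarith
    then have "(s * (real n + 1) - 1) / (real n + 1) \<le> real_of_int \<lfloor>s * (real n + 1)\<rfloor> / (real n + 1)"
      by (intro divide_right_mono) auto
    then show "s - 1 / (real n + 1) \<le> real_of_int \<lfloor>s * (real n + 1)\<rfloor> / (real n + 1)"
      by (simp add: diff_divide_distrib)
  qed
  show "\<forall>\<^sub>F n in sequentially. real_of_int \<lfloor>s * (real n + 1)\<rfloor> / (real n + 1) \<le> s"
    by (rule always_eventually) (simp add: divide_le_eq)
  show "(\<lambda>n. s - 1 / (real n + 1)) \<longlonglongrightarrow> s"
  proof -
    have "(\<lambda>n. 1 / (real n + 1)) \<longlonglongrightarrow> 0"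
      using LIMSEQ_inverse_real_of_nat by (simp add: inverse_eq_divide add.commute)
    from tendsto_diff[OF tendsto_const[of s] this] show ?thesis by simp
  qed
qed simp

text \<open>The ultralimit is the real plane with the l^1 metric, and a plane stays connected when a
  point is removed. The scaling is \<open>n + 1\<close> rather than \<open>n\<close> because scaling
  factors must be positive from the start.\<close>

lemma no_cut_point:
  assumes \<omega>: "nonprincipal_ultrafilter \<omega>" "\<omega> \<le> sequentially" and x: "\<And>i. x i \<in> carrier G"
  defines "d \<equiv> \<lambda>n. real n + 1" and "X \<equiv> \<lambda>_::nat. word_metric G gens"
  shows "scaling_sequence \<omega> d" "\<not> cut_point (mtopology_of (ultralimit \<omega> X x d)) p"
proof -
  have dpos: "d i > 0" for i by (simp add: d_def)
  have "filterlim (\<lambda>n. real n + 1) at_top sequentially"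
    by (rule filterlim_at_top_mono[OF filterlim_real_sequentially]) simp
  then have "filterlim d at_top \<omega>" unfolding d_def by (rule filterlim_mono[OF _ order_refl \<omega>(2)])
  then show sc: "scaling_sequence \<omega> d" using dpos by (simp add: scaling_sequence_def)
  have ms: "mspace (X i) = carrier G" for i by (simp add: X_def mspace_plane)
  have md: "mdist (X i) (e k l) (e k' l') = of_int (\<bar>k - k'\<bar> + \<bar>l - l'\<bar>)" for i k l k' l'
    by (simp add: X_def mdist_plane)
  have xm: "x i \<in> mspace (X i)" for i using x ms by simp
  note [simp] = ms
  obtain xa xb where xe: "\<And>i. x i = e (xa i) (xb i)"
    using x unfolding carrier_eq by simp metis
  let ?S = "ultralimit_seqs \<omega> X x d" and ?c = "ultralimit_class \<omega> X x d"
  \<comment> \<open>Lattice points whose offset from the base point \<open>x i\<close>, divided by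
    \<open>d i\<close>, tends to (s, t).\<close>
  define th where "th = (\<lambda>(s, t) i. e (xa i + \<lfloor>s * d i\<rfloor>) (xb i + \<lfloor>t * d i\<rfloor>))"
  have fl: "((\<lambda>i. real_of_int \<lfloor>s * d i\<rfloor> / d i) \<longlongrightarrow> s) \<omega>" for s
    using tendsto_mono[OF \<omega>(2) floor_scaled_tendsto] by (simp add: d_def)
  have thS: "th q \<in> ?S" for q
  proof -
    obtain s t where q: "q = (s, t)" by fastforce
    have "mdist (X i) (x i) (th q i) / d i \<le> \<bar>s\<bar> + \<bar>t\<bar> + 2" for i
    proof -
      have "\<bar>real_of_int \<lfloor>s * d i\<rfloor>\<bar> \<le> \<bar>s\<bar> * d i + 1" "\<bar>real_of_int \<lfloor>t * d i\<rfloor>\<bar> \<le> \<bar>t\<bar> * d i + 1"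
        using dpos[of i] abs_mult[of s "d i"] abs_mult[of t "d i"] by (auto simp: abs_if split: if_splits) linarith+
      then have "\<bar>real_of_int \<lfloor>s * d i\<rfloor>\<bar> + \<bar>real_of_int \<lfloor>t * d i\<rfloor>\<bar> \<le> (\<bar>s\<bar> + \<bar>t\<bar> + 2) * d i"
        by (simp add: d_def algebra_simps)
      then show ?thesis using dpos[of i] by (simp add: xe th_def q md pos_divide_le_eq)
    qed
    then show ?thesis
      by (auto simp: ultralimit_seqs_def th_def q intro!: exI[of _ "\<bar>s\<bar> + \<bar>t\<bar> + 2"])
  qed
  have thd: "ultralimit_pdist \<omega> X d (th (s, t)) (th (s', t')) = \<bar>s - s'\<bar> + \<bar>t - t'\<bar>" for s t s' t'
  proof (rule ultralimit_pdist_eqI[OF \<omega>(1) sc xm thS thS])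
    have "mdist (X i) (th (s, t) i) (th (s', t') i) / d i =
       \<bar>real_of_int \<lfloor>s * d i\<rfloor> / d i - real_of_int \<lfloor>s' * d i\<rfloor> / d i\<bar>
       + \<bar>real_of_int \<lfloor>t * d i\<rfloor> / d i - real_of_int \<lfloor>t' * d i\<rfloor> / d i\<bar>" for i
      using dpos[of i] by (simp add: th_def md add_divide_distrib diff_divide_distrib[symmetric] abs_divide)
    moreover have "((\<lambda>i. \<bar>real_of_int \<lfloor>s * d i\<rfloor> / d i - real_of_int \<lfloor>s' * d i\<rfloor> / d i\<bar>
       + \<bar>real_of_int \<lfloor>t * d i\<rfloor> / d i - real_of_int \<lfloor>t' * d i\<rfloor> / d i\<bar>) \<longlongrightarrow> \<bar>s - s'\<bar> + \<bar>t - t'\<bar>) \<omega>"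
      by (intro tendsto_intros fl)
    ultimately show "((\<lambda>i. mdist (X i) (th (s, t) i) (th (s', t') i) / d i) \<longlongrightarrow> \<bar>s - s'\<bar> + \<bar>t - t'\<bar>) \<omega>"
      by simp
  qed
  \<comment> \<open>The rescaled coordinates of \<open>y\<close> are bounded along the ultrafilter,
    so they converge; their limits are the coordinates of the class.\<close>
  have surj: "\<exists>q. ?c y = ?c (th q)" if y: "y \<in> ?S" for y
  proof -
    have "y i \<in> carrier G" for i using y by (simp add: ultralimit_seqs_def)
    then obtain ya yb where ye: "\<And>i. y i = e (ya i) (yb i)" unfolding carrier_eq by simp metis
    obtain B where B: "eventually (\<lambda>i. mdist (X i) (x i) (y i) / d i \<le> B) \<omega>"
      using y by (auto simp: ultralimit_seqs_def)
    then have ev0: "eventually (\<lambda>i. real_of_int (ya i - xa i) / d i \<in> {-B..B} \<and>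
        real_of_int (yb i - xb i) / d i \<in> {-B..B}) \<omega>"
    proof eventually_elim
      case (elim i)
      then have "real_of_int (\<bar>xa i - ya i\<bar> + \<bar>xb i - yb i\<bar>) \<le> B * d i"
        using dpos[of i] by (simp add: xe ye md pos_divide_le_eq)
      then have *: "\<bar>real_of_int (ya i - xa i)\<bar> \<le> B * d i" "\<bar>real_of_int (yb i - xb i)\<bar> \<le> B * d i" by auto
      show ?case
        using * dpos[of i] by (simp add: pos_divide_le_eq pos_le_divide_eq abs_le_iff)
    qed
    have ev: "eventually (\<lambda>i. real_of_int (ya i - xa i) / d i \<in> {-B..B}) \<omega>"
      "eventually (\<lambda>i. real_of_int (yb i - xb i) / d i \<in> {-B..B}) \<omega>"
      using ev0 by (auto elim: eventually_mono)
    obtain s t where st: "((\<lambda>i. real_of_int (ya i - xa i) / d i) \<longlongrightarrow> s) \<omega>"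
      "((\<lambda>i. real_of_int (yb i - xb i) / d i) \<longlongrightarrow> t) \<omega>"
      using ultrafilter_tendsto_real[OF \<omega>(1) ev(1)] ultrafilter_tendsto_real[OF \<omega>(1) ev(2)] by blast
    have "ultralimit_pdist \<omega> X d y (th (s, t)) = 0"
    proof (rule ultralimit_pdist_eqI[OF \<omega>(1) sc xm y thS])
      have "mdist (X i) (y i) (th (s, t) i) / d i =
         \<bar>real_of_int (ya i - xa i) / d i - real_of_int \<lfloor>s * d i\<rfloor> / d i\<bar>
         + \<bar>real_of_int (yb i - xb i) / d i - real_of_int \<lfloor>t * d i\<rfloor> / d i\<bar>" for i
        using dpos[of i]
        by (simp add: th_def ye md add_divide_distrib diff_divide_distrib[symmetric] abs_divide algebra_simps)
      moreover have "((\<lambda>i. \<bar>real_of_int (ya i - xa i) / d i - real_of_int \<lfloor>s * d i\<rfloor> / d i\<bar>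
         + \<bar>real_of_int (yb i - xb i) / d i - real_of_int \<lfloor>t * d i\<rfloor> / d i\<bar>) \<longlongrightarrow> \<bar>s - s\<bar> + \<bar>t - t\<bar>) \<omega>"
        by (intro tendsto_intros fl st)
      ultimately show "((\<lambda>i. mdist (X i) (y i) (th (s, t) i) / d i) \<longlongrightarrow> 0) \<omega>" by simp
    qed
    then show ?thesis using ultralimit_class_eq[OF \<omega>(1) sc xm y thS] by blast
  qed
  interpret U: Metric_space "ultralimit_space \<omega> X x d" "ultralimit_dist \<omega> X x d"
    by (rule Metric_space_ultralimit[OF \<omega>(1) sc xm])
  have top: "mtopology_of (ultralimit \<omega> X x d) = U.mtopology"
    by (simp add: mtopology_of_def ultralimit_def)
  have cth: "?c (th q) \<in> ultralimit_space \<omega> X x d" for q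
    using thS by (auto simp: ultralimit_space_def)
  have dist: "ultralimit_dist \<omega> X x d (?c (th (s, t))) (?c (th (s', t'))) = \<bar>s - s'\<bar> + \<bar>t - t'\<bar>" for s t s' t'
    by (simp add: ultralimit_dist_class[OF \<omega>(1) sc xm thS thS] thd)
  have inj: "?c (th q) = ?c (th q') \<longleftrightarrow> q = q'" for q q'
  proof -
    obtain s t s' t' where q: "q = (s, t)" "q' = (s', t')" by fastforce
    have "?c (th q) = ?c (th q') \<longleftrightarrow> \<bar>s - s'\<bar> + \<bar>t - t'\<bar> = 0"
      using U.zero[OF cth cth, of q q'] dist by (simp add: q)
    then show ?thesis by (auto simp: q)
  qed
  have cont: "continuous_map euclidean U.mtopology (\<lambda>q. ?c (th q))"
    unfolding U.continuous_map_to_metric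
  proof (intro ballI allI impI)
    fix q :: "real \<times> real" and r :: real assume "r > 0"
    obtain s t where q: "q = (s, t)" by fastforce
    let ?U = "{v :: real \<times> real. \<bar>s - fst v\<bar> + \<bar>t - snd v\<bar> < r}"
    have "open ?U" by (intro open_Collect_less continuous_intros)
    moreover have "?c (th v) \<in> U.mball (?c (th q)) r" if "v \<in> ?U" for v
      using that cth dist[of s t "fst v" "snd v"] by (simp add: q)
    ultimately show "\<exists>W. openin euclidean W \<and> q \<in> W \<and> (\<forall>v\<in>W. ?c (th v) \<in> U.mball (?c (th q)) r)"
      using \<open>r > 0\<close> q by (intro exI[of _ ?U]) auto
  qed
  show "\<not> cut_point (mtopology_of (ultralimit \<omega> X x d)) p"
  proof
    assume cp: "cut_point (mtopology_of (ultralimit \<omega> X x d)) p"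
    then have "p \<in> ultralimit_space \<omega> X x d" by (simp add: cut_point_def top)
    have sp: "\<exists>q. v = ?c (th q)" if v: "v \<in> ultralimit_space \<omega> X x d" for v
    proof -
      obtain y where "y \<in> ?S" "v = ?c y" using v unfolding ultralimit_space_def by blast
      then show ?thesis using surj[of y] by simp
    qed
    then obtain q where p: "p = ?c (th q)" using \<open>p \<in> ultralimit_space \<omega> X x d\<close> by blast
    have "ultralimit_space \<omega> X x d - {p} = (\<lambda>v. ?c (th v)) ` (- {q})"
      using sp cth inj unfolding p by blast
    moreover have "connectedin U.mtopology ((\<lambda>v. ?c (th v)) ` (- {q}))"
      by (rule connectedin_continuous_map_image[OF cont])
         (simp add: connectedin_iff_connected path_connected_punctured_universe path_connected_imp_connected)
    ultimately have "connected_space (subtopology U.mtopology (topspace U.mtopology - {p}))"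
      by (simp add: connectedin_def)
    then show False using cp by (simp add: cut_point_def top)
  qed
qed

text \<open>Thick of order 0. Through every point runs a horizontal line, which read at integer
  parts is a quasi-geodesic with constants 1 and 1, and the asymptotic cones are planes.\<close>

theorem thick_int_plane: "thick_group G"
proof -
  let ?M = "word_metric G gens"
  have "\<exists>q. biinfinite_quasigeodesic 1 1 ?M q \<and> (\<exists>t. mdist ?M x (q t) \<le> 0)" if xM: "x \<in> mspace ?M" for x
  proof -
    obtain i j where x: "x = e i j" using xM unfolding mspace_plane carrier_eq by blast
    have "biinfinite_quasigeodesic 1 1 ?M (\<lambda>t. e (i + \<lfloor>t\<rfloor>) j)"
      unfolding biinfinite_quasigeodesic_def mspace_plane mdist_plane
      by (auto simp: abs_if) linarith+
    moreover have "mdist ?M x (e (i + \<lfloor>0::real\<rfloor>) j) \<le> 0" by (simp add: x mdist_plane)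
    ultimately show ?thesis by blast
  qed
  moreover obtain \<omega> where \<omega>: "nonprincipal_ultrafilter \<omega>" "\<omega> \<le> sequentially"
    using ex_nonprincipal_ultrafilter by blast
  have "\<exists>\<omega> d. nonprincipal_ultrafilter \<omega> \<and> scaling_sequence \<omega> d \<and>
      (\<forall>x. (\<forall>i. x i \<in> mspace (X i)) --> (\<nexists>p. cut_point (mtopology_of (ultralimit \<omega> X x d)) p))"
    if "\<forall>i. X i \<in> {?M}" for X
  proof -
    have X: "X = (\<lambda>_. ?M)" using that by auto
    have "scaling_sequence \<omega> (\<lambda>n. real n + 1)"
      by (rule no_cut_point(1)[OF \<omega>, of "\<lambda>_. \<one>"]) simp
    moreover have "\<nexists>p. cut_point (mtopology_of (ultralimit \<omega> X x (\<lambda>n. real n + 1))) p"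
      if "\<forall>i. x i \<in> mspace (X i)" for x
      using no_cut_point(2)[OF \<omega>, of x] that unfolding X mspace_plane by blast
    ultimately show ?thesis using \<omega>(1) by blast
  qed
  ultimately have "uniformly_unconstricted {?M}"
    unfolding uniformly_unconstricted_def
    by (intro conjI exI[of _ 1] exI[of _ 0]) auto
  then have "uniformly_thick 0 {?M}" by simp
  then show ?thesis unfolding thick_group_def using finite_generating_gens by blast
qed

end

section \<open>Fundamental groups\<close>

abbreviation unit_top :: "real topology" where "unit_top \<equiv> top_of_set {0..1}"

text \<open>The fixed ends are taken from \<open>p\<close>, so that open paths are covered too; for
  loops this is equality of loop classes.\<close>

definition phom :: "'a topology => (real => 'a) => (real => 'a) => bool" where
  "phom X p q \<longleftrightarrow> homotopic_with (\<lambda>r. r 0 = p 0 \<and> r 1 = p 1) unit_top X p q"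

lemma phomI:
  assumes "continuous_map (prod_topology unit_top unit_top) X h"
    and "\<And>t. t \<in> {0..1} ==> h (0, t) = p t" "\<And>t. t \<in> {0..1} ==> h (1, t) = q t"
    and "\<And>s. s \<in> {0..1} ==> h (s, 0) = p 0" "\<And>s. s \<in> {0..1} ==> h (s, 1) = p 1"
  shows "phom X p q"
  unfolding phom_def
  by (subst homotopic_with) (use assms in \<open>auto intro!: exI[of _ h]\<close>)

lemma phomE:
  assumes "phom X p q"
  obtains h where "continuous_map (prod_topology unit_top unit_top) X h"
    "\<And>t. h (0, t) = p t" "\<And>t. h (1, t) = q t"
    "\<And>s. s \<in> {0..1} ==> h (s, 0) = p 0" "\<And>s. s \<in> {0..1} ==> h (s, 1) = p 1"
  using assms unfolding phom_def homotopic_with_def by auto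

lemma phom_ends: "phom X p q ==> q 0 = p 0 \<and> q 1 = p 1"
  unfolding phom_def using homotopic_with_imp_property by blast

lemma phom_pathin: "phom X p q ==> pathin X p \<and> pathin X q"
  unfolding phom_def pathin_def using homotopic_with_imp_continuous_maps by blast

lemma phom_eq: "pathin X p ==> (\<And>t. t \<in> {0..1} ==> p t = q t) ==> phom X p q"
  unfolding phom_def pathin_def by (rule homotopic_with_equal) auto

lemma phom_refl: "pathin X p ==> phom X p p"
  by (rule phom_eq) auto

lemma phom_sym: "phom X p q ==> phom X q p"
  using phom_ends[of X p q] unfolding phom_def by (simp add: homotopic_with_symD)

lemma phom_trans [trans]: "phom X p q ==> phom X q r ==> phom X p r"
  using phom_ends[of X p q] unfolding phom_def by (simp add: homotopic_with_trans)

lemma continuous_map_unit_square: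
  "prod_topology unit_top unit_top = top_of_set ({0..1} \<times> {0..1})"
  by (simp add: subtopology_Times[symmetric] euclidean_product_topology)

text \<open>Two reparametrisations are joined linearly inside the unit interval. The homotopies
  behind the group laws below are all of this kind.\<close>

lemma phom_reparam:
  assumes "pathin X p" "continuous_on {0..1} \<phi>" "continuous_on {0..1} \<psi>"
    and "\<phi> ` {0..1} \<subseteq> {0..1}" "\<psi> ` {0..1} \<subseteq> {0..1}" "\<phi> 0 = \<psi> 0" "\<phi> 1 = \<psi> 1"
  shows "phom X (\<lambda>t. p (\<phi> t)) (\<lambda>t. p (\<psi> t))"
proof (rule phomI[where h = "p \<circ> (\<lambda>z. (1 - fst z) * \<phi> (snd z) + fst z * \<psi> (snd z))"])
  have "continuous_on ({0..1} \<times> {0..1}) (\<lambda>z. \<phi> (snd z))" "continuous_on ({0..1} \<times> {0..1}) (\<lambda>z. \<psi> (snd z))"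
    by (rule continuous_on_compose2[OF assms(2)] continuous_on_compose2[OF assms(3)]; auto intro: continuous_intros)+
  then have "continuous_on ({0..1} \<times> {0..1}) (\<lambda>z. (1 - fst z) * \<phi> (snd z) + fst z * \<psi> (snd z))"
    by (intro continuous_intros)
  moreover have "(1 - s) * \<phi> t + s * \<psi> t \<in> {0..1}" if "s \<in> {0..1}" "t \<in> {0..1}" for s t
  proof -
    have "\<phi> t \<in> {0..1}" "\<psi> t \<in> {0..1}" using assms(4,5) that(2) by blast+
    then show ?thesis
      using convexD_alt[OF convex_real_interval(5), of "\<phi> t" 0 1 "\<psi> t" s] that(1) by auto
  qed
  ultimately have "continuous_map (prod_topology unit_top unit_top) unit_top
      (\<lambda>z. (1 - fst z) * \<phi> (snd z) + fst z * \<psi> (snd z))"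
    by (auto simp: continuous_map_unit_square continuous_map_in_subtopology)
  then show "continuous_map (prod_topology unit_top unit_top) X (p \<circ> (\<lambda>z. (1 - fst z) * \<phi> (snd z) + fst z * \<psi> (snd z)))"
    using assms(1) unfolding pathin_def by (rule continuous_map_compose)
qed (use assms in \<open>auto simp: algebra_simps\<close>)

lemma continuous_map_join:
  assumes h1: "continuous_map (prod_topology Y unit_top) X h1" and h2: "continuous_map (prod_topology Y unit_top) X h2"
    and eq: "\<And>y. y \<in> topspace Y ==> h1 (y, 1) = h2 (y, 0)"
  shows "continuous_map (prod_topology Y unit_top) X
    (\<lambda>z. if snd z \<le> 1/2 then h1 (fst z, 2 * snd z) else h2 (fst z, 2 * snd z - 1))"
proof (rule continuous_map_cases_le)
  have snd: "continuous_map (prod_topology Y unit_top) euclideanreal snd"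
    using continuous_map_snd continuous_map_in_subtopology by blast
  show "continuous_map (prod_topology Y unit_top) euclideanreal snd" by (rule snd)
  show "continuous_map (prod_topology Y unit_top) euclideanreal (\<lambda>z. 1/2)" by simp
  have l: "continuous_map (subtopology (prod_topology Y unit_top) S) (prod_topology Y unit_top) (\<lambda>z. (fst z, f (snd z)))"
    if "continuous_on UNIV f" "\<And>z. z \<in> S ==> snd z \<in> {0..1} ==> f (snd z) \<in> {0..1}" for f :: "real => real" and S
  proof (rule continuous_map_pairedI)
    show "continuous_map (subtopology (prod_topology Y unit_top) S) Y fst"
      by (intro continuous_map_from_subtopology continuous_map_fst)
    have "continuous_map (prod_topology Y unit_top) euclideanreal (f \<circ> snd)"
      using snd that(1) by (intro continuous_map_compose[OF snd]) simp
    then have "continuous_map (subtopology (prod_topology Y unit_top) S) euclideanreal (\<lambda>z. f (snd z))"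
      by (auto simp: o_def intro: continuous_map_from_subtopology)
    then show "continuous_map (subtopology (prod_topology Y unit_top) S) unit_top (\<lambda>z. f (snd z))"
      using that(2) by (auto simp: continuous_map_in_subtopology)
  qed
  show "continuous_map (subtopology (prod_topology Y unit_top) {z \<in> topspace (prod_topology Y unit_top). snd z \<le> 1/2}) X
      (\<lambda>z. h1 (fst z, 2 * snd z))"
    by (rule continuous_map_compose[OF l[where f = "\<lambda>t. 2 * t"] h1, unfolded o_def]) (auto intro!: continuous_intros)
  show "continuous_map (subtopology (prod_topology Y unit_top) {z \<in> topspace (prod_topology Y unit_top). 1/2 \<le> snd z}) X
      (\<lambda>z. h2 (fst z, 2 * snd z - 1))"
    by (rule continuous_map_compose[OF l[where f = "\<lambda>t. 2 * t - 1"] h2, unfolded o_def]) (auto intro!: continuous_intros)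
  show "h1 (fst z, 2 * snd z) = h2 (fst z, 2 * snd z - 1)"
    if z: "z \<in> topspace (prod_topology Y unit_top)" "snd z = 1/2" for z
    using eq[of "fst z"] z(1) unfolding z(2) by (simp add: mem_Times_iff)
qed

lemma phom_join:
  assumes "phom X p p'" "phom X q q'" "p 1 = q 0"
  shows "phom X (path_join p q) (path_join p' q')"
proof -
  obtain h1 where h1: "continuous_map (prod_topology unit_top unit_top) X h1"
    "\<And>t. h1 (0, t) = p t" "\<And>t. h1 (1, t) = p' t"
    "\<And>s. s \<in> {0..1} ==> h1 (s, 0) = p 0" "\<And>s. s \<in> {0..1} ==> h1 (s, 1) = p 1"
    using phomE[OF assms(1)] by blast
  obtain h2 where h2: "continuous_map (prod_topology unit_top unit_top) X h2"
    "\<And>t. h2 (0, t) = q t" "\<And>t. h2 (1, t) = q' t"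
    "\<And>s. s \<in> {0..1} ==> h2 (s, 0) = q 0" "\<And>s. s \<in> {0..1} ==> h2 (s, 1) = q 1"
    using phomE[OF assms(2)] by blast
  show ?thesis
    by (rule phomI[OF continuous_map_join[OF h1(1) h2(1)]]) (use h1 h2 assms(3) in \<open>auto simp: path_join_def\<close>)
qed

lemma pathin_path_join:
  assumes "pathin X p" "pathin X q" "p 1 = q 0"
  shows "pathin X (path_join p q)"
  using phom_pathin phom_join[OF phom_refl[OF assms(1)] phom_refl[OF assms(2)] assms(3)] by blast

lemma path_join_ends [simp]: "path_join p q 0 = p 0" "path_join p q 1 = q 1"
  by (auto simp: path_join_def)

definition path_rev :: "(real => 'a) => real => 'a" where
  "path_rev p = (\<lambda>t. p (1 - t))"

lemma path_rev_ends [simp]: "path_rev p 0 = p 1" "path_rev p 1 = p 0"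
  by (auto simp: path_rev_def)

lemma pathin_compose_unit:
  assumes "pathin X p" "continuous_on {0..1} \<phi>" "\<phi> ` {0..1} \<subseteq> {0..1}"
  shows "pathin X (\<lambda>t. p (\<phi> t))"
  using phom_pathin phom_reparam[OF assms(1,2,2,3,3) refl refl] by blast

lemma pathin_path_rev: "pathin X p ==> pathin X (path_rev p)"
  unfolding path_rev_def by (rule pathin_compose_unit) (auto intro!: continuous_intros)

lemma phom_assoc:
  assumes "pathin X p" "pathin X q" "pathin X r" "p 1 = q 0" "q 1 = r 0"
  shows "phom X (path_join (path_join p q) r) (path_join p (path_join q r))"
proof -
  let ?c = "path_join p (path_join q r)"
  \<comment> \<open>The piecewise linear map taking the break points 1/4 and 1/2 of the left
    bracketing to the break points 1/2 and 3/4 of the right one.\<close>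
  define \<phi> :: "real => real" where
    "\<phi> = (\<lambda>t. if t \<le> 1/2 then (if t \<le> 1/4 then 2 * t else t + 1/4) else t / 2 + 1/2)"
  have path: "pathin X ?c" using assms by (intro pathin_path_join) auto
  have "continuous_on ({0..1/2} \<union> {1/2..1}) \<phi>"
    unfolding \<phi>_def
  proof (rule continuous_on_cases_le)
    have "continuous_on ({0..1/4} \<union> {1/4..1/2}) (\<lambda>t::real. if t \<le> 1/4 then 2 * t else t + 1/4)"
      by (rule continuous_on_cases_le) (auto intro!: continuous_intros)
    then show "continuous_on {t \<in> {0..1/2} \<union> {1/2..1}. t \<le> 1/2} (\<lambda>t::real. if t \<le> 1/4 then 2 * t else t + 1/4)"
      by (elim continuous_on_subset) auto
  qed (auto intro!: continuous_intros)
  moreover have "{0..1/2} \<union> {1/2..1} = {0..1::real}" by auto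
  ultimately have "continuous_on {0..1} \<phi>" by simp
  moreover have "\<phi> ` {0..1} \<subseteq> {0..1}" by (auto simp: \<phi>_def)
  ultimately have "phom X (\<lambda>t. ?c (\<phi> t)) (\<lambda>t. ?c t)"
    by (intro phom_reparam[OF path]) (auto simp: \<phi>_def)
  moreover have "?c (\<phi> t) = path_join (path_join p q) r t" for t
    by (auto simp: \<phi>_def path_join_def algebra_simps)
  ultimately show ?thesis by simp
qed

lemma phom_const_left:
  assumes "pathin X p"
  shows "phom X (path_join (\<lambda>_. p 0) p) p"
proof -
  define \<phi> :: "real => real" where "\<phi> = (\<lambda>t. max 0 (2 * t - 1))"
  have "phom X (\<lambda>t. p (\<phi> t)) (\<lambda>t. p t)"
    by (intro phom_reparam[OF assms]) (auto simp: \<phi>_def intro!: continuous_intros)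
  moreover have "p (\<phi> t) = path_join (\<lambda>_. p 0) p t" for t
  proof (cases "t = 1/2")
    case True
    show ?thesis unfolding True by (simp add: \<phi>_def path_join_def)
  qed (auto simp: \<phi>_def path_join_def max_def)
  ultimately show ?thesis by simp
qed

lemma phom_const_right:
  assumes "pathin X p"
  shows "phom X (path_join p (\<lambda>_. p 1)) p"
proof -
  define \<phi> :: "real => real" where "\<phi> = (\<lambda>t. min 1 (2 * t))"
  have "phom X (\<lambda>t. p (\<phi> t)) (\<lambda>t. p t)"
    by (intro phom_reparam[OF assms]) (auto simp: \<phi>_def intro!: continuous_intros)
  moreover have "p (\<phi> t) = path_join p (\<lambda>_. p 1) t" for t
  proof (cases "t = 1/2")
    case True
    show ?thesis unfolding True by (simp add: \<phi>_def path_join_def)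
  qed (auto simp: \<phi>_def path_join_def min_def)
  ultimately show ?thesis by simp
qed

lemma phom_rev_right:
  assumes "pathin X p"
  shows "phom X (path_join p (path_rev p)) (\<lambda>_. p 0)"
proof -
  \<comment> \<open>The tent function runs out and back along \<open>p\<close>; inside the interval
    it contracts to 0.\<close>
  define \<phi> :: "real => real" where "\<phi> = (\<lambda>t. 1 - \<bar>2 * t - 1\<bar>)"
  have "phom X (\<lambda>t. p (\<phi> t)) (\<lambda>t. p 0)"
    by (rule phom_reparam[OF assms]) (auto simp: \<phi>_def intro!: continuous_intros)
  moreover have "p (\<phi> t) = path_join p (path_rev p) t" for t
    by (auto simp: \<phi>_def path_join_def path_rev_def abs_if algebra_simps)
  ultimately show ?thesis by simp
qed

lemma phom_rev_left:
  assumes "pathin X p"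
  shows "phom X (path_join (path_rev p) p) (\<lambda>_. p 1)"
  using phom_rev_right[OF pathin_path_rev[OF assms]] by (simp add: path_rev_def)

lemma phom_loop_class:
  assumes "p \<in> loops_at X a" "q \<in> loops_at X a"
  shows "loop_class X a p = loop_class X a q \<longleftrightarrow> phom X p q"
proof -
  have *: "r \<in> loop_class X a p \<longleftrightarrow> phom X p r" if "p \<in> loops_at X a" for p r
    using that by (simp add: loops_at_def loop_class_def phom_def)
  have "phom X q q" using assms(2) by (simp add: loops_at_def phom_refl)
  then show ?thesis
    using *[OF assms(1)] *[OF assms(2)] phom_sym phom_trans by blast
qed

lemma mem_loop_class: "p \<in> loops_at X a ==> q \<in> loop_class X a p \<longleftrightarrow> phom X p q"
  by (simp add: loops_at_def loop_class_def phom_def)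

lemma loops_at_phom: "p \<in> loops_at X a ==> phom X p q ==> q \<in> loops_at X a"
  using phom_ends[of X p q] phom_pathin[of X p q] by (simp add: loops_at_def)

lemma loops_at_join: "p \<in> loops_at X a ==> q \<in> loops_at X a ==> path_join p q \<in> loops_at X a"
  by (simp add: loops_at_def pathin_path_join)

text \<open>The product is defined as a union over all pairs of representatives; by
  \<open>phom_join\<close> every member of the union is the same class.\<close>

lemma fundamental_group_mult:
  assumes p: "p \<in> loops_at X a" and q: "q \<in> loops_at X a"
  shows "loop_class X a p \<otimes>\<^bsub>fundamental_group X a\<^esub> loop_class X a q = loop_class X a (path_join p q)"
proof -
  have eq: "loop_class X a (path_join p' q') = loop_class X a (path_join p q)"
    if "p' \<in> loop_class X a p" "q' \<in> loop_class X a q" for p' q'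
  proof -
    have h: "phom X p p'" "phom X q q'" using that p q by (auto simp: mem_loop_class)
    have "phom X (path_join p q) (path_join p' q')"
      using h p q by (intro phom_join) (auto simp: loops_at_def)
    then show ?thesis
      using phom_loop_class[OF loops_at_join[OF p q] loops_at_phom[OF loops_at_join[OF p q]]] by blast
  qed
  have mem: "p \<in> loop_class X a p" "q \<in> loop_class X a q"
    using mem_loop_class[OF p, of p] mem_loop_class[OF q, of q] p q phom_refl[of X p] phom_refl[of X q]
    by (simp_all add: loops_at_def)
  have "(\<Union>p'\<in>loop_class X a p. \<Union>q'\<in>loop_class X a q. loop_class X a (path_join p' q'))
     = (\<Union>p'\<in>loop_class X a p. \<Union>q'\<in>loop_class X a q. loop_class X a (path_join p q))"
    by (intro SUP_cong refl eq)
  also have "\<dots> = loop_class X a (path_join p q)" using mem by blast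
  finally show ?thesis by (simp add: fundamental_group_def)
qed

lemma fundamental_group_simps:
  "carrier (fundamental_group X a) = loop_class X a ` loops_at X a"
  "\<one>\<^bsub>fundamental_group X a\<^esub> = loop_class X a (\<lambda>_. a)"
  by (simp_all add: fundamental_group_def)

lemma const_loop: "a \<in> topspace X ==> (\<lambda>_. a) \<in> loops_at X a"
  by (simp add: loops_at_def pathin_const)

lemma group_fundamental_group:
  assumes a: "a \<in> topspace X"
  shows "group (fundamental_group X a)"
proof (rule groupI)
  let ?G = "fundamental_group X a"
  note [simp] = fundamental_group_simps
  show "\<one>\<^bsub>?G\<^esub> \<in> carrier ?G" using const_loop[OF a] by simp
  fix x y assume "x \<in> carrier ?G" "y \<in> carrier ?G"
  then obtain p q where p: "p \<in> loops_at X a" "x = loop_class X a p" and q: "q \<in> loops_at X a" "y = loop_class X a q"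
    by auto
  show "x \<otimes>\<^bsub>?G\<^esub> y \<in> carrier ?G"
    using p q loops_at_join[OF p(1) q(1)] by (simp add: fundamental_group_mult)
  show "x \<otimes>\<^bsub>?G\<^esub> y \<otimes>\<^bsub>?G\<^esub> z = x \<otimes>\<^bsub>?G\<^esub> (y \<otimes>\<^bsub>?G\<^esub> z)" if "z \<in> carrier ?G" for z
  proof -
    obtain r where r: "r \<in> loops_at X a" "z = loop_class X a r" using \<open>z \<in> carrier ?G\<close> by auto
    have "phom X (path_join (path_join p q) r) (path_join p (path_join q r))"
      using p(1) q(1) r(1) by (intro phom_assoc) (auto simp: loops_at_def)
    then show ?thesis
      using p q r by (simp add: fundamental_group_mult loops_at_join phom_loop_class)
  qed
next
  fix x assume "x \<in> carrier (fundamental_group X a)"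
  then obtain p where p: "p \<in> loops_at X a" "x = loop_class X a p"
    by (auto simp: fundamental_group_simps)
  have rv: "path_rev p \<in> loops_at X a" using p by (simp add: loops_at_def pathin_path_rev)
  show "\<one>\<^bsub>fundamental_group X a\<^esub> \<otimes>\<^bsub>fundamental_group X a\<^esub> x = x"
    using phom_const_left[of X p] p const_loop[OF a]
    by (simp add: fundamental_group_simps fundamental_group_mult phom_loop_class loops_at_join) (simp add: loops_at_def)
  show "\<exists>y\<in>carrier (fundamental_group X a). y \<otimes>\<^bsub>fundamental_group X a\<^esub> x = \<one>\<^bsub>fundamental_group X a\<^esub>"
    using phom_rev_left[of X p] p const_loop[OF a] rv
    by (intro bexI[of _ "loop_class X a (path_rev p)"])
      (simp_all add: fundamental_group_simps fundamental_group_mult phom_loop_class loops_at_join, simp add: loops_at_def)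
qed

section \<open>Holonomy of flat cocycles\<close>

locale based_space =
  fixes X :: "'x topology" and a :: 'x
  assumes base_in: "a \<in> topspace X"
begin

definition pcomp :: "'x set" where
  "pcomp = {x. \<exists>p. pathin X p \<and> p 0 = a \<and> p 1 = x}"

text \<open>Only at the base point is the path prescribed, as the constant one, so that the
  transport of a loop is its own class.\<close>

definition base_path :: "'x => real => 'x" where
  "base_path x = (if x = a then (\<lambda>_. a) else SOME p. pathin X p \<and> p 0 = a \<and> p 1 = x)"

text \<open>A path is closed up by the chosen paths from the base point to its ends. This turns the
  fundamental groupoid into the fundamental group multiplicatively.\<close>

definition transport :: "(real => 'x) => (real => 'x) set" where
  "transport p = loop_class X a
     (path_join (base_path (p 0)) (path_join p (path_rev (base_path (p 1)))))"

abbreviation G where "G \<equiv> fundamental_group X a"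

sublocale G: group G by (rule group_fundamental_group[OF base_in])

lemma base_path:
  assumes "x \<in> pcomp"
  shows "pathin X (base_path x)" "base_path x 0 = a" "base_path x 1 = x"
proof -
  have "pathin X (base_path x) \<and> base_path x 0 = a \<and> base_path x 1 = x"
  proof (cases "x = a")
    case True
    then show ?thesis using base_in by (simp add: base_path_def)
  next
    case False
    have "\<exists>p. pathin X p \<and> p 0 = a \<and> p 1 = x" using assms by (simp add: pcomp_def)
    from someI_ex[OF this] show ?thesis using False by (simp add: base_path_def)
  qed
  then show "pathin X (base_path x)" "base_path x 0 = a" "base_path x 1 = x" by auto
qed

lemma base_path_base: "base_path a = (\<lambda>_. a)"
  by (simp add: base_path_def)

lemma base_pcomp: "a \<in> pcomp"
  unfolding pcomp_def using base_in by (auto intro!: exI[of _ "\<lambda>_. a"])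

lemma pcomp_path:
  assumes p: "pathin X p" and "p 0 \<in> pcomp" and t: "t \<in> {0..1}"
  shows "p t \<in> pcomp"
proof -
  have "pathin X (\<lambda>s. p (t * s))"
    by (rule pathin_compose_unit[OF p]) (use t in \<open>auto intro!: continuous_intros mult_le_one\<close>)
  then have "pathin X (path_join (base_path (p 0)) (\<lambda>s. p (t * s)))"
    using base_path[OF assms(2)] by (intro pathin_path_join) auto
  then show ?thesis unfolding pcomp_def
    using base_path[OF assms(2)] by (auto intro!: exI[of _ "path_join (base_path (p 0)) (\<lambda>s. p (t * s))"])
qed

lemma transport_loop:
  assumes p: "pathin X p" and "p 0 \<in> pcomp"
  shows "path_join (base_path (p 0)) (path_join p (path_rev (base_path (p 1)))) \<in> loops_at X a"
proof -
  have 1: "p 1 \<in> pcomp" using pcomp_path[OF assms] by simp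
  show ?thesis
    using base_path[OF assms(2)] base_path[OF 1] p
    by (simp add: loops_at_def pathin_path_join pathin_path_rev)
qed

lemma transport_closed: "pathin X p ==> p 0 \<in> pcomp ==> transport p \<in> carrier G"
  using transport_loop by (auto simp: transport_def fundamental_group_simps)

lemma transport_phom:
  assumes "phom X p q" "p 0 \<in> pcomp"
  shows "transport p = transport q"
proof -
  have pq: "pathin X p" "pathin X q" "q 0 = p 0" "q 1 = p 1" using phom_pathin[OF assms(1)] phom_ends[OF assms(1)] by auto
  have 1: "p 1 \<in> pcomp" using pcomp_path[OF pq(1) assms(2)] by simp
  have "phom X (path_join (base_path (p 0)) (path_join p (path_rev (base_path (p 1)))))
     (path_join (base_path (p 0)) (path_join q (path_rev (base_path (p 1)))))"
    using base_path[OF assms(2)] base_path[OF 1] assms(1)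
    by (intro phom_join phom_refl) (auto simp: pathin_path_rev)
  then show ?thesis
    using phom_loop_class[OF transport_loop[OF pq(1) assms(2)] transport_loop[of q]] pq assms(2)
    by (simp add: transport_def)
qed

text \<open>The return along the base path of the middle point cancels against the departure along
  the same path.\<close>

lemma transport_join:
  assumes p: "pathin X p" "p 0 \<in> pcomp" and q: "pathin X q" "p 1 = q 0"
  shows "transport (path_join p q) = transport p \<otimes>\<^bsub>G\<^esub> transport q"
proof -
  have c: "q 0 \<in> pcomp" "q 1 \<in> pcomp"
    using pcomp_path[OF p, of 1] q pcomp_path[OF q(1), of 1] by auto
  define R where "R = base_path (p 0)"
  define Y where "Y = base_path (q 0)"
  define Z where "Z = base_path (q 1)"
  have R: "pathin X R" "R 0 = a" "R 1 = p 0" using base_path[OF p(2)] by (auto simp: R_def)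
  have Y: "pathin X Y" "Y 0 = a" "Y 1 = q 0" using base_path[OF c(1)] by (auto simp: Y_def)
  have Z: "pathin X Z" "Z 0 = a" "Z 1 = q 1" using base_path[OF c(2)] by (auto simp: Z_def)
  note P = p(1) q(1) R(1) Y(1) Z(1) pathin_path_rev[OF Y(1)] pathin_path_rev[OF Z(1)]
  note E = R(2,3) Y(2,3) Z(2,3) q(2)
  let ?J = path_join
  have qZ: "pathin X (?J q (path_rev Z))" using P E by (intro pathin_path_join) auto
  have YqZ: "pathin X (?J Y (?J q (path_rev Z)))" using P E qZ by (intro pathin_path_join) auto
  have in1: "phom X (?J (path_rev Y) (?J Y (?J q (path_rev Z)))) (?J q (path_rev Z))"
  proof -
    have "phom X (?J (path_rev Y) (?J Y (?J q (path_rev Z)))) (?J (?J (path_rev Y) Y) (?J q (path_rev Z)))"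
      using P E qZ by (intro phom_sym[OF phom_assoc]) auto
    also have "phom X \<dots> (?J (\<lambda>_. Y 1) (?J q (path_rev Z)))"
      using P E qZ by (intro phom_join phom_rev_left phom_refl) auto
    also have "phom X \<dots> (?J q (path_rev Z))"
      using phom_const_left[OF qZ] E by simp
    finally show ?thesis .
  qed
  have "phom X (?J (?J R (?J p (path_rev Y))) (?J Y (?J q (path_rev Z))))
      (?J R (?J (?J p (path_rev Y)) (?J Y (?J q (path_rev Z)))))"
    using P E YqZ by (intro phom_assoc pathin_path_join) auto
  also have "phom X \<dots> (?J R (?J p (?J (path_rev Y) (?J Y (?J q (path_rev Z))))))"
    using P E YqZ by (intro phom_join[OF phom_refl phom_assoc]) auto
  also have "phom X \<dots> (?J R (?J p (?J q (path_rev Z))))"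
    using P E in1 by (intro phom_join phom_refl in1) auto
  also have "phom X \<dots> (?J R (?J (?J p q) (path_rev Z)))"
    using P E by (intro phom_join[OF phom_refl phom_sym[OF phom_assoc]]) auto
  finally have main: "phom X (?J (?J R (?J p (path_rev Y))) (?J Y (?J q (path_rev Z)))) (?J R (?J (?J p q) (path_rev Z)))" .
  have l1: "?J R (?J p (path_rev Y)) \<in> loops_at X a" using transport_loop[OF p] q(2) by (simp add: R_def Y_def)
  have l2: "?J Y (?J q (path_rev Z)) \<in> loops_at X a" using transport_loop[OF q(1) c(1)] by (simp add: Z_def Y_def)
  have l3: "?J R (?J (?J p q) (path_rev Z)) \<in> loops_at X a"
    using loops_at_phom[OF loops_at_join[OF l1 l2] main] .
  have t: "transport p = loop_class X a (?J R (?J p (path_rev Y)))" "transport q = loop_class X a (?J Y (?J q (path_rev Z)))"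
    "transport (?J p q) = loop_class X a (?J R (?J (?J p q) (path_rev Z)))"
    using q(2) by (simp_all add: transport_def R_def Y_def Z_def)
  show ?thesis
    unfolding t fundamental_group_mult[OF l1 l2]
    using phom_loop_class[OF loops_at_join[OF l1 l2] l3] main by simp
qed

lemma transport_loops:
  assumes "p \<in> loops_at X a"
  shows "transport p = loop_class X a p"
proof -
  have p: "pathin X p" "p 0 = a" "p 1 = a" using assms by (auto simp: loops_at_def)
  have "phom X (path_join (\<lambda>_. a) (path_join p (\<lambda>_. a))) (path_join p (\<lambda>_. a))"
    using phom_const_left[of X "path_join p (\<lambda>_. a)"] pathin_path_join[OF p(1), of "\<lambda>_. a"] p base_in by simp
  also have "phom X \<dots> p" using phom_const_right[OF p(1)] p by simp
  finally have h: "phom X (path_join (\<lambda>_. a) (path_join p (\<lambda>_. a))) p" .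
  have "path_rev (\<lambda>_. a) = (\<lambda>_. a)" by (simp add: path_rev_def)
  then show ?thesis
    using phom_loop_class[OF loops_at_phom[OF assms phom_sym[OF h]] assms] h p
    by (simp add: transport_def base_path_base)
qed

lemma transport_const:
  assumes "x \<in> pcomp"
  shows "transport (\<lambda>_. x) = \<one>\<^bsub>G\<^esub>"
proof -
  have x: "x \<in> topspace X"
    using base_path[OF assms] path_start_in_topspace[of X "base_path x"]
      path_finish_in_topspace[of X "base_path x"] by metis
  then have p: "pathin X (\<lambda>_. x)" by simp
  have "path_join (\<lambda>_. x) (\<lambda>_. x) = (\<lambda>_. x)" by (simp add: path_join_def)
  then have "transport (\<lambda>_. x) = transport (\<lambda>_. x) \<otimes>\<^bsub>G\<^esub> transport (\<lambda>_. x)"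
    using transport_join[OF p _ p] assms by simp
  then show ?thesis using transport_closed[OF p] assms by (metis G.l_cancel_one')
qed

lemma transport_rev:
  assumes p: "pathin X p" "p 0 \<in> pcomp"
  shows "transport (path_rev p) = inv\<^bsub>G\<^esub> (transport p)"
proof -
  have 1: "p 1 \<in> pcomp" using pcomp_path[OF p] by simp
  have "transport (path_rev p) \<otimes>\<^bsub>G\<^esub> transport p = transport (path_join (path_rev p) p)"
    using p 1 by (intro transport_join[symmetric]) (auto simp: pathin_path_rev)
  also have "\<dots> = transport (\<lambda>_. p 1)"
    using p 1 by (intro transport_phom[OF phom_rev_left]) auto
  also have "\<dots> = \<one>\<^bsub>G\<^esub>" by (rule transport_const[OF 1])
  finally show ?thesis
    using transport_closed[OF p] transport_closed[OF pathin_path_rev[OF p(1)]] 1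
    by (intro G.inv_equality[symmetric]) auto
qed

lemma transport_subpath:
  assumes p: "pathin X p" "p 0 \<in> pcomp" and rst: "0 \<le> r" "r \<le> s" "s \<le> t" "t \<le> 1"
  shows "transport (\<lambda>x. p (r + (t - r) * x)) =
    transport (\<lambda>x. p (r + (s - r) * x)) \<otimes>\<^bsub>G\<^esub> transport (\<lambda>x. p (s + (t - s) * x))"
proof -
  let ?sub = "\<lambda>r s x. p (r + (s - r) * x)"
  have im0: "u + (v - u) * x \<in> {0..1}" if "0 \<le> u" "u \<le> v" "v \<le> 1" "x \<in> {0..1}" for u v x :: real
  proof -
    have "(v - u) * x \<le> v - u" "0 \<le> (v - u) * x" using that by (auto intro: mult_left_le)
    then show ?thesis using that by simp
  qed
  then have im: "(\<lambda>x. u + (v - u) * x) ` {0..1} \<subseteq> {0..1}" if "0 \<le> u" "u \<le> v" "v \<le> 1" for u v :: real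
    using that by blast
  have path: "pathin X (?sub u v)" if "0 \<le> u" "u \<le> v" "v \<le> 1" for u v
    by (rule pathin_compose_unit[OF p(1) _ im[OF that]]) (intro continuous_intros)
  have rc: "p r \<in> pcomp" using pcomp_path[OF p] rst by simp
  define \<phi> where "\<phi> = (\<lambda>x. if x \<le> 1/2 then r + (s - r) * (2 * x) else s + (t - s) * (2 * x - 1))"
  have "continuous_on ({0..1/2} \<union> {1/2..1}) \<phi>"
    unfolding \<phi>_def by (rule continuous_on_cases_le) (auto intro!: continuous_intros simp: algebra_simps)
  moreover have "{0..1/2} \<union> {1/2..1} = {0..1::real}" by auto
  ultimately have c: "continuous_on {0..1} \<phi>" by simp
  have "\<phi> x \<in> {0..1}" if x: "x \<in> {0..1}" for x
  proof (cases "x \<le> 1/2")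
    case True
    then have "2 * x \<in> {0..1}" using x by auto
    then have "r + (s - r) * (2 * x) \<in> {0..1}" using im0[of r s "2 * x"] rst by simp
    then show ?thesis using True by (simp add: \<phi>_def)
  next
    case False
    then have "2 * x - 1 \<in> {0..1}" using x by auto
    then have "s + (t - s) * (2 * x - 1) \<in> {0..1}" using im0[of s t "2 * x - 1"] rst by simp
    then show ?thesis using False by (simp add: \<phi>_def)
  qed
  then have im1: "\<phi> ` {0..1} \<subseteq> {0..1}" by blast
  have im2: "(\<lambda>x. r + (t - r) * x) ` {0..1} \<subseteq> {0..1}" using rst by (intro im) linarith+
  have "phom X (\<lambda>x. p (\<phi> x)) (?sub r t)"
    by (rule phom_reparam[OF p(1) c _ im1 im2]) (simp_all add: \<phi>_def continuous_on_add continuous_on_mult)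
  moreover have "(\<lambda>x. p (\<phi> x)) = path_join (?sub r s) (?sub s t)"
    by (auto simp: fun_eq_iff \<phi>_def path_join_def)
  ultimately have "transport (?sub r t) = transport (path_join (?sub r s) (?sub s t))"
    using rc by (intro transport_phom[symmetric]) auto
  also have "\<dots> = transport (?sub r s) \<otimes>\<^bsub>G\<^esub> transport (?sub s t)"
    using rst rc by (intro transport_join path) auto
  finally show ?thesis .
qed

end

section \<open>Ordered products along subdivisions, and holonomy\<close>

primrec seqprod :: "('h, 'm) monoid_scheme => (nat => 'h) => nat => 'h" where
  "seqprod H f 0 = \<one>\<^bsub>H\<^esub>"
| "seqprod H f (Suc n) = seqprod H f n \<otimes>\<^bsub>H\<^esub> f n"

context monoid begin

lemma seqprod_closed: "(\<And>k. k < n ==> f k \<in> carrier G) ==> seqprod G f n \<in> carrier G"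
  by (induction n) auto

lemma seqprod_add:
  "(\<And>k. k < m + n ==> f k \<in> carrier G) ==> seqprod G f (m + n) = seqprod G f m \<otimes> seqprod G (\<lambda>k. f (m + k)) n"
proof (induction n)
  case 0
  then show ?case by (simp add: seqprod_closed)
next
  case (Suc n)
  have "seqprod G f m \<in> carrier G" "seqprod G (\<lambda>k. f (m + k)) n \<in> carrier G" "f (m + n) \<in> carrier G"
    using Suc.prems by (auto intro!: seqprod_closed)
  then show ?case using Suc by (simp add: m_assoc)
qed

lemma seqprod_mult:
  "(\<And>k. k < n * m ==> f k \<in> carrier G) ==>
     seqprod G f (n * m) = seqprod G (\<lambda>k. seqprod G (\<lambda>j. f (k * m + j)) m) n"
proof (induction n)
  case (Suc n)
  have "seqprod G f (Suc n * m) = seqprod G f (n * m + m)" by (simp add: add.commute)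
  also have "\<dots> = seqprod G f (n * m) \<otimes> seqprod G (\<lambda>k. f (n * m + k)) m"
    by (rule seqprod_add) (use Suc.prems in auto)
  also have "seqprod G f (n * m) = seqprod G (\<lambda>k. seqprod G (\<lambda>j. f (k * m + j)) m) n"
    by (rule Suc.IH) (use Suc.prems in auto)
  finally show ?case by simp
qed simp

lemma seqprod_cong: "(\<And>k. k < n ==> f k = g k) ==> seqprod G f n = seqprod G g n"
  by (induction n) auto

end

text \<open>A discrete flat connection: \<open>\<tau> x y\<close> is meaningful only for two points
  of a common \<open>N z\<close>, where it satisfies the cocycle identity. Its product along a fine
  subdivision of a path is then invariant under homotopy.\<close>

locale flat_cocycle = based_space X a + H: group H
  for X :: "'x topology" and a :: 'x and H :: "('h, 'b) monoid_scheme" (structure) +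
  fixes \<tau> :: "'x => 'x => 'h" and N :: "'x => 'x set"
  assumes N_open: "z \<in> topspace X ==> openin X (N z)" and N_mem: "z \<in> topspace X ==> z \<in> N z"
    and \<tau>_closed: "z \<in> topspace X ==> x \<in> N z ==> y \<in> N z ==> \<tau> x y \<in> carrier H"
    and \<tau>_cocycle: "z \<in> topspace X ==> x \<in> N z ==> y \<in> N z ==> w \<in> N z ==> \<tau> x y \<otimes> \<tau> y w = \<tau> x w"
begin

lemma \<tau>_refl: "z \<in> topspace X ==> x \<in> N z ==> \<tau> x x = \<one>"
  using \<tau>_cocycle[of z x x x] \<tau>_closed[of z x x] by (metis H.l_cancel_one')

lemma \<tau>_inv: "z \<in> topspace X ==> x \<in> N z ==> y \<in> N z ==> inv (\<tau> x y) = \<tau> y x"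
  using \<tau>_cocycle[of z y x y] \<tau>_refl[of z y] \<tau>_closed[of z] by (intro H.inv_equality) auto

text \<open>The Lebesgue number of the pulled-back cover. It is applied to the interval, to
  subdivide paths, and to the square, to subdivide homotopies.\<close>

lemma lebesgue:
  fixes f :: "'m::heine_borel => 'x"
  assumes K: "compact K" and f: "continuous_map (top_of_set K) X f"
  shows "\<exists>\<delta>>0. \<forall>T\<subseteq>K. diameter T < \<delta> --> T \<noteq> {} --> (\<exists>z\<in>topspace X. f ` T \<subseteq> N z)"
proof (cases "K = {}")
  case True
  then show ?thesis by (intro exI[of _ 1]) auto
next
  case False
  let ?C = "{B. open B \<and> (\<exists>z\<in>topspace X. f ` (K \<inter> B) \<subseteq> N z)}"
  have cov: "\<exists>B\<in>?C. x \<in> B" if x: "x \<in> K" for x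
  proof -
    have fx: "f x \<in> topspace X" using f x by (auto simp: continuous_map_def)
    have "openin (top_of_set K) {y \<in> topspace (top_of_set K). f y \<in> N (f x)}"
      using f N_open[OF fx] by (rule openin_continuous_map_preimage)
    then obtain B where "open B" "{y \<in> K. f y \<in> N (f x)} = K \<inter> B" by (auto simp: openin_open)
    then show ?thesis using fx N_mem[OF fx] x by (intro bexI[of _ B]) auto
  qed
  then have cv: "K \<subseteq> \<Union>?C" and ne: "?C \<noteq> {}" using False by auto
  obtain \<delta> where d: "0 < \<delta>" "\<And>T. T \<subseteq> K ==> diameter T < \<delta> ==> \<exists>B\<in>?C. T \<subseteq> B"
    by (rule Lebesgue_number_lemma[OF K ne cv]) auto
  have "\<exists>z\<in>topspace X. f ` T \<subseteq> N z" if T: "T \<subseteq> K" "diameter T < \<delta>" for T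
  proof -
    obtain B z where "T \<subseteq> B" "z \<in> topspace X" "f ` (K \<inter> B) \<subseteq> N z" using d(2)[OF T] by auto
    then show ?thesis using T(1) by blast
  qed
  with d(1) show ?thesis by blast
qed

definition fine_partition :: "nat => (real => 'x) => bool" where
  "fine_partition n p \<longleftrightarrow> n > 0 \<and>
     (\<forall>k<n. \<exists>z\<in>topspace X. \<forall>t\<in>{real k / real n..real (Suc k) / real n}. p t \<in> N z)"

definition holn :: "nat => (real => 'x) => 'h" where
  "holn n p = seqprod H (\<lambda>k. \<tau> (p (real k / real n)) (p (real (Suc k) / real n))) n"

definition hol :: "(real => 'x) => 'h" where
  "hol p = holn (SOME n. fine_partition n p) p"

lemma ex_fine_partition:
  assumes "pathin X p"
  shows "\<exists>m. \<forall>n\<ge>m. fine_partition n p"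
proof -
  obtain \<delta> where d: "\<delta> > 0" "\<And>T. T \<subseteq> {0..1} ==> diameter T < \<delta> ==> T \<noteq> {} ==> \<exists>z\<in>topspace X. p ` T \<subseteq> N z"
    using lebesgue[of "{0..1::real}" p] assms by (auto simp: pathin_def)
  obtain m where m: "1 / \<delta> < real m" using reals_Archimedean2 by blast
  have "fine_partition n p" if n: "n \<ge> Suc m" for n
    unfolding fine_partition_def
  proof (intro conjI allI impI)
    show "n > 0" using n by simp
    fix k assume k: "k < n"
    let ?T = "{real k / real n..real (Suc k) / real n}"
    have le: "real k / real n \<le> real (Suc k) / real n" by (simp add: divide_right_mono)
    have "1 / \<delta> < real n" using m n by linarith
    then have "1 / real n < \<delta>" using d(1) \<open>n > 0\<close> by (simp add: field_simps)
    moreover have "diameter ?T = 1 / real n"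
      using le \<open>n > 0\<close> by (simp add: diameter_closed_interval field_simps)
    moreover have "?T \<subseteq> {0..1}" using k by (auto simp: field_simps)
    ultimately show "\<exists>z\<in>topspace X. \<forall>t\<in>?T. p t \<in> N z" using d(2)[of ?T] le by fastforce
  qed
  then show ?thesis by blast
qed

lemma telescope:
  assumes z: "z \<in> topspace X" and x: "\<And>j. j \<le> m ==> x j \<in> N z"
  shows "seqprod H (\<lambda>j. \<tau> (x j) (x (Suc j))) m = \<tau> (x 0) (x m)"
  using x
proof (induction m)
  case 0
  then show ?case using \<tau>_refl[OF z] by simp
next
  case (Suc m)
  then show ?case using \<tau>_cocycle[OF z, of "x 0" "x m" "x (Suc m)"] by simp
qed

lemma holn_step_closed:
  assumes "fine_partition n p" "k < n"
  shows "\<tau> (p (real k / real n)) (p (real (Suc k) / real n)) \<in> carrier H"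
proof -
  obtain z where z: "z \<in> topspace X" "\<And>t. t \<in> {real k / real n..real (Suc k) / real n} ==> p t \<in> N z"
    using assms unfolding fine_partition_def by blast
  have "real k / real n \<le> real (Suc k) / real n" by (simp add: divide_right_mono)
  then show ?thesis using z by (intro \<tau>_closed[OF z(1)]) auto
qed

lemma holn_closed: "fine_partition n p ==> holn n p \<in> carrier H"
  unfolding holn_def by (rule H.seqprod_closed) (rule holn_step_closed)

text \<open>All new points within one old piece lie in one \<open>N z\<close>, so the new factors
  telescope to the old one. Two fine partitions have a common refinement of this kind, the product
  of their sizes.\<close>

lemma fine_refine:
  assumes "fine_partition n p" "m > 0"
  shows "fine_partition (n * m) p" "holn (n * m) p = holn n p"
proof -
  have n: "n > 0" using assms(1) by (simp add: fine_partition_def)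
  have sub: "real (k * m + j) / real (n * m) \<in> {real k / real n..real (Suc k) / real n}" if "j \<le> m" for k j
  proof -
    have "real (k * m) / real (n * m) = real k / real n" "real (k * m + m) / real (n * m) = real (Suc k) / real n"
      using assms(2) n by (simp_all add: field_simps)
    moreover have "real (k * m) / real (n * m) \<le> real (k * m + j) / real (n * m)"
      "real (k * m + j) / real (n * m) \<le> real (k * m + m) / real (n * m)"
      using that by (intro divide_right_mono; simp)+
    ultimately show ?thesis by simp
  qed
  show f: "fine_partition (n * m) p"
    unfolding fine_partition_def
  proof (intro conjI allI impI)
    show "n * m > 0" using n assms(2) by simp
    fix l assume l: "l < n * m"
    define k j where "k = l div m" and "j = l mod m"
    have lj: "l = k * m + j" "Suc l = k * m + Suc j" "j < m" using assms(2) by (auto simp: k_def j_def)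
    have "k < n" using l assms(2) by (simp add: k_def less_mult_imp_div_less)
    then obtain z where z: "z \<in> topspace X" "\<And>t. t \<in> {real k / real n..real (Suc k) / real n} ==> p t \<in> N z"
      using assms unfolding fine_partition_def by blast
    have "{real l / real (n * m)..real (Suc l) / real (n * m)} \<subseteq> {real k / real n..real (Suc k) / real n}"
      using sub[of j k] sub[of "Suc j" k] lj(3) unfolding lj(1)[symmetric] lj(2)[symmetric] by auto
    then show "\<exists>z\<in>topspace X. \<forall>t\<in>{real l / real (n * m)..real (Suc l) / real (n * m)}. p t \<in> N z"
      using z by blast
  qed
  have "holn (n * m) p = seqprod H (\<lambda>k. seqprod H (\<lambda>j. \<tau> (p (real (k * m + j) / real (n * m))) (p (real (Suc (k * m + j)) / real (n * m)))) m) n"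
    unfolding holn_def by (rule H.seqprod_mult) (rule holn_step_closed[OF f])
  also have "\<dots> = holn n p"
    unfolding holn_def
  proof (rule H.seqprod_cong)
    fix k assume "k < n"
    then obtain z where z: "z \<in> topspace X" "\<And>t. t \<in> {real k / real n..real (Suc k) / real n} ==> p t \<in> N z"
      using assms unfolding fine_partition_def by blast
    have "seqprod H (\<lambda>j. \<tau> (p (real (k * m + j) / real (n * m))) (p (real (k * m + Suc j) / real (n * m)))) m
        = \<tau> (p (real (k * m + 0) / real (n * m))) (p (real (k * m + m) / real (n * m)))"
      by (rule telescope[OF z(1)]) (use z(2) sub in blast)
    moreover have "real (k * m + 0) / real (n * m) = real k / real n" "real (k * m + m) / real (n * m) = real (Suc k) / real n"
      using assms(2) n by (simp_all add: field_simps)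
    ultimately show "seqprod H (\<lambda>j. \<tau> (p (real (k * m + j) / real (n * m))) (p (real (Suc (k * m + j)) / real (n * m)))) m
        = \<tau> (p (real k / real n)) (p (real (Suc k) / real n))" by simp
  qed
  finally show "holn (n * m) p = holn n p" .
qed

lemma hol_eq:
  assumes "fine_partition n p"
  shows "hol p = holn n p"
proof -
  let ?m = "SOME n. fine_partition n p"
  have m: "fine_partition ?m p" using assms by (rule someI)
  have "holn (?m * n) p = holn ?m p" "holn (n * ?m) p = holn n p"
    using fine_refine(2)[OF m] fine_refine(2)[OF assms] m assms by (auto simp: fine_partition_def)
  then show ?thesis by (simp add: hol_def mult.commute)
qed

lemma hol_closed: "pathin X p ==> hol p \<in> carrier H"
  using ex_fine_partition[of p] hol_eq holn_closed by (metis order_refl)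

lemma hol_in_N:
  assumes "z \<in> topspace X" "\<And>t. t \<in> {0..1} ==> p t \<in> N z"
  shows "hol p = \<tau> (p 0) (p 1)"
proof -
  have "fine_partition 1 p" using assms by (auto simp: fine_partition_def intro!: bexI[of _ z])
  from hol_eq[OF this] show ?thesis
    using \<tau>_closed[OF assms(1) assms(2)[of 0] assms(2)[of 1]] by (simp add: holn_def)
qed

lemma hol_const: "x \<in> topspace X ==> hol (\<lambda>_. x) = \<one>"
  using hol_in_N[of x "\<lambda>_. x"] N_mem \<tau>_refl by simp

lemma hol_join:
  assumes p: "pathin X p" and q: "pathin X q" and pq: "p 1 = q 0"
  shows "hol (path_join p q) = hol p \<otimes> hol q"
proof -
  obtain m1 m2 where m: "\<And>n. n \<ge> m1 ==> fine_partition n p" "\<And>n. n \<ge> m2 ==> fine_partition n q"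
    using ex_fine_partition[OF p] ex_fine_partition[OF q] by blast
  define n where "n = Suc (max m1 m2)"
  have n: "n > 0" "fine_partition n p" "fine_partition n q" using m by (auto simp: n_def)
  have e1: "path_join p q (real k / real (n + n)) = p (real k / real n)" if "k \<le> n" for k
    using that n(1) by (simp add: path_join_def field_simps)
  have e2: "path_join p q (real (n + k) / real (n + n)) = q (real k / real n)" for k
  proof (cases "k = 0")
    case True
    then show ?thesis using e1[of n] n(1) pq by simp
  next
    case False
    then have "\<not> real (n + k) / real (n + n) \<le> 1/2" using n(1) by (simp add: field_simps)
    moreover have "2 * (real (n + k) / real (n + n)) - 1 = real k / real n" using n(1) by (simp add: field_simps)
    ultimately show ?thesis by (simp add: path_join_def)
  qed
  have f: "fine_partition (n + n) (path_join p q)"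
    unfolding fine_partition_def
  proof (intro conjI allI impI)
    fix k assume k: "k < n + n"
    show "\<exists>z\<in>topspace X. \<forall>t\<in>{real k / real (n + n)..real (Suc k) / real (n + n)}. path_join p q t \<in> N z"
    proof (cases "k < n")
      case True
      then obtain z where z: "z \<in> topspace X" "\<And>t. t \<in> {real k / real n..real (Suc k) / real n} ==> p t \<in> N z"
        using n(2) unfolding fine_partition_def by blast
      have "path_join p q t \<in> N z" if t: "t \<in> {real k / real (n + n)..real (Suc k) / real (n + n)}" for t
      proof -
        have "real (Suc k) / real (n + n) \<le> 1/2" using True n(1) by (simp add: field_simps)
        then have "t \<le> 1/2" using t by (meson atLeastAtMost_iff order_trans)
        moreover have "2 * t \<in> {real k / real n..real (Suc k) / real n}" using t n(1) by (simp add: field_simps)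
        ultimately show ?thesis using z(2) by (simp add: path_join_def)
      qed
      then show ?thesis using z(1) by blast
    next
      case False
      define j where "j = k - n"
      have j: "k = n + j" "j < n" using False k by (auto simp: j_def)
      then obtain z where z: "z \<in> topspace X" "\<And>t. t \<in> {real j / real n..real (Suc j) / real n} ==> q t \<in> N z"
        using n(3) unfolding fine_partition_def by blast
      have "path_join p q t \<in> N z" if t: "t \<in> {real k / real (n + n)..real (Suc k) / real (n + n)}" for t
      proof -
        have m: "2 * t - 1 \<in> {real j / real n..real (Suc j) / real n}" using t n(1) j by (simp add: field_simps)
        show ?thesis
        proof (cases "t \<le> 1/2")
          \<comment> \<open>The common end of both halves: here the join still reads
            \<open>p\<close>, whose end is the start of \<open>q\<close>.\<close>
          case True
          have "real j / real n \<ge> 0" by simp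
          then have "2 * t - 1 = 0" using m True unfolding atLeastAtMost_iff by linarith
          then have "path_join p q t = q (2 * t - 1)" using True pq by (simp add: path_join_def)
          then show ?thesis using z(2)[OF m] by simp
        next
          case False
          then show ?thesis using z(2)[OF m] by (simp add: path_join_def)
        qed
      qed
      then show ?thesis using z(1) by blast
    qed
  qed (use n(1) in simp)
  let ?f = "\<lambda>k. \<tau> (path_join p q (real k / real (n + n))) (path_join p q (real (Suc k) / real (n + n)))"
  have "hol (path_join p q) = seqprod H ?f (n + n)" using hol_eq[OF f] by (simp only: holn_def)
  also have "\<dots> = seqprod H ?f n \<otimes> seqprod H (\<lambda>k. ?f (n + k)) n"
    by (rule H.seqprod_add) (rule holn_step_closed[OF f])
  also have "seqprod H ?f n = holn n p"
    unfolding holn_def by (rule H.seqprod_cong) (simp only: e1 Suc_leI less_imp_le)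
  also have "seqprod H (\<lambda>k. ?f (n + k)) n = holn n q"
    unfolding holn_def by (rule H.seqprod_cong) (simp only: e2 add_Suc_right[symmetric])
  finally show ?thesis using hol_eq n by simp
qed

text \<open>The square of the homotopy is cut into small squares, each mapped into one
  \<open>N z\<close>. Neighbouring rows then have the same holonomy, because the two vertical sides
  at the fixed ends contribute nothing.\<close>

lemma hol_phom:
  assumes "phom X p q"
  shows "hol p = hol q"
proof -
  obtain h where h: "continuous_map (prod_topology unit_top unit_top) X h"
    "\<And>t. h (0, t) = p t" "\<And>t. h (1, t) = q t"
    "\<And>s. s \<in> {0..1} ==> h (s, 0) = p 0" "\<And>s. s \<in> {0..1} ==> h (s, 1) = p 1"
    using phomE[OF assms] by blast
  have K: "compact ({0..1::real} \<times> {0..1::real})" by (intro compact_Times compact_Icc)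
  obtain \<delta> where d: "\<delta> > 0" "\<And>T. T \<subseteq> {0..1} \<times> {0..1} ==> diameter T < \<delta> ==> T \<noteq> {} ==> \<exists>z\<in>topspace X. h ` T \<subseteq> N z"
    using lebesgue[OF K] h(1) unfolding continuous_map_unit_square by blast
  \<comment> \<open>A square of side 1/n has diameter at most 2/n; with 3 in place of 2 the
    inequality becomes strict.\<close>
  obtain m where m: "3 / \<delta> < real m" using reals_Archimedean2 by blast
  define n where "n = Suc m"
  have n: "n > 0" "3 / real n < \<delta>"
    using m d(1) by (auto simp: n_def field_simps)
  have sq: "\<exists>z\<in>topspace X. h ` ({real j / real n..real (Suc j) / real n} \<times> {real k / real n..real (Suc k) / real n}) \<subseteq> N z"
    if jk: "j < n" "k < n" for j k
  proof (rule d(2))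
    let ?I = "\<lambda>k. {real k / real n..real (Suc k) / real n}"
    have le: "real k / real n \<le> real (Suc k) / real n" for k by (simp add: divide_right_mono)
    have sub: "?I k \<subseteq> {0..1}" if "k < n" for k
    proof -
      have "real (Suc k) / real n \<le> 1" using that by (simp add: field_simps)
      moreover have "0 \<le> real k / real n" by simp
      ultimately show ?thesis by (meson atLeastatMost_subset_iff order_trans)
    qed
    show "?I j \<times> ?I k \<subseteq> {0..1} \<times> {0..1}" using sub jk by blast
    show "?I j \<times> ?I k \<noteq> {}" using le by auto
    have "diameter (?I j \<times> ?I k) \<le> 2 / real n"
    proof (rule diameter_le)
      fix u v assume uv: "u \<in> ?I j \<times> ?I k" "v \<in> ?I j \<times> ?I k"
      have "dist (fst u) (fst v) \<le> 1 / real n" "dist (snd u) (snd v) \<le> 1 / real n"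
        using uv n(1) by (auto simp: dist_real_def abs_le_iff mem_Times_iff add_divide_distrib)
      moreover have "norm (u - v) \<le> dist (fst u) (fst v) + dist (snd u) (snd v)"
      proof -
        have "u - v = (fst u - fst v, snd u - snd v)" by (simp add: prod_eq_iff)
        then show ?thesis using norm_Pair_le[of "fst u - fst v" "snd u - snd v"] by (simp only: dist_norm)
      qed
      ultimately show "norm (u - v) \<le> 2 / real n" by (simp add: add_divide_distrib)
    qed (use le in auto)
    then show "diameter (?I j \<times> ?I k) < \<delta>" using n(2) n(1) by (smt (verit) divide_strict_right_mono of_nat_0_less_iff)
  qed
  define x where "x j k = h (real j / real n, real k / real n)" for j k
  have xs: "\<exists>z\<in>topspace X. x j k \<in> N z \<and> x (Suc j) k \<in> N z \<and> x j (Suc k) \<in> N z \<and> x (Suc j) (Suc k) \<in> N z"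
    if jk: "j < n" "k < n" for j k
  proof -
    have le: "real k / real n \<le> real (Suc k) / real n" for k by (simp add: divide_right_mono)
    obtain z where z: "z \<in> topspace X" "h ` ({real j / real n..real (Suc j) / real n} \<times> {real k / real n..real (Suc k) / real n}) \<subseteq> N z"
      using sq[OF jk] by blast
    have "x j' k' \<in> N z" if "j' \<in> {j, Suc j}" "k' \<in> {k, Suc k}" for j' k'
      using z(2) that le[of j] le[of k] unfolding x_def by (intro subsetD[OF z(2)] imageI) auto
    then show ?thesis using z(1) by blast
  qed
  \<comment> \<open>The vertical edge is carried across the row: in each square both ways round
    equal the diagonal, by the cocycle identity.\<close>
  have row: "seqprod H (\<lambda>k. \<tau> (x j k) (x j (Suc k))) m \<otimes> \<tau> (x j m) (x (Suc j) m)
      = \<tau> (x j 0) (x (Suc j) 0) \<otimes> seqprod H (\<lambda>k. \<tau> (x (Suc j) k) (x (Suc j) (Suc k))) m"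
    if jn: "j < n" and mle: "m \<le> n" for j m
    using mle
  proof (induction m)
    case 0
    obtain z where "z \<in> topspace X" "x j 0 \<in> N z" "x (Suc j) 0 \<in> N z" using xs[OF jn n(1)] by blast
    then show ?case using \<tau>_closed by simp
  next
    case (Suc m)
    have mn: "m < n" using Suc.prems by simp
    let ?A = "seqprod H (\<lambda>k. \<tau> (x j k) (x j (Suc k))) m" and ?B = "seqprod H (\<lambda>k. \<tau> (x (Suc j) k) (x (Suc j) (Suc k))) m"
    have cl: "?A \<in> carrier H" "?B \<in> carrier H"
      using xs[OF jn] mn by (auto intro!: H.seqprod_closed intro: \<tau>_closed) (meson \<tau>_closed xs jn less_trans)+
    obtain z where z: "z \<in> topspace X" "x j m \<in> N z" "x (Suc j) m \<in> N z" "x j (Suc m) \<in> N z" "x (Suc j) (Suc m) \<in> N z"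
      using xs[OF jn mn] by blast
    obtain z0 where z0: "z0 \<in> topspace X" "x j 0 \<in> N z0" "x (Suc j) 0 \<in> N z0" using xs[OF jn n(1)] by blast
    note tc = \<tau>_closed[OF z(1)] \<tau>_closed[OF z0]
    have "?A \<otimes> \<tau> (x j m) (x j (Suc m)) \<otimes> \<tau> (x j (Suc m)) (x (Suc j) (Suc m))
        = ?A \<otimes> \<tau> (x j m) (x (Suc j) (Suc m))"
      using cl z tc(1) \<tau>_cocycle[OF z(1,2,4,5)] by (simp add: H.m_assoc)
    also have "\<dots> = ?A \<otimes> \<tau> (x j m) (x (Suc j) m) \<otimes> \<tau> (x (Suc j) m) (x (Suc j) (Suc m))"
      using cl z tc(1) \<tau>_cocycle[OF z(1,2,3,5)] by (simp add: H.m_assoc)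
    also have "\<dots> = \<tau> (x j 0) (x (Suc j) 0) \<otimes> ?B \<otimes> \<tau> (x (Suc j) m) (x (Suc j) (Suc m))"
      using Suc.IH mn by simp
    finally show ?case using cl z tc by (simp add: H.m_assoc)
  qed
  have ends: "real j / real n \<in> {0..1}" if "j \<le> n" for j using that n(1) by (simp add: field_simps)
  have same: "seqprod H (\<lambda>k. \<tau> (x j k) (x j (Suc k))) n = seqprod H (\<lambda>k. \<tau> (x 0 k) (x 0 (Suc k))) n" if "j \<le> n" for j
    using that
  proof (induction j)
    case (Suc j)
    have jn: "j < n" using Suc.prems by simp
    have x0: "x j 0 = p 0" "x (Suc j) 0 = p 0" "x j n = p 1" "x (Suc j) n = p 1"
      using h(4)[OF ends[of j]] h(4)[OF ends[of "Suc j"]] h(5)[OF ends[of j]] h(5)[OF ends[of "Suc j"]] jn n(1)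
      by (simp_all add: x_def)
    have tp: "p 0 \<in> topspace X" "p 1 \<in> topspace X"
      using phom_pathin[OF assms] path_start_in_topspace path_finish_in_topspace by blast+
    have one: "\<tau> (p 0) (p 0) = \<one>" "\<tau> (p 1) (p 1) = \<one>" using \<tau>_refl N_mem tp by blast+
    have cl: "seqprod H (\<lambda>k. \<tau> (x i k) (x i (Suc k))) n \<in> carrier H" if "i = j \<or> i = Suc j" for i
      by (rule H.seqprod_closed) (use xs[OF jn] that \<tau>_closed in blast)
    have "seqprod H (\<lambda>k. \<tau> (x j k) (x j (Suc k))) n \<otimes> \<one> = \<one> \<otimes> seqprod H (\<lambda>k. \<tau> (x (Suc j) k) (x (Suc j) (Suc k))) n"
      using row[OF jn order_refl] unfolding x0 one .
    then have "seqprod H (\<lambda>k. \<tau> (x j k) (x j (Suc k))) n = seqprod H (\<lambda>k. \<tau> (x (Suc j) k) (x (Suc j) (Suc k))) n"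
      using cl[of j] cl[of "Suc j"] by simp
    then show ?case using Suc by simp
  qed simp
  have fp: "fine_partition n p"
    unfolding fine_partition_def
  proof (intro conjI allI impI n(1))
    fix k assume k: "k < n"
    obtain z where "z \<in> topspace X" "h ` ({real 0 / real n..real (Suc 0) / real n} \<times> {real k / real n..real (Suc k) / real n}) \<subseteq> N z"
      using sq[OF n(1) k] by blast
    moreover have "0 \<in> {real 0 / real n..real (Suc 0) / real n}" by simp
    ultimately show "\<exists>z\<in>topspace X. \<forall>t\<in>{real k / real n..real (Suc k) / real n}. p t \<in> N z"
      using h(2) by (metis (no_types, lifting) SigmaI image_subset_iff)
  qed
  have fq: "fine_partition n q"
    unfolding fine_partition_def
  proof (intro conjI allI impI n(1))
    fix k assume k: "k < n"
    obtain z where "z \<in> topspace X" "h ` ({real (n - 1) / real n..real (Suc (n - 1)) / real n} \<times> {real k / real n..real (Suc k) / real n}) \<subseteq> N z"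
      using sq[of "n - 1" k] n(1) k by auto
    moreover have "1 \<in> {real (n - 1) / real n..real (Suc (n - 1)) / real n}" using n(1) by simp
    ultimately show "\<exists>z\<in>topspace X. \<forall>t\<in>{real k / real n..real (Suc k) / real n}. q t \<in> N z"
      using h(3) by (metis (no_types, lifting) SigmaI image_subset_iff)
  qed
  have "holn n p = seqprod H (\<lambda>k. \<tau> (x 0 k) (x 0 (Suc k))) n" by (simp add: holn_def x_def h(2))
  moreover have "holn n q = seqprod H (\<lambda>k. \<tau> (x n k) (x n (Suc k))) n" using n(1) by (simp add: holn_def x_def h(3))
  ultimately show ?thesis using same[of n] hol_eq[OF fp] hol_eq[OF fq] by simp
qed

definition Hol :: "(real => 'x) set => 'h" where
  "Hol A = hol (SOME p. p \<in> A)"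

lemma Hol_loop_class:
  assumes "p \<in> loops_at X a"
  shows "Hol (loop_class X a p) = hol p"
proof -
  have "p \<in> loop_class X a p" using assms mem_loop_class[OF assms] phom_refl[of X p] by (simp add: loops_at_def)
  then have "(SOME q. q \<in> loop_class X a p) \<in> loop_class X a p"
    by (rule someI[of "\<lambda>q. q \<in> loop_class X a p"])
  then show ?thesis using hol_phom[of p] mem_loop_class[OF assms] by (simp add: Hol_def)
qed

lemma Hol_hom: "Hol \<in> hom G H"
proof (rule homI)
  fix A assume "A \<in> carrier G"
  then obtain p where p: "p \<in> loops_at X a" "A = loop_class X a p" by (auto simp: fundamental_group_simps)
  then show "Hol A \<in> carrier H" using Hol_loop_class hol_closed[of p] by (simp add: loops_at_def)
  fix B assume "B \<in> carrier G"
  then obtain q where q: "q \<in> loops_at X a" "B = loop_class X a q" by (auto simp: fundamental_group_simps)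
  show "Hol (A \<otimes>\<^bsub>G\<^esub> B) = Hol A \<otimes> Hol B"
    unfolding p(2) q(2) fundamental_group_mult[OF p(1) q(1)]
    using p(1) q(1) Hol_loop_class hol_join[of p q] loops_at_join[OF p(1) q(1)] by (simp add: loops_at_def)
qed

lemma hol_rev:
  assumes "pathin X p"
  shows "hol (path_rev p) = inv (hol p)"
proof -
  have "hol (path_rev p) \<otimes> hol p = hol (path_join (path_rev p) p)"
    using assms by (intro hol_join[symmetric]) (auto simp: pathin_path_rev)
  also have "\<dots> = \<one>" using hol_phom[OF phom_rev_left[OF assms]] hol_const path_finish_in_topspace[OF assms] by simp
  finally show ?thesis
    using hol_closed assms pathin_path_rev by (intro H.inv_equality[symmetric]) auto
qed

lemma Hol_transport:
  assumes p: "pathin X p" "p 0 \<in> pcomp"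
  shows "Hol (transport p) = hol (base_path (p 0)) \<otimes> hol p \<otimes> inv (hol (base_path (p 1)))"
proof -
  have 1: "p 1 \<in> pcomp" using pcomp_path[OF p] by simp
  note b = base_path[OF p(2)] base_path[OF 1]
  have j: "pathin X (path_join p (path_rev (base_path (p 1))))"
    using p b by (intro pathin_path_join) (auto simp: pathin_path_rev)
  have "Hol (transport p) = hol (path_join (base_path (p 0)) (path_join p (path_rev (base_path (p 1)))))"
    unfolding transport_def by (rule Hol_loop_class[OF transport_loop[OF p]])
  also have "\<dots> = hol (base_path (p 0)) \<otimes> (hol p \<otimes> inv (hol (base_path (p 1))))"
    using p b j by (simp add: hol_join pathin_path_rev hol_rev)
  finally show ?thesis using p b by (simp add: H.m_assoc hol_closed)
qed

text \<open>
  If \<open>\<psi>\<close> turns the cocycle \<open>\<tau>\<close> into one cohomologous to parallel transport, then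
  it inverts the holonomy from the left.
\<close>

lemma retraction:
  assumes e: "\<And>y z. z \<in> topspace X ==> y \<in> N z ==> pathin X (e y z) \<and> e y z 0 = y \<and> e y z 1 = z"
    and contr: "\<And>z p. z \<in> topspace X ==> pathin X p ==> (\<And>t. t \<in> {0..1} ==> p t \<in> N z) ==>
       phom X p (path_join (e (p 0) z) (path_rev (e (p 1) z)))"
    and \<psi>: "\<psi> \<in> hom H G" and n: "\<And>x. x \<in> pcomp ==> n x \<in> carrier G" and na: "n a = \<one>\<^bsub>G\<^esub>"
    and key: "\<And>y z. z \<in> topspace X ==> z \<in> pcomp ==> y \<in> N z ==>
       n y \<otimes>\<^bsub>G\<^esub> transport (e y z) \<otimes>\<^bsub>G\<^esub> inv\<^bsub>G\<^esub> (n z) = \<psi> (\<tau> y z)"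
    and p: "p \<in> loops_at X a"
  shows "\<psi> (hol p) = loop_class X a p"
proof -
  interpret \<psi>: group_hom H G \<psi> using \<psi> by unfold_locales (simp add: group_hom_axioms_def)
  have canc: "inv\<^bsub>G\<^esub> g \<otimes>\<^bsub>G\<^esub> (g \<otimes>\<^bsub>G\<^esub> h) = h" if "g \<in> carrier G" "h \<in> carrier G" for g h
    using that by (simp add: G.m_assoc[symmetric])
  have pp: "pathin X p" "p 0 = a" "p 1 = a" using p by (auto simp: loops_at_def)
  have pc: "p t \<in> pcomp" if "t \<in> {0..1}" for t using pcomp_path[OF pp(1) _ that] base_pcomp pp by simp
  obtain m where m: "fine_partition m p" using ex_fine_partition[OF pp(1)] by blast
  then have m0: "m > 0" by (simp add: fine_partition_def)
  let ?sub = "\<lambda>r s x. p (r + (s - r) * x)"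
  let ?x = "\<lambda>k. p (real k / real m)"
  have unit: "real k / real m \<in> {0..1}" if "k \<le> m" for k using that m0 by (simp add: field_simps)
  have subpath: "pathin X (?sub r s)" if "0 \<le> r" "r \<le> s" "s \<le> 1" for r s
  proof (rule pathin_compose_unit[OF pp(1)])
    show "(\<lambda>x. r + (s - r) * x) ` {0..1} \<subseteq> {0..1}"
    proof clarsimp
      fix x :: real assume x: "0 \<le> x" "x \<le> 1"
      then have "(s - r) * x \<le> s - r" using that by (simp add: mult_left_le)
      then show "0 \<le> r + (s - r) * x \<and> r + (s - r) * x \<le> 1" using that x by simp
    qed
  qed (intro continuous_intros)
  \<comment> \<open>Within \<open>N z\<close> the piece of \<open>p\<close> is homotopic to the way
    over the centre \<open>z\<close>, so \<open>key\<close> can be applied at both ends and the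
    factor \<open>n z\<close> cancels.\<close>
  have step: "\<psi> (\<tau> (?x k) (?x (Suc k))) = n (?x k) \<otimes>\<^bsub>G\<^esub> transport (?sub (real k / real m) (real (Suc k) / real m)) \<otimes>\<^bsub>G\<^esub> inv\<^bsub>G\<^esub> (n (?x (Suc k)))"
    if k: "k < m" for k
  proof -
    obtain z where z: "z \<in> topspace X" "\<And>t. t \<in> {real k / real m..real (Suc k) / real m} ==> p t \<in> N z"
      using m k unfolding fine_partition_def by blast
    let ?r = "real k / real m" and ?s = "real (Suc k) / real m"
    have rs: "?r \<le> ?s" by (simp add: divide_right_mono)
    have u: "?r \<in> {0..1}" "?s \<in> {0..1}" using unit[of k] unit[of "Suc k"] k by auto
    have xy: "p ?r \<in> N z" "p ?s \<in> N z" using z(2) rs by auto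
    have xc: "p ?r \<in> pcomp" "p ?s \<in> pcomp" using pc u by auto
    have ex: "pathin X (e (p ?r) z)" "e (p ?r) z 0 = p ?r" "e (p ?r) z 1 = z" using e[OF z(1) xy(1)] by auto
    have ey: "pathin X (e (p ?s) z)" "e (p ?s) z 0 = p ?s" "e (p ?s) z 1 = z" using e[OF z(1) xy(2)] by auto
    have zc: "z \<in> pcomp" using pcomp_path[OF ex(1), of 1] ex xc by simp
    have sp: "pathin X (?sub ?r ?s)" using u rs by (intro subpath) auto
    have "?sub ?r ?s t \<in> N z" if t: "t \<in> {0..1}" for t
    proof (rule z(2))
      have "0 \<le> (?s - ?r) * t" "(?s - ?r) * t \<le> ?s - ?r" using t rs by (auto intro: mult_left_le)
      then show "?r + (?s - ?r) * t \<in> {?r..?s}" by simp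
    qed
    from contr[OF z(1) sp this] have "phom X (?sub ?r ?s) (path_join (e (p ?r) z) (path_rev (e (p ?s) z)))" by simp
    then have tr: "transport (?sub ?r ?s) = transport (e (p ?r) z) \<otimes>\<^bsub>G\<^esub> inv\<^bsub>G\<^esub> (transport (e (p ?s) z))"
      using transport_phom[of "?sub ?r ?s"] transport_join[OF ex(1) _ pathin_path_rev[OF ey(1)]] transport_rev[OF ey(1)] ex ey xc
      by simp
    have tcl: "transport (e (p ?r) z) \<in> carrier G" "transport (e (p ?s) z) \<in> carrier G"
      using transport_closed ex ey xc by auto
    have "\<psi> (\<tau> (p ?r) (p ?s)) = \<psi> (\<tau> (p ?r) z \<otimes> inv (\<tau> (p ?s) z))"
      using \<tau>_cocycle[OF z(1) xy(1) N_mem[OF z(1)] xy(2)] \<tau>_inv[OF z(1) xy(2) N_mem[OF z(1)]] by simp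
    also have "\<dots> = \<psi> (\<tau> (p ?r) z) \<otimes>\<^bsub>G\<^esub> inv\<^bsub>G\<^esub> (\<psi> (\<tau> (p ?s) z))"
      using \<tau>_closed[OF z(1) xy(1) N_mem[OF z(1)]] \<tau>_closed[OF z(1) xy(2) N_mem[OF z(1)]] by simp
    also have "\<dots> = (n (p ?r) \<otimes>\<^bsub>G\<^esub> transport (e (p ?r) z) \<otimes>\<^bsub>G\<^esub> inv\<^bsub>G\<^esub> (n z)) \<otimes>\<^bsub>G\<^esub>
        inv\<^bsub>G\<^esub> (n (p ?s) \<otimes>\<^bsub>G\<^esub> transport (e (p ?s) z) \<otimes>\<^bsub>G\<^esub> inv\<^bsub>G\<^esub> (n z))"
      using key[OF z(1) zc] xy by simp
    also have "\<dots> = n (p ?r) \<otimes>\<^bsub>G\<^esub> transport (?sub ?r ?s) \<otimes>\<^bsub>G\<^esub> inv\<^bsub>G\<^esub> (n (p ?s))"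
      unfolding tr using n[OF xc(1)] n[OF xc(2)] n[OF zc] tcl by (simp add: G.inv_mult_group G.m_assoc canc)
    finally show ?thesis .
  qed
  \<comment> \<open>Telescoping: the factors \<open>n\<close> at the intermediate points cancel, and
    at the base point \<open>n\<close> is trivial.\<close>
  have "\<psi> (seqprod H (\<lambda>k. \<tau> (?x k) (?x (Suc k))) k) = transport (?sub 0 (real k / real m)) \<otimes>\<^bsub>G\<^esub> inv\<^bsub>G\<^esub> (n (?x k))"
    if "k \<le> m" for k
    using that
  proof (induction k)
    case 0
    have "\<psi> \<one> = \<one>\<^bsub>G\<^esub>" by simp
    then show ?case using transport_const[OF base_pcomp] pp na by simp
  next
    case (Suc k)
    have k: "k < m" using Suc.prems by simp
    let ?r = "real k / real m" and ?s = "real (Suc k) / real m"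
    have u: "?r \<in> {0..1}" "?s \<in> {0..1}" using unit[of k] unit[of "Suc k"] k by auto
    have rs: "?r \<le> ?s" by (simp add: divide_right_mono)
    have cl: "seqprod H (\<lambda>k. \<tau> (?x k) (?x (Suc k))) k \<in> carrier H" "\<tau> (?x k) (?x (Suc k)) \<in> carrier H"
      using holn_step_closed[OF m] k by (auto intro!: H.seqprod_closed)
    have tc: "transport (?sub 0 ?r) \<in> carrier G" "transport (?sub ?r ?s) \<in> carrier G" "n (?x k) \<in> carrier G" "n (?x (Suc k)) \<in> carrier G"
    proof -
      have sc: "transport (?sub r s) \<in> carrier G" if "0 \<le> r" "r \<le> s" "s \<le> 1" for r s
        using transport_closed[OF subpath[OF that]] pc[of r] that by simp
      show "transport (?sub 0 ?r) \<in> carrier G" using u by (intro sc) auto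
      show "transport (?sub ?r ?s) \<in> carrier G" using u rs by (intro sc) auto
      show "n (?x k) \<in> carrier G" "n (?x (Suc k)) \<in> carrier G" by (intro n pc u)+
    qed
    have "\<psi> (seqprod H (\<lambda>k. \<tau> (?x k) (?x (Suc k))) (Suc k))
        = (transport (?sub 0 ?r) \<otimes>\<^bsub>G\<^esub> inv\<^bsub>G\<^esub> (n (?x k))) \<otimes>\<^bsub>G\<^esub> (n (?x k) \<otimes>\<^bsub>G\<^esub> transport (?sub ?r ?s) \<otimes>\<^bsub>G\<^esub> inv\<^bsub>G\<^esub> (n (?x (Suc k))))"
      using cl Suc k step[OF k] by simp
    also have "\<dots> = (transport (?sub 0 ?r) \<otimes>\<^bsub>G\<^esub> transport (?sub ?r ?s)) \<otimes>\<^bsub>G\<^esub> inv\<^bsub>G\<^esub> (n (?x (Suc k)))"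
      using tc by (simp add: G.m_assoc canc)
    also have "transport (?sub 0 ?r) \<otimes>\<^bsub>G\<^esub> transport (?sub ?r ?s) = transport (?sub 0 ?s)"
      using transport_subpath[OF pp(1), of 0 ?r ?s] base_pcomp pp u rs by simp
    finally show ?case .
  qed
  from this[of m] have "\<psi> (holn m p) = transport p \<otimes>\<^bsub>G\<^esub> inv\<^bsub>G\<^esub> (n a)" using m0 pp by (simp add: holn_def)
  also have "\<dots> = transport p" using na transport_closed[OF pp(1)] base_pcomp pp by simp
  finally show ?thesis using transport_loops[OF p] hol_eq[OF m] by simp
qed

end

section \<open>Unordered configurations as finite sets\<close>

text \<open>Orbits of tuples are replaced by their image sets, so that configurations become finite
  sets of complex numbers. The identification is \<open>homeomorphic_map_orbit_set\<close>.\<close>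

definition cset :: "nat => complex set => complex set topology" where
  "cset n Z = quotient_topology (conf_space n (top_of_set Z)) (\<lambda>x. x ` {..<n})"

lemma topspace_conf_space: "topspace (conf_space n X) = {x \<in> PiE {..<n} (\<lambda>_. topspace X). inj_on x {..<n}}"
  by (auto simp: conf_space_def topspace_product_topology)

lemma topspace_quotient_topology: "topspace (quotient_topology X f) = f ` topspace X"
  using quotient_map_quotient_topology[of X f] by (simp add: quotient_map_def)

lemma quotient_map_cset: "quotient_map (conf_space n (top_of_set Z)) (cset n Z) (\<lambda>x. x ` {..<n})"
  unfolding cset_def by (rule quotient_map_quotient_topology)

lemma topspace_cset: "topspace (cset n Z) = {y. y \<subseteq> Z \<and> finite y \<and> card y = n}"
proof (intro equalityI subsetI)
  fix y assume "y \<in> topspace (cset n Z)"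
  then show "y \<in> {y. y \<subseteq> Z \<and> finite y \<and> card y = n}"
    by (auto simp: cset_def topspace_quotient_topology topspace_conf_space card_image PiE_def Pi_def)
next
  fix y assume y: "y \<in> {y. y \<subseteq> Z \<and> finite y \<and> card y = n}"
  then obtain x where x: "bij_betw x {..<n} y"
    using ex_bij_betw_nat_finite[of y] by (auto simp: atLeast0LessThan)
  then have "restrict x {..<n} \<in> topspace (conf_space n (top_of_set Z))" "restrict x {..<n} ` {..<n} = y"
    using y by (auto simp: topspace_conf_space bij_betw_def inj_on_def)
  then show "y \<in> topspace (cset n Z)"
    unfolding cset_def topspace_quotient_topology by blast
qed

lemma cset_finite: "y \<in> topspace (cset n Z) ==> finite y"
  and cset_card: "y \<in> topspace (cset n Z) ==> card y = n"
  and cset_sub: "y \<in> topspace (cset n Z) ==> y \<subseteq> Z"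
  by (auto simp: topspace_cset)

text \<open>Neighbourhoods of a configuration will be cut out by such conditions, hitting a small
  ball round each of its points.\<close>

lemma openin_cset_hit:
  assumes "open V"
  shows "openin (cset n Z) {y \<in> topspace (cset n Z). y \<inter> V \<noteq> {}}"
proof -
  let ?C = "conf_space n (top_of_set Z)"
  have proj: "continuous_map ?C euclidean (\<lambda>x. x i)" if "i < n" for i
  proof -
    have "continuous_map (product_topology (\<lambda>_. top_of_set Z) {..<n}) (top_of_set Z) (\<lambda>x. x i)"
      by (rule continuous_map_product_projection) (use that in simp)
    then show ?thesis
      unfolding conf_space_def
      by (intro continuous_map_from_subtopology) (simp add: continuous_map_in_subtopology)
  qed
  have "openin ?C {x \<in> topspace ?C. x i \<in> V}" if "i < n" for i
    using openin_continuous_map_preimage[OF proj[OF that], of V] assms by simp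
  then have "openin ?C (\<Union>i<n. {x \<in> topspace ?C. x i \<in> V})" by (intro openin_Union) auto
  moreover have "(\<Union>i<n. {x \<in> topspace ?C. x i \<in> V}) = {x \<in> topspace ?C. x ` {..<n} \<in> {y \<in> topspace (cset n Z). y \<inter> V \<noteq> {}}}"
    by (auto simp: cset_def topspace_quotient_topology)
  ultimately have "openin ?C {x \<in> topspace ?C. x ` {..<n} \<in> {y \<in> topspace (cset n Z). y \<inter> V \<noteq> {}}}" by simp
  moreover have "{y \<in> topspace (cset n Z). y \<inter> V \<noteq> {}} \<subseteq> topspace (cset n Z)" by blast
  ultimately show ?thesis using quotient_map_cset[of n Z] unfolding quotient_map_def by blast
qed

lemma continuous_map_cset:
  assumes c: "\<And>i. i < n ==> continuous_map T euclidean (\<phi> i)"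
    and Z: "\<And>i s. i < n ==> s \<in> topspace T ==> \<phi> i s \<in> Z"
    and inj: "\<And>s. s \<in> topspace T ==> inj_on (\<lambda>i. \<phi> i s) {..<n}"
  shows "continuous_map T (cset n Z) (\<lambda>s. (\<lambda>i. \<phi> i s) ` {..<n})"
proof -
  let ?f = "\<lambda>s. restrict (\<lambda>i. \<phi> i s) {..<n}"
  have "continuous_map T (product_topology (\<lambda>_. top_of_set Z) {..<n}) ?f"
  proof (subst continuous_map_componentwise, intro conjI ballI)
    show "?f ` topspace T \<subseteq> extensional {..<n}" by auto
    fix i assume i: "i \<in> {..<n}"
    then show "continuous_map T (top_of_set Z) (\<lambda>s. ?f s i)"
      using c[of i] Z[of i] by (auto simp: continuous_map_in_subtopology)
  qed
  moreover have "?f s \<in> {x. inj_on x {..<n}}" if "s \<in> topspace T" for s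
    using inj[OF that] by (simp add: inj_on_def)
  ultimately have "continuous_map T (conf_space n (top_of_set Z)) ?f"
    unfolding conf_space_def by (auto simp: continuous_map_in_subtopology)
  then have "continuous_map T (cset n Z) ((\<lambda>x. x ` {..<n}) \<circ> ?f)"
    by (rule continuous_map_compose) (use quotient_imp_continuous_map[OF quotient_map_cset] in blast)
  then show ?thesis by (rule continuous_map_eq) auto
qed

section \<open>Straight-line motions of enumerated particles\<close>

definition motion :: "nat => (nat => complex) => (nat => complex) => real => complex set" where
  "motion n x x' = (\<lambda>t. (\<lambda>i. of_real (1 - t) * x i + of_real t * x' i) ` {..<n})"

lemma phom_cset:
  assumes c: "\<And>i. i < n ==> continuous_on {0..1} (\<phi> i)" "\<And>i. i < n ==> continuous_on {0..1} (\<psi> i)"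
    and Z: "\<And>i s t. i < n ==> s \<in> {0..1} ==> t \<in> {0..1} ==> of_real (1 - s) * \<phi> i t + of_real s * \<psi> i t \<in> Z"
    and inj: "\<And>s t. s \<in> {0..1} ==> t \<in> {0..1} ==> inj_on (\<lambda>i. of_real (1 - s) * \<phi> i t + of_real s * \<psi> i t) {..<n}"
    and e: "\<And>i. i < n ==> \<phi> i 0 = \<psi> i 0" "\<And>i. i < n ==> \<phi> i 1 = \<psi> i 1"
  shows "phom (cset n Z) (\<lambda>t. (\<lambda>i. \<phi> i t) ` {..<n}) (\<lambda>t. (\<lambda>i. \<psi> i t) ` {..<n})"
proof (rule phomI[where h = "\<lambda>z. (\<lambda>i. of_real (1 - fst z) * \<phi> i (snd z) + of_real (fst z) * \<psi> i (snd z)) ` {..<n}"])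
  show "continuous_map (prod_topology unit_top unit_top) (cset n Z)
     (\<lambda>z. (\<lambda>i. of_real (1 - fst z) * \<phi> i (snd z) + of_real (fst z) * \<psi> i (snd z)) ` {..<n})"
  proof (rule continuous_map_cset)
    fix i assume i: "i < n"
    have "continuous_on ({0..1} \<times> {0..1}) (\<lambda>z::real \<times> real. \<phi> i (snd z))" "continuous_on ({0..1} \<times> {0..1}) (\<lambda>z::real \<times> real. \<psi> i (snd z))"
      by (rule continuous_on_compose2[OF c(1)[OF i]] continuous_on_compose2[OF c(2)[OF i]]; auto intro: continuous_intros)+
    then have "continuous_on ({0..1} \<times> {0..1}) (\<lambda>z::real \<times> real. of_real (1 - fst z) * \<phi> i (snd z) + of_real (fst z) * \<psi> i (snd z))"
      by (intro continuous_intros)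
    then show "continuous_map (prod_topology unit_top unit_top) euclidean (\<lambda>z. of_real (1 - fst z) * \<phi> i (snd z) + of_real (fst z) * \<psi> i (snd z))"
      by (simp add: continuous_map_unit_square)
  qed (use Z inj in auto)
qed (use e in \<open>auto simp: algebra_simps intro!: image_cong\<close>)

lemma pathin_cset:
  assumes c: "\<And>i. i < n ==> continuous_on {0..1} (\<phi> i)"
    and Z: "\<And>i t. i < n ==> t \<in> {0..1} ==> \<phi> i t \<in> Z"
    and inj: "\<And>t. t \<in> {0..1} ==> inj_on (\<lambda>i. \<phi> i t) {..<n}"
  shows "pathin (cset n Z) (\<lambda>t. (\<lambda>i. \<phi> i t) ` {..<n})"
  unfolding pathin_def by (rule continuous_map_cset) (use assms in auto)

text \<open>The triangle spanned by three enumerated configurations contains no collision and does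
  not leave \<open>Z\<close>; so each side is a path, and two sides compose to the third up to
  homotopy.\<close>

definition valid_motion :: "nat => complex set => (nat => complex) => (nat => complex) => (nat => complex) => bool" where
  "valid_motion n Z x y w \<longleftrightarrow> (\<forall>\<alpha>\<ge>0. \<forall>\<beta>\<ge>0. \<forall>\<gamma>\<ge>0. \<alpha> + \<beta> + \<gamma> = 1 -->
     (\<forall>i<n. of_real \<alpha> * x i + of_real \<beta> * y i + of_real \<gamma> * w i \<in> Z) \<and>
     inj_on (\<lambda>i. of_real \<alpha> * x i + of_real \<beta> * y i + of_real \<gamma> * w i) {..<n})"

lemma valid_motionD:
  assumes "valid_motion n Z x y w" "\<alpha> \<ge> 0" "\<beta> \<ge> 0" "\<gamma> \<ge> 0" "\<alpha> + \<beta> + \<gamma> = 1"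
  shows "i < n ==> of_real \<alpha> * x i + of_real \<beta> * y i + of_real \<gamma> * w i \<in> Z"
    "inj_on (\<lambda>i. of_real \<alpha> * x i + of_real \<beta> * y i + of_real \<gamma> * w i) {..<n}"
  using assms unfolding valid_motion_def by blast+

lemma motion_ends [simp]: "motion n x x' 0 = x ` {..<n}" "motion n x x' 1 = x' ` {..<n}"
  by (auto simp: motion_def)

lemma pathin_motion:
  assumes "valid_motion n Z x y w"
  shows "pathin (cset n Z) (motion n x y)" "pathin (cset n Z) (motion n y w)" "pathin (cset n Z) (motion n x w)"
proof -
  have v: "of_real (1 - t) * x i + of_real t * y i \<in> Z" "of_real (1 - t) * y i + of_real t * w i \<in> Z" "of_real (1 - t) * x i + of_real t * w i \<in> Z"
    if "t \<in> {0..1}" "i < n" for t i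
    using valid_motionD(1)[OF assms, of "1 - t" t 0 i] valid_motionD(1)[OF assms, of 0 "1 - t" t i]
      valid_motionD(1)[OF assms, of "1 - t" 0 t i] that by simp_all
  have u: "inj_on (\<lambda>i. of_real (1 - t) * x i + of_real t * y i) {..<n}" "inj_on (\<lambda>i. of_real (1 - t) * y i + of_real t * w i) {..<n}"
     "inj_on (\<lambda>i. of_real (1 - t) * x i + of_real t * w i) {..<n}"
    if "t \<in> {0..1}" for t
    using valid_motionD(2)[OF assms, of "1 - t" t 0] valid_motionD(2)[OF assms, of 0 "1 - t" t]
      valid_motionD(2)[OF assms, of "1 - t" 0 t] that by simp_all
  show "pathin (cset n Z) (motion n x y)" "pathin (cset n Z) (motion n y w)" "pathin (cset n Z) (motion n x w)"
    unfolding motion_def by (rule pathin_cset; use u v in \<open>auto intro!: continuous_intros\<close>)+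
qed

text \<open>The linear homotopy between the broken path over \<open>y\<close> and the direct path
  has all its values in the triangle of \<open>valid_motion\<close>.\<close>

lemma phom_motion:
  assumes "valid_motion n Z x y w"
  shows "phom (cset n Z) (path_join (motion n x y) (motion n y w)) (motion n x w)"
proof -
  define \<phi> where "\<phi> i t = (if t \<le> 1/2 then of_real (1 - 2 * t) * x i + of_real (2 * t) * y i
     else of_real (1 - (2 * t - 1)) * y i + of_real (2 * t - 1) * w i)" for i and t :: real
  define \<psi> where "\<psi> i t = of_real (1 - t) * x i + of_real t * w i" for i and t :: real
  have l: "\<exists>\<alpha> \<beta> \<gamma>. \<alpha> \<ge> 0 \<and> \<beta> \<ge> 0 \<and> \<gamma> \<ge> 0 \<and> \<alpha> + \<beta> + \<gamma> = 1 \<and>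
      (\<forall>i. of_real (1 - s) * \<phi> i t + of_real s * \<psi> i t = of_real \<alpha> * x i + of_real \<beta> * y i + of_real \<gamma> * w i)"
    if st: "s \<in> {0..1}" "t \<in> {0..1}" for s t
  proof (cases "t \<le> 1/2")
    case True
    let ?a = "(1 - s) * (1 - 2 * t) + s * (1 - t)" and ?b = "(1 - s) * (2 * t)" and ?c = "s * t"
    have "?a \<ge> 0" "?b \<ge> 0" "?c \<ge> 0" using True st by (auto intro!: add_nonneg_nonneg mult_nonneg_nonneg)
    moreover have "?a + ?b + ?c = 1" by (simp add: algebra_simps)
    moreover have "of_real (1 - s) * \<phi> i t + of_real s * \<psi> i t = of_real ?a * x i + of_real ?b * y i + of_real ?c * w i" for i
      using True by (simp add: \<phi>_def \<psi>_def algebra_simps)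
    ultimately show ?thesis by blast
  next
    case False
    let ?a = "s * (1 - t)" and ?b = "(1 - s) * (2 - 2 * t)" and ?c = "(1 - s) * (2 * t - 1) + s * t"
    have "?a \<ge> 0" "?b \<ge> 0" "?c \<ge> 0" using False st by (auto intro!: add_nonneg_nonneg mult_nonneg_nonneg)
    moreover have "?a + ?b + ?c = 1" by (simp add: algebra_simps)
    moreover have "of_real (1 - s) * \<phi> i t + of_real s * \<psi> i t = of_real ?a * x i + of_real ?b * y i + of_real ?c * w i" for i
      using False by (simp add: \<phi>_def \<psi>_def algebra_simps)
    ultimately show ?thesis by blast
  qed
  have "phom (cset n Z) (\<lambda>t. (\<lambda>i. \<phi> i t) ` {..<n}) (\<lambda>t. (\<lambda>i. \<psi> i t) ` {..<n})"
  proof (rule phom_cset)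
    fix i :: nat
    have "\<phi> i = (\<lambda>t. of_real (1 - min 1 (2 * t)) * x i + of_real (min 1 (2 * t) - max 0 (2 * t - 1)) * y i
        + of_real (max 0 (2 * t - 1)) * w i)"
    proof
      fix t :: real
      show "\<phi> i t = of_real (1 - min 1 (2 * t)) * x i + of_real (min 1 (2 * t) - max 0 (2 * t - 1)) * y i
          + of_real (max 0 (2 * t - 1)) * w i"
        by (cases "t \<le> 1/2") (simp_all add: \<phi>_def min_absorb1 min_absorb2 max_absorb1 max_absorb2)
    qed
    then show "continuous_on {0..1} (\<phi> i)" by (auto intro!: continuous_intros)
    show "continuous_on {0..1} (\<psi> i)" unfolding \<psi>_def by (intro continuous_intros)
    show "\<phi> i 0 = \<psi> i 0" "\<phi> i 1 = \<psi> i 1" by (simp_all add: \<phi>_def \<psi>_def)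
  next
    fix i s t assume i: "i < n" and st: "s \<in> {0..1::real}" "t \<in> {0..1::real}"
    show "of_real (1 - s) * \<phi> i t + of_real s * \<psi> i t \<in> Z"
      using l[OF st] valid_motionD(1)[OF assms _ _ _ _ i] by metis
  next
    fix s t assume st: "s \<in> {0..1::real}" "t \<in> {0..1::real}"
    obtain \<alpha> \<beta> \<gamma> where abc: "\<alpha> \<ge> 0" "\<beta> \<ge> 0" "\<gamma> \<ge> 0" "\<alpha> + \<beta> + \<gamma> = 1"
      and eq: "\<And>i. of_real (1 - s) * \<phi> i t + of_real s * \<psi> i t = of_real \<alpha> * x i + of_real \<beta> * y i + of_real \<gamma> * w i"
      using l[OF st] by blast
    show "inj_on (\<lambda>i. of_real (1 - s) * \<phi> i t + of_real s * \<psi> i t) {..<n}"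
      unfolding eq by (rule valid_motionD(2)[OF assms abc])
  qed
  moreover have "(\<lambda>t. (\<lambda>i. \<phi> i t) ` {..<n}) = path_join (motion n x y) (motion n y w)"
    by (auto simp: fun_eq_iff path_join_def motion_def \<phi>_def)
  moreover have "(\<lambda>t. (\<lambda>i. \<psi> i t) ` {..<n}) = motion n x w" by (simp add: motion_def \<psi>_def)
  ultimately show ?thesis by simp
qed

section \<open>Star-shaped neighbourhoods\<close>

definition locally_starlike :: "complex set => bool" where
  "locally_starlike Z \<longleftrightarrow> (\<forall>p\<in>Z. \<exists>\<epsilon>>0. \<forall>q\<in>Z. dist p q < \<epsilon> --> closed_segment p q \<subseteq> Z)"

text \<open>The balls round the points of \<open>z\<close> are disjoint, and inside a ball every
  point of \<open>Z\<close> can move straight to the centre. So nearby configurations can slide to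
  \<open>z\<close> without collision.\<close>

definition good_radius :: "complex set => complex set => real => bool" where
  "good_radius Z z \<epsilon> \<longleftrightarrow> \<epsilon> > 0 \<and> (\<forall>p\<in>z. \<forall>q\<in>z. p \<noteq> q --> 2 * \<epsilon> \<le> dist p q) \<and>
     (\<forall>p\<in>z. \<forall>q\<in>Z. dist p q < \<epsilon> --> closed_segment p q \<subseteq> Z)"

lemma good_radius_mono: "good_radius Z z \<epsilon> ==> 0 < \<delta> ==> \<delta> \<le> \<epsilon> ==> good_radius Z z \<delta>"
  unfolding good_radius_def by (meson less_le_trans mult_left_mono order_trans zero_le_numeral)

lemma ex_good_radius:
  assumes Z: "locally_starlike Z" and z: "z \<subseteq> Z" "finite z"
  shows "\<exists>\<epsilon>. good_radius Z z \<epsilon>"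
proof -
  have 1: "\<exists>\<epsilon>>0. \<forall>p\<in>z. \<forall>q\<in>z. p \<noteq> q --> 2 * \<epsilon> \<le> dist p q"
  proof -
    let ?D = "insert 1 ((\<lambda>(p, q). dist p q) ` {(p, q) \<in> z \<times> z. p \<noteq> q})"
    have "finite {(p, q) \<in> z \<times> z. p \<noteq> q}"
      by (rule finite_subset[of _ "z \<times> z"]) (use z(2) in auto)
    then have fin: "finite ?D" by blast
    have "Min ?D > 0" using fin by (subst Min_gr_iff) auto
    moreover have "Min ?D \<le> dist p q" if "p \<in> z" "q \<in> z" "p \<noteq> q" for p q
      using that by (intro Min_le[OF fin]) auto
    ultimately show ?thesis by (intro exI[of _ "Min ?D / 2"]) auto
  qed
  have 2: "\<exists>\<epsilon>>0. \<forall>p\<in>z. \<forall>q\<in>Z. dist p q < \<epsilon> --> closed_segment p q \<subseteq> Z"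
    using z(2,1)
  proof (induction z)
    case empty
    then show ?case by (auto intro: exI[of _ 1])
  next
    case (insert p z)
    then obtain e1 where e1: "e1 > 0" "\<forall>p\<in>z. \<forall>q\<in>Z. dist p q < e1 --> closed_segment p q \<subseteq> Z" by auto
    obtain e2 where e2: "e2 > 0" "\<forall>q\<in>Z. dist p q < e2 --> closed_segment p q \<subseteq> Z"
      using Z insert.prems unfolding locally_starlike_def by blast
    show ?case using e1 e2 by (intro exI[of _ "min e1 e2"]) auto
  qed
  obtain e1 e2 where "e1 > 0" "\<forall>p\<in>z. \<forall>q\<in>z. p \<noteq> q --> 2 * e1 \<le> dist p q"
    "e2 > 0" "\<forall>p\<in>z. \<forall>q\<in>Z. dist p q < e2 --> closed_segment p q \<subseteq> Z"
    using 1 2 by blast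
  then have "good_radius Z z (min e1 e2)"
    unfolding good_radius_def by (auto simp: min_def) (smt (verit))+
  then show ?thesis by blast
qed

definition nbr :: "nat => complex set => complex set => real => complex set set" where
  "nbr n Z z \<epsilon> = {y \<in> topspace (cset n Z). \<forall>p\<in>z. y \<inter> ball p \<epsilon> \<noteq> {}}"

definition near_pt :: "real => complex set => complex => complex" where
  "near_pt \<epsilon> y p = (THE q. q \<in> y \<inter> ball p \<epsilon>)"

lemma openin_nbr:
  assumes "finite z"
  shows "openin (cset n Z) (nbr n Z z \<epsilon>)"
proof -
  have "nbr n Z z \<epsilon> = topspace (cset n Z) \<inter> (\<Inter>p\<in>z. {y \<in> topspace (cset n Z). y \<inter> ball p \<epsilon> \<noteq> {}})"
    by (auto simp: nbr_def)
  moreover have "openin (cset n Z) (topspace (cset n Z) \<inter> (\<Inter>p\<in>z. {y \<in> topspace (cset n Z). y \<inter> ball p \<epsilon> \<noteq> {}}))"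
    using assms
  proof (induction z)
    case (insert p z)
    then show ?case using openin_Int[OF insert.IH openin_cset_hit[OF open_ball[of p \<epsilon>], of n Z]]
      by (simp add: Int_ac)
  qed simp
  ultimately show ?thesis by simp
qed

context
  fixes n :: nat and Z z :: "complex set" and \<epsilon> :: real
  assumes z: "z \<in> topspace (cset n Z)" and good: "good_radius Z z \<epsilon>"
begin

text \<open>Pigeonhole: \<open>y\<close> has as many points as \<open>z\<close> and meets all the
  disjoint balls, so it has exactly one point in each.\<close>

lemma near_pt:
  assumes y: "y \<in> nbr n Z z \<epsilon>"
  shows "p \<in> z ==> near_pt \<epsilon> y p \<in> y \<and> dist p (near_pt \<epsilon> y p) < \<epsilon>"
    "p \<in> z ==> q \<in> y ==> dist p q < \<epsilon> ==> q = near_pt \<epsilon> y p"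
    "inj_on (near_pt \<epsilon> y) z" "near_pt \<epsilon> y ` z = y"
proof -
  have yt: "finite y" "card y = n" "y \<subseteq> Z" using y by (auto simp: nbr_def topspace_cset)
  have zt: "finite z" "card z = n" using z by (auto simp: topspace_cset)
  define f where "f p = (SOME q. q \<in> y \<inter> ball p \<epsilon>)" for p
  have f: "f p \<in> y" "dist p (f p) < \<epsilon>" if "p \<in> z" for p
  proof -
    have "\<exists>q. q \<in> y \<inter> ball p \<epsilon>" using y that by (auto simp: nbr_def)
    from someI_ex[OF this] show "f p \<in> y" "dist p (f p) < \<epsilon>" by (auto simp: f_def)
  qed
  have far: "p = p'" if "p \<in> z" "p' \<in> z" "dist p q < \<epsilon>" "dist p' q < \<epsilon>" for p p' q
  proof (rule ccontr)
    assume "p \<noteq> p'"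
    then have "2 * \<epsilon> \<le> dist p p'" using good that by (simp add: good_radius_def)
    moreover have "dist p p' \<le> dist p q + dist p' q" using dist_triangle2 by blast
    ultimately show False using that by simp
  qed
  have injf: "inj_on f z"
  proof (rule inj_onI)
    fix p p' assume "p \<in> z" "p' \<in> z" "f p = f p'"
    then show "p = p'" using far[of p p' "f p"] f by metis
  qed
  have imf: "f ` z = y"
    by (rule card_subset_eq[OF yt(1)]) (use f zt yt card_image[OF injf] in auto)
  have uniq: "q = f p" if pq: "p \<in> z" "q \<in> y" "dist p q < \<epsilon>" for p q
  proof -
    obtain p' where p': "p' \<in> z" "q = f p'" using imf pq(2) by blast
    then have "p = p'" using far[OF pq(1) p'(1) pq(3)] f[OF p'(1)] by simp
    then show ?thesis using p' by simp
  qed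
  have nf: "near_pt \<epsilon> y p = f p" if "p \<in> z" for p
    unfolding near_pt_def
  proof (rule the_equality)
    show "f p \<in> y \<inter> ball p \<epsilon>" using f[OF that] by simp
    show "q = f p" if "q \<in> y \<inter> ball p \<epsilon>" for q
      by (rule uniq) (use that \<open>p \<in> z\<close> in auto)
  qed
  show "p \<in> z ==> near_pt \<epsilon> y p \<in> y \<and> dist p (near_pt \<epsilon> y p) < \<epsilon>" using nf f by simp
  show "p \<in> z ==> q \<in> y ==> dist p q < \<epsilon> ==> q = near_pt \<epsilon> y p" using nf[of p] uniq[of p q] by simp
  show "inj_on (near_pt \<epsilon> y) z" using injf nf by (simp add: inj_on_def)
  show "near_pt \<epsilon> y ` z = y" using imf nf by simp
qed

lemma nbr_self: "z \<in> nbr n Z z \<epsilon>"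
  using z good by (auto simp: nbr_def good_radius_def)

lemma near_pt_self: "p \<in> z ==> near_pt \<epsilon> z p = p"
  using near_pt(2)[OF nbr_self, of p p] good by (simp add: good_radius_def)

text \<open>The preimage of an open \<open>V\<close> is the condition of hitting \<open>V\<close>
  within the ball, which is open.\<close>

lemma continuous_near_pt:
  assumes "p \<in> z"
  shows "continuous_map (subtopology (cset n Z) (nbr n Z z \<epsilon>)) euclidean (\<lambda>y. near_pt \<epsilon> y p)"
  unfolding continuous_map_def
proof (intro conjI allI impI)
  let ?S = "subtopology (cset n Z) (nbr n Z z \<epsilon>)"
  have top: "topspace ?S = nbr n Z z \<epsilon>" by (auto simp: nbr_def)
  fix V :: "complex set" assume "openin euclidean V"
  then have "open (V \<inter> ball p \<epsilon>)" by auto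
  have "{y \<in> topspace ?S. near_pt \<epsilon> y p \<in> V} = nbr n Z z \<epsilon> \<inter> {y \<in> topspace (cset n Z). y \<inter> (V \<inter> ball p \<epsilon>) \<noteq> {}}"
  proof (intro equalityI subsetI)
    fix y assume "y \<in> {y \<in> topspace ?S. near_pt \<epsilon> y p \<in> V}"
    then have y: "y \<in> nbr n Z z \<epsilon>" "near_pt \<epsilon> y p \<in> V" using top by auto
    then show "y \<in> nbr n Z z \<epsilon> \<inter> {y \<in> topspace (cset n Z). y \<inter> (V \<inter> ball p \<epsilon>) \<noteq> {}}"
      using near_pt(1)[OF y(1) assms] by (auto simp: nbr_def)
  next
    fix y assume "y \<in> nbr n Z z \<epsilon> \<inter> {y \<in> topspace (cset n Z). y \<inter> (V \<inter> ball p \<epsilon>) \<noteq> {}}"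
    then obtain q where y: "y \<in> nbr n Z z \<epsilon>" and q: "q \<in> y" "q \<in> V" "dist p q < \<epsilon>" by auto
    then have "q = near_pt \<epsilon> y p" using near_pt(2)[OF y assms] by simp
    then show "y \<in> {y \<in> topspace ?S. near_pt \<epsilon> y p \<in> V}" using y q top by simp
  qed
  then show "openin ?S {y \<in> topspace ?S. near_pt \<epsilon> y p \<in> V}"
    using openin_cset_hit[OF \<open>open (V \<inter> ball p \<epsilon>)\<close>, of n Z] by (auto simp: openin_subtopology)
qed auto

definition slide :: "complex set => real => complex set" where
  "slide y = (\<lambda>t. (\<lambda>p. of_real (1 - t) * near_pt \<epsilon> y p + of_real t * p) ` z)"

lemma convex_dist:
  assumes "t \<in> {0..1}"
  shows "dist p (of_real (1 - t) * q + of_real t * p) \<le> dist p (q :: complex)"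
proof -
  have "p - (of_real (1 - t) * q + of_real t * p) = of_real (1 - t) * (p - q)" by (simp add: algebra_simps)
  then have "dist p (of_real (1 - t) * q + of_real t * p) = norm (of_real (1 - t) * (p - q))"
    by (simp only: dist_norm)
  also have "\<dots> = (1 - t) * dist p q"
    using assms by (simp add: dist_norm norm_mult del: of_real_diff)
  finally have "dist p (of_real (1 - t) * q + of_real t * p) = (1 - t) * dist p q" .
  then show ?thesis using assms by (simp add: mult_left_le_one_le)
qed

lemma slide_pts:
  assumes y: "y \<in> nbr n Z z \<epsilon>" and t: "t \<in> {0..1}"
  shows "p \<in> z ==> of_real (1 - t) * near_pt \<epsilon> y p + of_real t * p \<in> Z \<inter> ball p \<epsilon>"
    "inj_on (\<lambda>p. of_real (1 - t) * near_pt \<epsilon> y p + of_real t * p) z"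
    "slide y t \<in> nbr n Z z \<epsilon>"
proof -
  let ?f = "\<lambda>p. of_real (1 - t) * near_pt \<epsilon> y p + of_real t * p"
  have yZ: "y \<subseteq> Z" using y by (auto simp: nbr_def topspace_cset)
  have in1: "?f p \<in> Z \<inter> ball p \<epsilon>" if p: "p \<in> z" for p
  proof -
    have n: "near_pt \<epsilon> y p \<in> y" "dist p (near_pt \<epsilon> y p) < \<epsilon>" using near_pt(1)[OF y p] by auto
    have "closed_segment p (near_pt \<epsilon> y p) \<subseteq> Z" using good p n yZ unfolding good_radius_def by blast
    moreover have "?f p \<in> closed_segment p (near_pt \<epsilon> y p)"
      unfolding closed_segment_def using t
      by (auto simp: scaleR_conv_of_real intro!: exI[of _ "1 - t"])
    moreover have "dist p (?f p) < \<epsilon>" using convex_dist[OF t, of p "near_pt \<epsilon> y p"] n(2) by linarith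
    ultimately show ?thesis by auto
  qed
  show "p \<in> z ==> ?f p \<in> Z \<inter> ball p \<epsilon>" by (rule in1)
  show inj: "inj_on ?f z"
  proof (rule inj_onI, rule ccontr)
    fix p q assume pq: "p \<in> z" "q \<in> z" "?f p = ?f q" "p \<noteq> q"
    have "dist p (?f p) < \<epsilon>" "dist q (?f p) < \<epsilon>" using in1[OF pq(1)] in1[OF pq(2)] pq(3) by auto
    moreover have "2 * \<epsilon> \<le> dist p q" using good pq by (simp add: good_radius_def)
    moreover have "dist p q \<le> dist p (?f p) + dist q (?f p)" using dist_triangle2 by blast
    ultimately show False by simp
  qed
  have zt: "finite z" "card z = n" using z by (auto simp: topspace_cset)
  have "slide y t \<in> topspace (cset n Z)"
    unfolding topspace_cset slide_def using in1 card_image[OF inj] zt by auto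
  moreover have "slide y t \<inter> ball p \<epsilon> \<noteq> {}" if "p \<in> z" for p
    using in1[OF that] that unfolding slide_def by blast
  ultimately show "slide y t \<in> nbr n Z z \<epsilon>" by (simp add: nbr_def)
qed

lemma slide_ends: "y \<in> nbr n Z z \<epsilon> ==> slide y 0 = y" "slide y 1 = z"
  using near_pt(4)[of y] by (auto simp: slide_def)

lemma slide_square:
  assumes P: "pathin (cset n Z) P" and PN: "\<And>t. t \<in> {0..1} ==> P t \<in> nbr n Z z \<epsilon>"
  shows "continuous_map (prod_topology unit_top unit_top) (cset n Z) (\<lambda>w. slide (P (snd w)) (fst w))"
proof -
  have zt: "finite z" "card z = n" using z by (auto simp: topspace_cset)
  obtain x where "bij_betw x {0..<card z} z" using ex_bij_betw_nat_finite[OF zt(1)] by blast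
  then have x: "bij_betw x {..<n} z" using zt(2) by (simp add: atLeast0LessThan)
  then have xz: "\<And>i. i < n ==> x i \<in> z" and xi: "x ` {..<n} = z" and xinj: "inj_on x {..<n}" by (auto simp: bij_betw_def)
  have Pc: "continuous_map unit_top (subtopology (cset n Z) (nbr n Z z \<epsilon>)) P"
    using P PN by (auto simp: pathin_def continuous_map_in_subtopology)
  have "continuous_map (prod_topology unit_top unit_top) (cset n Z)
     (\<lambda>w. (\<lambda>i. of_real (1 - fst w) * near_pt \<epsilon> (P (snd w)) (x i) + of_real (fst w) * x i) ` {..<n})"
  proof (rule continuous_map_cset)
    fix i assume i: "i < n"
    have "continuous_map unit_top euclidean ((\<lambda>y. near_pt \<epsilon> y (x i)) \<circ> P)"
      by (rule continuous_map_compose[OF Pc continuous_near_pt[OF xz[OF i]]])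
    then have c: "continuous_on {0..1} (\<lambda>t. near_pt \<epsilon> (P t) (x i))" by (simp add: o_def)
    have "continuous_on ({0..1} \<times> {0..1}) (\<lambda>w::real \<times> real. near_pt \<epsilon> (P (snd w)) (x i))"
      by (rule continuous_on_compose2[OF c]) (auto intro: continuous_intros)
    then have "continuous_on ({0..1} \<times> {0..1}) (\<lambda>w::real \<times> real. of_real (1 - fst w) * near_pt \<epsilon> (P (snd w)) (x i) + of_real (fst w) * x i)"
      by (intro continuous_intros)
    then show "continuous_map (prod_topology unit_top unit_top) euclidean (\<lambda>w. of_real (1 - fst w) * near_pt \<epsilon> (P (snd w)) (x i) + of_real (fst w) * x i)"
      by (simp add: continuous_map_unit_square)
  next
    fix i and w :: "real \<times> real" assume i: "i < n" and w: "w \<in> topspace (prod_topology unit_top unit_top)"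
    then have "P (snd w) \<in> nbr n Z z \<epsilon>" "fst w \<in> {0..1}" using PN by (auto simp: mem_Times_iff)
    from slide_pts(1)[OF this xz[OF i]]
    show "of_real (1 - fst w) * near_pt \<epsilon> (P (snd w)) (x i) + of_real (fst w) * x i \<in> Z" by simp
  next
    fix w :: "real \<times> real" assume w: "w \<in> topspace (prod_topology unit_top unit_top)"
    then have "P (snd w) \<in> nbr n Z z \<epsilon>" "fst w \<in> {0..1}" using PN by (auto simp: mem_Times_iff)
    from comp_inj_on[OF xinj, of "\<lambda>p. of_real (1 - fst w) * near_pt \<epsilon> (P (snd w)) p + of_real (fst w) * p"] slide_pts(2)[OF this]
    show "inj_on (\<lambda>i. of_real (1 - fst w) * near_pt \<epsilon> (P (snd w)) (x i) + of_real (fst w) * x i) {..<n}"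
      unfolding xi by (simp add: o_def)
  qed
  moreover have "(\<lambda>i. of_real (1 - fst w) * near_pt \<epsilon> (P (snd w)) (x i) + of_real (fst w) * x i) ` {..<n} = slide (P (snd w)) (fst w)" for w :: "real \<times> real"
  proof -
    have "(\<lambda>i. of_real (1 - fst w) * near_pt \<epsilon> (P (snd w)) (x i) + of_real (fst w) * x i) ` {..<n}
        = (\<lambda>p. of_real (1 - fst w) * near_pt \<epsilon> (P (snd w)) p + of_real (fst w) * p) ` (x ` {..<n})"
      by (simp only: image_image)
    then show ?thesis by (simp only: xi slide_def)
  qed
  ultimately show ?thesis by simp
qed

lemma pathin_slide:
  assumes "y \<in> nbr n Z z \<epsilon>"
  shows "pathin (cset n Z) (slide y)"
proof -
  have "y \<in> topspace (cset n Z)" using assms by (simp add: nbr_def)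
  then have c1: "continuous_map (prod_topology unit_top unit_top) (cset n Z) (\<lambda>w. slide y (fst w))"
    using slide_square[of "\<lambda>_. y"] assms by simp
  have c2: "continuous_map unit_top (prod_topology unit_top unit_top) (\<lambda>t. (t, 0))"
    by (intro continuous_map_pairedI) auto
  from continuous_map_compose[OF c2 c1] show ?thesis by (simp add: pathin_def o_def)
qed

text \<open>The slides along \<open>P\<close> form a square with \<open>P\<close> on one side and
  the constant \<open>z\<close> on the opposite one. Pushing \<open>P\<close> across the square
  gives the way over \<open>z\<close>.\<close>

lemma phom_slide:
  assumes P: "pathin (cset n Z) P" and PN: "\<And>t. t \<in> {0..1} ==> P t \<in> nbr n Z z \<epsilon>"
  shows "phom (cset n Z) P (path_join (slide (P 0)) (path_rev (slide (P 1))))"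
proof -
  let ?Q = "\<lambda>w. slide (P (snd w)) (fst w)"
  \<comment> \<open>The other way round the square: on [0, 1/4] the slide height \<open>c\<close>
    rises at the start of \<open>P\<close>, on [1/4, 1/2] the parameter \<open>d\<close> runs
    through \<open>P\<close> at height 1, where the slide is constantly \<open>z\<close>, and on
    [1/2, 1] the height falls again at the end of \<open>P\<close>. The times fit the nested joins
    below.\<close>
  define c where "c t = (if t \<le> 1/2 then (if t \<le> 1/4 then 4 * t else 1) else 2 - 2 * t)" for t :: real
  define d where "d t = min 1 (max 0 (4 * t - 1))" for t :: real
  have "continuous_on ({0..1/4} \<union> {1/4..1/2}) (\<lambda>t::real. if t \<le> 1/4 then 4 * t else 1)"
    by (rule continuous_on_cases_le) (auto intro!: continuous_intros)
  then have "continuous_on {t \<in> {0..1/2} \<union> {1/2..1}. t \<le> 1/2} (\<lambda>t::real. if t \<le> 1/4 then 4 * t else 1)"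
    by (elim continuous_on_subset) auto
  then have "continuous_on ({0..1/2} \<union> {1/2..1}) c"
    unfolding c_def by (intro continuous_on_cases_le) (auto intro!: continuous_intros)
  moreover have "{0..1/2} \<union> {1/2..1} = {0..1::real}" by auto
  ultimately have cc: "continuous_on {0..1} c" by simp
  have cd: "continuous_on {0..1} d" unfolding d_def by (intro continuous_intros)
  have c01: "c t \<in> {0..1}" "d t \<in> {0..1}" if "t \<in> {0..1}" for t using that by (auto simp: c_def d_def)
  let ?h = "\<lambda>w. (fst w * c (snd w), (1 - fst w) * snd w + fst w * d (snd w))"
  have "phom (cset n Z) P (\<lambda>t. ?Q (c t, d t))"
  proof (rule phomI[where h = "?Q \<circ> ?h"])
    have "continuous_on ({0..1} \<times> {0..1}) (\<lambda>w::real \<times> real. c (snd w))" "continuous_on ({0..1} \<times> {0..1}) (\<lambda>w::real \<times> real. d (snd w))"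
      by (rule continuous_on_compose2[OF cc] continuous_on_compose2[OF cd]; auto intro: continuous_intros)+
    then have "continuous_on ({0..1} \<times> {0..1}) ?h" by (intro continuous_intros)
    moreover have "?h w \<in> {0..1} \<times> {0..1}" if "w \<in> {0..1} \<times> {0..1}" for w
    proof -
      have "fst w * c (snd w) \<in> {0..1}" using that c01[of "snd w"] by (auto simp: mem_Times_iff mult_le_one)
      moreover have "(1 - fst w) * snd w + fst w * d (snd w) \<in> {0..1}"
        using convexD_alt[OF convex_real_interval(5), of "snd w" 0 1 "d (snd w)" "fst w"] that c01[of "snd w"]
        by (auto simp: mem_Times_iff)
      ultimately show ?thesis by simp
    qed
    ultimately have "continuous_map (prod_topology unit_top unit_top) (prod_topology unit_top unit_top) ?h"
      unfolding continuous_map_unit_square by (auto simp: continuous_map_in_subtopology)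
    then show "continuous_map (prod_topology unit_top unit_top) (cset n Z) (?Q \<circ> ?h)"
      using slide_square[OF P PN] by (rule continuous_map_compose)
    show "(?Q \<circ> ?h) (0, t) = P t" if "t \<in> {0..1}" for t using slide_ends(1)[OF PN[OF that]] by simp
    show "(?Q \<circ> ?h) (s, 0) = P 0" if "s \<in> {0..1}" for s
      using slide_ends(1)[OF PN[of 0]] by (simp add: c_def d_def)
    show "(?Q \<circ> ?h) (s, 1) = P 1" if "s \<in> {0..1}" for s
      using slide_ends(1)[OF PN[of 1]] by (simp add: c_def d_def algebra_simps)
  qed simp
  also have "(\<lambda>t. ?Q (c t, d t)) = path_join (path_join (slide (P 0)) (\<lambda>_. slide (P 0) 1)) (path_rev (slide (P 1)))"
  proof
    fix t :: real
    show "?Q (c t, d t) = path_join (path_join (slide (P 0)) (\<lambda>_. slide (P 0) 1)) (path_rev (slide (P 1))) t"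
    proof (cases "t \<le> 1/2")
      case True
      show ?thesis
      proof (cases "t \<le> 1/4")
        case t4: True
        then have "d t = 0" by (simp add: d_def max_absorb1)
        then show ?thesis using True t4 by (simp add: path_join_def c_def)
      next
        case False
        then show ?thesis using True slide_ends(2) by (simp add: path_join_def c_def)
      qed
    next
      case False
      then have "d t = 1" by (simp add: d_def min_def max_def)
      then show ?thesis using False by (simp add: path_join_def path_rev_def c_def algebra_simps)
    qed
  qed
  also have "phom (cset n Z) \<dots> (path_join (slide (P 0)) (path_rev (slide (P 1))))"
  proof -
    have N: "P 0 \<in> nbr n Z z \<epsilon>" "P 1 \<in> nbr n Z z \<epsilon>" using PN by auto
    show ?thesis
      using pathin_slide[OF N(1)] pathin_slide[OF N(2)] slide_ends(2)
      by (intro phom_join phom_const_right phom_refl pathin_path_rev) auto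
  qed
  finally show ?thesis .
qed

end

section \<open>Realizations of graphs in the plane\<close>

definition induced_map :: "'b topology => ('a => 'b) => 'a => (real => 'a) set => (real => 'b) set" where
  "induced_map Y f a A = loop_class Y (f a) (f \<circ> (SOME p. p \<in> A))"

lemma loops_at_compose:
  assumes "continuous_map X Y f" "p \<in> loops_at X a"
  shows "f \<circ> p \<in> loops_at Y (f a)"
  using assms(2) continuous_map_compose[OF _ assms(1), of unit_top p] by (simp add: loops_at_def pathin_def)

lemma phom_compose:
  assumes f: "continuous_map X Y f" and h: "phom X p q"
  shows "phom Y (f \<circ> p) (f \<circ> q)"
proof -
  obtain k where k: "continuous_map (prod_topology unit_top unit_top) X k" "\<And>t. k (0, t) = p t" "\<And>t. k (1, t) = q t"
    "\<And>s. s \<in> {0..1} ==> k (s, 0) = p 0" "\<And>s. s \<in> {0..1} ==> k (s, 1) = p 1"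
    using phomE[OF h] by metis
  show ?thesis by (rule phomI[OF continuous_map_compose[OF k(1) f]]) (simp_all add: k)
qed

lemma induced_map_class:
  assumes f: "continuous_map X Y f" and p: "p \<in> loops_at X a"
  shows "induced_map Y f a (loop_class X a p) = loop_class Y (f a) (f \<circ> p)"
proof -
  let ?q = "SOME q. q \<in> loop_class X a p"
  have "p \<in> loop_class X a p" using mem_loop_class[OF p] phom_refl p by (auto simp: loops_at_def)
  then have "?q \<in> loop_class X a p" by (rule someI[of "\<lambda>q. q \<in> loop_class X a p"])
  then have pq: "phom X p ?q" by (simp add: mem_loop_class[OF p])
  have "loop_class Y (f a) (f \<circ> p) = loop_class Y (f a) (f \<circ> ?q)"
    using phom_loop_class[OF loops_at_compose[OF f p] loops_at_compose[OF f loops_at_phom[OF p pq]]] phom_compose[OF f pq] by blast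
  then show ?thesis by (simp add: induced_map_def)
qed

lemma fundamental_group_homeomorphic:
  assumes h: "homeomorphic_map X Y f" and a: "a \<in> topspace X"
  shows "induced_map Y f a \<in> iso (fundamental_group X a) (fundamental_group Y (f a))"
proof -
  obtain g where "homeomorphic_maps X Y f g" using h by (auto simp: homeomorphic_map_maps)
  then have f: "continuous_map X Y f" and g: "continuous_map Y X g" and gf: "\<And>x. x \<in> topspace X ==> g (f x) = x"
    and fg: "\<And>y. y \<in> topspace Y ==> f (g y) = y" by (auto simp: homeomorphic_maps_def)
  let ?G = "fundamental_group X a" and ?H = "fundamental_group Y (f a)"
  have ga: "g (f a) = a" using gf a by simp
  have top: "p t \<in> topspace W" if "p \<in> loops_at W b" "t \<in> {0..1}" for W and p :: "real => 'z" and b t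
    using that by (auto simp: loops_at_def pathin_def continuous_map_def Pi_iff)
  have gfp: "loop_class X a (g \<circ> (f \<circ> p)) = loop_class X a p" if p: "p \<in> loops_at X a" for p
  proof -
    have l: "g \<circ> (f \<circ> p) \<in> loops_at X a" using loops_at_compose[OF g loops_at_compose[OF f p]] ga by simp
    then have "phom X (g \<circ> (f \<circ> p)) p" by (intro phom_eq) (use top[OF p] gf in \<open>auto simp: loops_at_def\<close>)
    then show ?thesis using phom_loop_class[OF l p] by simp
  qed
  have fgp: "loop_class Y (f a) (f \<circ> (g \<circ> p)) = loop_class Y (f a) p" if p: "p \<in> loops_at Y (f a)" for p
  proof -
    have "g \<circ> p \<in> loops_at X a" using loops_at_compose[OF g p] ga by simp
    then have l: "f \<circ> (g \<circ> p) \<in> loops_at Y (f a)" by (rule loops_at_compose[OF f])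
    then have "phom Y (f \<circ> (g \<circ> p)) p" by (intro phom_eq) (use top[OF p] fg in \<open>auto simp: loops_at_def\<close>)
    then show ?thesis using phom_loop_class[OF l p] by simp
  qed
  note F = induced_map_class[OF f]
  have c: "induced_map Y f a x \<in> carrier ?H" if "x \<in> carrier ?G" for x
    using that F loops_at_compose[OF f] by (auto simp: fundamental_group_simps)
  have "induced_map Y f a \<in> hom ?G ?H"
  proof (rule homI[OF c])
    fix x y assume "x \<in> carrier ?G" "y \<in> carrier ?G"
    then obtain p q where p: "p \<in> loops_at X a" "x = loop_class X a p" and q: "q \<in> loops_at X a" "y = loop_class X a q"
      by (auto simp: fundamental_group_simps)
    have "f \<circ> path_join p q = path_join (f \<circ> p) (f \<circ> q)" by (auto simp: path_join_def)
    then show "induced_map Y f a (x \<otimes>\<^bsub>?G\<^esub> y) = induced_map Y f a x \<otimes>\<^bsub>?H\<^esub> induced_map Y f a y"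
      using F[OF p(1)] F[OF q(1)] F[OF loops_at_join[OF p(1) q(1)]] loops_at_compose[OF f p(1)] loops_at_compose[OF f q(1)]
      by (simp add: p(2) q(2) fundamental_group_mult p(1) q(1))
  qed
  moreover have "bij_betw (induced_map Y f a) (carrier ?G) (carrier ?H)"
  proof (rule bij_betw_byWitness[where f' = "induced_map X g (f a)"])
    note K = induced_map_class[OF g, unfolded ga]
    show "\<forall>x\<in>carrier ?G. induced_map X g (f a) (induced_map Y f a x) = x"
    proof
      fix x assume "x \<in> carrier ?G"
      then obtain p where p: "p \<in> loops_at X a" "x = loop_class X a p" by (auto simp: fundamental_group_simps)
      show "induced_map X g (f a) (induced_map Y f a x) = x"
        unfolding p(2) F[OF p(1)] induced_map_class[OF g loops_at_compose[OF f p(1)]] ga by (rule gfp[OF p(1)])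
    qed
    show "\<forall>y\<in>carrier ?H. induced_map Y f a (induced_map X g (f a) y) = y"
    proof
      fix y assume "y \<in> carrier ?H"
      then obtain p where p: "p \<in> loops_at Y (f a)" "y = loop_class Y (f a) p" by (auto simp: fundamental_group_simps)
      have l: "g \<circ> p \<in> loops_at X a" using loops_at_compose[OF g p(1)] ga by simp
      show "induced_map Y f a (induced_map X g (f a) y) = y"
        unfolding p(2) induced_map_class[OF g p(1)] ga F[OF l] by (rule fgp[OF p(1)])
    qed
    show "induced_map Y f a ` carrier ?G \<subseteq> carrier ?H" using c by blast
    show "induced_map X g (f a) ` carrier ?H \<subseteq> carrier ?G"
    proof
      fix x assume "x \<in> induced_map X g (f a) ` carrier ?H"
      then obtain p where p: "p \<in> loops_at Y (f a)" "x = induced_map X g (f a) (loop_class Y (f a) p)" by (auto simp: fundamental_group_simps)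
      have "x = loop_class X a (g \<circ> p)" using induced_map_class[OF g p(1)] ga p(2) by simp
      moreover have "g \<circ> p \<in> loops_at X a" using loops_at_compose[OF g p(1)] ga by simp
      ultimately show "x \<in> carrier ?G" by (simp add: fundamental_group_simps)
    qed
  qed
  ultimately show ?thesis by (simp add: iso_def)
qed

section \<open>Configuration spaces of homeomorphic spaces\<close>

lemma conf_space_continuous_map:
  assumes f: "continuous_map X Y f" and inj: "inj_on f (topspace X)"
  shows "continuous_map (conf_space n X) (conf_space n Y) (\<lambda>x. restrict (f \<circ> x) {..<n})"
proof -
  have "continuous_map (conf_space n X) (product_topology (\<lambda>_. Y) {..<n}) (\<lambda>x. restrict (f \<circ> x) {..<n})"
  proof (subst continuous_map_componentwise, intro conjI ballI)
    fix i assume i: "i \<in> {..<n}"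
    have "continuous_map (conf_space n X) X (\<lambda>x. x i)"
      unfolding conf_space_def using i by (intro continuous_map_from_subtopology continuous_map_product_projection)
    from continuous_map_compose[OF this f] show "continuous_map (conf_space n X) Y (\<lambda>x. restrict (f \<circ> x) {..<n} i)"
      using i by (simp add: o_def)
  qed auto
  moreover have "inj_on (restrict (f \<circ> x) {..<n}) {..<n}" if "x \<in> topspace (conf_space n X)" for x
  proof -
    have "inj_on x {..<n}" "x ` {..<n} \<subseteq> topspace X" using that by (auto simp: topspace_conf_space PiE_iff)
    then have "inj_on (f \<circ> x) {..<n}" using inj by (meson comp_inj_on inj_on_subset)
    then show ?thesis by (simp add: inj_on_def)
  qed
  ultimately show ?thesis by (auto simp: conf_space_def[of n Y] continuous_map_in_subtopology)
qed

lemma perm_orbit_image: "y \<in> perm_orbit n x ==> y ` {..<n} = x ` {..<n}"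
proof -
  assume "y \<in> perm_orbit n x"
  then obtain \<sigma> where "y = x \<circ> \<sigma>" "\<sigma> permutes {..<n}" by (auto simp: perm_orbit_def)
  then show ?thesis by (simp only: image_comp[symmetric] permutes_image)
qed

lemma self_in_perm_orbit: "x \<in> perm_orbit n x"
  unfolding perm_orbit_def by (rule CollectI, rule exI[of _ id]) (simp add: permutes_id)

lemma perm_orbit_eq:
  assumes x: "x \<in> topspace (conf_space n X)" "y \<in> topspace (conf_space n X)" and e: "x ` {..<n} = y ` {..<n}"
  shows "perm_orbit n x = perm_orbit n y"
proof -
  have sub: "perm_orbit n y \<subseteq> perm_orbit n x"
    if x: "x \<in> topspace (conf_space n X)" "y \<in> topspace (conf_space n X)" and e: "x ` {..<n} = y ` {..<n}" for x y
  proof -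
    have inj: "inj_on x {..<n}" "inj_on y {..<n}" and ext: "x \<in> extensional {..<n}" "y \<in> extensional {..<n}"
      using x by (auto simp: topspace_conf_space PiE_iff)
    \<comment> \<open>The permutation that carries the numbering \<open>x\<close> of the common
      image set into the numbering \<open>y\<close>, extended by the identity.\<close>
    define \<sigma> where "\<sigma> i = (if i < n then inv_into {..<n} x (y i) else i)" for i
    have s: "\<sigma> i < n \<and> x (\<sigma> i) = y i" if "i < n" for i
    proof -
      have "y i \<in> x ` {..<n}" using e that by auto
      then show ?thesis using inv_into_into[of "y i" x "{..<n}"] f_inv_into_f[of "y i" x "{..<n}"] that by (simp add: \<sigma>_def)
    qed
    have "inj_on \<sigma> {..<n}"
    proof (rule inj_onI)
      fix i j assume "i \<in> {..<n}" "j \<in> {..<n}" "\<sigma> i = \<sigma> j"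
      then show "i = j" using s[of i] s[of j] inj(2) by (metis inj_onD lessThan_iff)
    qed
    moreover have "\<sigma> ` {..<n} \<subseteq> {..<n}" using s by auto
    ultimately have "bij_betw \<sigma> {..<n} {..<n}" by (simp add: bij_betw_def endo_inj_surj)
    then have p: "\<sigma> permutes {..<n}" by (rule bij_imp_permutes) (simp add: \<sigma>_def)
    have "y = x \<circ> \<sigma>"
    proof
      fix i show "y i = (x \<circ> \<sigma>) i"
        using s[of i] ext by (cases "i < n") (auto simp: \<sigma>_def extensional_def)
    qed
    then have "y \<circ> \<rho> = x \<circ> (\<sigma> \<circ> \<rho>)" for \<rho> by (simp add: o_assoc)
    then show ?thesis unfolding perm_orbit_def using permutes_compose[OF _ p] by blast
  qed
  show ?thesis using sub[OF x e] sub[OF x(2,1) e[symmetric]] by blast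
qed

definition orbit_set :: "nat => ('a => complex) => (nat => 'a) set => complex set" where
  "orbit_set n h S = (\<Union>x\<in>S. h ` x ` {..<n})"

text \<open>Both spaces are quotients of homeomorphic spaces of ordered configurations, and two
  injective tuples lie in one orbit exactly if they have the same image.\<close>

lemma homeomorphic_map_orbit_set:
  assumes h: "homeomorphic_map T (top_of_set Z) h"
  shows "homeomorphic_map (uconf_space n T) (cset n Z) (orbit_set n h)"
proof -
  obtain k where hk: "homeomorphic_maps T (top_of_set Z) h k" using h by (auto simp: homeomorphic_map_maps)
  then have c: "continuous_map T (top_of_set Z) h" "continuous_map (top_of_set Z) T k"
    and kh: "\<And>x. x \<in> topspace T ==> k (h x) = x" and hkz: "\<And>z. z \<in> Z ==> h (k z) = z"
    by (auto simp: homeomorphic_maps_def)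
  have inj: "inj_on h (topspace T)" "inj_on k Z" using kh hkz by (auto intro: inj_on_inverseI)
  have o: "orbit_set n h (perm_orbit n x) = h ` x ` {..<n}" for x
    unfolding orbit_set_def using perm_orbit_image self_in_perm_orbit by blast
  let ?f = "\<lambda>x. restrict (h \<circ> x) {..<n}" and ?g = "\<lambda>x. restrict (k \<circ> x) {..<n}"
  have "homeomorphic_maps (conf_space n T) (conf_space n (top_of_set Z)) ?f ?g"
    unfolding homeomorphic_maps_def
  proof (intro conjI ballI)
    show "continuous_map (conf_space n T) (conf_space n (top_of_set Z)) ?f" by (rule conf_space_continuous_map[OF c(1) inj(1)])
    show "continuous_map (conf_space n (top_of_set Z)) (conf_space n T) ?g" by (rule conf_space_continuous_map[OF c(2)]) (simp add: inj)
    show "?g (?f x) = x" if "x \<in> topspace (conf_space n T)" for x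
    proof
      fix i show "?g (?f x) i = x i" using that kh by (cases "i < n") (auto simp: topspace_conf_space PiE_iff extensional_def)
    qed
    show "?f (?g x) = x" if "x \<in> topspace (conf_space n (top_of_set Z))" for x
    proof
      fix i show "?f (?g x) i = x i" using that hkz by (cases "i < n") (auto simp: topspace_conf_space PiE_iff extensional_def)
    qed
  qed
  then have "quotient_map (conf_space n T) (conf_space n (top_of_set Z)) ?f"
    using homeomorphic_map_maps homeomorphic_map_def by blast
  then have "quotient_map (conf_space n T) (cset n Z) ((\<lambda>x. x ` {..<n}) \<circ> ?f)"
    by (rule quotient_map_compose[OF _ quotient_map_cset])
  moreover have "(\<lambda>x. x ` {..<n}) \<circ> ?f = orbit_set n h \<circ> perm_orbit n"
    by (rule ext) (simp add: o image_image)
  ultimately have "quotient_map (uconf_space n T) (cset n Z) (orbit_set n h)"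
    using quotient_map_compose_eq[OF quotient_map_quotient_topology] unfolding uconf_space_def by metis
  moreover have "inj_on (orbit_set n h) (topspace (uconf_space n T))"
  proof (rule inj_onI)
    fix S S' assume "S \<in> topspace (uconf_space n T)" "S' \<in> topspace (uconf_space n T)" and e: "orbit_set n h S = orbit_set n h S'"
    then obtain x y where x: "x \<in> topspace (conf_space n T)" "S = perm_orbit n x" and y: "y \<in> topspace (conf_space n T)" "S' = perm_orbit n y"
      by (auto simp: uconf_space_def topspace_quotient_topology)
    have s: "x ` {..<n} \<subseteq> topspace T" "y ` {..<n} \<subseteq> topspace T" using x(1) y(1) by (auto simp: topspace_conf_space PiE_iff)
    have "h ` x ` {..<n} = h ` y ` {..<n}" using e unfolding x(2) y(2) o .
    then have "x ` {..<n} = y ` {..<n}" by (simp only: inj_on_image_eq_iff[OF inj(1) s])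
    then show "S = S'" unfolding x(2) y(2) by (rule perm_orbit_eq[OF x(1) y(1)])
  qed
  ultimately show ?thesis by (simp add: homeomorphic_map_def)
qed

section \<open>Straight-line drawings of graphs\<close>

definition draw :: "('v, 'e) pre_digraph => ('v => complex) => ('v, 'e) graph_point => complex" where
  "draw \<Gamma> pos x = (case x of Vertex v => pos v | Inner e t => linepath (pos (tail \<Gamma> e)) (pos (head \<Gamma> e)) t)"

lemma draw_char_map: "draw \<Gamma> pos (char_map \<Gamma> e t) = linepath (pos (tail \<Gamma> e)) (pos (head \<Gamma> e)) t"
  by (simp add: draw_def char_map_def linepath_def)

lemma linepath_image_segment: "linepath x y ` {0..1} = closed_segment x (y :: complex)"
  using path_image_linepath[of x y] by (simp add: path_image_def)

lemma compact_realization: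
  assumes "finite (verts \<Gamma>)" "finite (arcs \<Gamma>)"
  shows "compact_space (realization \<Gamma>)"
proof -
  have v: "compactin (realization \<Gamma>) (Vertex ` verts \<Gamma>)"
    using assms(1) by (intro finite_imp_compactin) (auto simp: topspace_realization graph_points_def)
  have e: "compactin (realization \<Gamma>) (char_map \<Gamma> e ` {0..1})" if e: "e \<in> arcs \<Gamma>" for e
  proof (rule image_compactin[of "top_of_set {0..1}"])
    show "compactin (top_of_set {0..1::real}) {0..1}" by (simp add: compactin_subtopology compactin_euclidean_iff)
    show "continuous_map (top_of_set {0..1}) (realization \<Gamma>) (char_map \<Gamma> e)"
      using e by (auto simp: continuous_map_def openin_realization topspace_realization graph_points_def)
  qed
  have "compactin (realization \<Gamma>) (\<Union>((\<lambda>e. char_map \<Gamma> e ` {0..1}) ` arcs \<Gamma>))"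
    using assms(2) e by (intro compactin_Union) auto
  then have "compactin (realization \<Gamma>) (graph_points \<Gamma>)" unfolding graph_points_def by (rule compactin_Un[OF v])
  then show ?thesis by (simp add: compact_space_def topspace_realization)
qed

definition drawing :: "('v, 'e) pre_digraph => ('v => complex) => complex set" where
  "drawing \<Gamma> pos = pos ` verts \<Gamma> \<union> (\<Union>e\<in>arcs \<Gamma>. closed_segment (pos (tail \<Gamma> e)) (pos (head \<Gamma> e)))"

text \<open>A continuous injection of a compact space into a Hausdorff space is a homeomorphism onto
  its image. The assumptions say that vertices and open arcs do not meet in the drawing.\<close>

lemma draw_homeomorphic:
  assumes wf: "wf_digraph \<Gamma>" and fin: "finite (verts \<Gamma>)" "finite (arcs \<Gamma>)"
    and v: "inj_on pos (verts \<Gamma>)"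
    and ve: "\<And>v e t. v \<in> verts \<Gamma> ==> e \<in> arcs \<Gamma> ==> 0 < t ==> t < 1 ==> pos v \<noteq> linepath (pos (tail \<Gamma> e)) (pos (head \<Gamma> e)) t"
    and ee: "\<And>e e' s t. e \<in> arcs \<Gamma> ==> e' \<in> arcs \<Gamma> ==> 0 < s ==> s < 1 ==> 0 < t ==> t < 1 ==>
      linepath (pos (tail \<Gamma> e)) (pos (head \<Gamma> e)) s = linepath (pos (tail \<Gamma> e')) (pos (head \<Gamma> e')) t ==> e = e' \<and> s = t"
  shows "homeomorphic_map (realization \<Gamma>) (top_of_set (drawing \<Gamma> pos)) (draw \<Gamma> pos)"
proof -
  have pts: "x \<in> Vertex ` verts \<Gamma> \<or> (\<exists>e t. e \<in> arcs \<Gamma> \<and> 0 < t \<and> t < 1 \<and> x = Inner e t)" if x: "x \<in> graph_points \<Gamma>" for x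
  proof (cases "x \<in> Vertex ` verts \<Gamma>")
    case False
    then obtain e t where e: "e \<in> arcs \<Gamma>" "0 \<le> t" "t \<le> 1" "x = char_map \<Gamma> e t" using x by (auto simp: graph_points_def)
    have "tail \<Gamma> e \<in> verts \<Gamma>" "head \<Gamma> e \<in> verts \<Gamma>" using wf e(1) by (auto simp: wf_digraph_def)
    then have "t \<noteq> 0" "t \<noteq> 1" using False e by (auto simp: char_map_def)
    then show ?thesis using e by (auto simp: char_map_def)
  qed simp
  have inj: "inj_on (draw \<Gamma> pos) (graph_points \<Gamma>)"
  proof (rule inj_onI)
    fix x y assume xy: "x \<in> graph_points \<Gamma>" "y \<in> graph_points \<Gamma>" "draw \<Gamma> pos x = draw \<Gamma> pos y"
    show "x = y"
    proof (cases x)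
      case x: (Vertex w)
      then have w: "w \<in> verts \<Gamma>" using pts[OF xy(1)] by auto
      show ?thesis
      proof (cases y)
        case y: (Vertex w')
        then have "w' \<in> verts \<Gamma>" using pts[OF xy(2)] by auto
        then show ?thesis using inj_onD[OF v _ w] xy(3) x y by (simp add: draw_def)
      next
        case y: (Inner e t)
        then show ?thesis using ve[OF w, of e t] pts[OF xy(2)] xy(3) x by (auto simp: draw_def)
      qed
    next
      case x: (Inner e t)
      then have e: "e \<in> arcs \<Gamma>" "0 < t" "t < 1" using pts[OF xy(1)] by auto
      show ?thesis
      proof (cases y)
        case y: (Vertex w')
        then have "w' \<in> verts \<Gamma>" using pts[OF xy(2)] by auto
        then show ?thesis using ve[OF _ e, of w'] xy(3) x y by (simp add: draw_def)
      next
        case y: (Inner e' t')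
        then have e': "e' \<in> arcs \<Gamma>" "0 < t'" "t' < 1" using pts[OF xy(2)] by auto
        then show ?thesis using ee[OF e(1) e'(1) e(2,3) e'(2,3)] xy(3) x y by (simp add: draw_def)
      qed
    qed
  qed
  have img: "draw \<Gamma> pos ` graph_points \<Gamma> = drawing \<Gamma> pos"
  proof -
    have "draw \<Gamma> pos ` Vertex ` verts \<Gamma> = pos ` verts \<Gamma>" by (auto simp: draw_def image_image)
    moreover have "draw \<Gamma> pos ` char_map \<Gamma> e ` {0..1} = closed_segment (pos (tail \<Gamma> e)) (pos (head \<Gamma> e))" for e
      by (simp add: image_image draw_char_map linepath_image_segment)
    ultimately show ?thesis by (simp add: graph_points_def drawing_def image_Un image_UN)
  qed
  have "continuous_map (realization \<Gamma>) euclidean (draw \<Gamma> pos)"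
    unfolding continuous_map_def
  proof (intro conjI allI impI)
    fix U :: "complex set" assume U: "openin euclidean U"
    show "openin (realization \<Gamma>) {x \<in> topspace (realization \<Gamma>). draw \<Gamma> pos x \<in> U}"
      unfolding openin_realization topspace_realization
    proof (intro conjI ballI)
      fix e assume e: "e \<in> arcs \<Gamma>"
      have cg: "char_map \<Gamma> e t \<in> graph_points \<Gamma>" if "t \<in> {0..1}" for t using e that unfolding graph_points_def by blast
      have "{t \<in> {0..1}. char_map \<Gamma> e t \<in> {x \<in> graph_points \<Gamma>. draw \<Gamma> pos x \<in> U}} = {t \<in> {0..1}. linepath (pos (tail \<Gamma> e)) (pos (head \<Gamma> e)) t \<in> U}"
        using cg by (auto simp: draw_char_map)
      moreover have "openin (top_of_set {0..1}) ({0..1} \<inter> linepath (pos (tail \<Gamma> e)) (pos (head \<Gamma> e)) -` U)"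
        by (rule continuous_openin_preimage_gen[OF continuous_on_linepath]) (use U in \<open>simp only: open_openin\<close>)
      moreover have "{0..1} \<inter> linepath (pos (tail \<Gamma> e)) (pos (head \<Gamma> e)) -` U = {t \<in> {0..1}. linepath (pos (tail \<Gamma> e)) (pos (head \<Gamma> e)) t \<in> U}" by auto
      ultimately show "openin (top_of_set {0..1}) {t \<in> {0..1}. char_map \<Gamma> e t \<in> {x \<in> graph_points \<Gamma>. draw \<Gamma> pos x \<in> U}}" by simp
    qed auto
  qed auto
  then have c: "continuous_map (realization \<Gamma>) (top_of_set (drawing \<Gamma> pos)) (draw \<Gamma> pos)"
    using img by (auto simp: continuous_map_in_subtopology topspace_realization)
  have "closed_map (realization \<Gamma>) (top_of_set (drawing \<Gamma> pos)) (draw \<Gamma> pos)"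
    by (rule continuous_imp_closed_map_gen[OF compact_realization[OF fin] _ c]) (simp add: Hausdorff_imp_kc_space Hausdorff_space_subtopology)
  then show ?thesis
    using bijective_closed_imp_homeomorphic_map[OF c] img inj by (simp add: topspace_realization)
qed

text \<open>The pieces that miss \<open>p\<close> are closed and finitely many, so a small ball
  avoids them; a point in the ball shares a convex piece with \<open>p\<close>.\<close>

lemma locally_starlike_Union:
  assumes "finite \<F>" and F: "\<And>C. C \<in> \<F> ==> closed C \<and> convex C"
  shows "locally_starlike (\<Union>\<F>)"
  unfolding locally_starlike_def
proof
  fix p assume "p \<in> \<Union>\<F>"
  let ?U = "- \<Union>{C \<in> \<F>. p \<notin> C}"
  have "open ?U" using assms by (intro open_Compl closed_Union) auto
  then obtain e where e: "e > 0" "\<And>q. dist q p < e ==> q \<in> ?U" unfolding open_dist by (metis (no_types, lifting) ComplI UnionE mem_Collect_eq)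
  show "\<exists>\<epsilon>>0. \<forall>q\<in>\<Union>\<F>. dist p q < \<epsilon> --> closed_segment p q \<subseteq> \<Union>\<F>"
  proof (intro exI[of _ e] conjI ballI impI e(1))
    fix q assume "q \<in> \<Union>\<F>" "dist p q < e"
    then obtain C where C: "C \<in> \<F>" "q \<in> C" "p \<in> C" using e(2)[of q] by (auto simp: dist_commute)
    then have "closed_segment p q \<subseteq> C" using F[OF C(1)] by (simp add: closed_segment_subset)
    then show "closed_segment p q \<subseteq> \<Union>\<F>" using C(1) by blast
  qed
qed

lemma locally_starlike_drawing:
  assumes "finite (verts \<Gamma>)" "finite (arcs \<Gamma>)"
  shows "locally_starlike (drawing \<Gamma> pos)"
proof -
  have "drawing \<Gamma> pos = \<Union>((\<lambda>v. {pos v}) ` verts \<Gamma> \<union> (\<lambda>e. closed_segment (pos (tail \<Gamma> e)) (pos (head \<Gamma> e))) ` arcs \<Gamma>)"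
    by (auto simp: drawing_def)
  moreover have "locally_starlike (\<Union>((\<lambda>v. {pos v}) ` verts \<Gamma> \<union> (\<lambda>e. closed_segment (pos (tail \<Gamma> e)) (pos (head \<Gamma> e))) ` arcs \<Gamma>))"
    by (rule locally_starlike_Union) (use assms in auto)
  ultimately show ?thesis by simp
qed

section \<open>Enumeration by a real key\<close>

text \<open>The increasing enumeration by a key gives an unordered configuration a canonical
  numbering, so that two configurations determine a motion.\<close>

definition enum :: "(complex => real) => complex set => nat => complex" where
  "enum k y i = the_inv_into y k (sorted_list_of_set (k ` y) ! i)"

context
  fixes k :: "complex => real" and y :: "complex set"
  assumes fin: "finite y" and inj: "inj_on k y"
begin

lemma enum_key: "i < card y ==> enum k y i \<in> y \<and> k (enum k y i) = sorted_list_of_set (k ` y) ! i"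
proof -
  assume i: "i < card y"
  have "length (sorted_list_of_set (k ` y)) = card y" by (simp add: card_image[OF inj])
  then have "sorted_list_of_set (k ` y) ! i \<in> k ` y"
    using i fin by (metis finite_imageI nth_mem set_sorted_list_of_set)
  then show ?thesis unfolding enum_def
    using the_inv_into_into[OF inj _ order_refl] f_the_inv_into_f[OF inj] by blast
qed

lemma enum_mem: "i < card y ==> enum k y i \<in> y"
  using enum_key by blast

lemma enum_less: "i < j ==> j < card y ==> k (enum k y i) < k (enum k y j)"
  using enum_key[of i] enum_key[of j] sorted_wrt_nth_less[of "(<)" "sorted_list_of_set (k ` y)" i j]
  by (simp add: card_image[OF inj])

lemma enum_inj: "inj_on (enum k y) {..<card y}"
  by (rule linorder_inj_onI) (use enum_less in fastforce)+

lemma enum_image: "enum k y ` {..<card y} = y"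
  by (rule card_subset_eq[OF fin]) (use enum_mem card_image[OF enum_inj] in auto)

lemma enum_unique:
  assumes x: "\<And>i. i < card y ==> x i \<in> y" and less: "\<And>i j. i < j ==> j < card y ==> k (x i) < k (x j)"
    and i: "i < card y"
  shows "x i = enum k y i"
proof -
  let ?xs = "map (\<lambda>i. k (x i)) [0..<card y]"
  have "inj_on x {..<card y}"
    by (rule linorder_inj_onI) (use less in fastforce)+
  then have xy: "x ` {..<card y} = y"
    by (intro card_subset_eq[OF fin]) (use x card_image[of x "{..<card y}"] in auto)
  have "sorted_wrt (<) ?xs" by (auto simp: sorted_wrt_iff_nth_less intro: less)
  moreover have "set ?xs = set (sorted_list_of_set (k ` y))"
  proof -
    have "set ?xs = k ` x ` {..<card y}" by (simp add: image_image atLeast0LessThan)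
    then show ?thesis using fin by (simp add: xy)
  qed
  ultimately have "?xs = sorted_list_of_set (k ` y)" by (intro strict_sorted_equal) auto
  then have "k (x i) = k (enum k y i)" using enum_key[OF i] i by (metis add_0 diff_zero length_upt nth_map nth_upt)
  then show ?thesis using inj x[OF i] enum_mem[OF i] by (auto dest: inj_onD)
qed

text \<open>A property inherited by smaller keys holds on an initial segment of the enumeration, and
  the length of the segment is a count.\<close>

lemma enum_rank:
  assumes down: "\<And>p q. p \<in> y ==> q \<in> y ==> k p < k q ==> P q ==> P p" and i: "i < card y"
  shows "P (enum k y i) \<longleftrightarrow> i < card {p \<in> y. P p}"
proof -
  let ?S = "{j. j < card y \<and> P (enum k y j)}"
  have "bij_betw (enum k y) ?S {p \<in> y. P p}"
    unfolding bij_betw_def using enum_inj enum_image enum_mem by (auto simp: inj_on_def)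
  then have c: "card ?S = card {p \<in> y. P p}" by (rule bij_betw_same_card)
  have dn: "P (enum k y j)" if "j \<le> l" "l < card y" "P (enum k y l)" for j l
    using that down[of "enum k y j" "enum k y l"] enum_less[of j l] enum_mem by (cases "j = l") auto
  show ?thesis
  proof
    assume P: "P (enum k y i)"
    then have "{..i} \<subseteq> ?S" using dn i by auto
    then have "card {..i} \<le> card ?S" by (intro card_mono) auto
    then show "i < card {p \<in> y. P p}" using c by simp
  next
    assume lt: "i < card {p \<in> y. P p}"
    show "P (enum k y i)"
    proof (rule ccontr)
      assume n: "\<not> P (enum k y i)"
      then have "?S \<subseteq> {..<i}" using dn i by (metis (mono_tags, lifting) lessThan_iff linorder_not_less mem_Collect_eq subsetI)
      then have "card ?S \<le> i" using card_mono[of "{..<i}" ?S] by simp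
      then show False using lt c by simp
    qed
  qed
qed

end

lemma enum_cong:
  assumes "\<And>p. p \<in> y ==> k p = k' p" "finite y" "inj_on k y" "i < card y"
  shows "enum k y i = enum k' y i"
proof -
  have inj': "inj_on k' y" using assms by (metis inj_on_cong)
  show ?thesis
    by (rule enum_unique[OF assms(2) inj'])
       (use enum_mem[OF assms(2,3)] enum_less[OF assms(2,3)] assms in fastforce)+
qed

lemma enum_insert:
  assumes fin: "finite y" and inj: "inj_on k (insert w y)" and w: "w \<notin> y" and i: "i < Suc (card y)"
    and r: "r = card {p \<in> y. k p < k w}"
  shows "enum k (insert w y) i = (if i < r then enum k y i else if i = r then w else enum k y (i - 1))"
proof -
  have injy: "inj_on k y" using inj by simp
  have ry: "r \<le> card y" unfolding r by (rule card_mono) (use fin in auto)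
  have rank: "k (enum k y j) < k w \<longleftrightarrow> j < r" if "j < card y" for j
    unfolding r by (rule enum_rank[OF fin injy]) (use that in auto)
  have gt: "k w < k (enum k y j)" if "j < card y" "r \<le> j" for j
  proof -
    have "enum k y j \<in> y" using enum_mem[OF fin injy] that by blast
    then have "k (enum k y j) \<noteq> k w" using inj w by (auto simp: inj_on_def)
    then show ?thesis using rank[OF that(1)] that(2) by linarith
  qed
  let ?x = "\<lambda>i. if i < r then enum k y i else if i = r then w else enum k y (i - 1)"
  have c: "card (insert w y) = Suc (card y)" using fin w by simp
  have "?x i = enum k (insert w y) i"
  proof (rule enum_unique)
    show "finite (insert w y)" "inj_on k (insert w y)" "i < card (insert w y)" using fin inj i c by auto
    show "?x j \<in> insert w y" if "j < card (insert w y)" for j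
      using that c ry enum_mem[OF fin injy] by auto
    fix j l assume jl: "j < l" "l < card (insert w y)"
    consider "l < r" | "l = r" | "j < r" "r < l" | "j = r" | "r < j" using jl(1) by linarith
    then show "k (?x j) < k (?x l)"
    proof cases
      case 1 then show ?thesis using jl ry enum_less[OF fin injy, of j l] by simp
    next
      case 2 then show ?thesis using jl ry rank[of j] by simp
    next
      case 3 then show ?thesis using jl c enum_less[OF fin injy, of j "l - 1"] by auto
    next
      case 4 then show ?thesis using jl c gt[of "l - 1"] by auto
    next
      case 5 then show ?thesis using jl c enum_less[OF fin injy, of "j - 1" "l - 1"] by auto
    qed
  qed
  then show ?thesis by simp
qed

text \<open>A particle that rests at \<open>w\<close> and has the same rank on both sides does not
  influence how the others are matched. This allows its key to be changed without changing the
  motion.\<close>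

lemma motion_insert:
  assumes y: "finite y" "finite y'" "card y = m" "card y' = m" and w: "w \<notin> y" "w \<notin> y'"
    and inj: "inj_on k (insert w y)" "inj_on k' (insert w y')"
    and rank: "card {p \<in> y. k p < k w} = card {p \<in> y'. k' p < k' w}"
  shows "motion (Suc m) (enum k (insert w y)) (enum k' (insert w y')) t = insert w (motion m (enum k y) (enum k' y') t)"
proof -
  define r where "r = card {p \<in> y. k p < k w}"
  have r': "r = card {p \<in> y'. k' p < k' w}" using rank by (simp add: r_def)
  have rm: "r \<le> m" unfolding r_def y(3)[symmetric] by (rule card_mono) (use y in auto)
  let ?f = "\<lambda>i. of_real (1 - t) * enum k (insert w y) i + of_real t * enum k' (insert w y') i"
  let ?g = "\<lambda>i. of_real (1 - t) * enum k y i + of_real t * enum k' y' i"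
  have f: "?f i = (if i < r then ?g i else if i = r then w else ?g (i - 1))" if "i < Suc m" for i
    using enum_insert[OF y(1) inj(1) w(1), of i r] enum_insert[OF y(2) inj(2) w(2), of i r] that y r' r_def
    by (auto simp: algebra_simps)
  have "?f ` {..<Suc m} = insert w (?g ` {..<m})"
  proof (intro equalityI subsetI)
    fix p assume "p \<in> ?f ` {..<Suc m}"
    then obtain i where i: "i < Suc m" "p = ?f i" by blast
    consider "i < r" | "i = r" | "r < i" by linarith
    then show "p \<in> insert w (?g ` {..<m})"
    proof cases
      case 1
      then have "p = ?g i" "i < m" using f[OF i(1)] i rm by auto
      then show ?thesis by blast
    next
      case 2
      then show ?thesis using f[OF i(1)] i by simp
    next
      case 3
      then have "p = ?g (i - 1)" "i - 1 < m" using f[OF i(1)] i by auto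
      then show ?thesis by blast
    qed
  next
    fix p assume "p \<in> insert w (?g ` {..<m})"
    then consider "p = w" | i where "i < m" "p = ?g i" by blast
    then show "p \<in> ?f ` {..<Suc m}"
    proof cases
      case 1
      then have "p = ?f r" using f[of r] rm by simp
      then show ?thesis using rm by auto
    next
      case (2 i)
      show ?thesis
      proof (cases "i < r")
        case True
        then have "p = ?f i" "i < Suc m" using f[of i] 2 by auto
        then show ?thesis by blast
      next
        case False
        then have "p = ?f (Suc i)" "Suc i < Suc m" using f[of "Suc i"] 2 by auto
        then show ?thesis by blast
      qed
    qed
  qed
  then show ?thesis by (simp only: motion_def)
qed

section \<open>Configurations on a comb\<close>

text \<open>
  The comb consists of a spine on the real axis and of prongs standing on the points 0 and 1.
  A particle at the foot 0 (or 1) of a prong counts as a spine particle unless the flag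
  \<open>A\<close> (or \<open>B\<close>) is set.
\<close>

definition lab :: "bool => bool => complex => nat" where
  "lab A B p = (if Im p > 0 then (if Re p = 0 then 1 else 2) else if A \<and> p = 0 then 1
     else if B \<and> p = 1 then 2 else 0)"

text \<open>The factor 10 separates the labels: spine keys lie in [-3, 3], prong keys in [9, 10] and
  [19, 20]. The spine is read from left to right and a prong from the tip down, so that a flagged
  foot particle is the last one on its prong.\<close>

definition key :: "bool => bool => complex => real" where
  "key A B p = 10 * real (lab A B p) + (if lab A B p = 0 then Re p else - Im p)"

text \<open>Letters for the arcs of the comb: a and d for the prongs over 0 and 1, b and e for the
  outer halves of the spine to the left of 0 and to the right of 1. Particles on the feet and
  between the feet are counted by none of the four.\<close>

definition na where "na y = card {p \<in> y. Im p > 0 \<and> Re p = 0}"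
definition nd where "nd y = card {p \<in> y. Im p > 0 \<and> Re p \<noteq> 0}"
definition nb where "nb y = card {p \<in> y. Im p = 0 \<and> Re p < 0}"
definition ne where "ne y = card {p \<in> y. Im p = 0 \<and> Re p > 1}"

type_synonym fconf = "bool \<times> bool \<times> complex set"

fun tup :: "fconf => nat => complex" where "tup (A, B, y) = enum (key A B) y"
fun flab :: "fconf => complex => nat" where "flab (A, B, y) = lab A B"
fun fset :: "fconf => complex set" where "fset (A, B, y) = y"
fun flagA :: "fconf => bool" where "flagA (A, B, y) = A"
fun flagB :: "fconf => bool" where "flagB (A, B, y) = B"

text \<open>\<open>Z\<close> may be any part of the comb, also a disconnected one, because it serves
  for proper subgraphs too. The bound 3 is the reach of their drawings by
  \<open>H_place\<close>.\<close>

locale comb =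
  fixes n :: nat and Z :: "complex set"
  assumes comb_Z: "p \<in> Z ==> (Im p = 0 \<and> \<bar>Re p\<bar> \<le> 3) \<or> (0 < Im p \<and> Im p \<le> 1 \<and> (Re p = 0 \<or> Re p = 1))"
    and starlike: "locally_starlike Z"
begin

abbreviation X where "X \<equiv> cset n Z"

definition fconfs :: "fconf set" where
  "fconfs = {(A, B, y). y \<in> topspace X \<and> (A --> 0 \<in> y) \<and> (B --> 1 \<in> y)}"

lemma key_inj: "inj_on (key A B) Z"
proof (rule inj_onI)
  fix p q assume pq: "p \<in> Z" "q \<in> Z" and e: "key A B p = key A B q"
  have l: "lab A B p = lab A B q"
    using e comb_Z[OF pq(1)] comb_Z[OF pq(2)] by (auto simp: key_def lab_def split: if_splits)
  show "p = q"
    using e l comb_Z[OF pq(1)] comb_Z[OF pq(2)]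
    by (auto simp: key_def lab_def complex_eq_iff split: if_splits)
qed

lemma fconfs_facts:
  assumes "u \<in> fconfs"
  shows "finite (fset u)" "card (fset u) = n" "fset u \<subseteq> Z" "fset u \<in> topspace X"
    "flagA u ==> 0 \<in> fset u" "flagB u ==> 1 \<in> fset u"
  using assms by (auto simp: fconfs_def topspace_cset)

lemma tup_facts:
  assumes u: "u \<in> fconfs"
  shows "i < n ==> tup u i \<in> fset u" "i < n ==> tup u i \<in> Z" "tup u ` {..<n} = fset u" "inj_on (tup u) {..<n}"
    "i < j ==> j < n ==> key (flagA u) (flagB u) (tup u i) < key (flagA u) (flagB u) (tup u j)"
proof -
  obtain A B y where ue: "u = (A, B, y)" by (cases u)
  have f: "finite y" "card y = n" "y \<subseteq> Z" using fconfs_facts[OF u] by (auto simp: ue)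
  have inj: "inj_on (key A B) y" using key_inj f(3) by (rule inj_on_subset)
  show "i < n ==> tup u i \<in> fset u" "i < n ==> tup u i \<in> Z" "tup u ` {..<n} = fset u" "inj_on (tup u) {..<n}"
    "i < j ==> j < n ==> key (flagA u) (flagB u) (tup u i) < key (flagA u) (flagB u) (tup u j)"
    using enum_mem[OF f(1) inj] enum_image[OF f(1) inj] enum_inj[OF f(1) inj] enum_less[OF f(1) inj] f by (auto simp: ue)
qed

text \<open>The particles can be matched by rank and moved straight along their arcs. The last two
  clauses matter when a foot is occupied from the prong in both configurations: then no spine
  particle may have to pass that foot.\<close>

definition compat :: "fconf => fconf => bool" where
  "compat u v \<longleftrightarrow> u \<in> fconfs \<and> v \<in> fconfs \<and>
     (\<forall>i<n. flab u (tup u i) = flab v (tup v i) \<and> closed_segment (tup u i) (tup v i) \<subseteq> Z) \<and>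
     (flagA u \<and> flagA v --> (\<forall>i<n. flab u (tup u i) = 0 --> (Re (tup u i) < 0 \<longleftrightarrow> Re (tup v i) < 0))) \<and>
     (flagB u \<and> flagB v --> (\<forall>i<n. flab u (tup u i) = 0 --> (Re (tup u i) > 1 \<longleftrightarrow> Re (tup v i) > 1)))"

lemma compat_sym: "compat u v ==> compat v u"
  unfolding compat_def by (auto simp: closed_segment_commute)

lemma label_geometry:
  assumes "p \<in> Z"
  shows "lab A B p = 0 ==> Im p = 0" "lab A B p = 1 ==> Re p = 0 \<and> Im p \<ge> 0 \<and> (Im p = 0 --> A)"
    "lab A B p = 2 ==> Re p = 1 \<and> Im p \<ge> 0 \<and> (Im p = 0 --> B)" "lab A B p \<in> {0, 1, 2}"
  using comb_Z[OF assms] by (auto simp: lab_def complex_eq_iff split: if_splits)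

lemma three_collinear:
  fixes r s t :: real
  assumes "\<alpha> \<ge> 0" "\<beta> \<ge> 0" "\<gamma> \<ge> 0" "\<alpha> + \<beta> + \<gamma> = 1"
  shows "\<alpha> * r + \<beta> * s + \<gamma> * t \<in> closed_segment r s \<union> closed_segment s t \<union> closed_segment r t"
proof -
  let ?c = "\<alpha> * r + \<beta> * s + \<gamma> * t" and ?m = "min r (min s t)" and ?M = "max r (max s t)"
  have "\<alpha> * ?m \<le> \<alpha> * r" "\<beta> * ?m \<le> \<beta> * s" "\<gamma> * ?m \<le> \<gamma> * t" "\<alpha> * r \<le> \<alpha> * ?M" "\<beta> * s \<le> \<beta> * ?M" "\<gamma> * t \<le> \<gamma> * ?M"
    using assms by (auto intro!: mult_left_mono)
  moreover have "\<alpha> * ?m + \<beta> * ?m + \<gamma> * ?m = ?m" "\<alpha> * ?M + \<beta> * ?M + \<gamma> * ?M = ?M"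
    using assms(4) by (metis distrib_right mult_1)+
  ultimately have "?m \<le> ?c" "?c \<le> ?M" by linarith+
  then show ?thesis by (auto simp: closed_segment_eq_real_ivl min_def max_def split: if_splits)
qed

lemma weighted_neg:
  fixes r s t :: real
  assumes "\<alpha> \<ge> 0" "\<beta> \<ge> 0" "\<gamma> \<ge> 0" "\<alpha> + \<beta> + \<gamma> = 1" "\<alpha> > 0 ==> r < 0" "\<beta> > 0 ==> s < 0" "\<gamma> > 0 ==> t < 0"
  shows "\<alpha> * r + \<beta> * s + \<gamma> * t < 0"
proof -
  have "\<alpha> * r \<le> 0" "\<beta> * s \<le> 0" "\<gamma> * t \<le> 0" and pos: "\<alpha> > 0 ==> \<alpha> * r < 0" "\<beta> > 0 ==> \<beta> * s < 0" "\<gamma> > 0 ==> \<gamma> * t < 0"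
    using assms by (auto simp: mult_less_0_iff mult_le_0_iff) force+
  moreover have "\<alpha> > 0 \<or> \<beta> > 0 \<or> \<gamma> > 0" using assms by linarith
  ultimately show ?thesis by fastforce
qed

text \<open>The mean misses the foot \<open>w\<close> if all values of positive weight lie strictly
  on one side of it. Values of weight zero are exempt because the flags of their configurations say
  nothing about the meeting point.\<close>

lemma weighted_foot:
  fixes r s t w :: real
  assumes w: "\<alpha> \<ge> 0" "\<beta> \<ge> 0" "\<gamma> \<ge> 0" "\<alpha> + \<beta> + \<gamma> = 1"
    and ne: "\<alpha> > 0 ==> r \<noteq> w" "\<beta> > 0 ==> s \<noteq> w" "\<gamma> > 0 ==> t \<noteq> w"
    and same: "\<alpha> > 0 ==> \<beta> > 0 ==> r < w \<longleftrightarrow> s < w" "\<beta> > 0 ==> \<gamma> > 0 ==> s < w \<longleftrightarrow> t < w" "\<alpha> > 0 ==> \<gamma> > 0 ==> r < w \<longleftrightarrow> t < w"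
  shows "\<alpha> * r + \<beta> * s + \<gamma> * t \<noteq> w"
proof -
  have e: "\<alpha> * r + \<beta> * s + \<gamma> * t - w = \<alpha> * (r - w) + \<beta> * (s - w) + \<gamma> * (t - w)"
  proof -
    have "\<alpha> * w + \<beta> * w + \<gamma> * w = w" using w(4) by (metis distrib_right mult_1)
    then show ?thesis by (simp add: algebra_simps)
  qed
  have e': "w - (\<alpha> * r + \<beta> * s + \<gamma> * t) = \<alpha> * (w - r) + \<beta> * (w - s) + \<gamma> * (w - t)"
  proof -
    have "\<alpha> * w + \<beta> * w + \<gamma> * w = w" using w(4) by (metis distrib_right mult_1)
    then show ?thesis by (simp add: algebra_simps)
  qed
  have "((\<alpha> > 0 --> r < w) \<and> (\<beta> > 0 --> s < w) \<and> (\<gamma> > 0 --> t < w)) \<or>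
     ((\<alpha> > 0 --> w < r) \<and> (\<beta> > 0 --> w < s) \<and> (\<gamma> > 0 --> w < t))"
    using ne same by (meson linorder_cases order_less_asym)
  then show ?thesis
  proof
    assume "(\<alpha> > 0 --> r < w) \<and> (\<beta> > 0 --> s < w) \<and> (\<gamma> > 0 --> t < w)"
    then have "\<alpha> * (r - w) + \<beta> * (s - w) + \<gamma> * (t - w) < 0" by (intro weighted_neg[OF w]) auto
    then show ?thesis using e by linarith
  next
    assume "(\<alpha> > 0 --> w < r) \<and> (\<beta> > 0 --> w < s) \<and> (\<gamma> > 0 --> w < t)"
    then have "\<alpha> * (w - r) + \<beta> * (w - s) + \<gamma> * (w - t) < 0" by (intro weighted_neg[OF w]) auto
    then show ?thesis using e' by linarith
  qed
qed

lemma weighted_zero: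
  fixes r s t :: real
  assumes "\<alpha> \<ge> 0" "\<beta> \<ge> 0" "\<gamma> \<ge> 0" "r \<ge> 0" "s \<ge> 0" "t \<ge> 0" "\<alpha> * r + \<beta> * s + \<gamma> * t = 0"
  shows "\<alpha> > 0 ==> r = 0" "\<beta> > 0 ==> s = 0" "\<gamma> > 0 ==> t = 0"
proof -
  have "\<alpha> * r \<ge> 0" "\<beta> * s \<ge> 0" "\<gamma> * t \<ge> 0" using assms by auto
  then have "\<alpha> * r = 0" "\<beta> * s = 0" "\<gamma> * t = 0" using assms(7) by linarith+
  then show "\<alpha> > 0 ==> r = 0" "\<beta> > 0 ==> s = 0" "\<gamma> > 0 ==> t = 0" by auto
qed

text \<open>Particles of equal label keep their order on a common line. Particles of different
  labels could meet only if one is on the spine, and then only at a foot, which the side clauses of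
  \<open>compat\<close> exclude.\<close>

lemma valid_compat:
  assumes c: "compat u v" "compat v w" "compat u w"
  shows "valid_motion n Z (tup u) (tup v) (tup w)"
  unfolding valid_motion_def
proof (intro allI impI conjI)
  fix \<alpha> \<beta> \<gamma> :: real assume abc: "\<alpha> \<ge> 0" "\<beta> \<ge> 0" "\<gamma> \<ge> 0" "\<alpha> + \<beta> + \<gamma> = 1"
  have f: "u \<in> fconfs" "v \<in> fconfs" "w \<in> fconfs" using c by (auto simp: compat_def)
  let ?c = "\<lambda>i. of_real \<alpha> * tup u i + of_real \<beta> * tup v i + of_real \<gamma> * tup w i"
  have Re: "Re (?c i) = \<alpha> * Re (tup u i) + \<beta> * Re (tup v i) + \<gamma> * Re (tup w i)"
    and Im: "Im (?c i) = \<alpha> * Im (tup u i) + \<beta> * Im (tup v i) + \<gamma> * Im (tup w i)" for i by simp_all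
  have lb: "flab v (tup v i) = flab u (tup u i)" "flab w (tup w i) = flab u (tup u i)" if "i < n" for i
    using c that by (auto simp: compat_def)
  have labs: "lab (flagA t) (flagB t) = flab t" for t by (cases t) auto
  have geo: "flab t (tup t i) = 0 ==> Im (tup t i) = 0"
    "flab t (tup t i) = 1 ==> Re (tup t i) = 0 \<and> Im (tup t i) \<ge> 0 \<and> (Im (tup t i) = 0 --> flagA t)"
    "flab t (tup t i) = 2 ==> Re (tup t i) = 1 \<and> Im (tup t i) \<ge> 0 \<and> (Im (tup t i) = 0 --> flagB t)"
    "flab t (tup t i) \<in> {0, 1, 2}" if "t \<in> fconfs" "i < n" for t i
    using label_geometry[OF tup_facts(2)[OF that], where A = "flagA t" and B = "flagB t"] unfolding labs by auto
  have one: "\<alpha> * x + \<beta> * x + \<gamma> * x = x" for x :: real using abc(4) by (metis distrib_right mult_1)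
  show "?c i \<in> Z" if i: "i < n" for i
  proof -
    have sub: "closed_segment (tup u i) (tup v i) \<union> closed_segment (tup v i) (tup w i) \<union> closed_segment (tup u i) (tup w i) \<subseteq> Z"
      using c i by (auto simp: compat_def)
    have "?c i \<in> closed_segment (tup u i) (tup v i) \<union> closed_segment (tup v i) (tup w i) \<union> closed_segment (tup u i) (tup w i)"
    proof (cases "flab u (tup u i) = 0")
      case True
      then have "Im (tup u i) = 0" "Im (tup v i) = 0" "Im (tup w i) = 0"
        using geo(1)[OF f(1) i] geo(1)[OF f(2) i] geo(1)[OF f(3) i] lb[OF i] by auto
      then show ?thesis
        using three_collinear[OF abc, of "Re (tup u i)" "Re (tup v i)" "Re (tup w i)"]
        by (auto simp: closed_segment_same_Im Re Im)
    next
      case False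
      then have "flab u (tup u i) = 1 \<or> flab u (tup u i) = 2" using geo(4)[OF f(1) i] by auto
      then have "Re (tup v i) = Re (tup u i)" "Re (tup w i) = Re (tup u i)"
        using geo(2,3)[OF f(1) i] geo(2,3)[OF f(2) i] geo(2,3)[OF f(3) i] lb[OF i] by auto
      then show ?thesis
        using three_collinear[OF abc, of "Im (tup u i)" "Im (tup v i)" "Im (tup w i)"] one[of "Re (tup u i)"]
        by (auto simp: closed_segment_same_Re Re Im)
    qed
    then show ?thesis using sub by blast
  qed
  have main: "?c i \<noteq> ?c j" if ij: "i < j" "j < n" for i j
  proof
    assume eq: "?c i = ?c j"
    have i: "i < n" using ij by simp
    note gi = geo[OF f(1) i] geo[OF f(2) i] geo[OF f(3) i] and gj = geo[OF f(1) ij(2)] geo[OF f(2) ij(2)] geo[OF f(3) ij(2)]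
    have less: "key (flagA t) (flagB t) (tup t i) < key (flagA t) (flagB t) (tup t j)" if "t \<in> fconfs" for t
      by (rule tup_facts(5)[OF that ij])
    have keyl: "key (flagA t) (flagB t) p = 10 * real (flab t p) + (if flab t p = 0 then Re p else - Im p)" for t p
      by (cases t) (simp add: key_def)
    have bnd: "\<bar>Re (tup t k)\<bar> \<le> 3 \<and> \<bar>Im (tup t k)\<bar> \<le> 1" if "t \<in> fconfs" "k < n" for t k
      using comb_Z[OF tup_facts(2)[OF that]] by auto
    have le: "flab u (tup u i) \<le> flab u (tup u j)"
      using less[OF f(1)] bnd[OF f(1) i] bnd[OF f(1) ij(2)] gi(4) gj(4) unfolding keyl by (auto split: if_splits)
    have xne: "tup t i \<noteq> tup t j" if "t \<in> fconfs" for t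
      using tup_facts(4)[OF that] ij i by (auto dest: inj_onD)
    consider "flab u (tup u i) = flab u (tup u j)" | "flab u (tup u i) = 0" "flab u (tup u j) = 1"
      | "flab u (tup u i) = 0" "flab u (tup u j) = 2" | "flab u (tup u i) = 1" "flab u (tup u j) = 2"
      using le gi(4) gj(4) by auto
    then show False
    proof cases
      case 1
      show False
      proof (cases "flab u (tup u i) = 0")
        case True
        then have "Re (tup t i) - Re (tup t j) < 0" if "t \<in> {u, v, w}" for t
          using less[of t] that f lb[OF i] lb[OF ij(2)] 1 unfolding keyl by auto
        then have "\<alpha> * (Re (tup u i) - Re (tup u j)) + \<beta> * (Re (tup v i) - Re (tup v j)) + \<gamma> * (Re (tup w i) - Re (tup w j)) < 0"
          by (intro weighted_neg[OF abc]) auto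
        moreover have "Re (?c i) = Re (?c j)" using eq by simp
        ultimately show False unfolding Re by (simp add: algebra_simps)
      next
        case False
        then have "Im (tup t j) - Im (tup t i) < 0" if "t \<in> {u, v, w}" for t
          using less[of t] that f lb[OF i] lb[OF ij(2)] 1 unfolding keyl by auto
        then have "\<alpha> * (Im (tup u j) - Im (tup u i)) + \<beta> * (Im (tup v j) - Im (tup v i)) + \<gamma> * (Im (tup w j) - Im (tup w i)) < 0"
          by (intro weighted_neg[OF abc]) auto
        moreover have "Im (?c i) = Im (?c j)" using eq by simp
        ultimately show False unfolding Im by (simp add: algebra_simps)
      qed
    next
      case 2
      have Imi: "Im (tup u i) = 0" "Im (tup v i) = 0" "Im (tup w i) = 0"
        using gi(1,5,9) 2 lb[OF i] by auto
      have gju: "Re (tup u j) = 0 \<and> Im (tup u j) \<ge> 0 \<and> (Im (tup u j) = 0 --> flagA u)"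
        "Re (tup v j) = 0 \<and> Im (tup v j) \<ge> 0 \<and> (Im (tup v j) = 0 --> flagA v)"
        "Re (tup w j) = 0 \<and> Im (tup w j) \<ge> 0 \<and> (Im (tup w j) = 0 --> flagA w)"
        using gj(2,6,10) 2 lb[OF ij(2)] by auto
      \<comment> \<open>The meeting point has height 0, so in every configuration of positive weight
        the prong particle stands on the foot and is flagged. Between those configurations the spine
        particle keeps its side of the foot.\<close>
      have "Im (?c j) = 0" using eq Im[of i] Imi by (metis add.right_neutral mult_zero_right)
      then have "\<alpha> * Im (tup u j) + \<beta> * Im (tup v j) + \<gamma> * Im (tup w j) = 0" unfolding Im .
      note zero = weighted_zero[OF abc(1-3) _ _ _ this]
      have z: "\<alpha> > 0 ==> flagA u \<and> tup u j = 0" "\<beta> > 0 ==> flagA v \<and> tup v j = 0" "\<gamma> > 0 ==> flagA w \<and> tup w j = 0"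
        using zero gju by (auto simp: complex_eq_iff)
      have ri: "\<alpha> > 0 ==> Re (tup u i) \<noteq> 0" "\<beta> > 0 ==> Re (tup v i) \<noteq> 0" "\<gamma> > 0 ==> Re (tup w i) \<noteq> 0"
        using z xne[OF f(1)] xne[OF f(2)] xne[OF f(3)] Imi by (auto simp: complex_eq_iff)
      have "\<alpha> * Re (tup u i) + \<beta> * Re (tup v i) + \<gamma> * Re (tup w i) \<noteq> 0"
      proof (rule weighted_foot[OF abc ri])
        show "Re (tup u i) < 0 \<longleftrightarrow> Re (tup v i) < 0" if "\<alpha> > 0" "\<beta> > 0"
          using c(1) z(1)[OF that(1)] z(2)[OF that(2)] 2 i unfolding compat_def by blast
        show "Re (tup v i) < 0 \<longleftrightarrow> Re (tup w i) < 0" if "\<beta> > 0" "\<gamma> > 0"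
          using c(2) z(2)[OF that(1)] z(3)[OF that(2)] 2 i lb[OF i] unfolding compat_def by auto
        show "Re (tup u i) < 0 \<longleftrightarrow> Re (tup w i) < 0" if "\<alpha> > 0" "\<gamma> > 0"
          using c(3) z(1)[OF that(1)] z(3)[OF that(2)] 2 i unfolding compat_def by blast
      qed
      moreover have "Re (?c j) = 0" unfolding Re using gju by simp
      ultimately show False using eq Re[of i] by simp
    next
      case 3
      have Imi: "Im (tup u i) = 0" "Im (tup v i) = 0" "Im (tup w i) = 0"
        using gi(1,5,9) 3 lb[OF i] by auto
      have gju: "Re (tup u j) = 1 \<and> Im (tup u j) \<ge> 0 \<and> (Im (tup u j) = 0 --> flagB u)"
        "Re (tup v j) = 1 \<and> Im (tup v j) \<ge> 0 \<and> (Im (tup v j) = 0 --> flagB v)"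
        "Re (tup w j) = 1 \<and> Im (tup w j) \<ge> 0 \<and> (Im (tup w j) = 0 --> flagB w)"
        using gj(3,7,11) 3 lb[OF ij(2)] by auto
      have "Im (?c j) = 0" using eq Im[of i] Imi by (metis add.right_neutral mult_zero_right)
      then have "\<alpha> * Im (tup u j) + \<beta> * Im (tup v j) + \<gamma> * Im (tup w j) = 0" unfolding Im .
      note zero = weighted_zero[OF abc(1-3) _ _ _ this]
      have z: "\<alpha> > 0 ==> flagB u \<and> tup u j = 1" "\<beta> > 0 ==> flagB v \<and> tup v j = 1" "\<gamma> > 0 ==> flagB w \<and> tup w j = 1"
        using zero gju by (auto simp: complex_eq_iff)
      have ri: "\<alpha> > 0 ==> Re (tup u i) \<noteq> 1" "\<beta> > 0 ==> Re (tup v i) \<noteq> 1" "\<gamma> > 0 ==> Re (tup w i) \<noteq> 1"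
        using z xne[OF f(1)] xne[OF f(2)] xne[OF f(3)] Imi by (auto simp: complex_eq_iff)
      have "\<alpha> * Re (tup u i) + \<beta> * Re (tup v i) + \<gamma> * Re (tup w i) \<noteq> 1"
      proof (rule weighted_foot[OF abc ri])
        show "Re (tup u i) < 1 \<longleftrightarrow> Re (tup v i) < 1" if h: "\<alpha> > 0" "\<beta> > 0"
        proof -
          have "Re (tup u i) > 1 \<longleftrightarrow> Re (tup v i) > 1"
            using c(1) z(1)[OF h(1)] z(2)[OF h(2)] 3 i unfolding compat_def by blast
          then show ?thesis using ri(1)[OF h(1)] ri(2)[OF h(2)] by linarith
        qed
        show "Re (tup v i) < 1 \<longleftrightarrow> Re (tup w i) < 1" if h: "\<beta> > 0" "\<gamma> > 0"
        proof -
          have "Re (tup v i) > 1 \<longleftrightarrow> Re (tup w i) > 1"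
            using c(2) z(2)[OF h(1)] z(3)[OF h(2)] 3 i lb[OF i] unfolding compat_def by auto
          then show ?thesis using ri(2)[OF h(1)] ri(3)[OF h(2)] by linarith
        qed
        show "Re (tup u i) < 1 \<longleftrightarrow> Re (tup w i) < 1" if h: "\<alpha> > 0" "\<gamma> > 0"
        proof -
          have "Re (tup u i) > 1 \<longleftrightarrow> Re (tup w i) > 1"
            using c(3) z(1)[OF h(1)] z(3)[OF h(2)] 3 i unfolding compat_def by blast
          then show ?thesis using ri(1)[OF h(1)] ri(3)[OF h(2)] by linarith
        qed
      qed
      moreover have "Re (?c j) = 1" unfolding Re using gju one[of 1] by simp
      ultimately show False using eq Re[of i] by simp
    next
      case 4
      have "Re (?c i) = 0" unfolding Re using gi(2,6,10) 4 lb[OF i] by simp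
      moreover have "Re (?c j) = 1" unfolding Re using gj(3,7,11) 4 lb[OF ij(2)] one[of 1] by simp
      ultimately show False using eq by simp
    qed
  qed
  show "inj_on ?c {..<n}"
    by (rule linorder_inj_onI) (use main in auto)
qed

end

lemma card_Collect_split:
  assumes "finite y"
  shows "card {p \<in> y. P p} + card {p \<in> y. \<not> P p} = card y"
proof -
  have "card ({p \<in> y. P p} \<union> {p \<in> y. \<not> P p}) = card {p \<in> y. P p} + card {p \<in> y. \<not> P p}"
    by (rule card_Un_disjoint) (use assms in auto)
  moreover have "{p \<in> y. P p} \<union> {p \<in> y. \<not> P p} = y" by auto
  ultimately show ?thesis by simp
qed

context comb begin

lemma card_lab:
  assumes u: "(A, B, y) \<in> fconfs"
  shows "card {p \<in> y. lab A B p = 1} = na y + of_bool A" "card {p \<in> y. lab A B p = 2} = nd y + of_bool B"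
    "card {p \<in> y. lab A B p = 0} = n - (na y + of_bool A) - (nd y + of_bool B)"
    "na y + of_bool A + (nd y + of_bool B) \<le> n"
    "{p \<in> y. lab A B p = 0 \<and> Re p < 0} = {p \<in> y. Im p = 0 \<and> Re p < 0}"
    "card {p \<in> y. lab A B p = 0 \<and> Re p \<le> 1} + ne y = card {p \<in> y. lab A B p = 0}"
proof -
  have f: "finite y" "card y = n" "y \<subseteq> Z" "A ==> 0 \<in> y" "B ==> 1 \<in> y" using fconfs_facts[OF u] by auto
  have im: "Im p \<ge> 0" if p: "p \<in> y" for p using comb_Z[OF subsetD[OF f(3) p]] by auto
  have "{p \<in> y. lab A B p = 1} = {p \<in> y. Im p > 0 \<and> Re p = 0} \<union> (if A then {0} else {})"
    using f(4) by (auto simp: lab_def split: if_splits)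
  moreover have "card ({p \<in> y. Im p > 0 \<and> Re p = 0} \<union> (if A then {0} else {})) = na y + of_bool A"
    using f(1) by (subst card_Un_disjoint) (auto simp: na_def)
  ultimately show 1: "card {p \<in> y. lab A B p = 1} = na y + of_bool A" by simp
  have "{p \<in> y. lab A B p = 2} = {p \<in> y. Im p > 0 \<and> Re p \<noteq> 0} \<union> (if B then {1} else {})"
    using f(5) by (auto simp: lab_def split: if_splits)
  moreover have "card ({p \<in> y. Im p > 0 \<and> Re p \<noteq> 0} \<union> (if B then {1} else {})) = nd y + of_bool B"
    using f(1) by (subst card_Un_disjoint) (auto simp: nd_def)
  ultimately show 2: "card {p \<in> y. lab A B p = 2} = nd y + of_bool B" by simp
  have "card {p \<in> y. lab A B p = 0} + card {p \<in> y. lab A B p \<noteq> 0} = n"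
    using card_Collect_split[OF f(1), of "\<lambda>p. lab A B p = 0"] f(2) by simp
  moreover have "{p \<in> y. lab A B p \<noteq> 0} = {p \<in> y. lab A B p = 1} \<union> {p \<in> y. lab A B p = 2}"
    by (auto simp: lab_def)
  moreover have "card ({p \<in> y. lab A B p = 1} \<union> {p \<in> y. lab A B p = 2}) = card {p \<in> y. lab A B p = 1} + card {p \<in> y. lab A B p = 2}"
    by (rule card_Un_disjoint) (use f(1) in auto)
  ultimately show "card {p \<in> y. lab A B p = 0} = n - (na y + of_bool A) - (nd y + of_bool B)"
    "na y + of_bool A + (nd y + of_bool B) \<le> n" using 1 2 by auto
  show "{p \<in> y. lab A B p = 0 \<and> Re p < 0} = {p \<in> y. Im p = 0 \<and> Re p < 0}"
    using im by (force simp: lab_def)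
  have "{p \<in> {p \<in> y. lab A B p = 0}. \<not> Re p \<le> 1} = {p \<in> y. Im p = 0 \<and> Re p > 1}"
    using im by (force simp: lab_def)
  then show "card {p \<in> y. lab A B p = 0 \<and> Re p \<le> 1} + ne y = card {p \<in> y. lab A B p = 0}"
    using card_Collect_split[of "{p \<in> y. lab A B p = 0}" "\<lambda>p. Re p \<le> 1"] f(1) by (simp add: ne_def conj_assoc)
qed

lemma key_lab_mono:
  assumes "p \<in> Z" "q \<in> Z" "key A B p < key A B q"
  shows "lab A B p \<le> lab A B q" "lab A B p = lab A B q ==> lab A B p = 0 ==> Re p < Re q"
    "lab A B p = lab A B q ==> lab A B p \<noteq> 0 ==> Im q < Im p"
  using assms comb_Z[OF assms(1)] comb_Z[OF assms(2)]
  by (auto simp: key_def lab_def split: if_splits)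

lemma keyI:
  assumes "p \<in> Z" "q \<in> Z"
    and "lab A B p < lab A B q \<or> (lab A B p = lab A B q \<and> (if lab A B p = 0 then Re p < Re q else Im q < Im p))"
  shows "key A B p < key A B q"
  using assms(3) comb_Z[OF assms(1)] comb_Z[OF assms(2)]
  by (auto simp: key_def lab_def split: if_splits)

lemma tup_rank:
  assumes u: "(A, B, y) \<in> fconfs" and i: "i < n"
  shows "lab A B (tup (A, B, y) i) = 0 \<longleftrightarrow> i < card {p \<in> y. lab A B p = 0}"
    "lab A B (tup (A, B, y) i) \<noteq> 2 \<longleftrightarrow> i < card {p \<in> y. lab A B p \<noteq> 2}"
    "lab A B (tup (A, B, y) i) = 0 \<and> Re (tup (A, B, y) i) < 0 \<longleftrightarrow> i < card {p \<in> y. lab A B p = 0 \<and> Re p < 0}"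
    "lab A B (tup (A, B, y) i) = 0 \<and> Re (tup (A, B, y) i) \<le> 1 \<longleftrightarrow> i < card {p \<in> y. lab A B p = 0 \<and> Re p \<le> 1}"
proof -
  have f: "finite y" "card y = n" "y \<subseteq> Z" using fconfs_facts[OF u] by auto
  have inj: "inj_on (key A B) y" using key_inj f(3) by (rule inj_on_subset)
  have l3: "lab A B p \<in> {0, 1, 2}" for p by (auto simp: lab_def)
  have m: "lab A B p \<le> lab A B q" "lab A B p = lab A B q ==> lab A B p = 0 ==> Re p < Re q"
    if "p \<in> y" "q \<in> y" "key A B p < key A B q" for p q
    using key_lab_mono[of p q A B] that f(3) by auto
  note rank = enum_rank[OF f(1) inj _ i[folded f(2)]]
  show "lab A B (tup (A, B, y) i) = 0 \<longleftrightarrow> i < card {p \<in> y. lab A B p = 0}"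
    unfolding tup.simps by (rule rank) (use m(1) in fastforce)
  show "lab A B (tup (A, B, y) i) \<noteq> 2 \<longleftrightarrow> i < card {p \<in> y. lab A B p \<noteq> 2}"
    unfolding tup.simps
  proof (rule rank)
    fix p q assume "p \<in> y" "q \<in> y" "key A B p < key A B q" "lab A B q \<noteq> 2"
    then show "lab A B p \<noteq> 2" using m(1)[of p q] l3[of p] l3[of q] by auto
  qed
  show "lab A B (tup (A, B, y) i) = 0 \<and> Re (tup (A, B, y) i) < 0 \<longleftrightarrow> i < card {p \<in> y. lab A B p = 0 \<and> Re p < 0}"
    unfolding tup.simps
  proof (rule rank)
    fix p q assume "p \<in> y" "q \<in> y" "key A B p < key A B q" "lab A B q = 0 \<and> Re q < 0"
    then show "lab A B p = 0 \<and> Re p < 0" using m[of p q] by fastforce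
  qed
  show "lab A B (tup (A, B, y) i) = 0 \<and> Re (tup (A, B, y) i) \<le> 1 \<longleftrightarrow> i < card {p \<in> y. lab A B p = 0 \<and> Re p \<le> 1}"
    unfolding tup.simps
  proof (rule rank)
    fix p q assume "p \<in> y" "q \<in> y" "key A B p < key A B q" "lab A B q = 0 \<and> Re q \<le> 1"
    then show "lab A B p = 0 \<and> Re p \<le> 1" using m[of p q] by fastforce
  qed
qed

text \<open>The enumeration lists the spine, then the prong over 0, then the prong over 1. Hence
  label and side of the i-th particle depend only on the counts.\<close>

lemma tup_counts:
  assumes u: "(A, B, y) \<in> fconfs" and v: "(A', B', y') \<in> fconfs"
    and c: "na y + of_bool A = na y' + of_bool A'" "nd y + of_bool B = nd y' + of_bool B'" and i: "i < n"
  shows "lab A B (tup (A, B, y) i) = lab A' B' (tup (A', B', y') i)"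
    "nb y = nb y' ==> lab A B (tup (A, B, y) i) = 0 ==> Re (tup (A, B, y) i) < 0 \<longleftrightarrow> Re (tup (A', B', y') i) < 0"
    "ne y = ne y' ==> lab A B (tup (A, B, y) i) = 0 ==> Re (tup (A, B, y) i) > 1 \<longleftrightarrow> Re (tup (A', B', y') i) > 1"
proof -
  have e0: "card {p \<in> y. lab A B p = 0} = card {p \<in> y'. lab A' B' p = 0}"
    using card_lab(3)[OF u] card_lab(3)[OF v] c by simp
  have "card {p \<in> y. lab A B p \<noteq> 2} + card {p \<in> y. lab A B p = 2} = n" "card {p \<in> y'. lab A' B' p \<noteq> 2} + card {p \<in> y'. lab A' B' p = 2} = n"
    using card_Collect_split[of y "\<lambda>p. lab A B p \<noteq> 2"] card_Collect_split[of y' "\<lambda>p. lab A' B' p \<noteq> 2"]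
      fconfs_facts[OF u] fconfs_facts[OF v] by auto
  then have e2: "card {p \<in> y. lab A B p \<noteq> 2} = card {p \<in> y'. lab A' B' p \<noteq> 2}"
    using card_lab(2)[OF u] card_lab(2)[OF v] c by simp
  have l3: "lab A B p \<in> {0, 1, 2}" for A B p by (auto simp: lab_def)
  show l: "lab A B (tup (A, B, y) i) = lab A' B' (tup (A', B', y') i)"
    using tup_rank(1,2)[OF u i] tup_rank(1,2)[OF v i] e0 e2 l3[of A B "tup (A, B, y) i"] l3[of A' B' "tup (A', B', y') i"]
    by auto
  show "Re (tup (A, B, y) i) < 0 \<longleftrightarrow> Re (tup (A', B', y') i) < 0"
    if "nb y = nb y'" "lab A B (tup (A, B, y) i) = 0"
  proof -
    have "card {p \<in> y. lab A B p = 0 \<and> Re p < 0} = card {p \<in> y'. lab A' B' p = 0 \<and> Re p < 0}"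
      using that(1) by (simp only: card_lab(5)[OF u] card_lab(5)[OF v] nb_def)
    then show ?thesis using tup_rank(3)[OF u i] tup_rank(3)[OF v i] that(2) l by simp
  qed
  show "Re (tup (A, B, y) i) > 1 \<longleftrightarrow> Re (tup (A', B', y') i) > 1"
    if "ne y = ne y'" "lab A B (tup (A, B, y) i) = 0"
  proof -
    have "card {p \<in> y. lab A B p = 0 \<and> Re p \<le> 1} = card {p \<in> y'. lab A' B' p = 0 \<and> Re p \<le> 1}"
      using card_lab(6)[OF u] card_lab(6)[OF v] e0 that(1) by simp
    then show ?thesis using tup_rank(4)[OF u i] tup_rank(4)[OF v i] that(2) l by auto
  qed
qed

text \<open>A particle resting on the foot may be counted to the prong or to the spine: it keeps
  still, and the others are matched as if it were absent. The assumptions make its ranks agree under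
  both readings.\<close>

lemma switchA:
  assumes u: "(True, B, z) \<in> fconfs" and v: "(True, B', z') \<in> fconfs"
    and c: "nd z + of_bool B = nd z' + of_bool B'" "nb z = nb z'"
  shows "motion n (tup (True, B, z)) (tup (True, B', z')) = motion n (tup (False, B, z)) (tup (False, B', z'))"
proof
  fix t
  note fu = fconfs_facts[OF u, simplified] and fv = fconfs_facts[OF v, simplified]
  let ?y = "z - {0}" and ?y' = "z' - {0}"
  have z: "z = insert 0 ?y" "z' = insert 0 ?y'" using fu(5) fv(5) by auto
  have n: "n = Suc (card ?y)" using fu(1,2,5) by (metis card_Suc_Diff1)
  have fin: "finite ?y" "finite ?y'" "card ?y' = card ?y" using fu(1,2,5) fv(1,2,5) n by (auto simp: card_Diff_singleton)
  have inj: "inj_on (key A B) (insert 0 ?y)" "inj_on (key A B) (insert 0 ?y')" for A B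
    using key_inj fu(3) fv(3) z by (metis inj_on_subset)+
  have injy: "inj_on (key A B) ?y" "inj_on (key A B) ?y'" for A B
    using key_inj fu(3) fv(3) by (meson Diff_subset inj_on_subset order_trans)+
  \<comment> \<open>Counted to the prong, the foot particle comes after everything except the other
    prong.\<close>
  have r1: "card {p \<in> x - {0}. key True C p < key True C 0} = card (x - {0}) - (nd x + of_bool C)" if x: "(True, C, x) \<in> fconfs" for C x
  proof -
    note fx = fconfs_facts[OF x, simplified]
    have "{p \<in> x - {0}. \<not> key True C p < key True C 0} = {p \<in> x. lab True C p = 2}"
      using comb_Z fx(3) by (fastforce simp: key_def lab_def split: if_splits)
    then have "card {p \<in> x - {0}. \<not> key True C p < key True C 0} = nd x + of_bool C" using card_lab(2)[OF x] by simp
    then show ?thesis using card_Collect_split[of "x - {0}" "\<lambda>p. key True C p < key True C 0"] fx(1) by simp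
  qed
  \<comment> \<open>Counted to the spine, it comes after the particles to its left only.\<close>
  have r2: "card {p \<in> x - {0}. key False C p < key False C 0} = nb x" if x: "(True, C, x) \<in> fconfs" for C x
  proof -
    note fx = fconfs_facts[OF x, simplified]
    have "{p \<in> x - {0}. key False C p < key False C 0} = {p \<in> x. Im p = 0 \<and> Re p < 0}"
      using comb_Z fx(3) by (fastforce simp: key_def lab_def split: if_splits)
    then show ?thesis by (simp add: nb_def)
  qed
  have m: "motion n (enum (key A B) z) (enum (key A B') z') t = insert 0 (motion (card ?y) (enum (key A B) ?y) (enum (key A B') ?y') t)"
    if "card {p \<in> ?y. key A B p < key A B 0} = card {p \<in> ?y'. key A B' p < key A B' 0}" for A
    using motion_insert[OF fin(1,2) refl fin(3) _ _ inj(1) inj(2) that] z n by (metis Diff_iff insertI1)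
  have k: "key True C p = key False C p" if "p \<noteq> 0" for C p using that by (simp add: key_def lab_def)
  have en: "enum (key True B) ?y i = enum (key False B) ?y i" "enum (key True B') ?y' i = enum (key False B') ?y' i" if "i < card ?y" for i
    using that fin injy by (auto intro!: enum_cong k)
  have "motion (card ?y) (enum (key True B) ?y) (enum (key True B') ?y') t = motion (card ?y) (enum (key False B) ?y) (enum (key False B') ?y') t"
    unfolding motion_def by (rule image_cong) (use en in auto)
  then show "motion n (tup (True, B, z)) (tup (True, B', z')) t = motion n (tup (False, B, z)) (tup (False, B', z')) t"
    using m[of True] m[of False] r1[OF u] r1[OF v] r2[OF u] r2[OF v] c fin(3) by simp
qed

text \<open>As in \<open>switchA\<close>, but the foot 1 has other ranks: counted to the prong it is
  the last particle of all, counted to the spine it is followed by the spine particles beyond 1 and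
  by the prongs.\<close>

lemma switchB:
  assumes u: "(A, True, z) \<in> fconfs" and v: "(A', True, z') \<in> fconfs"
    and c: "na z + of_bool A = na z' + of_bool A'" "nd z = nd z'" "ne z = ne z'"
  shows "motion n (tup (A, True, z)) (tup (A', True, z')) = motion n (tup (A, False, z)) (tup (A', False, z'))"
proof
  fix t
  note fu = fconfs_facts[OF u, simplified] and fv = fconfs_facts[OF v, simplified]
  let ?y = "z - {1}" and ?y' = "z' - {1}"
  have z: "z = insert 1 ?y" "z' = insert 1 ?y'" using fu(6) fv(6) by auto
  have n: "n = Suc (card ?y)" using fu(1,2,6) by (metis card_Suc_Diff1)
  have fin: "finite ?y" "finite ?y'" "card ?y' = card ?y" using fu(1,2,6) fv(1,2,6) n by (auto simp: card_Diff_singleton)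
  have inj: "inj_on (key A B) (insert 1 ?y)" "inj_on (key A B) (insert 1 ?y')" for A B
    using key_inj fu(3) fv(3) z by (metis inj_on_subset)+
  have injy: "inj_on (key A B) ?y" "inj_on (key A B) ?y'" for A B
    using key_inj fu(3) fv(3) by (meson Diff_subset inj_on_subset order_trans)+
  have r1: "card {p \<in> x - {1}. key C True p < key C True 1} = card (x - {1})" if x: "(C, True, x) \<in> fconfs" for C x
  proof -
    note fx = fconfs_facts[OF x, simplified]
    have "{p \<in> x - {1}. key C True p < key C True 1} = x - {1}"
      using comb_Z fx(3) by (fastforce simp: key_def lab_def split: if_splits)
    then show ?thesis by simp
  qed
  have r2: "Suc (card {p \<in> x - {1}. key C False p < key C False 1}) + ne x = n - (na x + of_bool C) - nd x" if x: "(C, True, x) \<in> fconfs" for C x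
  proof -
    note fx = fconfs_facts[OF x, simplified]
    have xF: "(C, False, x) \<in> fconfs" using x by (auto simp: fconfs_def)
    have "insert 1 {p \<in> x - {1}. key C False p < key C False 1} = {p \<in> x. lab C False p = 0 \<and> Re p \<le> 1}"
    proof (intro equalityI subsetI)
      fix p assume p: "p \<in> insert 1 {p \<in> x - {1}. key C False p < key C False 1}"
      show "p \<in> {p \<in> x. lab C False p = 0 \<and> Re p \<le> 1}"
      proof (cases "p = 1")
        case True
        then show ?thesis using fx(6) by (simp add: lab_def)
      next
        case False
        then have "p \<in> x" "key C False p < 1" using p by (auto simp: key_def lab_def)
        then show ?thesis using comb_Z[of p] fx(3) by (auto simp: key_def lab_def split: if_splits)
      qed
    next
      fix p assume p: "p \<in> {p \<in> x. lab C False p = 0 \<and> Re p \<le> 1}"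
      then have "p = 1 \<or> Re p < 1" using comb_Z[of p] fx(3) by (auto simp: lab_def complex_eq_iff split: if_splits)
      then show "p \<in> insert 1 {p \<in> x - {1}. key C False p < key C False 1}" using p by (auto simp: key_def lab_def)
    qed
    moreover have "card (insert 1 {p \<in> x - {1}. key C False p < key C False 1}) = Suc (card {p \<in> x - {1}. key C False p < key C False 1})"
      using fx(1) by simp
    ultimately show ?thesis using card_lab(6)[OF xF] card_lab(3)[OF xF] by simp
  qed
  have m: "motion n (enum (key A B) z) (enum (key A' B) z') t = insert 1 (motion (card ?y) (enum (key A B) ?y) (enum (key A' B) ?y') t)"
    if "card {p \<in> ?y. key A B p < key A B 1} = card {p \<in> ?y'. key A' B p < key A' B 1}" for B
    using motion_insert[OF fin(1,2) refl fin(3) _ _ inj(1) inj(2) that] z n by (metis Diff_iff insertI1)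
  have k: "key C True p = key C False p" if "p \<noteq> 1" for C p using that by (simp add: key_def lab_def)
  have en: "enum (key A True) ?y i = enum (key A False) ?y i" "enum (key A' True) ?y' i = enum (key A' False) ?y' i" if "i < card ?y" for i
    using that fin injy by (auto intro!: enum_cong k)
  have "motion (card ?y) (enum (key A True) ?y) (enum (key A' True) ?y') t = motion (card ?y) (enum (key A False) ?y) (enum (key A' False) ?y') t"
    unfolding motion_def by (rule image_cong) (use en in auto)
  then show "motion n (tup (A, True, z)) (tup (A', True, z')) t = motion n (tup (A, False, z)) (tup (A', False, z')) t"
    using m[of True] m[of False] r1[OF u] r1[OF v] r2[OF u] r2[OF v] c fin(3) by simp
qed

section \<open>Small neighbourhoods\<close>

text \<open>Within this radius a particle off the feet keeps its arc and its side of each foot, so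
  that only foot particles can change label. The bound 1/2 rules out a change of prong.\<close>

definition comb_radius :: "complex set => real => bool" where
  "comb_radius z \<epsilon> \<longleftrightarrow> good_radius Z z \<epsilon> \<and> \<epsilon> \<le> 1/2 \<and> (\<forall>p\<in>z. (Im p > 0 --> \<epsilon> \<le> Im p) \<and>
     (Im p = 0 --> p \<noteq> 0 --> \<epsilon> \<le> \<bar>Re p\<bar>) \<and> (Im p = 0 --> p \<noteq> 1 --> \<epsilon> \<le> \<bar>Re p - 1\<bar>))"

lemma ex_comb_radius:
  assumes z: "z \<in> topspace X"
  shows "\<exists>\<epsilon>. comb_radius z \<epsilon>"
proof -
  obtain e0 where e0: "good_radius Z z e0" using ex_good_radius[OF starlike] z by (auto simp: topspace_cset)
  have "\<exists>\<epsilon>>0. \<forall>p\<in>z. (Im p > 0 --> \<epsilon> \<le> Im p) \<and>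
     (Im p = 0 --> p \<noteq> 0 --> \<epsilon> \<le> \<bar>Re p\<bar>) \<and> (Im p = 0 --> p \<noteq> 1 --> \<epsilon> \<le> \<bar>Re p - 1\<bar>)"
    using cset_finite[OF z]
  proof (induction z)
    case empty
    then show ?case by (auto intro: exI[of _ 1])
  next
    case (insert p z)
    then obtain e where e: "e > 0" "\<forall>p\<in>z. (Im p > 0 --> e \<le> Im p) \<and>
      (Im p = 0 --> p \<noteq> 0 --> e \<le> \<bar>Re p\<bar>) \<and> (Im p = 0 --> p \<noteq> 1 --> e \<le> \<bar>Re p - 1\<bar>)" by blast
    let ?d = "min (if Im p > 0 then Im p else 1) (min (if Im p = 0 \<and> p \<noteq> 0 then \<bar>Re p\<bar> else 1) (if Im p = 0 \<and> p \<noteq> 1 then \<bar>Re p - 1\<bar> else 1))"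
    have "?d > 0" by (auto simp: complex_eq_iff)
    then show ?case using e by (intro exI[of _ "min e ?d"]) (auto simp: min_le_iff_disj)
  qed
  then obtain e1 where e1: "e1 > 0" "\<forall>p\<in>z. (Im p > 0 --> e1 \<le> Im p) \<and>
     (Im p = 0 --> p \<noteq> 0 --> e1 \<le> \<bar>Re p\<bar>) \<and> (Im p = 0 --> p \<noteq> 1 --> e1 \<le> \<bar>Re p - 1\<bar>)" by blast
  let ?e = "min e0 (min e1 (1/2))"
  have "e0 > 0" using e0 by (simp add: good_radius_def)
  then have "good_radius Z z ?e" using e1(1) by (intro good_radius_mono[OF e0]) auto
  then have "comb_radius z ?e" using e1(2) by (auto simp: comb_radius_def min_le_iff_disj)
  then show ?thesis by blast
qed

definition eps :: "complex set => real" where "eps z = (SOME \<epsilon>. comb_radius z \<epsilon>)"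
definition N :: "complex set => complex set set" where "N z = nbr n Z z (eps z)"
definition near :: "complex set => complex set => complex => complex" where "near z = near_pt (eps z)"
text \<open>The flag that the foot particle of \<open>z\<close> must carry to be described from the
  side of \<open>y\<close>: set if \<open>y\<close> has it up on the prong.\<close>

definition fA :: "complex set => complex set => bool" where "fA z y \<longleftrightarrow> 0 \<in> z \<and> Im (near z y 0) > 0"
definition fB :: "complex set => complex set => bool" where "fB z y \<longleftrightarrow> 1 \<in> z \<and> Im (near z y 1) > 0"

lemma eps: "z \<in> topspace X ==> comb_radius z (eps z)"
  unfolding eps_def using ex_comb_radius by (rule someI_ex)

lemma good_eps: "z \<in> topspace X ==> good_radius Z z (eps z)"
  using eps by (simp add: comb_radius_def)

lemma N_top: "y \<in> N z ==> y \<in> topspace X"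
  by (simp add: N_def nbr_def)

context
  fixes z y assumes z: "z \<in> topspace X" and y: "y \<in> N z"
begin

lemma near_facts:
  "p \<in> z ==> near z y p \<in> y" "p \<in> z ==> dist p (near z y p) < eps z" "inj_on (near z y) z" "near z y ` z = y"
  "p \<in> z ==> near z y p \<in> Z" "p \<in> z ==> closed_segment p (near z y p) \<subseteq> Z"
proof -
  note np = near_pt[OF z good_eps[OF z] y[unfolded N_def]]
  show 1: "p \<in> z ==> near z y p \<in> y" "p \<in> z ==> dist p (near z y p) < eps z" "inj_on (near z y) z" "near z y ` z = y"
    using np by (auto simp: near_def)
  show 2: "p \<in> z ==> near z y p \<in> Z" using 1(1) cset_sub[OF N_top[OF y]] by blast
  show "p \<in> z ==> closed_segment p (near z y p) \<subseteq> Z"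
    using good_eps[OF z] 1(2) 2 unfolding good_radius_def by blast
qed

lemma near_coords:
  assumes "p \<in> z"
  shows "\<bar>Re p - Re (near z y p)\<bar> < eps z" "\<bar>Im p - Im (near z y p)\<bar> < eps z"
  using near_facts(2)[OF assms] abs_Re_le_cmod[of "p - near z y p"] abs_Im_le_cmod[of "p - near z y p"]
  by (auto simp: dist_norm)

text \<open>The radius leaves only a foot particle the choice of an arc, and the flags record this
  choice.\<close>

lemma near_lab:
  assumes p: "p \<in> z"
  shows "lab False False (near z y p) = lab (fA z y) (fB z y) p"
    "lab (fA z y) (fB z y) p = 0 ==> p \<noteq> 0 ==> Re (near z y p) < 0 \<longleftrightarrow> Re p < 0"
    "lab (fA z y) (fB z y) p = 0 ==> p \<noteq> 1 ==> Re (near z y p) > 1 \<longleftrightarrow> Re p > 1"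
proof -
  let ?q = "near z y p"
  have pZ: "p \<in> Z" using cset_sub[OF z] p by blast
  have r: "eps z \<le> 1/2" "Im p > 0 ==> eps z \<le> Im p" "Im p = 0 ==> p \<noteq> 0 ==> eps z \<le> \<bar>Re p\<bar>" "Im p = 0 ==> p \<noteq> 1 ==> eps z \<le> \<bar>Re p - 1\<bar>"
    using eps[OF z] p by (auto simp: comb_radius_def)
  note c = near_coords[OF p] comb_Z[OF pZ] comb_Z[OF near_facts(5)[OF p]]
  show "lab False False ?q = lab (fA z y) (fB z y) p"
  proof (cases "Im p > 0")
    case True
    then have "Im ?q > 0" using c(2) r(2) by linarith
    moreover have "Re ?q = Re p" using True c calculation r(1) by (auto simp: abs_if split: if_splits)
    ultimately show ?thesis using True by (simp add: lab_def)
  next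
    case False
    then have Ip: "Im p = 0" using c(3) by auto
    show ?thesis
    proof (cases "Im ?q > 0")
      case True
      then have R: "Re ?q = 0 \<or> Re ?q = 1" using c(4) by auto
      show ?thesis
      proof (cases "Re ?q = 0")
        case R0: True
        then have "\<bar>Re p\<bar> < eps z" using c(1) by simp
        then have "p = 0" using r(3)[OF Ip] by fastforce
        then show ?thesis using True R0 p by (simp add: lab_def fA_def)
      next
        case R1: False
        then have "\<bar>Re p - 1\<bar> < eps z" using c(1) R by simp
        then have "p = 1" using r(4)[OF Ip] by fastforce
        then show ?thesis using True R1 p by (simp add: lab_def fB_def)
      qed
    next
      case Fq: False
      then have "p = 0 ==> \<not> fA z y" "p = 1 ==> \<not> fB z y" by (auto simp: fA_def fB_def)
      then show ?thesis using Fq False by (auto simp: lab_def)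
    qed
  qed
  assume l: "lab (fA z y) (fB z y) p = 0"
  then have Ip: "Im p = 0" using label_geometry(1)[OF pZ] by blast
  show "p \<noteq> 0 ==> Re ?q < 0 \<longleftrightarrow> Re p < 0" using c(1) r(3)[OF Ip] by (auto simp: abs_if split: if_splits)
  show "p \<noteq> 1 ==> Re ?q > 1 \<longleftrightarrow> Re p > 1" using c(1) r(4)[OF Ip] by (auto simp: abs_if split: if_splits)
qed

text \<open>Particles of equal label lie on one line at distance at least twice the radius, so
  moving each by less than the radius keeps their order.\<close>

lemma near_key:
  assumes p: "p \<in> z" and q: "q \<in> z" and less: "key (fA z y) (fB z y) p < key (fA z y) (fB z y) q"
  shows "key False False (near z y p) < key False False (near z y q)"
proof (rule keyI[OF near_facts(5)[OF p] near_facts(5)[OF q]])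
  let ?l = "lab (fA z y) (fB z y)"
  have pZ: "p \<in> Z" "q \<in> Z" using cset_sub[OF z] p q by auto
  have far: "2 * eps z \<le> dist p q"
    using good_eps[OF z] p q less by (auto simp: good_radius_def)
  have "?l p < ?l q \<or> (?l p = ?l q \<and> (if ?l p = 0 then Re (near z y p) < Re (near z y q) else Im (near z y q) < Im (near z y p)))"
  proof (cases "?l p = ?l q")
    case False
    then show ?thesis using key_lab_mono(1)[OF pZ less] by simp
  next
    case True
    show ?thesis
    proof (cases "?l p = 0")
      case l0: True
      then have "Im p = 0" "Im q = 0" using label_geometry(1)[OF pZ(1)] label_geometry(1)[OF pZ(2)] True by auto
      then have "dist p q = \<bar>Re p - Re q\<bar>" by (simp add: dist_norm cmod_def)
      moreover have "Re p < Re q" using key_lab_mono(2)[OF pZ less True l0] .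
      ultimately have "Re (near z y p) < Re (near z y q)"
        using far near_coords(1)[OF p] near_coords(1)[OF q] by linarith
      then show ?thesis using True l0 by simp
    next
      case l1: False
      then have "?l p = 1 \<or> ?l p = 2" using label_geometry(4)[OF pZ(1), of "fA z y" "fB z y"] by auto
      then have "Re p = Re q"
        using label_geometry(2,3)[OF pZ(1)] label_geometry(2,3)[OF pZ(2)] True by auto
      then have "dist p q = \<bar>Im p - Im q\<bar>" by (simp add: dist_norm cmod_def)
      moreover have "Im q < Im p" using key_lab_mono(3)[OF pZ less True l1] .
      ultimately have "Im (near z y q) < Im (near z y p)"
        using far near_coords(2)[OF p] near_coords(2)[OF q] by linarith
      then show ?thesis using True l1 by simp
    qed
  qed
  then show "lab False False (near z y p) < lab False False (near z y q) \<or>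
    lab False False (near z y p) = lab False False (near z y q) \<and>
    (if lab False False (near z y p) = 0 then Re (near z y p) < Re (near z y q) else Im (near z y q) < Im (near z y p))"
    using near_lab(1)[OF p] near_lab(1)[OF q] by simp
qed

lemma fl_fconfs: "(fA z y, fB z y, z) \<in> fconfs" "(False, False, y) \<in> fconfs"
  using z N_top[OF y] by (auto simp: fconfs_def fA_def fB_def)

text \<open>Passing to the nearby particle is monotone for the keys, hence preserves ranks. Thus the
  slide to \<open>z\<close> is a motion of enumerated particles.\<close>

lemma tup_near:
  assumes i: "i < n"
  shows "tup (False, False, y) i = near z y (tup (fA z y, fB z y, z) i)"
proof -
  note f = fconfs_facts[OF fl_fconfs(2), simplified] and t = tup_facts[OF fl_fconfs(1), simplified]
  have inj: "inj_on (key False False) y" using key_inj f(3) by (rule inj_on_subset)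
  have "near z y (tup (fA z y, fB z y, z) i) = enum (key False False) y i"
    by (rule enum_unique[OF f(1) inj]) (use near_facts(1) near_key t f(2) i in auto)
  then show ?thesis by simp
qed

lemma slide_motion: "slide z (eps z) y = motion n (tup (False, False, y)) (tup (fA z y, fB z y, z))"
proof
  fix t
  let ?u = "tup (fA z y, fB z y, z)"
  have "slide z (eps z) y t = (\<lambda>p. of_real (1 - t) * near z y p + of_real t * p) ` (?u ` {..<n})"
    using tup_facts(3)[OF fl_fconfs(1)] by (simp add: slide_def[OF z good_eps[OF z]] near_def)
  also have "\<dots> = motion n (tup (False, False, y)) ?u t"
    unfolding motion_def image_image by (rule image_cong) (use tup_near in auto)
  finally show "slide z (eps z) y t = motion n (tup (False, False, y)) ?u t" .
qed

lemma compat_slide: "compat (False, False, y) (fA z y, fB z y, z)"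
proof -
  have "lab False False (tup (False, False, y) i) = lab (fA z y) (fB z y) (tup (fA z y, fB z y, z) i) \<and>
    closed_segment (tup (False, False, y) i) (tup (fA z y, fB z y, z) i) \<subseteq> Z" if i: "i < n" for i
    using tup_near[OF i] near_lab(1) near_facts(6) tup_facts(1)[OF fl_fconfs(1) i]
    by (simp add: closed_segment_commute)
  then show ?thesis unfolding compat_def using fl_fconfs by auto
qed

lemma count_near: "card {q \<in> y. Q q} = card {p \<in> z. Q (near z y p)}"
proof -
  have "bij_betw (near z y) {p \<in> z. Q (near z y p)} {q \<in> y. Q q}"
    using near_facts(3,4) by (auto simp: bij_betw_def inj_on_def)
  then show ?thesis by (rule bij_betw_same_card[symmetric])
qed

text \<open>A foot particle that moves up the prong cannot join the outer half of the spine; so the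
  counts of \<open>z\<close>, which index the crossing, can be read off from
  \<open>y\<close>.\<close>

lemma counts_near:
  "na y = na z + of_bool (fA z y)" "nd y = nd z + of_bool (fB z y)"
  "fA z y ==> nb y = nb z" "fB z y ==> ne y = ne z"
proof -
  have l: "{p \<in> z. lab False False (near z y p) = k} = {p \<in> z. lab (fA z y) (fB z y) p = k}" for k
    using near_lab(1) by auto
  show "na y = na z + of_bool (fA z y)"
    using card_lab(1)[OF fl_fconfs(1)] card_lab(1)[OF fl_fconfs(2)] count_near[of "\<lambda>p. lab False False p = 1"] l[of 1] by simp
  show "nd y = nd z + of_bool (fB z y)"
    using card_lab(2)[OF fl_fconfs(1)] card_lab(2)[OF fl_fconfs(2)] count_near[of "\<lambda>p. lab False False p = 2"] l[of 2] by simp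
  show "nb y = nb z" if A: "fA z y"
  proof -
    have "{p \<in> z. lab False False (near z y p) = 0 \<and> Re (near z y p) < 0} = {p \<in> z. lab (fA z y) (fB z y) p = 0 \<and> Re p < 0}"
    proof (rule Collect_cong, rule conj_cong[OF refl])
      fix p assume p: "p \<in> z"
      have "p \<noteq> 0" if "lab (fA z y) (fB z y) p = 0" using that A by (auto simp: lab_def)
      then show "(lab False False (near z y p) = 0 \<and> Re (near z y p) < 0) = (lab (fA z y) (fB z y) p = 0 \<and> Re p < 0)"
        using near_lab(1,2)[OF p] by auto
    qed
    then show ?thesis
      using card_lab(5)[OF fl_fconfs(1)] card_lab(5)[OF fl_fconfs(2)]
        count_near[of "\<lambda>p. lab False False p = 0 \<and> Re p < 0"] by (simp add: nb_def)
  qed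
  show "ne y = ne z" if B: "fB z y"
  proof -
    have "{p \<in> z. lab False False (near z y p) = 0 \<and> Re (near z y p) > 1} = {p \<in> z. lab (fA z y) (fB z y) p = 0 \<and> Re p > 1}"
    proof (rule Collect_cong, rule conj_cong[OF refl])
      fix p assume p: "p \<in> z"
      have "p \<noteq> 1" if "lab (fA z y) (fB z y) p = 0" using that B by (auto simp: lab_def)
      then show "(lab False False (near z y p) = 0 \<and> Re (near z y p) > 1) = (lab (fA z y) (fB z y) p = 0 \<and> Re p > 1)"
        using near_lab(1,3)[OF p] by auto
    qed
    moreover have "{p \<in> y'. lab C D p = 0 \<and> Re p > 1} = {p \<in> y'. Im p = 0 \<and> Re p > 1}" if "y' \<subseteq> Z" for y' C D
      using comb_Z that by (fastforce simp: lab_def)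
    ultimately show ?thesis
      using count_near[of "\<lambda>p. lab False False p = 0 \<and> Re p > 1"] cset_sub[OF z] cset_sub[OF N_top[OF y]]
      by (simp add: ne_def)
  qed
qed

end

lemma N_open: "z \<in> topspace X ==> openin X (N z)"
  unfolding N_def by (rule openin_nbr[OF cset_finite])

lemma N_self: "z \<in> topspace X ==> z \<in> N z"
  unfolding N_def by (rule nbr_self[OF _ good_eps])

lemma near_self: "z \<in> topspace X ==> p \<in> z ==> near z z p = p"
  unfolding near_def by (rule near_pt_self[OF _ good_eps])

lemma flags_self: "z \<in> topspace X ==> \<not> fA z z \<and> \<not> fB z z"
  by (auto simp: fA_def fB_def near_self)

end

locale comb_based = comb n Z + based_space "cset n Z" a for n Z a
begin

definition Lm :: "fconf => fconf => (real => complex set) set" where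
  "Lm u v = transport (motion n (tup u) (tup v))"

lemma compat_refl: "u \<in> fconfs ==> compat u u"
  unfolding compat_def using tup_facts(2) by auto

lemma compat_fconfs: "compat u v ==> u \<in> fconfs" "compat u v ==> v \<in> fconfs"
  by (auto simp: compat_def)

lemma compat_path:
  assumes "compat u v"
  shows "pathin (cset n Z) (motion n (tup u) (tup v))" "motion n (tup u) (tup v) 0 = fset u" "motion n (tup u) (tup v) 1 = fset v"
  using pathin_motion(1)[OF valid_compat[OF assms compat_refl[OF compat_fconfs(2)[OF assms]] assms]]
    tup_facts(3)[OF compat_fconfs(1)[OF assms]] tup_facts(3)[OF compat_fconfs(2)[OF assms]] by simp_all

lemma compat_pcomp: "compat u v ==> fset u \<in> pcomp ==> fset v \<in> pcomp"
  using pcomp_path[OF compat_path(1), of u v 1] compat_path(2,3)[of u v] by simp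

lemma Lm_closed: "compat u v ==> fset u \<in> pcomp ==> Lm u v \<in> carrier G"
  unfolding Lm_def using transport_closed[OF compat_path(1)] compat_path(2) by simp

lemma Lm_trans:
  assumes c: "compat u v" "compat v w" "compat u w" and p: "fset u \<in> pcomp"
  shows "Lm u v \<otimes>\<^bsub>G\<^esub> Lm v w = Lm u w"
proof -
  note cp = compat_path[OF c(1)] compat_path[OF c(2)] compat_path[OF c(3)]
  have "Lm u v \<otimes>\<^bsub>G\<^esub> Lm v w = transport (path_join (motion n (tup u) (tup v)) (motion n (tup v) (tup w)))"
    unfolding Lm_def using cp p by (intro transport_join[symmetric]) auto
  also have "\<dots> = Lm u w"
    unfolding Lm_def using cp p by (intro transport_phom[OF phom_motion[OF valid_compat[OF c]]]) auto
  finally show ?thesis .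
qed

lemma Lm_refl: "u \<in> fconfs ==> fset u \<in> pcomp ==> Lm u u = \<one>\<^bsub>G\<^esub>"
  using Lm_trans[OF compat_refl compat_refl compat_refl] Lm_closed[OF compat_refl] by (metis G.l_cancel_one')

end

section \<open>Transport between cells\<close>

lemma (in group) mult_inv_cancel_right:
  assumes "x \<in> carrier G" "y \<in> carrier G" "l \<in> carrier G"
  shows "x \<otimes> l \<otimes> inv (y \<otimes> l) = x \<otimes> inv y"
proof -
  have "x \<otimes> l \<otimes> inv (y \<otimes> l) = x \<otimes> (l \<otimes> inv l) \<otimes> inv y" using assms by (simp only: inv_mult_group m_assoc inv_closed m_closed)
  then show ?thesis using assms by simp
qed

lemma (in group) mult_inv_cancel_left:
  assumes "x \<in> carrier G" "y \<in> carrier G" "w \<in> carrier G"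
  shows "x \<otimes> inv y \<otimes> (y \<otimes> w) = x \<otimes> w"
proof -
  have "x \<otimes> inv y \<otimes> (y \<otimes> w) = x \<otimes> (inv y \<otimes> y) \<otimes> w" using assms by (simp only: m_assoc inv_closed m_closed)
  then show ?thesis using assms by simp
qed

context comb begin

lemma compatD:
  assumes "compat u v" "i < n"
  shows "flab u (tup u i) = flab v (tup v i)" "closed_segment (tup u i) (tup v i) \<subseteq> Z"
  using assms unfolding compat_def by blast+

lemma flab_eq: "flab u = lab (flagA u) (flagB u)" by (cases u) auto

lemma flab_geometry:
  assumes "u \<in> fconfs" "i < n"
  shows "flab u (tup u i) = 0 ==> Im (tup u i) = 0"
    "flab u (tup u i) = 1 ==> Re (tup u i) = 0 \<and> Im (tup u i) \<ge> 0"
    "flab u (tup u i) = 2 ==> Re (tup u i) = 1 \<and> Im (tup u i) \<ge> 0" "flab u (tup u i) \<in> {0, 1, 2}"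
  using label_geometry[OF tup_facts(2)[OF assms], where A = "flagA u" and B = "flagB u"] by (auto simp: flab_eq)

lemma segment_trans:
  assumes f: "u \<in> fconfs" "v \<in> fconfs" "w \<in> fconfs" and i: "i < n"
    and l: "flab u (tup u i) = flab v (tup v i)" "flab v (tup v i) = flab w (tup w i)"
    and s: "closed_segment (tup u i) (tup v i) \<subseteq> Z" "closed_segment (tup v i) (tup w i) \<subseteq> Z"
  shows "closed_segment (tup u i) (tup w i) \<subseteq> Z"
proof -
  note g = flab_geometry[OF f(1) i] flab_geometry[OF f(2) i] flab_geometry[OF f(3) i]
  have r: "closed_segment x z \<subseteq> closed_segment x y \<union> closed_segment y z" for x y z :: real
    by (auto simp: closed_segment_eq_real_ivl split: if_splits)
  have "closed_segment (tup u i) (tup w i) \<subseteq> closed_segment (tup u i) (tup v i) \<union> closed_segment (tup v i) (tup w i)"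
  proof (cases "flab u (tup u i) = 0")
    case True
    then have "Im (tup u i) = 0" "Im (tup v i) = 0" "Im (tup w i) = 0" using g l by auto
    then show ?thesis using r[of "Re (tup u i)" "Re (tup w i)" "Re (tup v i)"] by (auto simp: closed_segment_same_Im)
  next
    case False
    then have "Re (tup v i) = Re (tup u i)" "Re (tup w i) = Re (tup u i)" using g l by auto
    then show ?thesis using r[of "Im (tup u i)" "Im (tup w i)" "Im (tup v i)"] by (auto simp: closed_segment_same_Re)
  qed
  then show ?thesis using s by blast
qed

text \<open>Segments on a common line compose, but the side clauses would not pass through an
  unflagged \<open>v\<close>; the assumptions on the flags make them vacuous for the ends.\<close>

lemma compat_trans:
  assumes uv: "compat u v" and vw: "compat v w" and fl: "\<not> (flagA u \<and> flagA w)" "\<not> (flagB u \<and> flagB w)"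
  shows "compat u w"
  unfolding compat_def using assms segment_trans[of u v w] unfolding compat_def by auto

lemma count_tup:
  assumes u: "u \<in> fconfs"
  shows "card {p \<in> fset u. Q p} = card {i. i < n \<and> Q (tup u i)}"
proof -
  have "bij_betw (tup u) {i. i < n \<and> Q (tup u i)} {p \<in> fset u. Q p}"
    using tup_facts(3,4)[OF u] by (auto simp: bij_betw_def inj_on_def)
  then show ?thesis by (rule bij_betw_same_card[symmetric])
qed

lemma compat_counts:
  assumes "compat (A, B, y) (A', B', y')"
  shows "na y + of_bool A = na y' + of_bool A'" "nd y + of_bool B = nd y' + of_bool B'"
proof -
  have f: "(A, B, y) \<in> fconfs" "(A', B', y') \<in> fconfs" using assms by (auto simp: compat_def)
  have "{i. i < n \<and> lab A B (tup (A, B, y) i) = k} = {i. i < n \<and> lab A' B' (tup (A', B', y') i) = k}" for k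
    using compatD(1)[OF assms] by auto
  then have "card {p \<in> y. lab A B p = k} = card {p \<in> y'. lab A' B' p = k}" for k
    using count_tup[OF f(1), of "\<lambda>p. lab A B p = k"] count_tup[OF f(2), of "\<lambda>p. lab A' B' p = k"] by simp
  then show "na y + of_bool A = na y' + of_bool A'" "nd y + of_bool B = nd y' + of_bool B'"
    using card_lab(1,2)[OF f(1)] card_lab(1,2)[OF f(2)] by simp_all
qed

text \<open>Before the end of the motion a prong particle still has positive height, so the
  configuration has not left the cell of \<open>y\<close>.\<close>

lemma motion_counts:
  assumes c: "compat (False, False, y) u" and t: "0 \<le> t" "t < 1"
  shows "na (motion n (tup (False, False, y)) (tup u) t) = na y" "nd (motion n (tup (False, False, y)) (tup u) t) = nd y"
proof -
  let ?y = "(False, False, y) :: fconf"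
  let ?c = "\<lambda>i. of_real (1 - t) * tup ?y i + of_real t * tup u i"
  have f: "?y \<in> fconfs" "u \<in> fconfs" using c by (auto simp: compat_def)
  have "compat u u" unfolding compat_def using f(2) tup_facts(2) by auto
  then have inj: "inj_on ?c {..<n}"
    using valid_motionD(2)[OF valid_compat[OF c _ c], of "1 - t" t 0] t by simp
  have cnt: "card {p \<in> motion n (tup ?y) (tup u) t. Q p} = card {i. i < n \<and> Q (?c i)}" for Q
  proof -
    have "bij_betw ?c {i. i < n \<and> Q (?c i)} {p \<in> motion n (tup ?y) (tup u) t. Q p}"
      using inj by (auto simp: bij_betw_def inj_on_def motion_def)
    then show ?thesis by (rule bij_betw_same_card[symmetric])
  qed
  have l: "(Im (?c i) > 0 \<and> Re (?c i) = 0 \<longleftrightarrow> Im (tup ?y i) > 0 \<and> Re (tup ?y i) = 0) \<and>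
    (Im (?c i) > 0 \<and> Re (?c i) \<noteq> 0 \<longleftrightarrow> Im (tup ?y i) > 0 \<and> Re (tup ?y i) \<noteq> 0)" if i: "i < n" for i
  proof -
    have e: "flab u (tup u i) = lab False False (tup ?y i)" using compatD(1)[OF c i] by simp
    have q: "Im (tup ?y i) \<ge> 0" "Im (tup ?y i) > 0 ==> Re (tup ?y i) = 0 \<or> Re (tup ?y i) = 1"
      using comb_Z[OF tup_facts(2)[OF f(1) i]] by linarith+
    show ?thesis
    proof (cases "Im (tup ?y i) > 0")
      case True
      then have "flab u (tup u i) = (if Re (tup ?y i) = 0 then 1 else 2)" unfolding e by (simp add: lab_def)
      then have r: "Re (tup u i) = Re (tup ?y i)" "Im (tup u i) \<ge> 0"
        using flab_geometry(2,3)[OF f(2) i] q(2)[OF True] by (auto split: if_splits)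
      have "(1 - t) * Im (tup ?y i) > 0" "t * Im (tup u i) \<ge> 0" using True t r(2) by simp_all
      moreover have "(1 - t) * Re (tup ?y i) + t * Re (tup u i) = Re (tup ?y i)" unfolding r(1) by (simp add: algebra_simps)
      ultimately have "Im (?c i) > 0" "Re (?c i) = Re (tup ?y i)" by simp_all
      then show ?thesis using True by simp
    next
      case False
      then have "Im (tup ?y i) = 0" "Im (tup u i) = 0"
        using flab_geometry(1)[OF f(2) i] q(1) unfolding e by (simp_all add: lab_def)
      then show ?thesis by simp
    qed
  qed
  show "na (motion n (tup ?y) (tup u) t) = na y" "nd (motion n (tup ?y) (tup u) t) = nd y"
    unfolding na_def nd_def cnt using count_tup[OF f(1)] l by (auto intro!: arg_cong[where f = card])
qed

end

context comb_based begin

text \<open>The cell that touches \<open>u\<close> on the side selected by its flags: its members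
  are described without flags.\<close>

definition cls :: "fconf => complex set set" where "cls u = {y. compat (False, False, y) u}"
text \<open>The base point represents its own cell, which makes \<open>m\<close> trivial
  there.\<close>

definition rep :: "fconf => complex set" where "rep u = (if a \<in> cls u then a else SOME y. y \<in> cls u)"
definition m :: "fconf => (real => complex set) set" where "m u = Lm (False, False, rep u) u"

lemma cls_eq:
  assumes "compat u v"
  shows "cls u = cls v"
  unfolding cls_def
proof (rule Collect_cong, rule iffI)
  fix y
  show "compat (False, False, y) v" if "compat (False, False, y) u" by (rule compat_trans[OF that assms]) simp_all
  show "compat (False, False, y) u" if "compat (False, False, y) v" by (rule compat_trans[OF that compat_sym[OF assms]]) simp_all
qed

lemma rep_eq: "cls u = cls v ==> rep u = rep v"
  by (simp add: rep_def)

lemma rep: "cls u \<noteq> {} ==> compat (False, False, rep u) u"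
  using some_in_eq[of "cls u"] by (auto simp: rep_def cls_def)

lemma rep_pcomp: "cls u \<noteq> {} ==> fset u \<in> pcomp ==> rep u \<in> pcomp"
  using compat_pcomp[OF compat_sym[OF rep]] by simp

lemma m_closed: "cls u \<noteq> {} ==> fset u \<in> pcomp ==> m u \<in> carrier G"
  unfolding m_def using Lm_closed[OF rep] rep_pcomp by simp

lemma m_trans:
  assumes c: "compat u v" and u: "cls u \<noteq> {}" "fset u \<in> pcomp"
  shows "m u \<otimes>\<^bsub>G\<^esub> Lm u v = m v"
proof -
  have e: "cls v = cls u" "rep v = rep u" using cls_eq[OF c] rep_eq[of u v] by auto
  show ?thesis unfolding m_def e
    by (rule Lm_trans[OF rep[OF u(1)] c]) (use rep[of v] e u rep_pcomp[OF u] in auto)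
qed

lemma cls_self: "y \<in> topspace X ==> y \<in> cls (False, False, y)"
  using compat_refl[of "(False, False, y)"] by (simp add: cls_def fconfs_def)

lemma m_base: "m (False, False, a) = \<one>\<^bsub>G\<^esub>"
  unfolding m_def rep_def using cls_self[OF base_in] Lm_refl[of "(False, False, a)"] base_in base_pcomp by (simp add: fconfs_def)

lemma motion_segment:
  assumes "\<And>t. t \<in> {0..1} ==> motion n x x' t \<subseteq> Z" "i < n"
  shows "closed_segment (x i) (x' i) \<subseteq> Z"
proof
  fix p assume "p \<in> closed_segment (x i) (x' i)"
  then obtain t where t: "0 \<le> t" "t \<le> 1" "p = of_real (1 - t) * x i + of_real t * x' i"
    by (auto simp: in_segment scaleR_conv_of_real)
  then show "p \<in> Z" using assms(1)[of t] assms(2) by (auto simp: motion_def)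
qed

lemma compat_motion_sub:
  assumes "compat u v" "t \<in> {0..1}"
  shows "motion n (tup u) (tup v) t \<subseteq> Z"
proof (rule cset_sub)
  show "motion n (tup u) (tup v) t \<in> topspace X"
    using compat_path(1)[OF assms(1)] assms(2) unfolding pathin_def continuous_map_def by (auto simp: Pi_iff)
qed

text \<open>The quotient is the value of crossing foot 0 at \<open>z\<close>: from the prong side
  in, out on the spine side. A motion that keeps the foot particle fixed multiplies both factors by
  the same transport, by \<open>switchA\<close>, so the quotient does not change.\<close>

lemma alpha_eq:
  assumes c: "compat (True, B, z) (True, B', z')" and nb: "nb z = nb z'" and B: "\<not> (B \<and> B')"
    and ne: "cls (True, B, z) \<noteq> {}" "cls (False, B, z) \<noteq> {}" and p: "z \<in> pcomp"
  shows "m (True, B, z) \<otimes>\<^bsub>G\<^esub> inv\<^bsub>G\<^esub> (m (False, B, z)) = m (True, B', z') \<otimes>\<^bsub>G\<^esub> inv\<^bsub>G\<^esub> (m (False, B', z'))"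
proof -
  note f = compat_fconfs[OF c] and cc = compat_counts[OF c]
  have sw: "motion n (tup (True, B, z)) (tup (True, B', z')) = motion n (tup (False, B, z)) (tup (False, B', z'))"
    by (rule switchA[OF f cc(2) nb])
  have f': "(False, B, z) \<in> fconfs" "(False, B', z') \<in> fconfs" using f by (auto simp: fconfs_def)
  have c': "compat (False, B, z) (False, B', z')"
    unfolding compat_def using f' B tup_counts(1)[OF f'] cc motion_segment[OF compat_motion_sub[OF c, unfolded sw]] by auto
  have L: "Lm (False, B, z) (False, B', z') = Lm (True, B, z) (True, B', z')" by (simp only: Lm_def sw)
  have cl: "m (True, B, z) \<in> carrier G" "m (False, B, z) \<in> carrier G" "Lm (True, B, z) (True, B', z') \<in> carrier G"
    using m_closed ne p Lm_closed[OF c] by auto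
  have "m (True, B', z') \<otimes>\<^bsub>G\<^esub> inv\<^bsub>G\<^esub> (m (False, B', z')) =
    (m (True, B, z) \<otimes>\<^bsub>G\<^esub> Lm (True, B, z) (True, B', z')) \<otimes>\<^bsub>G\<^esub> inv\<^bsub>G\<^esub> (m (False, B, z) \<otimes>\<^bsub>G\<^esub> Lm (True, B, z) (True, B', z'))"
    using m_trans[OF c ne(1)] m_trans[OF c' ne(2)] p L by simp
  also have "\<dots> = m (True, B, z) \<otimes>\<^bsub>G\<^esub> inv\<^bsub>G\<^esub> (m (False, B, z))"
    using cl by (rule G.mult_inv_cancel_right)
  finally show ?thesis by simp
qed

lemma delta_eq:
  assumes c: "compat (A, True, z) (A', True, z')" and ne: "ne z = ne z'" and A: "\<not> (A \<and> A')"
    and cl: "cls (A, True, z) \<noteq> {}" "cls (A, False, z) \<noteq> {}" and p: "z \<in> pcomp"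
  shows "m (A, True, z) \<otimes>\<^bsub>G\<^esub> inv\<^bsub>G\<^esub> (m (A, False, z)) = m (A', True, z') \<otimes>\<^bsub>G\<^esub> inv\<^bsub>G\<^esub> (m (A', False, z'))"
proof -
  note f = compat_fconfs[OF c] and cc = compat_counts[OF c]
  have sw: "motion n (tup (A, True, z)) (tup (A', True, z')) = motion n (tup (A, False, z)) (tup (A', False, z'))"
    by (rule switchB[OF f cc(1) _ ne]) (use cc(2) in simp)
  have f': "(A, False, z) \<in> fconfs" "(A', False, z') \<in> fconfs" using f by (auto simp: fconfs_def)
  have c': "compat (A, False, z) (A', False, z')"
    unfolding compat_def using f' A tup_counts(1)[OF f'] cc motion_segment[OF compat_motion_sub[OF c, unfolded sw]] by auto
  have L: "Lm (A, False, z) (A', False, z') = Lm (A, True, z) (A', True, z')" by (simp only: Lm_def sw)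
  have cl': "m (A, True, z) \<in> carrier G" "m (A, False, z) \<in> carrier G" "Lm (A, True, z) (A', True, z') \<in> carrier G"
    using m_closed cl p Lm_closed[OF c] by auto
  have "m (A', True, z') \<otimes>\<^bsub>G\<^esub> inv\<^bsub>G\<^esub> (m (A', False, z')) =
    (m (A, True, z) \<otimes>\<^bsub>G\<^esub> Lm (A, True, z) (A', True, z')) \<otimes>\<^bsub>G\<^esub> inv\<^bsub>G\<^esub> (m (A, False, z) \<otimes>\<^bsub>G\<^esub> Lm (A, True, z) (A', True, z'))"
    using m_trans[OF c cl(1)] m_trans[OF c' cl(2)] p L by simp
  also have "\<dots> = m (A, True, z) \<otimes>\<^bsub>G\<^esub> inv\<^bsub>G\<^esub> (m (A, False, z))"
    using cl' by (rule G.mult_inv_cancel_right)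
  finally show ?thesis by simp
qed

text \<open>Shortly before its end the motion is inside \<open>N z\<close> but still in the cell of
  \<open>y\<close>; there the counts determine the flags.\<close>

lemma near_boundary:
  assumes c: "compat (False, False, y) (A, B, z)"
  shows "\<exists>x\<in>N z. fA z x = A \<and> fB z x = B"
proof -
  let ?p = "motion n (tup (False, False, y)) (tup (A, B, z))"
  have z: "z \<in> topspace X" using fconfs_facts(4)[OF compat_fconfs(2)[OF c]] by simp
  have "openin (top_of_set {0..1}) {t \<in> {0..1}. ?p t \<in> N z}"
    using openin_continuous_map_preimage[OF compat_path(1)[OF c, unfolded pathin_def] N_open[OF z]] by simp
  then obtain T where T: "open T" "{t \<in> {0..1}. ?p t \<in> N z} = {0..1} \<inter> T" by (auto simp: openin_open)
  have "1 \<in> T" using T(2) compat_path(3)[OF c] N_self[OF z] by auto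
  then obtain e where e: "e > 0" "\<And>t. dist t 1 < e ==> t \<in> T" using T(1) unfolding open_dist by blast
  define t where "t = max 0 (1 - e / 2)"
  have t: "0 \<le> t" "t < 1" "t \<in> T" using e by (auto simp: t_def dist_real_def)
  then have "t \<in> {t \<in> {0..1}. ?p t \<in> N z}" unfolding T(2) by simp
  then have x: "?p t \<in> N z" by blast
  have "of_bool (fA z (?p t)) = (of_bool A :: nat)" using counts_near(1)[OF z x] motion_counts(1)[OF c t(1,2)] compat_counts(1)[OF c] by simp
  moreover have "of_bool (fB z (?p t)) = (of_bool B :: nat)" using counts_near(2)[OF z x] motion_counts(2)[OF c t(1,2)] compat_counts(2)[OF c] by simp
  ultimately show ?thesis using x by (auto simp only: of_bool_eq_iff)
qed

end

text \<open>\<open>lA x\<close> and \<open>lB x\<close> are values for crossing a foot, read off at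
  a configuration \<open>x\<close> just beyond the crossing. They have to agree for all such
  \<open>x\<close> near one \<open>z\<close>, and values at different feet have to commute where
  both feet can be crossed.\<close>

locale comb_cocycle = comb_based n Z a + H: group H for n Z a and H :: "('h, 'b) monoid_scheme" (structure) +
  fixes lA lB :: "complex set => 'h"
  assumes l_closed: "x \<in> topspace X ==> lA x \<in> carrier H \<and> lB x \<in> carrier H"
    and lA_eq: "z \<in> topspace X ==> x \<in> N z ==> y \<in> N z ==> fA z x ==> fA z y ==> lA x = lA y"
    and lB_eq: "z \<in> topspace X ==> x \<in> N z ==> y \<in> N z ==> fB z x ==> fB z y ==> lB x = lB y"
    and l_commute: "z \<in> topspace X ==> x \<in> N z ==> y \<in> N z ==> fA z x ==> fB z y ==> lA x \<otimes> lB y = lB y \<otimes> lA x"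
begin

text \<open>Nearby configurations differ by at most one particle on a prong; the side with more
  particles supplies the value.\<close>

definition cross :: "nat => nat => 'h => 'h => 'h" where
  "cross i j g h = (if i = Suc j then g else if j = Suc i then inv h else \<one>)"

definition tau :: "complex set => complex set => 'h" where
  "tau x y = cross (na x) (na y) (lA x) (lA y) \<otimes> cross (nd x) (nd y) (lB x) (lB y)"

definition opt :: "bool => 'h => 'h" where "opt b g = (if b then g else \<one>)"

text \<open>Near \<open>z\<close> the cocycle is a coboundary: its potential multiplies the common
  values \<open>g\<close> and \<open>h\<close> of the feet whose particle has gone up. The cocycle
  identity follows at once; commutation is used to bring the four factors into order.\<close>

lemma tau_potential:
  assumes z: "z \<in> topspace X"
  shows "\<exists>g h. g \<in> carrier H \<and> h \<in> carrier H \<and>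
    (\<forall>x\<in>N z. \<forall>y\<in>N z. tau x y = opt (fA z x) g \<otimes> opt (fB z x) h \<otimes> inv (opt (fA z y) g \<otimes> opt (fB z y) h)) \<and>
    (\<forall>x\<in>N z. (fA z x --> lA x = g) \<and> (fB z x --> lB x = h))"
proof -
  \<comment> \<open>One if no configuration near \<open>z\<close> lies beyond the foot; then the
    value never enters.\<close>
  define g where "g = (if \<exists>x\<in>N z. fA z x then lA (SOME x. x \<in> N z \<and> fA z x) else \<one>)"
  define h where "h = (if \<exists>x\<in>N z. fB z x then lB (SOME x. x \<in> N z \<and> fB z x) else \<one>)"
  have sA: "(SOME x. x \<in> N z \<and> fA z x) \<in> N z \<and> fA z (SOME x. x \<in> N z \<and> fA z x)" if "\<exists>x\<in>N z. fA z x"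
    using that by (metis (mono_tags, lifting) someI_ex)
  have sB: "(SOME x. x \<in> N z \<and> fB z x) \<in> N z \<and> fB z (SOME x. x \<in> N z \<and> fB z x)" if "\<exists>x\<in>N z. fB z x"
    using that by (metis (mono_tags, lifting) someI_ex)
  have gA: "lA x = g" if x: "x \<in> N z" "fA z x" for x
  proof -
    have ex: "\<exists>x\<in>N z. fA z x" using x by blast
    show ?thesis unfolding g_def if_P[OF ex] using lA_eq[OF z x(1) _ x(2)] sA[OF ex] by blast
  qed
  have hB: "lB x = h" if x: "x \<in> N z" "fB z x" for x
  proof -
    have ex: "\<exists>x\<in>N z. fB z x" using x by blast
    show ?thesis unfolding h_def if_P[OF ex] using lB_eq[OF z x(1) _ x(2)] sB[OF ex] by blast
  qed
  have "g = \<one> \<or> (\<exists>x\<in>N z. g = lA x)" "h = \<one> \<or> (\<exists>x\<in>N z. h = lB x)" using gA hB unfolding g_def h_def by metis+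
  then have cl: "g \<in> carrier H" "h \<in> carrier H" using l_closed N_top by auto
  have comm: "g \<otimes> h = h \<otimes> g"
  proof (cases "(\<exists>x\<in>N z. fA z x) \<and> (\<exists>x\<in>N z. fB z x)")
    case True
    then show ?thesis using gA hB l_commute[OF z] by metis
  next
    case False
    then have "g = \<one> \<or> h = \<one>" by (auto simp: g_def h_def)
    then show ?thesis using cl by auto
  qed
  have comm': "inv g \<otimes> h = h \<otimes> inv g" "g \<otimes> inv h = inv h \<otimes> g" "inv g \<otimes> inv h = inv h \<otimes> inv g"
    using H.int_pow_commute[OF cl comm, of "-1" 1] H.int_pow_commute[OF cl comm, of 1 "-1"] H.int_pow_commute[OF cl comm, of "-1" "-1"] cl
    by (simp_all add: H.int_pow_neg H.int_pow_1)
  have "tau x y = opt (fA z x) g \<otimes> opt (fB z x) h \<otimes> inv (opt (fA z y) g \<otimes> opt (fB z y) h)" if xy: "x \<in> N z" "y \<in> N z" for x y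
  proof -
    note c = counts_near(1,2)[OF z xy(1)] counts_near(1,2)[OF z xy(2)]
    have "cross (na x) (na y) (lA x) (lA y) = opt (fA z x) g \<otimes> inv (opt (fA z y) g)"
      using gA xy c cl by (auto simp: cross_def opt_def)
    moreover have "cross (nd x) (nd y) (lB x) (lB y) = opt (fB z x) h \<otimes> inv (opt (fB z y) h)"
      using hB xy c cl by (auto simp: cross_def opt_def)
    ultimately have e: "tau x y = opt (fA z x) g \<otimes> inv (opt (fA z y) g) \<otimes> (opt (fB z x) h \<otimes> inv (opt (fB z y) h))"
      by (simp add: tau_def)
    define P Q R S where "P = opt (fA z x) g" "Q = opt (fB z x) h" "R = opt (fA z y) g" "S = opt (fB z y) h"
    have c: "P \<in> carrier H" "Q \<in> carrier H" "R \<in> carrier H" "S \<in> carrier H" using cl by (auto simp: P_Q_R_S_def opt_def)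
    have k: "inv R \<otimes> Q = Q \<otimes> inv R" "inv R \<otimes> inv S = inv S \<otimes> inv R"
      using cl comm' by (simp_all add: P_Q_R_S_def opt_def)
    have "P \<otimes> inv R \<otimes> (Q \<otimes> inv S) = P \<otimes> (inv R \<otimes> Q) \<otimes> inv S" using c by (simp only: H.m_assoc H.inv_closed H.m_closed)
    also have "\<dots> = P \<otimes> Q \<otimes> (inv R \<otimes> inv S)" unfolding k(1) using c by (simp only: H.m_assoc H.inv_closed H.m_closed)
    also have "\<dots> = P \<otimes> Q \<otimes> inv (R \<otimes> S)" unfolding k(2) using c by (simp only: H.inv_mult_group)
    finally show ?thesis unfolding e P_Q_R_S_def .
  qed
  then show ?thesis using cl gA hB by blast
qed

sublocale flat_cocycle "cset n Z" a H tau N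
proof
  fix z x y assume z: "z \<in> topspace X" and x: "x \<in> N z" and y: "y \<in> N z"
  obtain g h where gh: "g \<in> carrier H" "h \<in> carrier H"
    "\<And>x y. x \<in> N z ==> y \<in> N z ==> tau x y = opt (fA z x) g \<otimes> opt (fB z x) h \<otimes> inv (opt (fA z y) g \<otimes> opt (fB z y) h)"
    "\<And>x. x \<in> N z ==> fA z x ==> lA x = g" "\<And>x. x \<in> N z ==> fB z x ==> lB x = h"
    using tau_potential[OF z] by blast
  define f where "f x = opt (fA z x) g \<otimes> opt (fB z x) h" for x
  have f: "f x \<in> carrier H" for x using gh(1,2) by (simp add: f_def opt_def)
  have t: "tau x y = f x \<otimes> inv (f y)" if "x \<in> N z" "y \<in> N z" for x y using gh(3)[OF that] by (simp add: f_def)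
  show "tau x y \<in> carrier H" using t[OF x y] f by simp
  fix w assume w: "w \<in> N z"
  have "f x \<otimes> inv (f y) \<otimes> (f y \<otimes> inv (f w)) = f x \<otimes> inv (f w)"
    using f by (intro H.mult_inv_cancel_left) auto
  then show "tau x y \<otimes> tau y w = tau x w" using t[OF x y] t[OF y w] t[OF x w] by simp
qed (use N_open N_self in auto)

lemma tau_center:
  assumes "z \<in> topspace X" "y \<in> N z"
  shows "tau y z = opt (fA z y) (lA y) \<otimes> opt (fB z y) (lB y)"
proof -
  obtain g h where gh: "g \<in> carrier H" "h \<in> carrier H"
    "\<And>x y. x \<in> N z ==> y \<in> N z ==> tau x y = opt (fA z x) g \<otimes> opt (fB z x) h \<otimes> inv (opt (fA z y) g \<otimes> opt (fB z y) h)"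
    "\<And>x. x \<in> N z ==> fA z x ==> lA x = g" "\<And>x. x \<in> N z ==> fB z x ==> lB x = h"
    using tau_potential[OF assms(1)] by blast
  then show ?thesis using gh(3)[OF assms(2) N_self[OF assms(1)]] gh(4,5)[OF assms(2)] flags_self[OF assms(1)]
    by (auto simp: opt_def)
qed

lemma slide_Lm: "z \<in> topspace X ==> y \<in> N z ==> transport (slide z (eps z) y) = Lm (False, False, y) (fA z y, fB z y, z)"
  by (simp add: slide_motion Lm_def)

text \<open>\<open>retraction\<close> with the slides as paths to the centre. What remains to be
  found in each case is the gauge \<open>k\<close>.\<close>

lemma comb_retraction:
  assumes \<psi>: "\<psi> \<in> hom H G" and k: "\<And>x. x \<in> pcomp ==> k x \<in> carrier G" and ka: "k a = \<one>\<^bsub>G\<^esub>"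
    and key: "\<And>y z. z \<in> topspace X ==> z \<in> pcomp ==> y \<in> N z ==>
       k y \<otimes>\<^bsub>G\<^esub> Lm (False, False, y) (fA z y, fB z y, z) \<otimes>\<^bsub>G\<^esub> inv\<^bsub>G\<^esub> (k z) = \<psi> (opt (fA z y) (lA y) \<otimes> opt (fB z y) (lB y))"
    and x: "x \<in> carrier G"
  shows "\<psi> (Hol x) = x"
proof -
  obtain p where p: "p \<in> loops_at X a" "x = loop_class X a p"
    using x by (auto simp: fundamental_group_simps)
  have "\<psi> (hol p) = loop_class X a p"
  proof (rule retraction[where e = "\<lambda>y z. slide z (eps z) y" and n = k, OF _ _ \<psi> k ka _ p(1)])
    fix y z assume z: "z \<in> topspace X" and y: "y \<in> N z"
    show "pathin X (slide z (eps z) y) \<and> slide z (eps z) y 0 = y \<and> slide z (eps z) y 1 = z"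
      using pathin_slide[OF z good_eps[OF z]] slide_ends[OF z good_eps[OF z]] y by (simp add: N_def)
    show "z \<in> pcomp ==> k y \<otimes>\<^bsub>G\<^esub> transport (slide z (eps z) y) \<otimes>\<^bsub>G\<^esub> inv\<^bsub>G\<^esub> (k z) = \<psi> (tau y z)"
      using key[OF z _ y] by (simp add: slide_Lm[OF z y] tau_center[OF z y])
  next
    fix z p assume z: "z \<in> topspace X" and p: "pathin X p" "\<And>t. t \<in> {0..1} ==> p t \<in> N z"
    show "phom X p (path_join (slide z (eps z) (p 0)) (path_rev (slide z (eps z) (p 1))))"
      by (rule phom_slide[OF z good_eps[OF z] p(1)]) (use p(2) in \<open>simp add: N_def\<close>)
  qed
  then show ?thesis using Hol_loop_class[OF p(1)] p(2) by simp
qed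

end

section \<open>Combs with one prong\<close>

lemma subgroup_free_words: "subgroup free_words (word_group UNIV)"
proof -
  interpret group "word_group UNIV :: 'a letter list monoid" by (rule group_word_group)
  have sub: "free_words \<subseteq> words_over UNIV" by (auto simp: free_words_def words_over_def)
  show ?thesis
  proof (rule subgroupI)
    show "free_words \<subseteq> carrier (word_group UNIV)" using sub by simp
    show "free_words \<noteq> {}" by (auto simp: free_words_def reduced_word_def intro: exI[of _ "[]"])
    show "inv\<^bsub>word_group UNIV\<^esub> w \<in> free_words" if "w \<in> free_words" for w :: "'a letter list"
      using free_words_winv[OF that] inv_word_group subsetD[OF sub that] by metis
  qed (simp add: free_words_mult)
qed

lemma single_free_word: "[Fr x s] \<in> free_words" "[] \<in> free_words"
  by (simp_all add: free_words_def reduced_word_def)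

lemma (in group) independent_pair_hom_image:
  assumes h: "h \<in> hom G K" and K: "group K" and inj: "\<And>x. x \<in> carrier G ==> h x = \<one>\<^bsub>K\<^esub> ==> x = \<one>" and xy: "independent_pair x y"
  shows "group.independent_pair K (h x) (h y)"
proof -
  interpret K: group K by (rule K)
  interpret h: group_hom G K h using h by unfold_locales
  have c: "x \<in> carrier G" "y \<in> carrier G" "x \<otimes> y = y \<otimes> x" and ind: "\<And>i j. x [^] (i::int) \<otimes> y [^] (j::int) = \<one> ==> i = 0 \<and> j = 0"
    using xy by (auto simp: independent_pair_def)
  have "i = 0 \<and> j = 0" if "h x [^]\<^bsub>K\<^esub> i \<otimes>\<^bsub>K\<^esub> h y [^]\<^bsub>K\<^esub> j = \<one>\<^bsub>K\<^esub>" for i j :: int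
    using that c by (intro ind inj) (simp_all add: h.hom_int_pow)
  moreover have "h x \<otimes>\<^bsub>K\<^esub> h y = h y \<otimes>\<^bsub>K\<^esub> h x" using c by (metis h.hom_mult)
  ultimately show ?thesis unfolding K.independent_pair_def using c by auto
qed

locale tripod = comb_based +
  assumes no_prong: "p \<in> Z ==> Im p > 0 ==> Re p = 0"
begin

lemma nd_0:
  assumes "y \<in> topspace X"
  shows "nd y = 0"
proof -
  have "{p \<in> y. Im p > 0 \<and> Re p \<noteq> 0} = {}" using cset_sub[OF assms] no_prong by blast
  then show ?thesis by (simp only: nd_def card.empty)
qed

lemma not_fB:
  assumes z: "z \<in> topspace X" and y: "y \<in> N z"
  shows "\<not> fB z y"
  using counts_near(2)[OF z y] nd_0[OF z] nd_0[OF N_top[OF y]] by (cases "fB z y") simp_all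

definition free_group :: "(complex set set \<times> nat) letter list monoid" where
  "free_group = word_group UNIV\<lparr>carrier := free_words\<rparr>"

lemma free_group_one: "\<one>\<^bsub>free_group\<^esub> = []"
  by (simp add: free_group_def)

text \<open>On a possibly disconnected \<open>Z\<close> the counts do not determine the cell, so the
  cell itself is part of the index.\<close>

definition letter_of :: "complex set => (complex set set \<times> nat) letter list" where
  "letter_of x = [Fr (cls (False, False, x), nb x) True]"

lemma cls_near:
  assumes z: "z \<in> topspace X" and y: "y \<in> N z"
  shows "cls (False, False, y) = cls (fA z y, False, z)"
  using cls_eq[OF compat_slide[OF z y]] not_fB[OF z y] by simp

sublocale comb_cocycle n Z a free_group letter_of "\<lambda>_. []"
proof (intro comb_cocycle.intro comb_cocycle_axioms.intro)
  show "comb_based n Z a" by unfold_locales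
  show "group free_group" unfolding free_group_def
    by (rule group.subgroup_imp_group[OF group_word_group subgroup_free_words])
  fix z x y assume z: "z \<in> topspace X" and xy: "x \<in> N z" "y \<in> N z"
  show "letter_of x = letter_of y" if "fA z x" "fA z y"
    using cls_near[OF z xy(1)] cls_near[OF z xy(2)] counts_near(3)[OF z xy(1)] counts_near(3)[OF z xy(2)] that
    by (simp add: letter_of_def)
  show "fA z x ==> fB z y ==> letter_of x \<otimes>\<^bsub>free_group\<^esub> [] = [] \<otimes>\<^bsub>free_group\<^esub> letter_of x" using not_fB[OF z xy(2)] by simp
qed (auto simp: free_group_def letter_of_def single_free_word)

definition foot_class :: "complex set set => nat => complex set => bool" where
  "foot_class C b z \<longleftrightarrow> z \<in> pcomp \<and> (True, False, z) \<in> fconfs \<and> cls (True, False, z) \<noteq> {} \<and> cls (True, False, z) = C \<and> nb z = b"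

text \<open>The crossing value that belongs to a generator, taken at any foot configuration with
  that index; an index realised by none gets the value one.\<close>

definition lift :: "complex set set \<times> nat => (real => complex set) set" where
  "lift x = (case x of (C, b) => if \<exists>z. foot_class C b z then
     (let z = SOME z. foot_class C b z in m (True, False, z) \<otimes>\<^bsub>G\<^esub> inv\<^bsub>G\<^esub> (m (False, False, z))) else \<one>\<^bsub>G\<^esub>)"

lemma cls_FF: "(A, False, z) \<in> fconfs ==> cls (False, False, z) \<noteq> {}"
  using cls_self[of z] by (auto simp: fconfs_def)

lemma lift_closed: "lift x \<in> carrier G"
proof (cases x)
  case (Pair C b)
  show ?thesis
  proof (cases "\<exists>z. foot_class C b z")
    case True
    define z where "z = (SOME z. foot_class C b z)"
    have "foot_class C b z" unfolding z_def using True by (rule someI_ex)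
    then have "m (True, False, z) \<in> carrier G" "m (False, False, z) \<in> carrier G"
      using m_closed[of "(True, False, z)"] m_closed[of "(False, False, z)"] cls_FF[of True z]
      unfolding foot_class_def fset.simps by blast+
    then show ?thesis using True by (simp add: Pair lift_def z_def Let_def)
  next
    case False
    then show ?thesis unfolding Pair lift_def prod.case if_not_P[OF False] by simp
  qed
qed

text \<open>Two foot configurations with the same cell are joined through a configuration of the
  cell, and equal counts on the outer half keep the foot clear; then \<open>alpha_eq\<close>
  compares their values.\<close>

lemma lift_eq:
  assumes z: "foot_class C b z"
  shows "lift (C, b) = m (True, False, z) \<otimes>\<^bsub>G\<^esub> inv\<^bsub>G\<^esub> (m (False, False, z))"
proof -
  define z' where "z' = (SOME z. foot_class C b z)"
  have z': "foot_class C b z'" unfolding z'_def using z by (rule someI)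
  let ?z = "(True, False, z)" and ?z' = "(True, False, z')"
  have f: "?z \<in> fconfs" "?z' \<in> fconfs" and nb: "nb z = nb z'" and p: "z \<in> pcomp" and ne: "cls ?z \<noteq> {}" and cl: "cls ?z = cls ?z'"
    using z z' by (auto simp: foot_class_def)
  then obtain y where y: "compat (False, False, y) ?z" "compat (False, False, y) ?z'" by (auto simp: cls_def)
  note cc = compat_counts[OF y(1)] compat_counts[OF y(2)]
  have "compat ?z ?z'"
  proof -
    have "closed_segment (tup ?z i) (tup ?z' i) \<subseteq> Z" if i: "i < n" for i
    proof -
      have l: "flab ?z (tup ?z i) = flab (False, False, y) (tup (False, False, y) i)" "flab ?z' (tup ?z' i) = flab (False, False, y) (tup (False, False, y) i)"
        and s: "closed_segment (tup ?z i) (tup (False, False, y) i) \<subseteq> Z" "closed_segment (tup (False, False, y) i) (tup ?z' i) \<subseteq> Z"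
        using compatD[OF y(1) i] compatD[OF y(2) i] by (simp_all only: closed_segment_commute)
      show ?thesis by (rule segment_trans[OF f(1) compat_fconfs(1)[OF y(1)] f(2) i l(1) l(2)[symmetric] s])
    qed
    moreover have "flab ?z (tup ?z i) = flab ?z' (tup ?z' i) \<and> (flab ?z (tup ?z i) = 0 --> (Re (tup ?z i) < 0 \<longleftrightarrow> Re (tup ?z' i) < 0))" if i: "i < n" for i
      using tup_counts(1,2)[OF f _ _ i] cc nb by simp
    ultimately show ?thesis unfolding compat_def using f by auto
  qed
  from alpha_eq[OF this nb _ ne cls_FF[OF f(1)] p] z show ?thesis by (auto simp: lift_def Let_def z'_def)
qed

text \<open>With the gauge \<open>m\<close>, evaluation by \<open>lift\<close> inverts the holonomy
  from the left. So the holonomy is injective into a free group.\<close>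

theorem no_independent_pair: "\<not> G.independent_pair x y"
proof
  assume ind: "G.independent_pair x y"
  let ?\<psi> = "word_val G \<one>\<^bsub>G\<^esub> \<one>\<^bsub>G\<^esub> lift"
  have \<psi>: "?\<psi> \<in> hom free_group G"
    using G.word_val_hom[of "\<one>\<^bsub>G\<^esub>" "\<one>\<^bsub>G\<^esub>" lift UNIV] lift_closed subgroup.subset[OF subgroup_free_words]
    by (auto simp: hom_def free_group_def Pi_iff subset_iff)
  have r: "?\<psi> (Hol x) = x" if x: "x \<in> carrier G" for x
  proof (rule comb_retraction[where k = "\<lambda>x. m (False, False, x)", OF \<psi> _ m_base _ x])
    show "m (False, False, x) \<in> carrier G" if x: "x \<in> pcomp" for x
    proof -
      have "x \<in> topspace X" using base_path[OF x] path_finish_in_topspace[of "cset n Z" "base_path x"] by simp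
      then show ?thesis using m_closed[of "(False, False, x)"] cls_self x by auto
    qed
    fix y z assume z: "z \<in> topspace X" "z \<in> pcomp" and y: "y \<in> N z"
    note c = compat_slide[OF z(1) y]
    have yp: "y \<in> pcomp" using compat_pcomp[OF compat_sym[OF c]] z by simp
    have ne: "cls (False, False, y) \<noteq> {}" using cls_self[OF N_top[OF y]] by auto
    have "m (False, False, y) \<otimes>\<^bsub>G\<^esub> Lm (False, False, y) (fA z y, fB z y, z) = m (fA z y, False, z)"
      using m_trans[OF c ne] yp not_fB[OF z(1) y] by simp
    moreover have "m (fA z y, False, z) \<otimes>\<^bsub>G\<^esub> inv\<^bsub>G\<^esub> (m (False, False, z)) = ?\<psi> (opt (fA z y) (letter_of y))"
    proof (cases "fA z y")
      case True
      have e: "cls (False, False, y) = cls (True, False, z)" "nb y = nb z" using cls_near[OF z(1) y] counts_near(3)[OF z(1) y] True by auto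
      have "foot_class (cls (True, False, z)) (nb z) z"
        using z ne e compat_fconfs(2)[OF c] not_fB[OF z(1) y] True by (simp add: foot_class_def)
      from lift_eq[OF this] show ?thesis
        using True e lift_closed[of "(cls (True, False, z), nb z)"] by (simp add: opt_def letter_of_def word_val_def letter_val_def)
    next
      case False
      have "cls (False, False, z) \<noteq> {}" using cls_self[OF z(1)] by blast
      then have "m (False, False, z) \<in> carrier G" using m_closed[of "(False, False, z)"] z(2) by simp
      then show ?thesis using False by (simp add: opt_def word_val_def free_group_one)
    qed
    moreover have "opt (fA z y) (letter_of y) \<otimes>\<^bsub>free_group\<^esub> opt (fB z y) [] = opt (fA z y) (letter_of y)"
      by (simp add: opt_def free_group_one) (simp add: free_group_def letter_of_def)
    ultimately show "m (False, False, y) \<otimes>\<^bsub>G\<^esub> Lm (False, False, y) (fA z y, fB z y, z) \<otimes>\<^bsub>G\<^esub> inv\<^bsub>G\<^esub> (m (False, False, z)) =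
      ?\<psi> (opt (fA z y) (letter_of y) \<otimes>\<^bsub>free_group\<^esub> opt (fB z y) [])" by simp
  qed
  have H: "Hol \<in> hom G (word_group UNIV)" "Hol x \<in> free_words" if "x \<in> carrier G" for x
    using Hol_hom subgroup.subset[OF subgroup_free_words] that by (auto simp: hom_def free_group_def Pi_iff subset_iff)
  have xy: "x \<in> carrier G" "y \<in> carrier G" using ind by (auto simp: G.independent_pair_def)
  have "?\<psi> [] = \<one>\<^bsub>G\<^esub>" by (simp add: word_val_def)
  then have "group.independent_pair (word_group UNIV) (Hol x) (Hol y)"
    using r by (intro G.independent_pair_hom_image[OF H(1)[OF xy(1)] group_word_group _ ind]) (metis word_group_simps(3))
  then show False using free_words_no_independent_pair H(2) xy by blast
qed

end

section \<open>Four particles on the comb with two prongs\<close>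

definition full_comb_set :: "complex set" where
  "full_comb_set = {p. Im p = 0 \<and> -1 \<le> Re p \<and> Re p \<le> 2} \<union> {p. 0 \<le> Im p \<and> Im p \<le> 1 \<and> (Re p = 0 \<or> Re p = 1)}"

text \<open>Regions 0 to 4 are the prong over 0, the spine left of 0, between the feet, the prong
  over 1 and the spine right of 1; 5 and 6 are the feet. Steps of 1/5 leave room for four particles
  inside each arc.\<close>

definition grid_point :: "nat \<times> nat => complex" where
  "grid_point = (\<lambda>(r, j). let t = real (Suc j) / 5 in if r = 0 then Complex 0 t else if r = 1 then Complex (- t) 0
     else if r = 2 then Complex t 0 else if r = 3 then Complex 1 t else if r = 4 then Complex (1 + t) 0
     else if r = 5 then 0 else 1)"

lemma grid_configuration:
  assumes k: "\<And>r. k r \<le> 4" "k 5 \<le> 1" "k 6 \<le> (1::nat)" and I: "I = (SIGMA r:{..<7}. {..<k r})"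
  defines "z \<equiv> grid_point ` I"
  shows "z \<subseteq> full_comb_set" "finite z" "card z = (\<Sum>r<7. k r)"
    "na z = k 0" "nb z = k 1" "nd z = k 3" "ne z = k 4" "k 5 = 1 ==> 0 \<in> z" "k 6 = 1 ==> 1 \<in> z"
proof -
  have r7: "r < 7 \<longleftrightarrow> r = 0 \<or> r = 1 \<or> r = 2 \<or> r = 3 \<or> r = 4 \<or> r = 5 \<or> r = (6::nat)" for r by auto
  have j: "real (Suc j) / 5 > 0 \<and> real (Suc j) / 5 < 1 \<and> (r = 5 \<or> r = 6 --> j = 0) \<and> r < 7" if "(r, j) \<in> I" for r j
  proof -
    have "r < 7" "j < k r" using that I by auto
    moreover have "r = 5 \<or> r = 6 --> j = 0" using calculation k(2,3) by auto
    ultimately show ?thesis using k(1)[of r] by auto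
  qed
  \<comment> \<open>Recovers the region from the point; this gives injectivity and the
    counts.\<close>
  define reg :: "complex => nat" where "reg p = (if Im p > 0 then (if Re p = 0 then 0 else 3) else if Re p < 0 then 1
     else if Re p = 0 then 5 else if Re p < 1 then 2 else if Re p = 1 then 6 else 4)" for p
  have reg: "reg (grid_point (r, i)) = r" if "(r, i) \<in> I" for r i
  proof -
    define t where "t = real (Suc i) / 5"
    have "0 < t" "t < 1" "r < 7" using j[OF that] by (auto simp: t_def)
    then show ?thesis unfolding r7 grid_point_def prod.case t_def[symmetric] Let_def by (auto simp: reg_def)
  qed
  have inj: "inj_on grid_point I"
  proof (rule inj_onI)
    fix u v assume u: "u \<in> I" and v: "v \<in> I" and e: "grid_point u = grid_point v"
    obtain r i s l where uv: "u = (r, i)" "v = (s, l)" by (cases u, cases v)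
    have rs: "r = s" using reg[of r i] reg[of s l] u v e uv by simp
    have "i = l" using e j[of r i] j[of s l] u v unfolding uv rs r7 by (auto simp: grid_point_def Let_def)
    then show "u = v" using uv rs by simp
  qed
  show "z \<subseteq> full_comb_set"
  proof
    fix p assume "p \<in> z"
    then obtain r i where p: "(r, i) \<in> I" "p = grid_point (r, i)" by (auto simp: z_def)
    define t where "t = real (Suc i) / 5"
    have "0 < t" "t < 1" "r < 7" using j[OF p(1)] by (auto simp: t_def)
    then show "p \<in> full_comb_set"
      unfolding r7 p(2) grid_point_def prod.case t_def[symmetric] Let_def by (auto simp: full_comb_set_def)
  qed
  have fI: "finite I" unfolding I by auto
  show "finite z" using fI by (simp add: z_def)
  show "card z = (\<Sum>r<7. k r)" unfolding z_def card_image[OF inj] unfolding I by simp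
  have count: "card {p \<in> z. Q p} = k s" if s: "s < 7" and Q: "\<And>r i. (r, i) \<in> I ==> Q (grid_point (r, i)) \<longleftrightarrow> r = s" for Q s
  proof -
    have "{p \<in> z. Q p} = grid_point ` ({s} \<times> {..<k s})"
      unfolding z_def using Q s I by auto
    moreover have "inj_on grid_point ({s} \<times> {..<k s})" by (rule inj_on_subset[OF inj]) (use s I in auto)
    ultimately show ?thesis by (simp add: card_image)
  qed
  have Q: "(Im (grid_point (r, i)) > 0 \<and> Re (grid_point (r, i)) = 0 \<longleftrightarrow> r = 0) \<and>
     (Im (grid_point (r, i)) = 0 \<and> Re (grid_point (r, i)) < 0 \<longleftrightarrow> r = 1) \<and>
     (Im (grid_point (r, i)) > 0 \<and> Re (grid_point (r, i)) \<noteq> 0 \<longleftrightarrow> r = 3) \<and>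
     (Im (grid_point (r, i)) = 0 \<and> Re (grid_point (r, i)) > 1 \<longleftrightarrow> r = 4)" if "(r, i) \<in> I" for r i
  proof -
    define t where "t = real (Suc i) / 5"
    have "0 < t" "t < 1" "r < 7" using j[OF that] by (auto simp: t_def)
    then show ?thesis unfolding r7 grid_point_def prod.case t_def[symmetric] Let_def by auto
  qed
  show "na z = k 0" "nb z = k 1" "nd z = k 3" "ne z = k 4"
    unfolding na_def nb_def nd_def ne_def by (rule count; use Q in simp)+
  show "0 \<in> z" if "k 5 = 1"
  proof -
    have "(5, 0) \<in> I" using that I by simp
    from imageI[OF this, of grid_point] show ?thesis by (simp add: z_def grid_point_def)
  qed
  show "1 \<in> z" if "k 6 = 1"
  proof -
    have "(6, 0) \<in> I" using that I by simp
    from imageI[OF this, of grid_point] show ?thesis by (simp add: z_def grid_point_def)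
  qed
qed

lemma ex_configuration:
  assumes "a + b + d + e + of_bool s + of_bool t \<le> (4::nat)"
  shows "\<exists>z\<in>topspace (cset 4 full_comb_set). na z = a \<and> nb z = b \<and> nd z = d \<and> ne z = e \<and> (s --> 0 \<in> z) \<and> (t --> 1 \<in> z)"
proof -
  \<comment> \<open>The remaining particles go between the feet, where no count sees them.\<close>
  define c :: nat where "c = 4 - (a + b + d + e + of_bool s + of_bool t)"
  define k :: "nat => nat" where "k = (\<lambda>_. 0)(0 := a, 1 := b, 2 := c, 3 := d, 4 := e, 5 := of_bool s, 6 := of_bool t)"
  have "k r \<le> 4" for r using assms by (auto simp: k_def c_def)
  note z = grid_configuration[of k, OF this _ _ refl]
  have "(\<Sum>r<7. k r) = a + b + c + d + e + of_bool s + of_bool t"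
    by (simp add: k_def eval_nat_numeral)
  then have "(\<Sum>r<7. k r) = 4" using assms by (simp add: c_def)
  then show ?thesis using z by (intro bexI[of _ "grid_point ` (SIGMA r:{..<7}. {..<k r})"]) (auto simp: topspace_cset k_def)
qed

section \<open>Cells of the full comb\<close>

locale full_comb = comb_based 4 full_comb_set a for a +
  assumes base_cell: "na a = 0" "nd a = 0"
begin

text \<open>All arcs are complete here, so matched particles of equal label always have their
  segment in the comb, and the counts alone decide.\<close>

lemma full_compat:
  assumes u: "(A, B, y) \<in> fconfs" and v: "(A', B', y') \<in> fconfs"
    and c: "na y + of_bool A = na y' + of_bool A'" "nd y + of_bool B = nd y' + of_bool B'"
    and nb: "A ==> A' ==> nb y = nb y'" and ne: "B ==> B' ==> ne y = ne y'"
  shows "compat (A, B, y) (A', B', y')"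
proof -
  let ?u = "(A, B, y)" and ?v = "(A', B', y')"
  have "closed_segment (tup ?u i) (tup ?v i) \<subseteq> full_comb_set" if i: "i < 4" for i
  proof -
    have l: "lab A B (tup ?u i) = lab A' B' (tup ?v i)" by (rule tup_counts(1)[OF u v c i])
    have g: "tup ?u i \<in> full_comb_set" "tup ?v i \<in> full_comb_set" by (rule tup_facts(2)[OF u i], rule tup_facts(2)[OF v i])
    note gu = flab_geometry[OF u i, unfolded flab.simps] and gv = flab_geometry[OF v i, unfolded flab.simps]
    show ?thesis
    proof (cases "lab A B (tup ?u i) = 0")
      case True
      then have im: "Im (tup ?u i) = 0" "Im (tup ?v i) = 0" using gu(1) gv(1) l by simp_all
      then have "-1 \<le> Re (tup ?u i) \<and> Re (tup ?u i) \<le> 2" "-1 \<le> Re (tup ?v i) \<and> Re (tup ?v i) \<le> 2"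
        using g unfolding full_comb_set_def by auto
      then have r: "\<And>x. x \<in> closed_segment (Re (tup ?u i)) (Re (tup ?v i)) ==> -1 \<le> x \<and> x \<le> 2"
        by (auto simp: closed_segment_eq_real_ivl split: if_splits)
      have "closed_segment (tup ?u i) (tup ?v i) = {p. Im p = 0 \<and> Re p \<in> closed_segment (Re (tup ?u i)) (Re (tup ?v i))}"
        using closed_segment_same_Im[of "tup ?u i" "tup ?v i"] im by simp
      then show ?thesis using r unfolding full_comb_set_def by blast
    next
      case False
      then have re: "Re (tup ?u i) = Re (tup ?v i)" "Re (tup ?u i) = 0 \<or> Re (tup ?u i) = 1" "Im (tup ?u i) \<ge> 0" "Im (tup ?v i) \<ge> 0"
        using gu(2,3,4) gv(2,3) l by auto
      then have "Im (tup ?u i) \<le> 1" "Im (tup ?v i) \<le> 1"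
        using g unfolding full_comb_set_def by auto
      then have r: "\<And>x. x \<in> closed_segment (Im (tup ?u i)) (Im (tup ?v i)) ==> 0 \<le> x \<and> x \<le> 1"
        using re(3,4) by (auto simp: closed_segment_eq_real_ivl split: if_splits)
      have "closed_segment (tup ?u i) (tup ?v i) = {p. Re p = Re (tup ?u i) \<and> Im p \<in> closed_segment (Im (tup ?u i)) (Im (tup ?v i))}"
        using closed_segment_same_Re[of "tup ?u i" "tup ?v i"] re(1) by simp
      then show ?thesis using r re(2) unfolding full_comb_set_def by auto
    qed
  qed
  then show ?thesis
    unfolding compat_def flab.simps flagA.simps flagB.simps using u v tup_counts[OF u v c] nb ne by blast
qed

lemma total_count:
  assumes "y \<in> topspace X"
  shows "na y + nb y + nd y + ne y + of_bool (0 \<in> y) + of_bool (1 \<in> y) \<le> 4"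
proof -
  let ?A = "0 \<in> y" and ?B = "1 \<in> y"
  have u: "(?A, ?B, y) \<in> fconfs" using assms by (simp add: fconfs_def)
  have "{p \<in> y. lab ?A ?B p = 0 \<and> Re p < 0} \<subseteq> {p \<in> y. lab ?A ?B p = 0 \<and> Re p \<le> 1}" by auto
  then have "nb y \<le> card {p \<in> y. lab ?A ?B p = 0 \<and> Re p \<le> 1}"
    unfolding nb_def card_lab(5)[OF u, symmetric] using cset_finite[OF assms] by (intro card_mono) auto
  then show ?thesis using card_lab(3,4,6)[OF u] by linarith
qed

lemma fconf_count: "(A, B, y) \<in> fconfs ==> na y + nb y + nd y + ne y + of_bool A + of_bool B \<le> 4"
  using total_count[of y] by (auto simp: fconfs_def of_bool_def split: if_splits)

text \<open>A cell is given by the two prong counts, and it is reached from the cell with empty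
  prongs by crossings with an empty outer half. Since such crossings get the trivial generator, they
  play the part of a maximal tree.\<close>

lemma cell_induct [consumes 1, case_names base A B]:
  assumes "y \<in> topspace X"
    and "\<And>y. y \<in> topspace X ==> na y = 0 ==> nd y = 0 ==> P y"
    and "\<And>y z. y \<in> topspace X ==> (True, False, z) \<in> fconfs ==> nb z = 0 ==> na y = Suc (na z) ==> nd y = nd z ==> P z ==> P y"
    and "\<And>y z. y \<in> topspace X ==> (False, True, z) \<in> fconfs ==> ne z = 0 ==> nd y = Suc (nd z) ==> na y = na z ==> P z ==> P y"
  shows "P y"
  using assms(1)
proof (induction "na y + nd y" arbitrary: y rule: less_induct)
  case less
  note t = total_count[OF less.prems]
  consider "na y = 0" "nd y = 0" | i where "na y = Suc i" | j where "nd y = Suc j" by (meson not0_implies_Suc)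
  then show ?case
  proof cases
    case 1
    then show ?thesis using assms(2) less.prems by blast
  next
    case (2 i)
    then have "i + 0 + nd y + 0 + of_bool True + of_bool False \<le> (4::nat)" using t by simp
    then obtain z where z: "z \<in> topspace X" "na z = i" "nb z = 0" "nd z = nd y" "0 \<in> z"
      using ex_configuration by metis
    moreover have "P z" by (rule less.hyps[OF _ z(1)]) (use z 2 in simp)
    ultimately show ?thesis using assms(3)[OF less.prems, of z] 2 by (simp add: fconfs_def)
  next
    case (3 j)
    then have "na y + 0 + j + 0 + of_bool False + of_bool True \<le> (4::nat)" using t by simp
    then obtain z where z: "z \<in> topspace X" "na z = na y" "nd z = j" "ne z = 0" "1 \<in> z"
      using ex_configuration by metis
    moreover have "P z" by (rule less.hyps[OF _ z(1)]) (use z 3 in simp)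
    ultimately show ?thesis using assms(4)[OF less.prems, of z] 3 by (simp add: fconfs_def)
  qed
qed

lemma FF_fconfs: "y \<in> topspace X ==> (False, False, y) \<in> fconfs"
  by (simp add: fconfs_def)

lemma pcomp_all: "y \<in> topspace X ==> y \<in> pcomp"
proof (induction rule: cell_induct)
  case (base y)
  then have "compat (False, False, a) (False, False, y)" using base_cell base_in by (intro full_compat FF_fconfs) auto
  then show ?case using compat_pcomp base_pcomp by fastforce
next
  case (A y z)
  then have "compat (True, False, z) (False, False, y)" by (intro full_compat FF_fconfs) auto
  then show ?case using compat_pcomp A by fastforce
next
  case (B y z)
  then have "compat (False, True, z) (False, False, y)" by (intro full_compat FF_fconfs) auto
  then show ?case using compat_pcomp B by fastforce
qed

lemma fset_pcomp: "u \<in> fconfs ==> fset u \<in> pcomp"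
  using fconfs_facts(4) pcomp_all by blast

lemma cls_nonempty:
  assumes "u \<in> fconfs"
  shows "cls u \<noteq> {}"
proof -
  obtain A B z where u: "u = (A, B, z)" by (cases u)
  have "(na z + of_bool A) + 0 + (nd z + of_bool B) + 0 + of_bool False + of_bool False \<le> (4::nat)"
    using fconf_count[of A B z] assms u by simp
  then obtain y where y: "y \<in> topspace X" "na y = na z + of_bool A" "nd y = nd z + of_bool B"
    using ex_configuration by metis
  have "compat (False, False, y) u" unfolding u by (rule full_compat[OF FF_fconfs[OF y(1)]]) (use assms u y in auto)
  then show ?thesis by (auto simp: cls_def)
qed

lemma m_carrier: "u \<in> fconfs ==> m u \<in> carrier G"
  by (rule m_closed[OF cls_nonempty fset_pcomp])

text \<open>The value of crossing foot 0 with i particles on its prong, b on the outer half and d on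
  the other prong. For counts that occur in no such configuration it is some element of the
  group.\<close>

definition crossA :: "nat => nat => nat => (real => complex set) set" where
  "crossA i b d = (let z = SOME z. (True, False, z) \<in> fconfs \<and> na z = i \<and> nb z = b \<and> nd z = d in
     if (True, False, z) \<in> fconfs then m (True, False, z) \<otimes>\<^bsub>G\<^esub> inv\<^bsub>G\<^esub> (m (False, False, z)) else \<one>\<^bsub>G\<^esub>)"

definition crossB :: "nat => nat => nat => (real => complex set) set" where
  "crossB d e i = (let z = SOME z. (False, True, z) \<in> fconfs \<and> nd z = d \<and> ne z = e \<and> na z = i in
     if (False, True, z) \<in> fconfs then m (False, True, z) \<otimes>\<^bsub>G\<^esub> inv\<^bsub>G\<^esub> (m (False, False, z)) else \<one>\<^bsub>G\<^esub>)"

lemma fconfs_drop: "(A, B, z) \<in> fconfs ==> (False, B, z) \<in> fconfs" "(A, B, z) \<in> fconfs ==> (A, False, z) \<in> fconfs"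
  "(A, B, z) \<in> fconfs ==> (False, False, z) \<in> fconfs"
  by (auto simp: fconfs_def)

lemma cross_closed: "crossA i b d \<in> carrier G" "crossB d e i \<in> carrier G"
proof -
  have c: "m (A, B, z) \<otimes>\<^bsub>G\<^esub> inv\<^bsub>G\<^esub> (m (False, False, z)) \<in> carrier G" if "(A, B, z) \<in> fconfs" for A B z
    using m_carrier[OF that] m_carrier[OF fconfs_drop(3)[OF that]] by simp
  show "crossA i b d \<in> carrier G" "crossB d e i \<in> carrier G"
    unfolding crossA_def crossB_def Let_def using c by (simp_all split: if_split)
qed

text \<open>A particle on foot 1 that is flagged can be moved up its prong before foot 0 is crossed;
  it then counts as one more particle there.\<close>

lemma crossA_eq:
  assumes u: "(True, B, z) \<in> fconfs"
  shows "m (True, B, z) \<otimes>\<^bsub>G\<^esub> inv\<^bsub>G\<^esub> (m (False, B, z)) = crossA (na z) (nb z) (nd z + of_bool B)"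
proof -
  define w where "w = (SOME w. (True, False, w) \<in> fconfs \<and> na w = na z \<and> nb w = nb z \<and> nd w = nd z + of_bool B)"
  have "na z + nb z + (nd z + of_bool B) + 0 + of_bool True + of_bool False \<le> (4::nat)" using fconf_count[OF u] by simp
  then obtain w' where "w' \<in> topspace X" "na w' = na z" "nb w' = nb z" "nd w' = nd z + of_bool B" "0 \<in> w'"
    using ex_configuration by metis
  then have "(True, False, w') \<in> fconfs \<and> na w' = na z \<and> nb w' = nb z \<and> nd w' = nd z + of_bool B" by (simp add: fconfs_def)
  then have w: "(True, False, w) \<in> fconfs" "na w = na z" "nb w = nb z" "nd w = nd z + of_bool B"
    using someI[of "\<lambda>w. (True, False, w) \<in> fconfs \<and> na w = na z \<and> nb w = nb z \<and> nd w = nd z + of_bool B" w'] unfolding w_def by auto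
  have c: "compat (True, B, z) (True, False, w)" by (rule full_compat[OF u w(1)]) (use w in auto)
  have z: "z \<in> pcomp" using fset_pcomp[OF u] by simp
  have "m (True, B, z) \<otimes>\<^bsub>G\<^esub> inv\<^bsub>G\<^esub> (m (False, B, z)) = m (True, False, w) \<otimes>\<^bsub>G\<^esub> inv\<^bsub>G\<^esub> (m (False, False, w))"
    by (rule alpha_eq[OF c w(3)[symmetric] _ cls_nonempty[OF u] cls_nonempty[OF fconfs_drop(1)[OF u]] z]) simp
  then show ?thesis using w(1) by (simp add: crossA_def Let_def w_def[symmetric])
qed

lemma crossB_eq:
  assumes u: "(A, True, z) \<in> fconfs"
  shows "m (A, True, z) \<otimes>\<^bsub>G\<^esub> inv\<^bsub>G\<^esub> (m (A, False, z)) = crossB (nd z) (ne z) (na z + of_bool A)"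
proof -
  define w where "w = (SOME w. (False, True, w) \<in> fconfs \<and> nd w = nd z \<and> ne w = ne z \<and> na w = na z + of_bool A)"
  have "(na z + of_bool A) + 0 + nd z + ne z + of_bool False + of_bool True \<le> (4::nat)" using fconf_count[OF u] by simp
  then obtain w' where "w' \<in> topspace X" "na w' = na z + of_bool A" "nd w' = nd z" "ne w' = ne z" "1 \<in> w'"
    using ex_configuration by metis
  then have "(False, True, w') \<in> fconfs \<and> nd w' = nd z \<and> ne w' = ne z \<and> na w' = na z + of_bool A" by (simp add: fconfs_def)
  then have w: "(False, True, w) \<in> fconfs" "nd w = nd z" "ne w = ne z" "na w = na z + of_bool A"
    using someI[of "\<lambda>w. (False, True, w) \<in> fconfs \<and> nd w = nd z \<and> ne w = ne z \<and> na w = na z + of_bool A" w'] unfolding w_def by auto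
  have c: "compat (A, True, z) (False, True, w)" by (rule full_compat[OF u w(1)]) (use w in auto)
  have z: "z \<in> pcomp" using fset_pcomp[OF u] by simp
  have "m (A, True, z) \<otimes>\<^bsub>G\<^esub> inv\<^bsub>G\<^esub> (m (A, False, z)) = m (False, True, w) \<otimes>\<^bsub>G\<^esub> inv\<^bsub>G\<^esub> (m (False, False, w))"
    by (rule delta_eq[OF c w(3)[symmetric] _ cls_nonempty[OF u] cls_nonempty[OF fconfs_drop(2)[OF u]] z]) simp
  then show ?thesis using w(1) by (simp add: crossB_def Let_def w_def[symmetric])
qed

lemma cross_both:
  assumes u: "(True, True, z) \<in> fconfs"
  shows "m (True, True, z) \<otimes>\<^bsub>G\<^esub> inv\<^bsub>G\<^esub> (m (False, False, z)) = crossA (na z) (nb z) (Suc (nd z)) \<otimes>\<^bsub>G\<^esub> crossB (nd z) (ne z) (na z)"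
    "m (True, True, z) \<otimes>\<^bsub>G\<^esub> inv\<^bsub>G\<^esub> (m (False, False, z)) = crossB (nd z) (ne z) (Suc (na z)) \<otimes>\<^bsub>G\<^esub> crossA (na z) (nb z) (nd z)"
proof -
  note d = fconfs_drop[OF u]
  have c: "m (True, True, z) \<in> carrier G" "m (False, True, z) \<in> carrier G" "m (True, False, z) \<in> carrier G" "m (False, False, z) \<in> carrier G"
    using m_carrier u d by blast+
  show "m (True, True, z) \<otimes>\<^bsub>G\<^esub> inv\<^bsub>G\<^esub> (m (False, False, z)) = crossA (na z) (nb z) (Suc (nd z)) \<otimes>\<^bsub>G\<^esub> crossB (nd z) (ne z) (na z)"
    using crossA_eq[OF u] crossB_eq[OF d(1)] G.mult_inv_cancel_left[of "m (True, True, z)" "m (False, True, z)" "inv\<^bsub>G\<^esub> (m (False, False, z))"] c by simp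
  show "m (True, True, z) \<otimes>\<^bsub>G\<^esub> inv\<^bsub>G\<^esub> (m (False, False, z)) = crossB (nd z) (ne z) (Suc (na z)) \<otimes>\<^bsub>G\<^esub> crossA (na z) (nb z) (nd z)"
    using crossB_eq[OF u] crossA_eq[OF d(2)] G.mult_inv_cancel_left[of "m (True, True, z)" "m (True, False, z)" "inv\<^bsub>G\<^esub> (m (False, False, z))"] c by simp
qed

text \<open>With a particle on each foot the two crossings can be made in either order. The feet use
  up two of the four particles, hence the bound 2.\<close>

lemma cross_relation:
  assumes "i + b + d + e \<le> 2"
  shows "crossA i b (Suc d) \<otimes>\<^bsub>G\<^esub> crossB d e i = crossB d e (Suc i) \<otimes>\<^bsub>G\<^esub> crossA i b d"
proof -
  have "i + b + d + e + of_bool True + of_bool True \<le> (4::nat)" using assms by simp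
  then obtain z where z: "z \<in> topspace X" "na z = i" "nb z = b" "nd z = d" "ne z = e" "0 \<in> z" "1 \<in> z"
    using ex_configuration by metis
  then have "(True, True, z) \<in> fconfs" by (simp add: fconfs_def)
  from cross_both[OF this] show ?thesis using z by simp
qed

text \<open>A change of gauge along a maximal tree of cells: first the prong over 1 is filled, then
  the prong over 0, always with empty outer halves. It makes these crossings trivial.\<close>

primrec gauge0 :: "nat => (real => complex set) set" where
  "gauge0 0 = \<one>\<^bsub>G\<^esub>" | "gauge0 (Suc d) = gauge0 d \<otimes>\<^bsub>G\<^esub> inv\<^bsub>G\<^esub> (crossB d 0 0)"

primrec gauge :: "nat => nat => (real => complex set) set" where
  "gauge d 0 = gauge0 d" | "gauge d (Suc i) = gauge d i \<otimes>\<^bsub>G\<^esub> inv\<^bsub>G\<^esub> (crossA i 0 d)"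

lemma gauge_closed [simp]: "gauge d i \<in> carrier G"
proof -
  have "gauge0 d \<in> carrier G" by (induction d) (simp_all add: cross_closed)
  then show ?thesis by (induction i) (simp_all add: cross_closed)
qed

text \<open>Crossing values in the new gauge.\<close>

definition ah where "ah i b d = gauge d (Suc i) \<otimes>\<^bsub>G\<^esub> crossA i b d \<otimes>\<^bsub>G\<^esub> inv\<^bsub>G\<^esub> (gauge d i)"
definition dh where "dh d e i = gauge (Suc d) i \<otimes>\<^bsub>G\<^esub> crossB d e i \<otimes>\<^bsub>G\<^esub> inv\<^bsub>G\<^esub> (gauge d i)"

lemma hat_closed [simp]: "ah i b d \<in> carrier G" "dh d e i \<in> carrier G"
  unfolding ah_def dh_def using gauge_closed cross_closed by (meson G.inv_closed G.m_closed)+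

lemma ah_0: "ah i 0 d = \<one>\<^bsub>G\<^esub>"
  unfolding ah_def by (simp add: G.m_assoc cross_closed)

lemma dh_0_0: "dh d 0 0 = \<one>\<^bsub>G\<^esub>"
proof -
  have "gauge0 d \<in> carrier G" using gauge_closed[of d 0] by simp
  then show ?thesis unfolding dh_def by (simp add: G.m_assoc cross_closed)
qed

lemma conj_mult:
  assumes "g \<in> carrier G" "x \<in> carrier G" "h \<in> carrier G" "y \<in> carrier G" "k \<in> carrier G"
  shows "(g \<otimes>\<^bsub>G\<^esub> x \<otimes>\<^bsub>G\<^esub> inv\<^bsub>G\<^esub> h) \<otimes>\<^bsub>G\<^esub> (h \<otimes>\<^bsub>G\<^esub> y \<otimes>\<^bsub>G\<^esub> inv\<^bsub>G\<^esub> k) = g \<otimes>\<^bsub>G\<^esub> (x \<otimes>\<^bsub>G\<^esub> y) \<otimes>\<^bsub>G\<^esub> inv\<^bsub>G\<^esub> k"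
  using G.mult_inv_cancel_left[of "g \<otimes>\<^bsub>G\<^esub> x" h "y \<otimes>\<^bsub>G\<^esub> inv\<^bsub>G\<^esub> k"] assms by (simp add: G.m_assoc)

lemma hat_both:
  "ah i b (Suc d) \<otimes>\<^bsub>G\<^esub> dh d e i = gauge (Suc d) (Suc i) \<otimes>\<^bsub>G\<^esub> (crossA i b (Suc d) \<otimes>\<^bsub>G\<^esub> crossB d e i) \<otimes>\<^bsub>G\<^esub> inv\<^bsub>G\<^esub> (gauge d i)"
  "dh d e (Suc i) \<otimes>\<^bsub>G\<^esub> ah i b d = gauge (Suc d) (Suc i) \<otimes>\<^bsub>G\<^esub> (crossB d e (Suc i) \<otimes>\<^bsub>G\<^esub> crossA i b d) \<otimes>\<^bsub>G\<^esub> inv\<^bsub>G\<^esub> (gauge d i)"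
  unfolding ah_def dh_def by (rule conj_mult; simp only: gauge_closed cross_closed)+

lemma hat_relation: "i + b + d + e \<le> 2 ==> ah i b (Suc d) \<otimes>\<^bsub>G\<^esub> dh d e i = dh d e (Suc i) \<otimes>\<^bsub>G\<^esub> ah i b d"
  by (simp only: hat_both cross_relation)

text \<open>For b = 0 the crossing of foot 0 is trivial, so the relation reads as invariance of the
  other value under one more particle on the prong over 0.\<close>

lemma dh_indep: "i + d + e \<le> 3 ==> dh d e i = dh d e 0"
proof (induction i)
  case (Suc i)
  then show ?case using hat_relation[of i 0 d e] by (simp add: ah_0)
qed simp

lemma dh_0: "i + d \<le> 3 ==> dh d 0 i = \<one>\<^bsub>G\<^esub>"
  using dh_indep[of i d 0] dh_0_0 by simp

text \<open>The same with e = 0, once \<open>dh_0\<close> has made the crossing of foot 1 trivial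
  there.\<close>

lemma ah_indep: "i + b + d \<le> 3 ==> ah i b d = ah i b 0"
proof (induction d)
  case (Suc d)
  then show ?case using hat_relation[of i b d 0] dh_0[of i d] dh_0[of "Suc i" d] by simp
qed simp

text \<open>The one relation that survives: b = e = 1 with empty prongs exhausts the four
  particles.\<close>

lemma hat_commute: "ah 0 1 0 \<otimes>\<^bsub>G\<^esub> dh 0 1 0 = dh 0 1 0 \<otimes>\<^bsub>G\<^esub> ah 0 1 0"
  using hat_relation[of 0 1 0 1] ah_indep[of 0 1 1] dh_indep[of 1 0 1] by simp

end

text \<open>The ten free generators: the flag tells the prong, true for the one over 1, and i and b
  are the counts on the prong and on its outer half. The pair (0, 1) is left out because it gives a
  generator of the plane.\<close>

definition comb_index :: "(bool \<times> nat \<times> nat) set" where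
  "comb_index = {(s, i, b). 1 \<le> b \<and> i + b \<le> 3 \<and> (i, b) \<noteq> (0, 1)}"

definition comb_gen :: "bool => nat => nat => (bool \<times> nat \<times> nat) letter list" where
  "comb_gen s i b = (if b = 0 then [] else if i = 0 \<and> b = 1 then [if s then Ab 0 1 else Ab 1 0] else [Fr (s, i, b) True])"

lemma finite_comb_index: "finite comb_index"
  by (rule finite_subset[of _ "UNIV \<times> {..3} \<times> {..3}"]) (auto simp: comb_index_def)

lemma comb_gen_closed: "i + b \<le> 3 ==> comb_gen s i b \<in> words_over comb_index"
  by (auto simp: comb_gen_def comb_index_def words_over_def reduced_word_def)

text \<open>The bound forces one of the two to be trivial or both to be the generators of the
  plane.\<close>

lemma comb_gen_commute:
  assumes "i + b + d + e \<le> 2"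
  shows "foldr push (comb_gen False i b) (comb_gen True d e) = foldr push (comb_gen True d e) (comb_gen False i b)"
proof (cases "b = 0 \<or> e = 0")
  case True
  have r: "foldr push w [] = w" if "w \<in> words_over comb_index" for w
    using group.is_monoid[OF group_word_group[of comb_index]] monoid.r_one[of "word_group comb_index" w] that by simp
  have "comb_gen False i b \<in> words_over comb_index" "comb_gen True d e \<in> words_over comb_index"
    using assms by (auto intro: comb_gen_closed)
  then show ?thesis using True r[of "comb_gen False i b"] r[of "comb_gen True d e"] by (auto simp: comb_gen_def)
next
  case False
  then have "i = 0" "d = 0" "b = 1" "e = 1" using assms by auto
  then show ?thesis by (simp add: comb_gen_def)
qed

context full_comb begin

text \<open>A generator is indexed by the count before the crossing, while \<open>x\<close> already
  has the particle on the prong; hence the subtraction.\<close>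

definition letA where "letA x = (if na x = 0 then [] else comb_gen False (na x - 1) (nb x))"
definition letB where "letB x = (if nd x = 0 then [] else comb_gen True (nd x - 1) (ne x))"

abbreviation H where "H \<equiv> word_group comb_index"

lemma near_let:
  assumes z: "z \<in> topspace X" and y: "y \<in> N z"
  shows "fA z y ==> letA y = comb_gen False (na z) (nb z)" "fB z y ==> letB y = comb_gen True (nd z) (ne z)"
  using counts_near[OF z y] by (simp_all add: letA_def letB_def)

sublocale comb_cocycle 4 full_comb_set a H letA letB
proof (intro comb_cocycle.intro comb_cocycle_axioms.intro)
  show "comb_based 4 full_comb_set a" by unfold_locales
  show "group H" by (rule group_word_group)
  show "letA x \<in> carrier H \<and> letB x \<in> carrier H" if "x \<in> topspace X" for x
  proof -
    have "na x \<noteq> 0 ==> na x - 1 + nb x \<le> 3" "nd x \<noteq> 0 ==> nd x - 1 + ne x \<le> 3" using total_count[OF that] by auto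
    moreover have "[] \<in> words_over comb_index" using comb_gen_closed[of 0 0] by (simp add: comb_gen_def)
    ultimately show ?thesis using comb_gen_closed by (auto simp: letA_def letB_def)
  qed
  fix z x y assume z: "z \<in> topspace X" and x: "x \<in> N z" and y: "y \<in> N z"
  show "letA x = letA y" if "fA z x" "fA z y" using near_let(1)[OF z x] near_let(1)[OF z y] that by simp
  show "letB x = letB y" if "fB z x" "fB z y" using near_let(2)[OF z x] near_let(2)[OF z y] that by simp
  show "letA x \<otimes>\<^bsub>H\<^esub> letB y = letB y \<otimes>\<^bsub>H\<^esub> letA x" if f: "fA z x" "fB z y"
  proof -
    have "na z + nb z + nd z + ne z \<le> 2" using total_count[OF z] f by (simp add: fA_def fB_def)
    then show ?thesis using near_let(1)[OF z x f(1)] near_let(2)[OF z y f(2)] comb_gen_commute by simp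
  qed
qed

section \<open>The inverse homomorphism\<close>

definition hatv :: "bool \<times> nat \<times> nat => (real => complex set) set" where
  "hatv = (\<lambda>(s, i, b). if s then dh i b 0 else ah i b 0)"

definition val where "val = word_val G (ah 0 1 0) (dh 0 1 0) hatv"

lemma val_hom: "val \<in> hom H G"
  unfolding val_def by (rule G.word_val_hom[OF hat_closed hat_commute]) (auto simp: hatv_def)

lemma val_gen: "val (comb_gen False i b) = ah i b 0" "val (comb_gen True i b) = dh i b 0"
  by (auto simp: val_def comb_gen_def word_val_def letter_val_def hatv_def ah_0 dh_0_0)

text \<open>The transport from the representative of the cell, corrected by the gauge of the cell.
  This is the gauge for which \<open>comb_retraction\<close> applies.\<close>

definition pot where "pot y = gauge (nd y) (na y) \<otimes>\<^bsub>G\<^esub> m (False, False, y)"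

lemma pot_closed: "y \<in> topspace X ==> pot y \<in> carrier G"
  by (simp add: pot_def m_carrier FF_fconfs)

lemma pot_Lm:
  assumes c: "compat (False, False, y) (A, B, z)"
  shows "pot y \<otimes>\<^bsub>G\<^esub> Lm (False, False, y) (A, B, z) \<otimes>\<^bsub>G\<^esub> inv\<^bsub>G\<^esub> (pot z) =
    gauge (nd z + of_bool B) (na z + of_bool A) \<otimes>\<^bsub>G\<^esub> (m (A, B, z) \<otimes>\<^bsub>G\<^esub> inv\<^bsub>G\<^esub> (m (False, False, z))) \<otimes>\<^bsub>G\<^esub> inv\<^bsub>G\<^esub> (gauge (nd z) (na z))"
proof -
  note f = compat_fconfs[OF c]
  have mm: "m (False, False, y) \<in> carrier G" "m (A, B, z) \<in> carrier G" "m (False, False, z) \<in> carrier G" "Lm (False, False, y) (A, B, z) \<in> carrier G"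
    using m_carrier f fconfs_drop(3)[OF f(2)] Lm_closed[OF c fset_pcomp[OF f(1)]] by blast+
  have t: "m (A, B, z) = m (False, False, y) \<otimes>\<^bsub>G\<^esub> Lm (False, False, y) (A, B, z)"
    using m_trans[OF c cls_nonempty[OF f(1)] fset_pcomp[OF f(1)]] by simp
  have n: "nd z + of_bool B = nd y" "na z + of_bool A = na y" using compat_counts[OF c] by simp_all
  show ?thesis unfolding n t pot_def using mm by (simp add: G.m_assoc G.inv_mult_group)
qed

text \<open>According to the feet crossed between \<open>y\<close> and \<open>z\<close> the
  left-hand side is one, a value \<open>ah\<close>, a value \<open>dh\<close>, or their product; the
  independence lemmas remove the count on the other prong.\<close>

lemma pot_near:
  assumes z: "z \<in> topspace X" and y: "y \<in> N z"
  shows "pot y \<otimes>\<^bsub>G\<^esub> Lm (False, False, y) (fA z y, fB z y, z) \<otimes>\<^bsub>G\<^esub> inv\<^bsub>G\<^esub> (pot z) = val (opt (fA z y) (letA y) \<otimes>\<^bsub>H\<^esub> opt (fB z y) (letB y))"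
proof -
  interpret val: group_hom H G val using val_hom by unfold_locales
  note c = compat_slide[OF z y] and f = compat_fconfs(2)[OF compat_slide[OF z y]] and l = near_let[OF z y]
  have t: "na z + nb z + nd z + ne z + of_bool (fA z y) + of_bool (fB z y) \<le> 4" by (rule fconf_count[OF f])
  have mz: "m (False, False, z) \<in> carrier G" using m_carrier[OF fconfs_drop(3)[OF f]] .
  have cl: "comb_gen False (na z) (nb z) \<in> carrier H" if "fA z y" using t that by (auto intro: comb_gen_closed)
  have cl': "comb_gen True (nd z) (ne z) \<in> carrier H" if "fB z y" using t that by (auto intro: comb_gen_closed)
  have ah: "ah (na z) (nb z) (nd z + of_bool (fB z y)) = ah (na z) (nb z) 0" if "fA z y" using t that by (intro ah_indep) simp
  have dh: "dh (nd z) (ne z) (na z) = dh (nd z) (ne z) 0" if "fB z y" using t that by (intro dh_indep) simp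
  consider "\<not> fA z y" "\<not> fB z y" | "fA z y" "\<not> fB z y" | "\<not> fA z y" "fB z y" | "fA z y" "fB z y" by blast
  then show ?thesis
  proof cases
    case 1
    then show ?thesis unfolding pot_Lm[OF c] using mz val.hom_one by (simp add: opt_def)
  next
    case 2
    then have "m (True, False, z) \<otimes>\<^bsub>G\<^esub> inv\<^bsub>G\<^esub> (m (False, False, z)) = crossA (na z) (nb z) (nd z)" using crossA_eq[of False z] f by simp
    then have "gauge (nd z) (Suc (na z)) \<otimes>\<^bsub>G\<^esub> (m (True, False, z) \<otimes>\<^bsub>G\<^esub> inv\<^bsub>G\<^esub> (m (False, False, z))) \<otimes>\<^bsub>G\<^esub> inv\<^bsub>G\<^esub> (gauge (nd z) (na z)) = ah (na z) (nb z) 0"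
      using ah 2 by (simp only: ah_def[symmetric] of_bool_eq add_0_right)
    moreover have "opt (fA z y) (letA y) \<otimes>\<^bsub>H\<^esub> opt (fB z y) (letB y) = comb_gen False (na z) (nb z)"
      using 2 l cl H.r_one by (simp only: opt_def if_True if_False)
    ultimately show ?thesis unfolding pot_Lm[OF c] using 2 by (simp only: val_gen of_bool_eq add_0_right Suc_eq_plus1)
  next
    case 3
    then have "m (False, True, z) \<otimes>\<^bsub>G\<^esub> inv\<^bsub>G\<^esub> (m (False, False, z)) = crossB (nd z) (ne z) (na z)" using crossB_eq[of False z] f by simp
    then have "gauge (Suc (nd z)) (na z) \<otimes>\<^bsub>G\<^esub> (m (False, True, z) \<otimes>\<^bsub>G\<^esub> inv\<^bsub>G\<^esub> (m (False, False, z))) \<otimes>\<^bsub>G\<^esub> inv\<^bsub>G\<^esub> (gauge (nd z) (na z)) = dh (nd z) (ne z) 0"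
      using dh 3 by (simp only: dh_def[symmetric])
    moreover have "opt (fA z y) (letA y) \<otimes>\<^bsub>H\<^esub> opt (fB z y) (letB y) = comb_gen True (nd z) (ne z)"
      using 3 l cl' H.l_one by (simp only: opt_def if_True if_False)
    ultimately show ?thesis unfolding pot_Lm[OF c] using 3 by (simp only: val_gen of_bool_eq add_0_right Suc_eq_plus1)
  next
    case 4
    have a1: "ah (na z) (nb z) (Suc (nd z)) = ah (na z) (nb z) 0" using ah 4 by simp
    from 4 have "m (True, True, z) \<otimes>\<^bsub>G\<^esub> inv\<^bsub>G\<^esub> (m (False, False, z)) = crossA (na z) (nb z) (Suc (nd z)) \<otimes>\<^bsub>G\<^esub> crossB (nd z) (ne z) (na z)" using cross_both(1)[of z] f by simp
    then have "gauge (Suc (nd z)) (Suc (na z)) \<otimes>\<^bsub>G\<^esub> (m (True, True, z) \<otimes>\<^bsub>G\<^esub> inv\<^bsub>G\<^esub> (m (False, False, z))) \<otimes>\<^bsub>G\<^esub> inv\<^bsub>G\<^esub> (gauge (nd z) (na z)) =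
      ah (na z) (nb z) 0 \<otimes>\<^bsub>G\<^esub> dh (nd z) (ne z) 0"
      using a1 dh[OF 4(2)] by (simp only: hat_both(1)[symmetric])
    moreover have "opt (fA z y) (letA y) \<otimes>\<^bsub>H\<^esub> opt (fB z y) (letB y) = comb_gen False (na z) (nb z) \<otimes>\<^bsub>H\<^esub> comb_gen True (nd z) (ne z)"
      using 4 l by (simp only: opt_def if_True)
    moreover have "val (comb_gen False (na z) (nb z) \<otimes>\<^bsub>H\<^esub> comb_gen True (nd z) (ne z)) = ah (na z) (nb z) 0 \<otimes>\<^bsub>G\<^esub> dh (nd z) (ne z) 0"
      using val.hom_mult[OF cl cl'] 4 by (simp only: val_gen)
    ultimately show ?thesis unfolding pot_Lm[OF c] using 4 by (simp only: of_bool_eq Suc_eq_plus1)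
  qed
qed

lemma pot_base: "pot a = \<one>\<^bsub>G\<^esub>"
  by (simp add: pot_def base_cell m_base)

lemma pcomp_top: "x \<in> pcomp ==> x \<in> topspace X"
  using base_path[of x] path_finish_in_topspace[of "cset 4 full_comb_set" "base_path x"] by simp

lemma val_Hol: "x \<in> carrier G ==> val (Hol x) = x"
  by (rule comb_retraction[where k = pot, OF val_hom _ pot_base]) (use pot_closed pcomp_top pot_near in auto)

text \<open>The obstruction to \<open>val\<close> being a right inverse of \<open>Hol\<close> as
  well: on a cocycle value, \<open>Hol\<close> after \<open>val\<close> acts by multiplying with
  \<open>nu\<close> at one end and its inverse at the other. It turns out to be constantly
  one.\<close>

definition nu where "nu x = Hol (pot x) \<otimes>\<^bsub>H\<^esub> hol (base_path x)"

lemma nu_path: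
  assumes p: "pathin X p"
  shows "Hol (pot (p 0) \<otimes>\<^bsub>G\<^esub> transport p \<otimes>\<^bsub>G\<^esub> inv\<^bsub>G\<^esub> (pot (p 1))) = nu (p 0) \<otimes>\<^bsub>H\<^esub> hol p \<otimes>\<^bsub>H\<^esub> inv\<^bsub>H\<^esub> (nu (p 1))"
    "nu (p 0) \<in> carrier H" "nu (p 1) \<in> carrier H"
proof -
  interpret Hl: group_hom G H Hol using Hol_hom by unfold_locales
  have t: "p 0 \<in> topspace X" "p 1 \<in> topspace X"
    using path_start_in_topspace[OF p] path_finish_in_topspace[OF p] by auto
  note pc = pcomp_all[OF t(1)] pcomp_all[OF t(2)]
  have g: "pot (p 0) \<in> carrier G" "pot (p 1) \<in> carrier G" "transport p \<in> carrier G"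
    using pot_closed t transport_closed[OF p pc(1)] by auto
  have h: "hol (base_path (p 0)) \<in> carrier H" "hol (base_path (p 1)) \<in> carrier H" "hol p \<in> carrier H"
    "Hol (pot (p 0)) \<in> carrier H" "Hol (pot (p 1)) \<in> carrier H"
    using hol_closed base_path(1)[OF pc(1)] base_path(1)[OF pc(2)] p Hl.hom_closed g by blast+
  show n: "nu (p 0) \<in> carrier H" "nu (p 1) \<in> carrier H" unfolding nu_def using h by (simp_all only: H.m_closed)
  show "Hol (pot (p 0) \<otimes>\<^bsub>G\<^esub> transport p \<otimes>\<^bsub>G\<^esub> inv\<^bsub>G\<^esub> (pot (p 1))) = nu (p 0) \<otimes>\<^bsub>H\<^esub> hol p \<otimes>\<^bsub>H\<^esub> inv\<^bsub>H\<^esub> (nu (p 1))"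
    unfolding nu_def using g h
    by (simp only: Hl.hom_mult Hl.hom_inv G.m_closed G.inv_closed Hol_transport[OF p pc(1)] H.inv_mult_group H.m_assoc H.m_closed H.inv_closed)
qed

lemma hol_const_counts:
  assumes p: "pathin X p" and c: "\<And>t. t \<in> {0..1} ==> na (p t) = na (p 0) \<and> nd (p t) = nd (p 0)"
  shows "hol p = \<one>\<^bsub>H\<^esub>"
proof -
  obtain k where k: "fine_partition k p" using ex_fine_partition[OF p] by blast
  have "tau (p (real i / real k)) (p (real (Suc i) / real k)) = \<one>\<^bsub>H\<^esub>" if "i < k" for i
  proof -
    have "real i / real k \<in> {0..1}" "real (Suc i) / real k \<in> {0..1}" using that by (auto simp: field_simps)
    from c[OF this(1)] c[OF this(2)] show ?thesis by (simp add: tau_def cross_def)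
  qed
  then have "seqprod H (\<lambda>i. tau (p (real i / real k)) (p (real (Suc i) / real k))) j = \<one>\<^bsub>H\<^esub>" if "j \<le> k" for j
    using that by (induction j) simp_all
  then show ?thesis using hol_eq[OF k] by (simp add: holn_def)
qed

text \<open>A motion within a cell keeps the counts, so its holonomy is trivial, and it carries
  \<open>pot y\<close> to \<open>pot y'\<close>.\<close>

lemma nu_cell:
  assumes y: "y \<in> topspace X" "y' \<in> topspace X" and c: "na y = na y'" "nd y = nd y'"
  shows "nu y = nu y'"
proof -
  let ?p = "motion 4 (tup (False, False, y)) (tup (False, False, y'))"
  have co: "compat (False, False, y) (False, False, y')" using y c by (intro full_compat FF_fconfs) auto
  note p = compat_path[OF co, unfolded fset.simps]
  have "hol ?p = \<one>\<^bsub>H\<^esub>"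
  proof (rule hol_const_counts[OF p(1)])
    fix t :: real assume "t \<in> {0..1}"
    then show "na (?p t) = na (?p 0) \<and> nd (?p t) = nd (?p 0)"
      using motion_counts[OF co, of t] c unfolding p(2) by (cases "t = 1") (simp_all only: p(3), auto)
  qed
  moreover have "pot y \<otimes>\<^bsub>G\<^esub> transport ?p \<otimes>\<^bsub>G\<^esub> inv\<^bsub>G\<^esub> (pot y') = \<one>\<^bsub>G\<^esub>"
    using pot_Lm[OF co] m_carrier[OF FF_fconfs[OF y(2)]] by (simp add: Lm_def)
  moreover note nu_path[OF p(1), unfolded p(2,3)]
  moreover have "Hol \<one>\<^bsub>G\<^esub> = \<one>\<^bsub>H\<^esub>" by (rule hom_one[OF Hol_hom G.is_group H.is_group])
  ultimately have "nu y \<otimes>\<^bsub>H\<^esub> inv\<^bsub>H\<^esub> (nu y') = \<one>\<^bsub>H\<^esub>" and n: "nu y \<in> carrier H" "nu y' \<in> carrier H" by (simp_all only: H.r_one)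
  then show ?thesis using H.right_cancel[OF H.inv_closed[OF n(2)] n] H.r_inv[OF n(2)] by simp
qed

lemma nu_near:
  assumes z: "z \<in> topspace X" and y: "y \<in> N z"
  shows "Hol (val (tau y z)) = nu y \<otimes>\<^bsub>H\<^esub> tau y z \<otimes>\<^bsub>H\<^esub> inv\<^bsub>H\<^esub> (nu z)" "nu y \<in> carrier H" "nu z \<in> carrier H"
proof -
  let ?p = "slide z (eps z) y"
  have yn: "y \<in> nbr 4 full_comb_set z (eps z)" using y by (simp add: N_def)
  note p = pathin_slide[OF z good_eps[OF z] yn] and e = slide_ends(1)[OF z good_eps[OF z] yn] slide_ends(2)[OF z good_eps[OF z]]
  have "hol ?p = tau (?p 0) (?p 1)"
    by (rule hol_in_N[OF z]) (use slide_pts(3)[OF z good_eps[OF z] yn] in \<open>simp add: N_def\<close>)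
  then show "Hol (val (tau y z)) = nu y \<otimes>\<^bsub>H\<^esub> tau y z \<otimes>\<^bsub>H\<^esub> inv\<^bsub>H\<^esub> (nu z)" "nu y \<in> carrier H" "nu z \<in> carrier H"
    using nu_path[OF p, unfolded e] pot_near[OF z y] unfolding slide_Lm[OF z y] tau_center[OF z y, symmetric] e by simp_all
qed

lemma nu_near_eq:
  assumes z: "z \<in> topspace X" and y: "y \<in> N z" and t: "tau y z = \<one>\<^bsub>H\<^esub>"
  shows "nu y = nu z"
proof -
  have "val \<one>\<^bsub>H\<^esub> = \<one>\<^bsub>G\<^esub>" "Hol \<one>\<^bsub>G\<^esub> = \<one>\<^bsub>H\<^esub>"
    by (rule hom_one[OF val_hom H.is_group G.is_group], rule hom_one[OF Hol_hom G.is_group H.is_group])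
  then have "nu y \<otimes>\<^bsub>H\<^esub> inv\<^bsub>H\<^esub> (nu z) = \<one>\<^bsub>H\<^esub>" using nu_near[OF z y] unfolding t by (simp only: H.r_one)
  then show ?thesis using H.right_cancel[OF H.inv_closed[OF nu_near(3)[OF z y]] nu_near(2,3)[OF z y]] H.r_inv[OF nu_near(3)[OF z y]] by simp
qed

lemma near_crossing:
  assumes u: "(A, B, z) \<in> fconfs"
  obtains y where "y \<in> N z" "fA z y = A" "fB z y = B" "y \<in> topspace X" "na y = na z + of_bool A" "nd y = nd z + of_bool B"
proof -
  obtain y' where "compat (False, False, y') (A, B, z)" using cls_nonempty[OF u] by (auto simp: cls_def)
  then obtain y where y: "y \<in> N z" "fA z y = A" "fB z y = B" using near_boundary by blast
  have z: "z \<in> topspace X" using fconfs_facts(4)[OF u] by simp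
  show thesis by (rule that[OF y N_top[OF y(1)]]) (use counts_near(1,2)[OF z y(1)] y in simp_all)
qed

text \<open>Along the crossings of \<open>cell_induct\<close> the generator is trivial, so
  \<open>nu\<close> keeps its value from cell to cell.\<close>

lemma nu_one: "x \<in> topspace X ==> nu x = \<one>\<^bsub>H\<^esub>"
proof (induction rule: cell_induct)
  case (base x)
  have "nu a = \<one>\<^bsub>H\<^esub>"
    using hol_const[OF base_in] hom_one[OF Hol_hom G.is_group H.is_group] H.one_closed H.r_one[OF H.one_closed]
    by (simp only: nu_def pot_base base_path_base)
  then show ?case using nu_cell[OF base(1) base_in] base base_cell by simp
next
  case (A x z)
  have z: "z \<in> topspace X" using fconfs_facts(4)[OF A(2)] by simp
  obtain y where y: "y \<in> N z" "fA z y = True" "fB z y = False" "y \<in> topspace X" "na y = na z + of_bool True" "nd y = nd z + of_bool False"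
    using near_crossing[OF A(2)] .
  have "tau y z = \<one>\<^bsub>H\<^esub>" unfolding tau_center[OF z y(1)] using near_let(1)[OF z y(1)] y A by (simp add: opt_def comb_gen_def)
  then show ?case using nu_near_eq[OF z y(1)] nu_cell[OF A(1) y(4)] A y by simp
next
  case (B x z)
  have z: "z \<in> topspace X" using fconfs_facts(4)[OF B(2)] by simp
  obtain y where y: "y \<in> N z" "fA z y = False" "fB z y = True" "y \<in> topspace X" "na y = na z + of_bool False" "nd y = nd z + of_bool True"
    using near_crossing[OF B(2)] .
  have "tau y z = \<one>\<^bsub>H\<^esub>" unfolding tau_center[OF z y(1)] using near_let(2)[OF z y(1)] y B by (simp add: opt_def comb_gen_def)
  then show ?case using nu_near_eq[OF z y(1)] nu_cell[OF B(1) y(4)] B y by simp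
qed

lemma Hol_val_tau:
  assumes z: "z \<in> topspace X" and y: "y \<in> N z"
  shows "Hol (val (tau y z)) = tau y z"
proof -
  have t: "tau y z \<in> carrier H" by (rule \<tau>_closed[OF z y N_self[OF z]])
  show ?thesis unfolding nu_near(1)[OF z y] nu_one[OF z] nu_one[OF N_top[OF y]] H.inv_one H.l_one[OF t] H.r_one[OF t] ..
qed

text \<open>Every generator is the cocycle value at some crossing, and cocycle values are in the
  image by \<open>Hol_val_tau\<close>. This gives surjectivity.\<close>

lemma Hol_gen:
  assumes "i + b \<le> 3"
  shows "comb_gen s i b \<in> Hol ` carrier G"
proof -
  have "\<exists>z y. z \<in> topspace X \<and> y \<in> N z \<and> tau y z = comb_gen s i b"
  proof (cases s)
    case True
    have "0 + 0 + i + b + of_bool False + of_bool True \<le> (4::nat)" using assms by simp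
    then obtain z where z: "z \<in> topspace X" "nd z = i" "ne z = b" "1 \<in> z" using ex_configuration by metis
    then have "(False, True, z) \<in> fconfs" by (simp add: fconfs_def)
    then obtain y where y: "y \<in> N z" "fA z y = False" "fB z y = True" by (rule near_crossing)
    have "tau y z = \<one>\<^bsub>H\<^esub> \<otimes>\<^bsub>H\<^esub> comb_gen s i b" unfolding tau_center[OF z(1) y(1)] using near_let(2)[OF z(1) y(1)] y z True by (simp add: opt_def)
    then have "tau y z = comb_gen s i b" by simp
    then show ?thesis using z y by blast
  next
    case False
    have "i + b + 0 + 0 + of_bool True + of_bool False \<le> (4::nat)" using assms by simp
    then obtain z where z: "z \<in> topspace X" "na z = i" "nb z = b" "0 \<in> z" using ex_configuration by metis
    then have "(True, False, z) \<in> fconfs" by (simp add: fconfs_def)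
    then obtain y where y: "y \<in> N z" "fA z y = True" "fB z y = False" by (rule near_crossing)
    have "tau y z = comb_gen s i b \<otimes>\<^bsub>H\<^esub> \<one>\<^bsub>H\<^esub>" unfolding tau_center[OF z(1) y(1)] using near_let(1)[OF z(1) y(1)] y z False by (simp add: opt_def)
    then have "tau y z = comb_gen s i b" using H.r_one[of "comb_gen s i b"] comb_gen_closed[OF assms] by simp
    then show ?thesis using z y by blast
  qed
  then obtain z y where zy: "z \<in> topspace X" "y \<in> N z" "tau y z = comb_gen s i b" by blast
  have "val (comb_gen s i b) \<in> carrier G" using val_hom comb_gen_closed[OF assms] by (auto simp: hom_def Pi_iff)
  then show ?thesis using Hol_val_tau[OF zy(1,2)] unfolding zy(3) by (metis image_eqI)
qed

lemma Hol_inj: "inj_on Hol (carrier G)"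
  by (rule inj_on_inverseI[of _ val]) (rule val_Hol)

end

section \<open>The H-shaped tree\<close>

context int_plane_group begin

lemma e_int_pow: "e a b [^] (k::int) = e (k * a) (k * b)"
proof -
  have nat: "e a b [^] (k::nat) = e (int k * a) (int k * b)" for k
    by (induction k) (simp_all add: e_one e_mult algebra_simps)
  have inv: "inv (e c d) = e (- c) (- d)" for c d
    by (rule inv_equality) (simp_all add: e_mult e_one e_carrier)
  obtain l where "k = int l \<or> k = - int l" by (metis int_cases2)
  then show ?thesis
  proof
    assume k: "k = int l"
    show ?thesis unfolding k int_pow_int by (rule nat)
  next
    assume k: "k = - int l"
    show ?thesis unfolding k int_pow_neg_int[OF e_carrier] nat inv by (simp only: mult_minus_left)
  qed
qed

lemma independent_e: "independent_pair (e 1 0) (e 0 1)"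
proof -
  have ind: "i = 0 \<and> j = 0" if "e 1 0 [^] (i::int) \<otimes> e 0 1 [^] (j::int) = \<one>" for i j
    using that e_inj[of i j 0 0] by (simp add: e_int_pow e_mult e_one)
  have com: "e 1 0 \<otimes> e 0 1 = e 0 1 \<otimes> e 1 0" by (simp add: e_mult)
  show ?thesis unfolding independent_pair_def by (intro conjI allI e_carrier com) (rule impI, erule ind)
qed

end

lemma graph_braid_group_iso:
  assumes h: "homeomorphic_map (realization \<Gamma>) (top_of_set Z) f" and S: "S \<in> topspace (uconf_graph n \<Gamma>)"
  shows "\<exists>\<phi>. \<phi> \<in> iso (graph_braid_group n \<Gamma> S) (fundamental_group (cset n Z) (orbit_set n f S))"
    "orbit_set n f S \<in> topspace (cset n Z)" "group (graph_braid_group n \<Gamma> S)"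
proof -
  have o: "homeomorphic_map (uconf_graph n \<Gamma>) (cset n Z) (orbit_set n f)"
    unfolding uconf_graph_def by (rule homeomorphic_map_orbit_set[OF h])
  show "\<exists>\<phi>. \<phi> \<in> iso (graph_braid_group n \<Gamma> S) (fundamental_group (cset n Z) (orbit_set n f S))"
    unfolding graph_braid_group_def using fundamental_group_homeomorphic[OF o S] by blast
  show "orbit_set n f S \<in> topspace (cset n Z)" using homeomorphic_imp_surjective_map[OF o] S by blast
  show "group (graph_braid_group n \<Gamma> S)" unfolding graph_braid_group_def by (rule group_fundamental_group[OF S])
qed

text \<open>Arc 0 joins the two branch vertices 0 and 1. Arcs 1 and 2 lead from vertex 0 to the
  leaves 2 and 4, arcs 3 and 4 from vertex 1 to the leaves 3 and 5.\<close>

definition H_tail :: "nat => nat" where "H_tail e = (if e \<le> 2 then 0 else 1)"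
definition H_head :: "nat => nat" where
  "H_head e = (if e = 0 then 1 else if e = 1 then 2 else if e = 2 then 4 else if e = 3 then 3 else 5)"

definition H_tree :: "(nat, nat) pre_digraph" where
  "H_tree = \<lparr>verts = {..<6}, arcs = {..<5}, tail = H_tail, head = H_head\<rparr>"

text \<open>
  For \<open>r < 5\<close> the position \<open>H_place r\<close> serves the subgraphs without the arc \<open>r\<close>: their only possible
  branch vertex is moved to 0, and everything else fits on the spine.
\<close>

definition H_place :: "nat => nat => complex" where
  "H_place r v = (if r = 0 then [0, 2, -1, 1, \<i>, 3] else if r = 1 then [1, 0, 3, -1, 2, \<i>]
     else if r = 2 then [1, 0, 2, -1, 3, \<i>] else if r = 3 then [0, 1, -1, 3, \<i>, 2]
     else if r = 4 then [0, 1, -1, 2, \<i>, 3] else [0, 1, -1, 2, \<i>, 1 + \<i>]) ! v"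

lemma less_numerals:
  "(r::nat) < 6 \<longleftrightarrow> r = 0 \<or> r = 1 \<or> r = 2 \<or> r = 3 \<or> r = 4 \<or> r = 5"
  "(r::nat) < 5 \<longleftrightarrow> r = 0 \<or> r = 1 \<or> r = 2 \<or> r = 3 \<or> r = 4"
  by auto

lemma H_place_inj:
  assumes "r < 6"
  shows "inj_on (H_place r) {..<6}"
proof (rule inj_onI)
  fix v w assume "v \<in> {..<6}" "w \<in> {..<6}" "H_place r v = H_place r w"
  then show "v = w"
    using assms unfolding lessThan_iff less_numerals by (elim disjE) (simp_all add: H_place_def complex_eq_iff)
qed

abbreviation H_line :: "nat => nat => real => complex" where
  "H_line r e \<equiv> linepath (H_place r (H_tail e)) (H_place r (H_head e))"

lemma H_line_coords:
  "Re (linepath x y t) = Re x + t * (Re y - Re x)" "Im (linepath x y t) = Im x + t * (Im y - Im x)"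
  by (simp_all add: linepath_def algebra_simps)

lemma H_line_vertex:
  assumes "r < 6" "v < 6" "e < 5" "e \<noteq> r" "0 < t" "t < 1"
  shows "H_place r v \<noteq> H_line r e t"
proof
  assume "H_place r v = H_line r e t"
  then have "Re (H_place r v) = Re (H_line r e t)" "Im (H_place r v) = Im (H_line r e t)" by simp_all
  then show False
    using assms unfolding less_numerals H_line_coords
    by (elim disjE) (simp_all add: H_place_def H_tail_def H_head_def)
qed

lemma H_line_line:
  assumes "r < 6" "e < 5" "e' < 5" "e \<noteq> r" "e' \<noteq> r" "0 < s" "s < 1" "0 < t" "t < 1" and eq: "H_line r e s = H_line r e' t"
  shows "e = e' \<and> s = t"
proof -
  have "Re (H_line r e s) = Re (H_line r e' t)" "Im (H_line r e s) = Im (H_line r e' t)" using eq by simp_all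
  then show ?thesis
    using assms(1-9) unfolding less_numerals H_line_coords
    by (elim disjE) (simp_all add: H_place_def H_tail_def H_head_def)
qed

text \<open>The number \<open>r\<close> plays two parts, the missing arc and the choice of
  positions; as 5 is not an arc, the positions for 5 serve the whole tree.\<close>

lemma H_drawing:
  assumes sub: "subgraph \<Lambda> H_tree" and r: "r < 6" "r \<notin> arcs \<Lambda>"
  shows "homeomorphic_map (realization \<Lambda>) (top_of_set (drawing \<Lambda> (H_place r))) (draw \<Lambda> (H_place r))"
    "locally_starlike (drawing \<Lambda> (H_place r))"
    "\<And>p. p \<in> drawing \<Lambda> (H_place r) ==> (\<exists>v<6. p = H_place r v) \<or> (\<exists>e t. e < 5 \<and> e \<noteq> r \<and> 0 \<le> t \<and> t \<le> 1 \<and> p = H_line r e t)"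
proof -
  have s: "verts \<Lambda> \<subseteq> {..<6}" "arcs \<Lambda> \<subseteq> {..<5}" "wf_digraph \<Lambda>" "tail \<Lambda> = H_tail" "head \<Lambda> = H_head"
    using sub by (auto simp: subgraph_def compatible_def H_tree_def)
  have fin: "finite (verts \<Lambda>)" "finite (arcs \<Lambda>)" using s(1,2) finite_subset by blast+
  have a: "e < 5 \<and> e \<noteq> r" if "e \<in> arcs \<Lambda>" for e using that s(2) r(2) by auto
  show "homeomorphic_map (realization \<Lambda>) (top_of_set (drawing \<Lambda> (H_place r))) (draw \<Lambda> (H_place r))"
  proof (rule draw_homeomorphic[OF s(3) fin], unfold s(4,5))
    show "inj_on (H_place r) (verts \<Lambda>)" using H_place_inj[OF r(1)] s(1) by (rule inj_on_subset)
    show "H_place r v \<noteq> H_line r e t" if "v \<in> verts \<Lambda>" "e \<in> arcs \<Lambda>" "0 < t" "t < 1" for v e t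
      using H_line_vertex[OF r(1), of v e t] that a[of e] s(1) by auto
    show "e = e' \<and> u = t" if "e \<in> arcs \<Lambda>" "e' \<in> arcs \<Lambda>" "0 < u" "u < 1" "0 < t" "t < 1" "H_line r e u = H_line r e' t" for e e' u t
      using H_line_line[OF r(1), of e e' u t] that a[of e] a[of e'] by blast
  qed
  show "locally_starlike (drawing \<Lambda> (H_place r))" by (rule locally_starlike_drawing[OF fin])
  fix p assume "p \<in> drawing \<Lambda> (H_place r)"
  then consider v where "v \<in> verts \<Lambda>" "p = H_place r v" | e where "e \<in> arcs \<Lambda>" "p \<in> H_line r e ` {0..1}"
    unfolding drawing_def s(4,5) linepath_image_segment by blast
  then show "(\<exists>v<6. p = H_place r v) \<or> (\<exists>e t. e < 5 \<and> e \<noteq> r \<and> 0 \<le> t \<and> t \<le> 1 \<and> p = H_line r e t)"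
  proof cases
    case 1
    then show ?thesis using s(1) by blast
  next
    case (2 e)
    then obtain t where "0 \<le> t" "t \<le> 1" "p = H_line r e t" by auto
    then show ?thesis using a[OF 2(1)] by blast
  qed
qed

lemma H_place_comb:
  assumes "r < 5"
  shows "v < 6 ==> (Im (H_place r v) = 0 \<and> \<bar>Re (H_place r v)\<bar> \<le> 3) \<or> (0 < Im (H_place r v) \<and> Im (H_place r v) \<le> 1 \<and> Re (H_place r v) = 0)"
    "e < 5 ==> e \<noteq> r ==> 0 \<le> t ==> t \<le> 1 ==>
      (Im (H_line r e t) = 0 \<and> \<bar>Re (H_line r e t)\<bar> \<le> 3) \<or> (0 < Im (H_line r e t) \<and> Im (H_line r e t) \<le> 1 \<and> Re (H_line r e t) = 0)"
proof -
  show "(Im (H_place r v) = 0 \<and> \<bar>Re (H_place r v)\<bar> \<le> 3) \<or> (0 < Im (H_place r v) \<and> Im (H_place r v) \<le> 1 \<and> Re (H_place r v) = 0)" if "v < 6"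
    using that assms unfolding less_numerals by (elim disjE) (simp_all add: H_place_def)
  show "(Im (H_line r e t) = 0 \<and> \<bar>Re (H_line r e t)\<bar> \<le> 3) \<or> (0 < Im (H_line r e t) \<and> Im (H_line r e t) \<le> 1 \<and> Re (H_line r e t) = 0)"
    if "e < 5" "e \<noteq> r" "0 \<le> t" "t \<le> 1"
    using that assms unfolding less_numerals H_line_coords
    by (elim disjE) (simp_all add: H_place_def H_tail_def H_head_def, (auto simp: abs_if)?)
qed

lemma proper_subgraph_no_independent_pair:
  assumes sub: "subgraph \<Lambda> H_tree" and ne: "\<Lambda> \<noteq> H_tree" and S: "S \<in> topspace (uconf_graph k \<Lambda>)"
  shows "\<not> group.independent_pair (graph_braid_group k \<Lambda> S) x y"
proof -
  have s: "verts \<Lambda> \<subseteq> {..<6}" "arcs \<Lambda> \<subseteq> {..<5}" "wf_digraph \<Lambda>" "tail \<Lambda> = H_tail" "head \<Lambda> = H_head"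
    using sub by (auto simp: subgraph_def compatible_def H_tree_def)
  \<comment> \<open>Every vertex is an end of some arc, so a subgraph with all arcs is the whole
    tree.\<close>
  have "arcs \<Lambda> \<noteq> {..<5}"
  proof
    assume e: "arcs \<Lambda> = {..<5}"
    have ends: "H_tail i \<in> verts \<Lambda> \<and> H_head i \<in> verts \<Lambda>" if "i < 5" for i
      using wf_digraph.wellformed[OF s(3), of i] that by (simp add: e s(4,5))
    have "{..<6} \<subseteq> verts \<Lambda>"
    proof
      fix v :: nat assume "v \<in> {..<6}"
      then show "v \<in> verts \<Lambda>"
        using ends[of 0] ends[of 1] ends[of 2] ends[of 3] ends[of 4]
        unfolding lessThan_iff less_numerals by (elim disjE) (simp_all add: H_tail_def H_head_def)
    qed
    then have "\<Lambda> = H_tree" using s e by (intro pre_digraph.equality) (auto simp: H_tree_def)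
    then show False using ne by simp
  qed
  then obtain r where r: "r < 5" "r \<notin> arcs \<Lambda>" using s(2) by auto
  let ?Z = "drawing \<Lambda> (H_place r)"
  have r6: "r < 6" using r(1) by simp
  note d = H_drawing[OF sub r6 r(2)]
  have Z: "(Im p = 0 \<and> \<bar>Re p\<bar> \<le> 3) \<or> (0 < Im p \<and> Im p \<le> 1 \<and> Re p = 0)" if "p \<in> ?Z" for p
    using d(3)[OF that] H_place_comb[OF r(1)] by blast
  note b = graph_braid_group_iso[OF d(1) S]
  interpret tripod k ?Z "orbit_set k (draw \<Lambda> (H_place r)) S"
  proof unfold_locales
    fix p assume p: "p \<in> ?Z"
    show "Im p = 0 \<and> \<bar>Re p\<bar> \<le> 3 \<or> 0 < Im p \<and> Im p \<le> 1 \<and> (Re p = 0 \<or> Re p = 1)" using Z[OF p] by blast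
    show "0 < Im p ==> Re p = 0" using Z[OF p] by auto
  qed (rule d(2), rule b(2))
  interpret B: group "graph_braid_group k \<Lambda> S" by (rule b(3))
  obtain \<phi> where "\<phi> \<in> iso (graph_braid_group k \<Lambda> S) G" using b(1) by blast
  then have h: "\<phi> \<in> hom (graph_braid_group k \<Lambda> S) G" "inj_on \<phi> (carrier (graph_braid_group k \<Lambda> S))" by (auto simp: iso_def bij_betw_def)
  interpret h: group_hom "graph_braid_group k \<Lambda> S" G \<phi> using h(1) by unfold_locales
  show ?thesis
  proof
    assume "B.independent_pair x y"
    then have "G.independent_pair (\<phi> x) (\<phi> y)"
      by (rule B.independent_pair_hom_image[OF h(1) G.is_group, rotated]) (use h(2) in \<open>metis B.one_closed h.hom_one inj_onD\<close>)
    then show False using no_independent_pair by blast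
  qed
qed

lemma wf_H_tree: "wf_digraph H_tree"
  by unfold_locales (auto simp: H_tree_def H_tail_def H_head_def)

lemma subgraph_H_tree: "subgraph H_tree H_tree"
  using wf_H_tree by (simp add: subgraph_def compatible_def)

lemma connected_H_tree: "Digraph_Component.connected H_tree"
proof -
  let ?M = "with_proj (mk_symmetric H_tree)"
  have ends: "(H_tail e, H_head e) \<in> arcs_ends ?M \<and> (H_head e, H_tail e) \<in> arcs_ends ?M" if "e < 5" for e
    using that by (force simp: mk_symmetric_def H_tree_def arcs_ends_def arc_to_ends_def)
  have v: "verts ?M = {..<6}" by (simp add: mk_symmetric_def H_tree_def)
  have step: "(H_tail e, H_head e) \<in> rtrancl_on {..<6} (arcs_ends ?M) \<and> (H_head e, H_tail e) \<in> rtrancl_on {..<6} (arcs_ends ?M)" if "e < 5" for e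
    using ends[OF that] by (auto intro!: rtrancl_on_into_rtrancl_on[OF rtrancl_on_refl] simp: H_tail_def H_head_def)
  have z: "(0, w) \<in> rtrancl_on {..<6} (arcs_ends ?M) \<and> (w, 0) \<in> rtrancl_on {..<6} (arcs_ends ?M)" if "w < 6" for w
  proof -
    have 0: "(0, 1) \<in> rtrancl_on {..<6} (arcs_ends ?M)" "(1, 0) \<in> rtrancl_on {..<6} (arcs_ends ?M)"
      using step[of 0] by (simp_all add: H_tail_def H_head_def)
    have 1: "(0, 2) \<in> rtrancl_on {..<6} (arcs_ends ?M)" "(2, 0) \<in> rtrancl_on {..<6} (arcs_ends ?M)"
      using step[of 1] by (simp_all add: H_tail_def H_head_def)
    have 2: "(0, 4) \<in> rtrancl_on {..<6} (arcs_ends ?M)" "(4, 0) \<in> rtrancl_on {..<6} (arcs_ends ?M)"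
      using step[of 2] by (simp_all add: H_tail_def H_head_def)
    have 3: "(1, 3) \<in> rtrancl_on {..<6} (arcs_ends ?M)" "(3, 1) \<in> rtrancl_on {..<6} (arcs_ends ?M)"
      using step[of 3] by (simp_all add: H_tail_def H_head_def)
    have 4: "(1, 5) \<in> rtrancl_on {..<6} (arcs_ends ?M)" "(5, 1) \<in> rtrancl_on {..<6} (arcs_ends ?M)"
      using step[of 4] by (simp_all add: H_tail_def H_head_def)
    have 5: "(0, 3) \<in> rtrancl_on {..<6} (arcs_ends ?M)" "(3, 0) \<in> rtrancl_on {..<6} (arcs_ends ?M)"
      by (rule rtrancl_on_trans[OF 0(1) 3(1)], rule rtrancl_on_trans[OF 3(2) 0(2)])
    have 6: "(0, 5) \<in> rtrancl_on {..<6} (arcs_ends ?M)" "(5, 0) \<in> rtrancl_on {..<6} (arcs_ends ?M)"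
      by (rule rtrancl_on_trans[OF 0(1) 4(1)], rule rtrancl_on_trans[OF 4(2) 0(2)])
    show ?thesis using that 0 1 2 5 6 unfolding less_numerals by (elim disjE) simp_all
  qed
  have "(u, w) \<in> rtrancl_on {..<6} (arcs_ends ?M)" if "u \<in> {..<6}" "w \<in> {..<6}" for u w
    using rtrancl_on_trans[OF conjunct2[OF z] conjunct1[OF z], of u w] that by simp
  moreover have "{..<6::nat} \<noteq> {}" by (simp add: lessThan_empty_iff)
  ultimately show ?thesis
    unfolding Digraph_Component.connected_def strongly_connected_def reachable_def v by (intro conjI ballI)
qed

lemma H_tree_drawing: "drawing H_tree (H_place 5) = full_comb_set"
proof
  have d: "(\<exists>v<6. p = H_place 5 v) \<or> (\<exists>e t. e < 5 \<and> e \<noteq> 5 \<and> 0 \<le> t \<and> t \<le> 1 \<and> p = H_line 5 e t)" if "p \<in> drawing H_tree (H_place 5)" for p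
    by (rule H_drawing(3)[OF subgraph_H_tree _ _ that]) (simp_all add: H_tree_def)
  show "drawing H_tree (H_place 5) \<subseteq> full_comb_set"
  proof
    fix p assume "p \<in> drawing H_tree (H_place 5)"
    from d[OF this] consider v where "v < 6" "p = H_place 5 v" | e t where "e < 5" "0 \<le> t" "t \<le> 1" "p = H_line 5 e t" by blast
    then show "p \<in> full_comb_set"
    proof cases
      case 1
      then show ?thesis unfolding less_numerals by (elim disjE) (simp_all add: H_place_def full_comb_set_def)
    next
      case (2 e t)
      then have "(Im (H_line 5 e t) = 0 \<and> -1 \<le> Re (H_line 5 e t) \<and> Re (H_line 5 e t) \<le> 2) \<or>
          (0 \<le> Im (H_line 5 e t) \<and> Im (H_line 5 e t) \<le> 1 \<and> (Re (H_line 5 e t) = 0 \<or> Re (H_line 5 e t) = 1))"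
        unfolding less_numerals H_line_coords by (elim disjE) (simp_all add: H_place_def H_tail_def H_head_def)
      then show ?thesis unfolding 2(4) full_comb_set_def by blast
    qed
  qed
  have l: "H_line 5 e t \<in> drawing H_tree (H_place 5)" if "e < 5" "0 \<le> t" "t \<le> 1" for e t
    unfolding drawing_def linepath_image_segment[symmetric]
    by (rule UnI2, rule UN_I[of e], simp add: H_tree_def that, rule image_eqI[of _ _ t]) (simp_all add: H_tree_def that)
  show "full_comb_set \<subseteq> drawing H_tree (H_place 5)"
  proof
    fix p assume p: "p \<in> full_comb_set"
    have "\<exists>e t. e < 5 \<and> 0 \<le> t \<and> t \<le> 1 \<and> p = H_line 5 e t"
    proof (cases "Im p = 0")
      case True
      then have re: "-1 \<le> Re p" "Re p \<le> 2" using p by (auto simp: full_comb_set_def)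
      consider "Re p \<le> 0" | "0 \<le> Re p" "Re p \<le> 1" | "1 \<le> Re p" by linarith
      then show ?thesis
      proof cases
        case 1
        then have "p = H_line 5 1 (- Re p)" unfolding complex_eq_iff H_line_coords using True by (simp add: H_place_def H_tail_def H_head_def)
        then show ?thesis using 1 re by (intro exI[of _ 1] exI[of _ "- Re p"]) simp
      next
        case 2
        then have "p = H_line 5 0 (Re p)" unfolding complex_eq_iff H_line_coords using True by (simp add: H_place_def H_tail_def H_head_def)
        then show ?thesis using 2 by (intro exI[of _ 0] exI[of _ "Re p"]) simp
      next
        case 3
        then have "p = H_line 5 3 (Re p - 1)" unfolding complex_eq_iff H_line_coords using True by (simp add: H_place_def H_tail_def H_head_def)
        then show ?thesis using 3 re by (intro exI[of _ 3] exI[of _ "Re p - 1"]) simp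
      qed
    next
      case False
      then have im: "0 \<le> Im p" "Im p \<le> 1" "Re p = 0 \<or> Re p = 1" using p by (auto simp: full_comb_set_def)
      define e :: nat where "e = (if Re p = 0 then 2 else 4)"
      have "p = H_line 5 e (Im p)" unfolding complex_eq_iff H_line_coords using im(3) by (auto simp: e_def H_place_def H_tail_def H_head_def)
      moreover have "e < 5" by (simp add: e_def)
      ultimately show ?thesis using im by blast
    qed
    then show "p \<in> drawing H_tree (H_place 5)" using l by blast
  qed
qed

theorem theorem6:
  shows "\<exists>(\<Gamma> :: (nat, nat) pre_digraph) (n :: nat) S P.
    fin_digraph \<Gamma> \<and> Digraph_Component.connected \<Gamma> \<and> n > 0 \<and>
    S \<in> topspace (uconf_graph n \<Gamma>) \<and>
    subgroup P (graph_braid_group n \<Gamma> S) \<and>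
    P \<noteq> carrier (graph_braid_group n \<Gamma> S) \<and>
    hyperbolic_relative_to (graph_braid_group n \<Gamma> S) P \<and>
    thick_group ((graph_braid_group n \<Gamma> S)\<lparr>carrier := P\<rparr>) \<and>
    (\<forall>(k :: nat) \<Lambda> S'.
       0 < k \<and> k \<le> n \<and> subgraph \<Lambda> \<Gamma> \<and> \<Lambda> \<noteq> \<Gamma> \<and> S' \<in> topspace (uconf_graph k \<Lambda>) \<longrightarrow>
       \<not> embeds_in_group ((graph_braid_group n \<Gamma> S)\<lparr>carrier := P\<rparr>) (graph_braid_group k \<Lambda> S'))"
proof -
  have r: "(5::nat) < 6" "5 \<notin> arcs H_tree" by (simp_all add: H_tree_def)
  note d = H_drawing[OF subgraph_H_tree r, unfolded H_tree_drawing]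
  \<comment> \<open>The base point is taken with empty prongs, in the cell whose gauge is
    trivial.\<close>
  obtain a where a: "a \<in> topspace (cset 4 full_comb_set)" "na a = 0" "nd a = 0"
    using ex_configuration[of 0 0 0 0 False False] by auto
  have "a \<in> orbit_set 4 (draw H_tree (H_place 5)) ` topspace (uconf_graph 4 H_tree)"
    unfolding uconf_graph_def homeomorphic_imp_surjective_map[OF homeomorphic_map_orbit_set[OF d(1)]] by (rule a(1))
  then obtain S where S: "S \<in> topspace (uconf_graph 4 H_tree)" "a = orbit_set 4 (draw H_tree (H_place 5)) S" by blast
  interpret full_comb a
  proof unfold_locales
    fix p assume "p \<in> full_comb_set"
    then show "Im p = 0 \<and> \<bar>Re p\<bar> \<le> 3 \<or> 0 < Im p \<and> Im p \<le> 1 \<and> (Re p = 0 \<or> Re p = 1)"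
      by (auto simp: full_comb_set_def)
  qed (rule d(2), rule a(1), rule a(2), rule a(3))
  define B where "B = graph_braid_group 4 H_tree S"
  note b = graph_braid_group_iso[OF d(1) S(1), folded S(2) B_def]
  interpret B: group B by (rule b(3))
  obtain \<phi> where \<phi>: "\<phi> \<in> iso B G" using b(1) by blast
  interpret J: finite_index_words comb_index by unfold_locales (rule finite_comb_index)
  have "Hol ` carrier G = carrier H"
  proof
    interpret Hl: group_hom G H Hol using Hol_hom by unfold_locales
    show "Hol ` carrier G \<subseteq> carrier H" using Hl.hom_closed by blast
    have "J.wgens \<subseteq> Hol ` carrier G"
    proof
      fix w assume "w \<in> J.wgens"
      then consider "w = [Ab 1 0]" | "w = [Ab 0 1]" | s i b where "(s, i, b) \<in> comb_index" "w = [Fr (s, i, b) True]"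
        by (auto simp: J.wgens_def plane_elt_def)
      then show "w \<in> Hol ` carrier G"
      proof cases
        case 1
        then show ?thesis using Hol_gen[of 0 1 False] by (simp add: comb_gen_def)
      next
        case 2
        then show ?thesis using Hol_gen[of 0 1 True] by (simp add: comb_gen_def)
      next
        case (3 s i b)
        then have "comb_gen s i b = w" "i + b \<le> 3" by (auto simp: comb_index_def comb_gen_def)
        then show ?thesis using Hol_gen[of i b s] by simp
      qed
    qed
    then have "generate H J.wgens \<subseteq> Hol ` carrier G"
      by (rule H.generate_subgroup_incl[OF _ Hl.img_is_subgroup])
    then show "carrier H \<subseteq> Hol ` carrier G" using J.finite_generating_wgens by (simp add: finite_generating_set_def)
  qed
  then have "Hol \<in> iso G H" using Hol_hom Hol_inj by (simp add: iso_def bij_betw_def)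
  then have "Hol \<circ> \<phi> \<in> iso B H" by (rule iso_set_trans[OF \<phi>])
  then obtain \<kappa> where \<kappa>: "\<kappa> \<in> iso H B" using B.iso_set_sym by blast
  have \<kappa>h: "\<kappa> \<in> hom H B" "inj_on \<kappa> (carrier H)" "\<kappa> ` carrier H = carrier B" using \<kappa> by (auto simp: iso_def bij_betw_def)
  interpret \<kappa>: group_hom H B \<kappa> using \<kappa>h(1) by unfold_locales
  define P where "P = \<kappa> ` plane_subgroup"
  have hyp: "hyperbolic_relative_to B P" unfolding P_def
    by (rule hyperbolic_relative_to_iso[OF group_word_group B.is_group \<kappa> J.hyperbolic_relative_to_plane])
  then have P: "subgroup P B" by (simp add: hyperbolic_relative_to_def)
  have "P \<noteq> carrier B"
  proof
    assume "P = carrier B"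
    then have "\<kappa> ` plane_subgroup = \<kappa> ` carrier H" unfolding P_def \<kappa>h(3) .
    then have "plane_subgroup = carrier H"
      using inj_on_image_eq_iff[OF \<kappa>h(2), of plane_subgroup "carrier H"] subgroup.subset[OF subgroup_plane[of comb_index]] by simp
    \<comment> \<open>A free generator, which lies outside the plane.\<close>
    moreover have "comb_gen False 1 1 \<in> carrier H" by (simp add: comb_gen_closed)
    ultimately have "[Fr (False, Suc 0, Suc 0) True] \<in> plane_subgroup" by (simp add: comb_gen_def)
    then show False by (auto simp: plane_subgroup_def split: if_splits)
  qed
  interpret P: int_plane_group "B\<lparr>carrier := P\<rparr>" "\<lambda>i j. \<kappa> (plane_elt i j)"
  proof (intro int_plane_group.intro int_plane_group_axioms.intro)
    show "group (B\<lparr>carrier := P\<rparr>)" by (rule B.subgroup_imp_group[OF P])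
    show "carrier (B\<lparr>carrier := P\<rparr>) = {\<kappa> (plane_elt i j) |i j. True}" by (auto simp: P_def plane_subgroup_eq)
    fix i j k l :: int
    have c: "plane_elt i j \<in> carrier H" "plane_elt k l \<in> carrier H" by (simp_all add: plane_elt_words_over)
    show "i = k \<and> j = l" if "\<kappa> (plane_elt i j) = \<kappa> (plane_elt k l)"
      using plane_elt_inj inj_onD[OF \<kappa>h(2) that c] by blast
    show "\<kappa> (plane_elt i j) \<otimes>\<^bsub>B\<lparr>carrier := P\<rparr>\<^esub> \<kappa> (plane_elt k l) = \<kappa> (plane_elt (i + k) (j + l))"
      using \<kappa>.hom_mult[OF c] by (simp add: plane_elt_mult)
  qed
  have "\<not> embeds_in_group (B\<lparr>carrier := P\<rparr>) (graph_braid_group k \<Lambda> S')"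
    if \<Lambda>: "subgraph \<Lambda> H_tree" "\<Lambda> \<noteq> H_tree" and S': "S' \<in> topspace (uconf_graph k \<Lambda>)" for k \<Lambda> S'
  proof
    let ?D = "graph_braid_group k \<Lambda> S'"
    interpret D: group ?D unfolding graph_braid_group_def by (rule group_fundamental_group[OF S'])
    assume "embeds_in_group (B\<lparr>carrier := P\<rparr>) ?D"
    then obtain K h where K: "subgroup K ?D" and h: "h \<in> iso (B\<lparr>carrier := P\<rparr>) (?D\<lparr>carrier := K\<rparr>)"
      by (auto simp: embeds_in_group_def is_iso_def)
    have hh: "h \<in> hom (B\<lparr>carrier := P\<rparr>) ?D" "inj_on h P"
      using h subgroup.subset[OF K] by (auto simp: iso_def hom_def bij_betw_def Pi_iff subset_iff)
    interpret h: group_hom "B\<lparr>carrier := P\<rparr>" ?D h using hh(1) by unfold_locales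
    \<comment> \<open>An embedding carries the two generators of the plane to an independent pair,
      which no proper subgraph admits.\<close>
    have "D.independent_pair (h (\<kappa> (plane_elt 1 0))) (h (\<kappa> (plane_elt 0 1)))"
    proof (rule P.independent_pair_hom_image[OF hh(1) D.is_group _ P.independent_e])
      fix x assume x: "x \<in> carrier (B\<lparr>carrier := P\<rparr>)" "h x = \<one>\<^bsub>?D\<^esub>"
      then show "x = \<one>\<^bsub>B\<lparr>carrier := P\<rparr>\<^esub>" using inj_onD[OF hh(2), of x "\<one>\<^bsub>B\<lparr>carrier := P\<rparr>\<^esub>"] h.hom_one P.one_closed by simp
    qed
    then show False using proper_subgraph_no_independent_pair[OF \<Lambda> S'] by blast
  qed
  moreover have "fin_digraph H_tree"
    using wf_H_tree by (simp add: fin_digraph_def fin_digraph_axioms_def H_tree_def)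
  ultimately show ?thesis
    using connected_H_tree S(1) P \<open>P \<noteq> carrier B\<close> hyp P.thick_int_plane unfolding B_def
    by (intro exI[of _ H_tree] exI[of _ 4] exI[of _ S] exI[of _ P]) auto
qed

end
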